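(* Let $k$ be an algebraically closed field of characteristic $p\neq 2$. Let $E_1: y^2=x(x-\alpha_2)(x-\alpha_3)$ and $E_2: y^2=x(x-\beta_2)(x-\beta_3)$ be elliptic curves, where $\alpha_2,\alpha_3,\beta_2,\beta_3$ are pairwise distinct elements of $k\smallsetminus\{0\}$, and let $C$ be the normalization of $E_1\times_{\mathbb{P}^1}E_2$. (i) In the hyperelliptic case, i.e. when $\alpha_2\alpha_3=\beta_2\beta_3$, an equation defining $C$ is $$\begin{aligned}y^2=&\left(x^2-\frac{(\sqrt{\alpha_2}+\sqrt{\alpha_3}+\sqrt{\beta_2}+\sqrt{\beta_3})^2}{\alpha_2+\alpha_3-\beta_2-\beta_3}\right)\left(x^2-\frac{(\sqrt{\alpha_2}+\sqrt{\alpha_3}-\sqrt{\beta_2}-\sqrt{\beta_3})^2}{\alpha_2+\alpha_3-\beta_2-\beta_3}\right)\\&\left(x^2-\frac{(\sqrt{\alpha_2}-\sqrt{\alpha_3}+\sqrt{\beta_2}-\sqrt{\beta_3})^2}{\alpha_2+\alpha_3-\beta_2-\beta_3}\right)\left(x^2-\frac{(\sqrt{\alpha_2}-\sqrt{\alpha_3}-\sqrt{\beta_2}+\sqrt{\beta_3})^2}{\alpha_2+\alpha_3-\beta_2-\beta_3}\right).\end{aligned}$$ (ii) In the non-hyperelliptic case, i.e. when $\alpha_2\alpha_3\neq\beta_2\beta_3$, put $\tau_1=\alpha_2+\alpha_3$, $\tau_2=\alpha_2\alpha_3$, $\rho_1=\beta_2+\beta_3$, $\rho_2=\beta_2\beta_3$.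 Then $C$ is isomorphic to the plane quartic obtained as the projective closure in $\mathbb{P}^2$ of $f(Y,Z)=0$, where $$\begin{aligned} f=\;&\rho_2Y^4-(\tau_2+\rho_2)Y^2Z^2+\tau_2Z^4+(2\tau_1\rho_2-\tau_2\rho_1-\rho_1\rho_2)Y^2\\&+(-\tau_1\tau_2-\tau_1\rho_2+2\tau_2\rho_1)Z^2+\tau_1^2\rho_2-\tau_1\tau_2\rho_1-\tau_1\rho_1\rho_2+\tau_2^2+\tau_2\rho_1^2-2\tau_2\rho_2+\rho_2^2.\end{aligned}$$
   Context: The fiber product $E_1\times_{\mathbb{P}^1}E_2$ is taken with respect to the two double covers $E_i\to\mathbb{P}^1$ given by the $x$-coordinate; its normalization $C$ has genus $3$. It is recalled (Oort) that $C$ is hyperelliptic if and only if $\alpha_2\alpha_3=\beta_2\beta_3$. The symbols $\sqrt{\alpha_2},\sqrt{\alpha_3},\sqrt{\beta_2},\sqrt{\beta_3}$ denote square roots in $k$. An equation $y^2=h(x)$ with $h$ square-free of degree $8$ stands for its smooth projective model (a hyperelliptic curve of genus $3$).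
   Formalization: In (i) the square roots are required to satisfy √α2·√α3 = √β2·√β3 (always achievable by a sign change); for the other sign the equation can fail, e.g. roots 1, 6, 2, −3 make the third factor x², so the octic is not square-free. *)

theory Defs
  imports
    "HOL-Analysis.Abstract_Topology"
    "HOL-Analysis.Function_Topology"
    "HOL-Computational_Algebra.Computational_Algebra"
begin

section \<open>Spaces with functions\<close>

text \<open>
  Varieties over an algebraically closed field \<open>'k\<close> are treated as in Shafarevich, Springer or
  Kempf: a set of (closed) points with a Zariski topology and, for every open set \<open>U\<close>, the
  \<open>'k\<close>-algebra \<open>regular X U\<close> of \<open>'k\<close>-valued regular functions on \<open>U\<close>.  Elements of \<open>regular X U\<close>
  are total functions of which only the restriction to \<open>U\<close> matters.
\<close>

record ('a, 'k) kspace =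
  zariski :: "'a topology"
  regular :: "'a set \<Rightarrow> ('a \<Rightarrow> 'k) set"

definition points :: "('a, 'k) kspace \<Rightarrow> 'a set"
  where "points X = topspace (zariski X)"

text \<open>
  The first condition says both that regular functions form a sheaf and that being regular on
  \<open>U\<close> depends on the values on \<open>U\<close> only.
\<close>

definition space_with_functions :: "('a, 'k :: field) kspace \<Rightarrow> bool"
  where "space_with_functions X \<longleftrightarrow>
    (\<forall>U f. openin (zariski X) U \<longrightarrow>
      (f \<in> regular X U \<longleftrightarrow>
        (\<forall>p\<in>U. \<exists>V g. openin (zariski X) V \<and> p \<in> V \<and> g \<in> regular X V \<and> (\<forall>q\<in>U \<inter> V. f q = g q)))) \<and>
    (\<forall>U. openin (zariski X) U \<longrightarrow>
      (\<forall>c. (\<lambda>_. c) \<in> regular X U) \<and>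
      (\<forall>f\<in>regular X U. \<forall>g\<in>regular X U.
        (\<lambda>p. f p + g p) \<in> regular X U \<and> (\<lambda>p. f p * g p) \<in> regular X U) \<and>
      (\<forall>f\<in>regular X U. openin (zariski X) {p \<in> U. f p \<noteq> 0} \<and>
        (\<lambda>p. inverse (f p)) \<in> regular X {p \<in> U. f p \<noteq> 0}))"

definition morphism :: "('a, 'k) kspace \<Rightarrow> ('b, 'k) kspace \<Rightarrow> ('a \<Rightarrow> 'b) \<Rightarrow> bool"
  where "morphism X Y \<phi> \<longleftrightarrow>
    continuous_map (zariski X) (zariski Y) \<phi> \<and>
    (\<forall>V f. openin (zariski Y) V \<and> f \<in> regular Y V \<longrightarrow> f \<circ> \<phi> \<in> regular X {p \<in> points X. \<phi> p \<in> V})"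

definition isomorphism :: "('a, 'k) kspace \<Rightarrow> ('b, 'k) kspace \<Rightarrow> ('a \<Rightarrow> 'b) \<Rightarrow> bool"
  where "isomorphism X Y \<phi> \<longleftrightarrow> morphism X Y \<phi> \<and>
    (\<exists>\<psi>. morphism Y X \<psi> \<and> (\<forall>p\<in>points X. \<psi> (\<phi> p) = p) \<and> (\<forall>q\<in>points Y. \<phi> (\<psi> q) = q))"

definition isomorphic :: "('a, 'k) kspace \<Rightarrow> ('b, 'k) kspace \<Rightarrow> bool"
  where "isomorphic X Y \<longleftrightarrow> (\<exists>\<phi>. isomorphism X Y \<phi>)"

definition subspace_on :: "('a, 'k) kspace \<Rightarrow> 'a set \<Rightarrow> ('a, 'k) kspace"
  where "subspace_on X S =
    \<lparr> zariski = subtopology (zariski X) S,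
      regular = (\<lambda>W. {f. \<forall>p\<in>W. \<exists>U g. openin (zariski X) U \<and> p \<in> U \<and> g \<in> regular X U \<and>
                             (\<forall>q\<in>U \<inter> W. f q = g q)}) \<rparr>"

text \<open>
  The categorical product: its topology and regular functions are generated by finite sums
  \<open>\<Sum>i. f\<^sub>i \<otimes> g\<^sub>i\<close>; the topology is finer than the product topology.
\<close>

definition tensor_functions ::
    "('a, 'k :: field) kspace \<Rightarrow> ('b, 'k) kspace \<Rightarrow> 'a set \<Rightarrow> 'b set \<Rightarrow> ('a \<times> 'b \<Rightarrow> 'k) set"
  where "tensor_functions X Y U V =
    {\<lambda>(p, q). \<Sum>i<n. f i p * g i q | (n :: nat) f g.
       (\<forall>i<n. f i \<in> regular X U \<and> g i \<in> regular Y V)}"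

definition product_space ::
    "('a, 'k :: field) kspace \<Rightarrow> ('b, 'k) kspace \<Rightarrow> ('a \<times> 'b, 'k) kspace"
  where "product_space X Y =
    \<lparr> zariski = topology_generated_by
        {{z \<in> U \<times> V. h z \<noteq> 0} | U V h. openin (zariski X) U \<and> openin (zariski Y) V \<and>
                                     h \<in> tensor_functions X Y U V},
      regular = (\<lambda>W. {f. \<forall>z\<in>W. \<exists>U V g h. openin (zariski X) U \<and> openin (zariski Y) V \<and>
          g \<in> tensor_functions X Y U V \<and> h \<in> tensor_functions X Y U V \<and>
          z \<in> U \<times> V \<and> h z \<noteq> 0 \<and> (\<forall>w \<in> W \<inter> U \<times> V. h w \<noteq> 0 \<longrightarrow> f w = g w / h w)}) \<rparr>"

text \<open>
  The fibre product carries its reduced structure; a normalization factors through the reduction.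
\<close>

definition fibre_product ::
    "('a, 'k :: field) kspace \<Rightarrow> ('a \<Rightarrow> 'c) \<Rightarrow> ('b, 'k) kspace \<Rightarrow> ('b \<Rightarrow> 'c) \<Rightarrow> ('a \<times> 'b, 'k) kspace"
  where "fibre_product X \<phi> Y \<psi> =
    subspace_on (product_space X Y) {(p, q). p \<in> points X \<and> q \<in> points Y \<and> \<phi> p = \<psi> q}"


section \<open>Affine and projective space\<close>

text \<open>
  Coordinate vectors are functions on \<open>nat\<close> that vanish outside the relevant range.
  Since \<open>'k\<close> is infinite, polynomials in the coordinates may be identified with polynomial functions.
\<close>

inductive_set polynomial_functions :: "((nat \<Rightarrow> 'k :: field) \<Rightarrow> 'k) set"
  where
    const: "(\<lambda>_. c) \<in> polynomial_functions"
  | coord: "(\<lambda>v. v i) \<in> polynomial_functions"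
  | add: "f \<in> polynomial_functions \<Longrightarrow> g \<in> polynomial_functions \<Longrightarrow>
      (\<lambda>v. f v + g v) \<in> polynomial_functions"
  | mult: "f \<in> polynomial_functions \<Longrightarrow> g \<in> polynomial_functions \<Longrightarrow>
      (\<lambda>v. f v * g v) \<in> polynomial_functions"

inductive homogeneous :: "nat \<Rightarrow> ((nat \<Rightarrow> 'k :: field) \<Rightarrow> 'k) \<Rightarrow> bool"
  where
    const: "homogeneous 0 (\<lambda>_. c)"
  | coord: "homogeneous 1 (\<lambda>v. v i)"
  | add: "homogeneous d f \<Longrightarrow> homogeneous d g \<Longrightarrow> homogeneous d (\<lambda>v. f v + g v)"
  | mult: "homogeneous d f \<Longrightarrow> homogeneous e g \<Longrightarrow> homogeneous (d + e) (\<lambda>v. f v * g v)"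

definition vec_of :: "'k :: field list \<Rightarrow> nat \<Rightarrow> 'k"
  where "vec_of xs = (\<lambda>i. if i < length xs then xs ! i else 0)"

definition affine_space :: "nat \<Rightarrow> (nat \<Rightarrow> 'k :: field, 'k) kspace"
  where "affine_space n =
    (let A = {v. \<forall>i\<ge>n. v i = 0} in
     \<lparr> zariski = topology_generated_by {{v \<in> A. h v \<noteq> 0} | h. h \<in> polynomial_functions},
       regular = (\<lambda>W. {f. \<forall>p\<in>W. \<exists>g\<in>polynomial_functions. \<exists>h\<in>polynomial_functions.
                             h p \<noteq> 0 \<and> (\<forall>q\<in>W. h q \<noteq> 0 \<longrightarrow> f q = g q / h q)}) \<rparr>)"

text \<open>A point of projective space is the set of all its homogeneous coordinate vectors.\<close>

definition proj_point :: "(nat \<Rightarrow> 'k :: field) \<Rightarrow> (nat \<Rightarrow> 'k) set"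
  where "proj_point v = {\<lambda>i. c * v i | c. c \<noteq> 0}"

definition projective_space :: "nat \<Rightarrow> ((nat \<Rightarrow> 'k :: field) set, 'k) kspace"
  where "projective_space n =
    (let P = {proj_point v | v. (\<exists>i. v i \<noteq> 0) \<and> (\<forall>i>n. v i = 0)} in
     \<lparr> zariski = topology_generated_by {{p \<in> P. \<forall>v\<in>p. h v \<noteq> 0} | h d. homogeneous d h},
       regular = (\<lambda>W. {f. \<forall>p\<in>W. \<exists>d g h. homogeneous d g \<and> homogeneous d h \<and> (\<forall>v\<in>p. h v \<noteq> 0) \<and>
                             (\<forall>q\<in>W. \<forall>v\<in>q. h v \<noteq> 0 \<longrightarrow> f q = g v / h v)}) \<rparr>)"


section \<open>Varieties\<close>

definition is_affine :: "('a, 'k :: field) kspace \<Rightarrow> bool"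
  where "is_affine X \<longleftrightarrow>
    (\<exists>n Z. closedin (zariski (affine_space n)) Z \<and> isomorphic X (subspace_on (affine_space n) Z))"

definition is_projective :: "('a, 'k :: field) kspace \<Rightarrow> bool"
  where "is_projective X \<longleftrightarrow>
    (\<exists>n Z. closedin (zariski (projective_space n)) Z \<and> isomorphic X (subspace_on (projective_space n) Z))"

definition variety :: "('a, 'k :: field) kspace \<Rightarrow> bool"
  where "variety X \<longleftrightarrow> space_with_functions X \<and>
    (\<exists>\<U>. finite \<U> \<and> \<Union>\<U> = points X \<and>
         (\<forall>U\<in>\<U>. openin (zariski X) U \<and> is_affine (subspace_on X U))) \<and>
    closedin (zariski (product_space X X)) {(p, p) | p. p \<in> points X}"

definition irreducible_subset :: "'a topology \<Rightarrow> 'a set \<Rightarrow> bool"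
  where "irreducible_subset T S \<longleftrightarrow> S \<subseteq> topspace T \<and> S \<noteq> {} \<and>
    (\<forall>A B. closedin T A \<and> closedin T B \<and> S \<subseteq> A \<union> B \<longrightarrow> S \<subseteq> A \<or> S \<subseteq> B)"

definition irreducible_variety :: "('a, 'k :: field) kspace \<Rightarrow> bool"
  where "irreducible_variety X \<longleftrightarrow> variety X \<and> irreducible_subset (zariski X) (points X)"

text \<open>
  The ring of functions \<open>R\<close> on \<open>U\<close> (a domain in the situations where this is used) is integrally
  closed: every fraction \<open>a / b\<close> that is integral over \<open>R\<close> lies in \<open>R\<close>.
\<close>

definition integrally_closed_on :: "'a set \<Rightarrow> ('a \<Rightarrow> 'k :: field) set \<Rightarrow> bool"
  where "integrally_closed_on U R \<longleftrightarrow>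
    (\<forall>a\<in>R. \<forall>b\<in>R. (\<exists>p\<in>U. b p \<noteq> 0) \<and>
      (\<exists>n c. n > 0 \<and> (\<forall>i<n. c i \<in> R) \<and>
             (\<forall>p\<in>U. a p ^ n + (\<Sum>i<n. c i p * a p ^ i * b p ^ (n - i)) = 0)) \<longrightarrow>
      (\<exists>r\<in>R. \<forall>p\<in>U. a p = r p * b p))"

definition normal_variety :: "('a, 'k :: field) kspace \<Rightarrow> bool"
  where "normal_variety X \<longleftrightarrow> irreducible_variety X \<and>
    (\<forall>p\<in>points X. \<exists>U. openin (zariski X) U \<and> p \<in> U \<and> is_affine (subspace_on X U) \<and>
                      integrally_closed_on U (regular X U))"

definition finite_morphism :: "('a, 'k :: field) kspace \<Rightarrow> ('b, 'k) kspace \<Rightarrow> ('a \<Rightarrow> 'b) \<Rightarrow> bool"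
  where "finite_morphism X Y \<phi> \<longleftrightarrow> morphism X Y \<phi> \<and>
    (\<forall>y\<in>points Y. \<exists>V. openin (zariski Y) V \<and> y \<in> V \<and> is_affine (subspace_on Y V) \<and>
      (let U = {p \<in> points X. \<phi> p \<in> V} in
        is_affine (subspace_on X U) \<and>
        (\<forall>f\<in>regular X U. \<exists>n c. n > 0 \<and> (\<forall>i<n. c i \<in> regular Y V) \<and>
           (\<forall>p\<in>U. f p ^ n + (\<Sum>i<n. c i (\<phi> p) * f p ^ i) = 0))))"

definition birational_morphism ::
    "('a, 'k :: field) kspace \<Rightarrow> ('b, 'k) kspace \<Rightarrow> ('a \<Rightarrow> 'b) \<Rightarrow> bool"
  where "birational_morphism X Y \<phi> \<longleftrightarrow> morphism X Y \<phi> \<and>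
    (\<exists>V. openin (zariski Y) V \<and> zariski Y closure_of V = points Y \<and>
      (let U = {p \<in> points X. \<phi> p \<in> V} in
        zariski X closure_of U = points X \<and>
        isomorphism (subspace_on X U) (subspace_on Y V) \<phi>))"

definition is_normalization :: "('a, 'k :: field) kspace \<Rightarrow> ('a \<Rightarrow> 'b) \<Rightarrow> ('b, 'k) kspace \<Rightarrow> bool"
  where "is_normalization X \<nu> Y \<longleftrightarrow>
    normal_variety X \<and> finite_morphism X Y \<nu> \<and> birational_morphism X Y \<nu>"

definition birational :: "('a, 'k :: field) kspace \<Rightarrow> ('b, 'k) kspace \<Rightarrow> bool"
  where "birational X Y \<longleftrightarrow>
    (\<exists>U V. openin (zariski X) U \<and> zariski X closure_of U = points X \<and>
           openin (zariski Y) V \<and> zariski Y closure_of V = points Y \<and>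
           isomorphic (subspace_on X U) (subspace_on Y V))"

definition krull_dim :: "'a topology \<Rightarrow> nat \<Rightarrow> bool"
  where "krull_dim T d \<longleftrightarrow>
    (let chain = (\<lambda>n. \<exists>Z :: nat \<Rightarrow> 'a set.
           (\<forall>i\<le>n. closedin T (Z i) \<and> irreducible_subset T (Z i)) \<and> (\<forall>i<n. Z i \<subset> Z (Suc i)))
     in chain d \<and> \<not> chain (Suc d))"

text \<open>
  Functions regular near \<open>p\<close> that vanish at \<open>p\<close>, and those whose germ at \<open>p\<close> lies in the
  square of the maximal ideal of the local ring at \<open>p\<close>.
\<close>

definition vanishing_at :: "('a, 'k :: field) kspace \<Rightarrow> 'a \<Rightarrow> ('a \<Rightarrow> 'k) set"
  where "vanishing_at X p = {f. f p = 0 \<and> (\<exists>U. openin (zariski X) U \<and> p \<in> U \<and> f \<in> regular X U)}"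

definition vanishing_doubly_at :: "('a, 'k :: field) kspace \<Rightarrow> 'a \<Rightarrow> ('a \<Rightarrow> 'k) set"
  where "vanishing_doubly_at X p =
    {f. \<exists>U (n :: nat) a b. openin (zariski X) U \<and> p \<in> U \<and>
          (\<forall>i<n. a i \<in> vanishing_at X p \<and> b i \<in> vanishing_at X p) \<and>
          (\<forall>q\<in>U. f q = (\<Sum>i<n. a i q * b i q))}"

definition cotangent_dim :: "('a, 'k :: field) kspace \<Rightarrow> 'a \<Rightarrow> nat \<Rightarrow> bool"
  where "cotangent_dim X p d \<longleftrightarrow>
    (\<exists>t. (\<forall>i<d. t i \<in> vanishing_at X p) \<and>
      (\<forall>f\<in>vanishing_at X p. \<exists>c. (\<lambda>q. f q - (\<Sum>i<d. c i * t i q)) \<in> vanishing_doubly_at X p) \<and>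
      (\<forall>c. (\<lambda>q. \<Sum>i<d. c i * t i q) \<in> vanishing_doubly_at X p \<longrightarrow> (\<forall>i<d. c i = 0)))"

definition smooth_variety :: "('a, 'k :: field) kspace \<Rightarrow> bool"
  where "smooth_variety X \<longleftrightarrow> irreducible_variety X \<and>
    (\<exists>d. krull_dim (zariski X) d \<and> (\<forall>p\<in>points X. cotangent_dim X p d))"

text \<open>For a curve \<open>Y\<close>, such an \<open>X\<close> is unique up to isomorphism.\<close>

definition is_smooth_projective_model :: "('a, 'k :: field) kspace \<Rightarrow> ('b, 'k) kspace \<Rightarrow> bool"
  where "is_smooth_projective_model X Y \<longleftrightarrow>
    smooth_variety X \<and> is_projective X \<and> birational X Y"


section \<open>Plane curves\<close>

definition affine_plane_curve :: "('k :: field \<Rightarrow> 'k \<Rightarrow> 'k) \<Rightarrow> (nat \<Rightarrow> 'k, 'k) kspace"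
  where "affine_plane_curve f = subspace_on (affine_space 2) {vec_of [x, y] | x y. f x y = 0}"

text \<open>The affine plane is embedded in the projective plane by \<open>(x, y) \<mapsto> [1 : x : y]\<close>.\<close>

definition projective_plane_curve :: "('k :: field \<Rightarrow> 'k \<Rightarrow> 'k) \<Rightarrow> ((nat \<Rightarrow> 'k) set, 'k) kspace"
  where "projective_plane_curve f =
    subspace_on (projective_space 2)
      (zariski (projective_space 2) closure_of {proj_point (vec_of [1, x, y]) | x y. f x y = 0})"

definition elliptic_cubic :: "'k :: field \<Rightarrow> 'k \<Rightarrow> ((nat \<Rightarrow> 'k) set, 'k) kspace"
  where "elliptic_cubic a b = projective_plane_curve (\<lambda>x y. y ^ 2 - x * (x - a) * (x - b))"

text \<open>
  The morphism from \<open>elliptic_cubic a b\<close> to the projective line that extends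
  \<open>(x, y) \<mapsto> [1 : x]\<close>; the only point at infinity, \<open>[0 : 0 : 1]\<close>, is a pole of \<open>x\<close> and is sent to
  \<open>\<infinity> = [0 : 1]\<close>.
\<close>

definition x_cover :: "(nat \<Rightarrow> 'k :: field) set \<Rightarrow> (nat \<Rightarrow> 'k) set"
  where "x_cover p = (if \<exists>v\<in>p. v 0 \<noteq> 0 then {vec_of [v 0, v 1] | v. v \<in> p}
                      else proj_point (vec_of [0, 1]))"

text \<open>Bivariate polynomials in \<open>Y\<close>, \<open>Z\<close> are represented in \<open>'k[Z][Y]\<close>.\<close>

definition poly2 :: "'k :: field poly poly \<Rightarrow> 'k \<Rightarrow> 'k \<Rightarrow> 'k"
  where "poly2 f y z = poly (poly f [:y:]) z"

text \<open>
  Here \<open>a2, a3, b2, b3\<close> are square roots of \<open>\<alpha>2, \<alpha>3, \<beta>2, \<beta>3\<close>, so \<open>D = \<alpha>2 + \<alpha>3 - \<beta>2 - \<beta>3\<close>.  The four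
  sign patterns are the correct ones for roots normalized by \<open>a2 * a3 = b2 * b3\<close>; for
  \<open>a2 * a3 = - b2 * b3\<close> the octic need not even be square-free, e.g. \<open>(1, 6, 2, -3)\<close>.
\<close>

definition hyperelliptic_octic ::
    "'k :: field \<Rightarrow> 'k \<Rightarrow> 'k \<Rightarrow> 'k \<Rightarrow> 'k poly"
  where "hyperelliptic_octic a2 a3 b2 b3 =
    (let X = [:0, 1:];
         D = a2 ^ 2 + a3 ^ 2 - b2 ^ 2 - b3 ^ 2
     in (X ^ 2 - [:(a2 + a3 + b2 + b3) ^ 2 / D:]) *
        (X ^ 2 - [:(a2 + a3 - b2 - b3) ^ 2 / D:]) *
        (X ^ 2 - [:(a2 - a3 + b2 - b3) ^ 2 / D:]) *
        (X ^ 2 - [:(a2 - a3 - b2 + b3) ^ 2 / D:]))"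

definition plane_quartic :: "'k :: field \<Rightarrow> 'k \<Rightarrow> 'k \<Rightarrow> 'k \<Rightarrow> 'k poly poly"
  where "plane_quartic \<alpha>2 \<alpha>3 \<beta>2 \<beta>3 =
    (let Y = [:0, 1:];
         Z = [:[:0, 1:]:];
         K = (\<lambda>c. [:[:c:]:]);
         \<tau>1 = \<alpha>2 + \<alpha>3; \<tau>2 = \<alpha>2 * \<alpha>3; \<rho>1 = \<beta>2 + \<beta>3; \<rho>2 = \<beta>2 * \<beta>3
     in K \<rho>2 * Y ^ 4 - K (\<tau>2 + \<rho>2) * Y ^ 2 * Z ^ 2 + K \<tau>2 * Z ^ 4
        + K (2 * \<tau>1 * \<rho>2 - \<tau>2 * \<rho>1 - \<rho>1 * \<rho>2) * Y ^ 2
        + K (- \<tau>1 * \<tau>2 - \<tau>1 * \<rho>2 + 2 * \<tau>2 * \<rho>1) * Z ^ 2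
        + K (\<tau>1 ^ 2 * \<rho>2 - \<tau>1 * \<tau>2 * \<rho>1 - \<tau>1 * \<rho>1 * \<rho>2 + \<tau>2 ^ 2 + \<tau>2 * \<rho>1 ^ 2
             - 2 * \<tau>2 * \<rho>2 + \<rho>2 ^ 2))"

end

theory Submission
  imports Defs
begin

text \<open>
  The curve \<open>C\<close> is glued from three smooth affine curves of the shape \<open>m y\<^sup>2 = n\<^sub>1\<close>, \<open>m z\<^sup>2 = n\<^sub>2\<close> with
  \<open>m\<close>, \<open>n\<^sub>1\<close>, \<open>n\<^sub>2\<close> polynomials in \<open>x\<close>.  With \<open>y\<^sub>i\<close> the ordinate on \<open>E\<^sub>i\<close>, the functions \<open>x\<close>, \<open>y = y\<^sub>1 / x\<close>
  and \<open>z = y\<^sub>2 / x\<close> are coordinates where \<open>x \<noteq> 0, \<infinity>\<close>; near \<open>x = 0\<close> and \<open>x = \<infinity>\<close> the quotient \<open>y\<^sub>2 / y\<^sub>1\<close>,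
  which is regular there by normality, replaces \<open>z\<close>.  At every point of such a curve there is a
  uniformizer, so rational functions to a projective line have no indeterminacy, and this forces the
  charts of \<open>C\<close> to be isomorphisms.

  Where \<open>x \<noteq> 0, \<infinity>\<close> one has \<open>y\<^sup>2 = x + \<tau>\<^sub>2 / x - \<tau>\<^sub>1\<close> and \<open>z\<^sup>2 = x + \<rho>\<^sub>2 / x - \<rho>\<^sub>1\<close>.  The canonical map is
  \<open>[1 : y : z]\<close>, and \<open>[1 : y : z : y z : x : 1 / x]\<close> always embeds \<open>C\<close> in \<open>\<P>\<^sup>5\<close>.  If \<open>\<tau>\<^sub>2 \<noteq> \<rho>\<^sub>2\<close>, the two equations
  express \<open>x\<close> and \<open>1 / x\<close> through \<open>y\<^sup>2\<close> and \<open>z\<^sup>2\<close>, and \<open>x * (1 / x) = 1\<close> becomes the quartic.  If \<open>\<tau>\<^sub>2 = \<rho>\<^sub>2\<close>,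
  then \<open>y\<^sup>2 - z\<^sup>2 = - D\<close> is constant, so \<open>s = y + z\<close> parametrizes the conic which is the canonical image,
  and \<open>x - \<tau>\<^sub>2 / x\<close> is a square root of \<open>(y\<^sup>2 + \<tau>\<^sub>1)\<^sup>2 - 4 \<tau>\<^sub>2\<close>, up to a square the octic in \<open>s\<close>.
\<close>


section \<open>Smooth affine models of biquadratic covers of the line\<close>

text \<open>The curve \<open>C\<close> is known only through a finite birational morphism from a
  normal variety to the fibre product. Normality is invoked only to extract the square root that
  extends y2 / y1. Birationality makes rational functions on \<open>C\<close> fractions of elements
  of \<open>R\<close>; such a fraction can be reduced so that its two terms do not both vanish at a
  given point, so regular germs are fractions with nonzero denominator, and separating functions
  make a chart injective. Finiteness gives surjectivity: a point of the model is a place of the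
  function field, integral functions have no pole there, and evaluation at the place comes from a
  point of \<open>C\<close>. Concrete computation enters through the norm from the degree 4
  extension down to k(x): zero sets are finite, so nonempty open sets are cofinite and injective
  maps to spaces with closed points are open onto their images. What remains for an embedding is to
  write the chart coordinates as fractions of the embedding coordinates. In the hyperelliptic case
  the canonical map is no embedding, so projectivity rests on the map to P^5.\<close>

lemma infinite_alg_closed: "infinite (UNIV :: 'k :: alg_closed_field set)"
proof
  assume fin: "finite (UNIV :: 'k set)"
  define p :: "'k poly" where "p = (\<Prod>a\<in>UNIV. [:- a, 1:]) + 1"
  have "poly p x = 1" for x
    using fin by (simp add: p_def poly_prod prod_zero_iff)
  moreover have "degree p > 0"
  proof -
    have "degree (\<Prod>a\<in>UNIV. [:- a, 1 :: 'k:]) = (\<Sum>a\<in>(UNIV::'k set). 1)"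
      by (subst degree_prod_eq_sum_degree) auto
    hence "degree (\<Prod>a\<in>UNIV. [:- a, 1 :: 'k:]) > 0"
      using fin by (simp add: card_gt_0_iff)
    thus ?thesis
      unfolding p_def by (subst degree_add_eq_left) auto
  qed
  ultimately show False
    using alg_closed_imp_poly_has_root[of p] by auto
qed

lemma finite_square_roots: "finite {y :: 'k :: field. y ^ 2 = c}"
proof -
  have "{y. y ^ 2 = c} \<subseteq> {y. poly [:- c, 0, 1:] y = 0}"
    by (auto simp: power2_eq_square algebra_simps)
  moreover have "finite {y. poly [:- c, 0, 1:] y = 0}"
    by (rule poly_roots_finite) auto
  ultimately show ?thesis
    using finite_subset by blast
qed

definition simple_root :: "'k :: field \<Rightarrow> 'k poly \<Rightarrow> bool"
  where "simple_root r p \<longleftrightarrow> (\<exists>p'. p = [:- r, 1:] * p' \<and> poly p' r \<noteq> 0)"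

lemma simple_root_nonzero: "simple_root r p \<Longrightarrow> p \<noteq> 0"
  by (auto simp: simple_root_def simp del: mult_pCons_left)

text \<open>The order at \<open>r\<close> is even on the left and odd on the right unless both sides
  vanish: \<open>e\<close> is not a square in k(x).\<close>

lemma square_eq_simple_root_mult_square:
  fixes u v e :: "'k :: field poly"
  assumes "simple_root r e" "u ^ 2 = e * v ^ 2"
  shows "u = 0 \<and> v = 0"
proof -
  obtain p where p: "e = [:- r, 1:] * p" "poly p r \<noteq> 0"
    using assms(1) by (auto simp: simple_root_def)
  have e0: "e \<noteq> 0"
    using assms(1) by (rule simple_root_nonzero)
  have oe: "order r e = 1"
  proof -
    have "order r e = order r [:- r, 1:] + order r p"
      using p e0 by (simp add: order_mult del: mult_pCons_left)
    moreover have "order r [:- r, 1:] = 1"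
      using order_power_n_n[of r 1] by simp
    ultimately show ?thesis
      using p(2) by (simp add: order_0I)
  qed
  show ?thesis
  proof (cases "v = 0")
    case True
    thus ?thesis using assms by simp
  next
    case False
    hence nz: "e * v ^ 2 \<noteq> 0" "u \<noteq> 0"
      using e0 assms(2) by auto
    have "order r (u ^ 2) = 2 * order r u" "order r (v ^ 2) = 2 * order r v"
      using nz False by (simp_all add: power2_eq_square order_mult)
    moreover have "order r (e * v ^ 2) = 1 + order r (v ^ 2)"
      using nz oe by (simp add: order_mult)
    ultimately have "2 * order r u = 1 + 2 * order r v"
      using assms(2) by simp
    thus ?thesis by presburger
  qed
qed

text \<open>The three \<open>nonsquare\<close> assumptions make 1, y, z, y z linearly independent
  over k(x), so that the curve is irreducible; \<open>simple1\<close> and \<open>simple2\<close>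
  make it smooth where \<open>m\<close> does not vanish.\<close>

locale chart =
  fixes m n1 n2 :: "'k :: alg_closed_field poly"
  assumes two: "(2 :: 'k) \<noteq> 0"
    and nonsquare1: "\<exists>r. simple_root r (m * n1)"
    and nonsquare2: "\<exists>r. simple_root r (m * n2)"
    and nonsquare3: "\<exists>r. simple_root r (n1 * n2)"
    and simple1: "poly m r \<noteq> 0 \<Longrightarrow> poly n1 r = 0 \<Longrightarrow> simple_root r n1 \<and> poly n2 r \<noteq> 0"
    and simple2: "poly m r \<noteq> 0 \<Longrightarrow> poly n2 r = 0 \<Longrightarrow> simple_root r n2"
begin

section \<open>The affine curve and its ring of functions\<close>

definition X :: "('k \<times> 'k \<times> 'k) set"
  where "X = {(x, y, z). poly m x \<noteq> 0 \<and> poly m x * y ^ 2 = poly n1 x \<and> poly m x * z ^ 2 = poly n2 x}"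

text \<open>Only the values on \<open>X\<close> of the elements of \<open>R\<close> matter.\<close>

definition R :: "('k \<times> 'k \<times> 'k \<Rightarrow> 'k) set"
  where "R = {P. \<exists>N a b c d. \<forall>x y z. (x, y, z) \<in> X \<longrightarrow>
    P (x, y, z) * poly m x ^ N = poly a x + poly b x * y + poly c x * z + poly d x * y * z}"

lemma R_I:
  assumes "\<And>x y z. (x, y, z) \<in> X \<Longrightarrow>
    P (x, y, z) * poly m x ^ N = poly a x + poly b x * y + poly c x * z + poly d x * y * z"
  shows "P \<in> R"
  using assms unfolding R_def by blast

lemma R_E:
  assumes "P \<in> R"
  obtains N a b c d where "\<And>x y z. (x, y, z) \<in> X \<Longrightarrow>
    P (x, y, z) * poly m x ^ N = poly a x + poly b x * y + poly c x * z + poly d x * y * z"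
  using assms unfolding R_def by blast

lemma X_D:
  assumes "(x, y, z) \<in> X"
  shows "poly m x \<noteq> 0" "poly m x * y ^ 2 = poly n1 x" "poly m x * z ^ 2 = poly n2 x"
  using assms by (auto simp: X_def)

lemma R_poly: "(\<lambda>q. poly p (fst q)) \<in> R"
  by (rule R_I[where N = 0 and a = p and b = 0 and c = 0 and d = 0]) auto

lemma R_const: "(\<lambda>q. c) \<in> R"
  using R_poly[of "[:c:]"] by simp

lemma R_x: "(\<lambda>q. fst q) \<in> R"
  using R_poly[of "[:0, 1:]"] by simp

lemma R_y: "(\<lambda>q. fst (snd q)) \<in> R"
  by (rule R_I[where N = 0 and a = 0 and b = 1 and c = 0 and d = 0]) auto

lemma R_z: "(\<lambda>q. snd (snd q)) \<in> R"
  by (rule R_I[where N = 0 and a = 0 and b = 0 and c = 1 and d = 0]) auto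

lemma R_inverse_m: "(\<lambda>q. inverse (poly m (fst q))) \<in> R"
  by (rule R_I[where N = 1 and a = 1 and b = 0 and c = 0 and d = 0]) (auto simp: X_def)

lemma R_add:
  assumes "P \<in> R" "Q \<in> R"
  shows "(\<lambda>q. P q + Q q) \<in> R"
proof -
  obtain N a b c d where P: "\<And>x y z. (x, y, z) \<in> X \<Longrightarrow>
    P (x, y, z) * poly m x ^ N = poly a x + poly b x * y + poly c x * z + poly d x * y * z"
    using R_E[OF assms(1)] by blast
  obtain N' a' b' c' d' where Q: "\<And>x y z. (x, y, z) \<in> X \<Longrightarrow>
    Q (x, y, z) * poly m x ^ N' = poly a' x + poly b' x * y + poly c' x * z + poly d' x * y * z"
    using R_E[OF assms(2)] by blast
  show ?thesis
  proof (rule R_I[where N = "N + N'" and a = "m ^ N' * a + m ^ N * a'" and b = "m ^ N' * b + m ^ N * b'"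
        and c = "m ^ N' * c + m ^ N * c'" and d = "m ^ N' * d + m ^ N * d'"])
    fix x y z assume q: "(x, y, z) \<in> X"
    have "(P (x, y, z) + Q (x, y, z)) * poly m x ^ (N + N') =
      poly m x ^ N' * (P (x, y, z) * poly m x ^ N) + poly m x ^ N * (Q (x, y, z) * poly m x ^ N')"
      by (simp add: power_add algebra_simps)
    also have "\<dots> = poly (m ^ N' * a + m ^ N * a') x + poly (m ^ N' * b + m ^ N * b') x * y +
      poly (m ^ N' * c + m ^ N * c') x * z + poly (m ^ N' * d + m ^ N * d') x * y * z"
      unfolding P[OF q] Q[OF q] by (simp add: algebra_simps)
    finally show "(P (x, y, z) + Q (x, y, z)) * poly m x ^ (N + N') =
      poly (m ^ N' * a + m ^ N * a') x + poly (m ^ N' * b + m ^ N * b') x * y +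
      poly (m ^ N' * c + m ^ N * c') x * z + poly (m ^ N' * d + m ^ N * d') x * y * z" .
  qed
qed

lemma R_mult:
  assumes "P \<in> R" "Q \<in> R"
  shows "(\<lambda>q. P q * Q q) \<in> R"
proof -
  obtain N a b c d where P: "\<And>x y z. (x, y, z) \<in> X \<Longrightarrow>
    P (x, y, z) * poly m x ^ N = poly a x + poly b x * y + poly c x * z + poly d x * y * z"
    using R_E[OF assms(1)] by blast
  obtain N' a' b' c' d' where Q: "\<And>x y z. (x, y, z) \<in> X \<Longrightarrow>
    Q (x, y, z) * poly m x ^ N' = poly a' x + poly b' x * y + poly c' x * z + poly d' x * y * z"
    using R_E[OF assms(2)] by blast
  \<comment> \<open>Products are reduced by y^2 = n1 / m and z^2 = n2 / m; the term y^2 z^2 needs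
    the denominator \<open>m ^ 2\<close>, whence the extra 2 in the exponent.\<close>
  let ?a = "m ^ 2 * a * a' + m * n1 * b * b' + m * n2 * c * c' + n1 * n2 * d * d'"
  let ?b = "m ^ 2 * (a * b' + b * a') + m * n2 * (c * d' + d * c')"
  let ?c = "m ^ 2 * (a * c' + c * a') + m * n1 * (b * d' + d * b')"
  let ?d = "m ^ 2 * (a * d' + d * a' + b * c' + c * b')"
  show ?thesis
  proof (rule R_I[where N = "N + N' + 2" and a = ?a and b = ?b and c = ?c and d = ?d])
    fix x y z assume q: "(x, y, z) \<in> X"
    have "P (x, y, z) * Q (x, y, z) * poly m x ^ (N + N' + 2) =
      poly m x ^ 2 * (P (x, y, z) * poly m x ^ N) * (Q (x, y, z) * poly m x ^ N')"
      by (simp add: power_add algebra_simps power2_eq_square)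
    also have "\<dots> = poly ?a x + poly ?b x * y + poly ?c x * z + poly ?d x * y * z"
      unfolding P[OF q] Q[OF q] poly_add poly_mult poly_power X_D(2,3)[OF q, symmetric]
      by algebra
    finally show "P (x, y, z) * Q (x, y, z) * poly m x ^ (N + N' + 2) =
      poly ?a x + poly ?b x * y + poly ?c x * z + poly ?d x * y * z" .
  qed
qed

lemma R_diff: "P \<in> R \<Longrightarrow> Q \<in> R \<Longrightarrow> (\<lambda>q. P q - Q q) \<in> R"
  using R_add[OF _ R_mult[OF R_const[of "-1"]], of P Q] by simp

lemma R_power: "P \<in> R \<Longrightarrow> (\<lambda>q. P q ^ n) \<in> R"
  by (induction n) (auto intro: R_const R_mult)

lemma R_sum: "(\<And>i. i \<in> I \<Longrightarrow> P i \<in> R) \<Longrightarrow> (\<lambda>q. \<Sum>i\<in>I. P i q) \<in> R"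
  by (induction I rule: infinite_finite_induct) (auto intro: R_const R_add)

lemma R_prod: "(\<And>i. i \<in> I \<Longrightarrow> P i \<in> R) \<Longrightarrow> (\<lambda>q. \<Prod>i\<in>I. P i q) \<in> R"
  by (induction I rule: infinite_finite_induct) (auto intro: R_const R_mult)

section \<open>The norm to k[x] and finiteness of zero sets\<close>

lemma m_nonzero: "m \<noteq> 0" and n1_nonzero: "n1 \<noteq> 0" and n2_nonzero: "n2 \<noteq> 0"
  using nonsquare1 nonsquare3 simple_root_nonzero by fastforce+

text \<open>The form is m^4 times the norm of a + b y + c z + d y z: multiplying by the conjugate
  under y -> -y gives \<open>?U\<close> + 2 m z \<open>?V\<close>, up to m^2, and then z -> -z gives
  \<open>?U\<close>^2 - 4 m n2 \<open>?V\<close>^2. As m n2 is not a square, \<open>?U\<close> and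
  \<open>?V\<close> vanish separately.\<close>

lemma norm_form_eq_0:
  assumes "(m^2 * a^2 + m * n2 * c^2 - m * n1 * b^2 - n1 * n2 * d^2)^2
      - 4 * m * n2 * (m * a * c - n1 * b * d)^2 = 0"
  shows "a = 0 \<and> b = 0 \<and> c = 0 \<and> d = 0"
proof -
  let ?U = "m^2 * a^2 + m * n2 * c^2 - m * n1 * b^2 - n1 * n2 * d^2"
  let ?V = "m * a * c - n1 * b * d"
  obtain r1 r2 r3 where r: "simple_root r1 (m * n1)" "simple_root r2 (m * n2)" "simple_root r3 (n1 * n2)"
    using nonsquare1 nonsquare2 nonsquare3 by blast
  have "?U ^ 2 = (m * n2) * (2 * ?V)^2"
    using assms by (simp add: power2_eq_square algebra_simps)
  from square_eq_simple_root_mult_square[OF r(2) this]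
  have U: "?U = 0" and V2: "2 * ?V = 0"
    by auto
  have "(2 :: 'k poly) \<noteq> 0"
    using two by (metis poly_0 poly_numeral)
  hence V: "m * a * c = n1 * b * d"
    using V2 by auto
  have a: "a = 0"
  proof (rule ccontr)
    assume "a \<noteq> 0"
    \<comment> \<open>Multiplying \<open>?U\<close> by m a^2 and eliminating \<open>c\<close>
      through \<open>?V = 0\<close> splits it into two binary forms. If either vanished with
      \<open>a\<close> nonzero, m n1 or n1 n2 would be a square in k(x).\<close>
    have "(m * a^2 - n1 * b^2) * (m^2 * a^2 - n1 * n2 * d^2) =
       m * a^2 * ?U - n2 * ((m * a * c)^2 - (n1 * b * d)^2)"
      by algebra
    hence "(m * a^2 - n1 * b^2) * (m^2 * a^2 - n1 * n2 * d^2) = 0"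
      using U V by simp
    hence "m * a^2 = n1 * b^2 \<or> m^2 * a^2 = n1 * n2 * d^2"
      by simp
    hence "(m * a)^2 = (m * n1) * b^2 \<or> (m * a)^2 = (n1 * n2) * d^2"
      by (auto simp: power2_eq_square algebra_simps)
    hence "m * a = 0"
      using square_eq_simple_root_mult_square r by blast
    thus False using \<open>a \<noteq> 0\<close> m_nonzero by simp
  qed
  hence "b = 0 \<or> d = 0"
    using V n1_nonzero by simp
  thus ?thesis
  proof
    assume b: "b = 0"
    have "n2 * ((m * c^2) - n1 * d^2) = 0"
      using U a b by (simp add: algebra_simps)
    hence "(m * c)^2 = (m * n1) * d^2"
      using n2_nonzero by (simp add: power2_eq_square algebra_simps)
    from square_eq_simple_root_mult_square[OF r(1) this] show ?thesis
      using a b m_nonzero by simp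
  next
    assume d: "d = 0"
    have "m * (n2 * c^2 - n1 * b^2) = 0"
      using U a d by (simp add: algebra_simps)
    hence "(n2 * c)^2 = (n1 * n2) * b^2"
      using m_nonzero by (simp add: power2_eq_square algebra_simps)
    from square_eq_simple_root_mult_square[OF r(3) this] show ?thesis
      using a d n2_nonzero by simp
  qed
qed

text \<open>The cofactor is the product of the three nontrivial conjugates under \<open>(y, z) \<mapsto> (\<plusminus>y, \<plusminus>z)\<close>.\<close>

lemma R_norm:
  assumes "P \<in> R" "\<exists>q\<in>X. P q \<noteq> 0"
  shows "\<exists>P'\<in>R. \<exists>N. N \<noteq> 0 \<and> (\<forall>q\<in>X. P q * P' q = poly N (fst q))"
proof -
  obtain N a b c d where P: "\<And>x y z. (x, y, z) \<in> X \<Longrightarrow>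
    P (x, y, z) * poly m x ^ N = poly a x + poly b x * y + poly c x * z + poly d x * y * z"
    using R_E[OF assms(1)] by blast
  define n where "n = (m^2 * a^2 + m * n2 * c^2 - m * n1 * b^2 - n1 * n2 * d^2)^2
      - 4 * m * n2 * (m * a * c - n1 * b * d)^2"
  have "n \<noteq> 0"
  proof
    assume "n = 0"
    hence "a = 0 \<and> b = 0 \<and> c = 0 \<and> d = 0"
      using norm_form_eq_0 unfolding n_def by blast
    thus False
      using assms(2) P by (fastforce simp: X_def)
  qed
  define F where "F = (\<lambda>s t q. poly a (fst q) + s * poly b (fst q) * fst (snd q)
     + t * poly c (fst q) * snd (snd q) + s * t * poly d (fst q) * fst (snd q) * snd (snd q))"
  have FR: "F s t \<in> R" for s t
    by (rule R_I[where N = 0 and a = a and b = "smult s b" and c = "smult t c" and d = "smult (s * t) d"])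
       (simp add: F_def)
  \<comment> \<open>The power \<open>N\<close> clears the denominator of \<open>P\<close>, and 4 is
    the power of \<open>m\<close> in the norm form.\<close>
  define P' where "P' = (\<lambda>q. poly m (fst q) ^ (N + 4) * (F (-1) 1 q * (F 1 (-1) q * F (-1) (-1) q)))"
  have "P' \<in> R"
    unfolding P'_def by (intro R_mult FR) (use R_poly[of "m ^ (N + 4)"] in simp)
  moreover have "P q * P' q = poly n (fst q)" if "q \<in> X" for q
  proof -
    obtain x y z where q: "q = (x, y, z)"
      by (cases q) auto
    have "P q * P' q = poly m x ^ 4 * (P (x, y, z) * poly m x ^ N) * (F (-1) 1 q * (F 1 (-1) q * F (-1) (-1) q))"
      by (simp add: P'_def q power_add)
    also have "\<dots> = poly n x"
      unfolding P[OF that[unfolded q]] F_def q n_def fst_conv snd_conv poly_diff poly_add poly_mult poly_power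
         poly_numeral X_D(2,3)[OF that[unfolded q], symmetric]
      by algebra
    finally show ?thesis by (simp add: q)
  qed
  ultimately show ?thesis
    using \<open>n \<noteq> 0\<close> by blast
qed

lemma finite_fibre: "finite {q \<in> X. fst q = x}"
proof -
  let ?Y = "{y. y ^ 2 = poly n1 x / poly m x}" and ?Z = "{z. z ^ 2 = poly n2 x / poly m x}"
  have "{q \<in> X. fst q = x} \<subseteq> {x} \<times> ?Y \<times> ?Z"
    by (auto simp: X_def field_simps)
  thus ?thesis
    by (rule finite_subset) (auto intro!: finite_cartesian_product finite_square_roots)
qed

text \<open>Zeros of \<open>P\<close> lie over the roots of its norm, and the fibres over x are
  finite.\<close>

lemma finite_zeros:
  assumes "P \<in> R" "\<exists>q\<in>X. P q \<noteq> 0"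
  shows "finite {q \<in> X. P q = 0}"
proof -
  obtain P' N where N: "N \<noteq> 0" "\<And>q. q \<in> X \<Longrightarrow> P q * P' q = poly N (fst q)"
    using R_norm[OF assms] by blast
  have "{q \<in> X. P q = 0} \<subseteq> (\<Union>x\<in>{x. poly N x = 0}. {q \<in> X. fst q = x})"
    using N(2) by force
  moreover have "finite \<dots>"
    using poly_roots_finite[OF N(1)] finite_fibre by auto
  ultimately show ?thesis
    using finite_subset by blast
qed

lemma X_over:
  assumes "poly m x \<noteq> 0"
  shows "\<exists>y z. (x, y, z) \<in> X"
proof -
  obtain y z where "y ^ 2 = poly n1 x / poly m x" "z ^ 2 = poly n2 x / poly m x"
    using nth_root_exists[of 2] by (metis pos2)
  hence "(x, y, z) \<in> X"
    using assms by (auto simp: X_def)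
  thus ?thesis by blast
qed

lemma infinite_X: "infinite X"
proof
  assume "finite X"
  moreover have "- {x. poly m x = 0} \<subseteq> fst ` X"
    using X_over by force
  ultimately have "finite (- {x. poly m x = 0})"
    using finite_subset by blast
  thus False
    using poly_roots_finite[OF m_nonzero] infinite_alg_closed
    by (metis Compl_partition finite_UnI)
qed

lemma R_eq_0_if_infinite:
  assumes "P \<in> R" "infinite S" "S \<subseteq> X" "\<And>q. q \<in> S \<Longrightarrow> P q = 0" "q \<in> X"
  shows "P q = 0"
  using finite_zeros[OF assms(1)] assms finite_subset[of S "{q \<in> X. P q = 0}"] by blast

text \<open>Irreducibility by counting: two proper zero sets are finite, while \<open>X\<close> is
  infinite.\<close>

lemma R_domain:
  assumes "P \<in> R" "Q \<in> R" "\<And>q. q \<in> X \<Longrightarrow> P q * Q q = 0"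
  shows "(\<forall>q\<in>X. P q = 0) \<or> (\<forall>q\<in>X. Q q = 0)"
proof (rule ccontr)
  assume "\<not> ?thesis"
  hence "finite ({q \<in> X. P q = 0} \<union> {q \<in> X. Q q = 0})"
    using finite_zeros assms(1,2) by auto
  moreover have "X \<subseteq> {q \<in> X. P q = 0} \<union> {q \<in> X. Q q = 0}"
    using assms(3) by auto
  ultimately show False
    using infinite_X finite_subset by blast
qed

lemma R_cancel:
  assumes "P \<in> R" "Q \<in> R" "S \<in> R" "\<And>q. q \<in> X \<Longrightarrow> S q * P q = S q * Q q" "\<exists>q\<in>X. S q \<noteq> 0" "q \<in> X"
  shows "P q = Q q"
  using R_domain[OF assms(3) R_diff[OF assms(1,2)]] assms(4-6) by (force simp: right_diff_distrib)

subsection \<open>Uniformizers\<close>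

text \<open>Divisibility in the local ring at \<open>q\<close> is written with a denominator
  \<open>c\<close> that does not vanish at \<open>q\<close>. The last clause says that x - x(q) is a
  positive power of \<open>t\<close> times a unit; through the norm this bounds the order of every
  function.\<close>

definition uniformizer :: "'k \<times> 'k \<times> 'k \<Rightarrow> ('k \<times> 'k \<times> 'k \<Rightarrow> 'k) \<Rightarrow> bool"
  where "uniformizer q t \<longleftrightarrow> t \<in> R \<and> t q = 0 \<and>
    (\<forall>P\<in>R. P q = 0 \<longrightarrow> (\<exists>c\<in>R. \<exists>g\<in>R. c q \<noteq> 0 \<and> (\<forall>q'\<in>X. P q' * c q' = t q' * g q'))) \<and>
    (\<exists>k e c. k > 0 \<and> e \<in> R \<and> c \<in> R \<and> c q \<noteq> 0 \<and> (\<forall>q'\<in>X. (fst q' - fst q) * c q' = t q' ^ k * e q' \<and> e q \<noteq> 0))"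

text \<open>Only the three coordinates have to be tested: the functions whose increment from
  \<open>q\<close> is divisible by \<open>t\<close> form a ring \<open>S\<close> containing the
  constants, and an element of \<open>R\<close> is in that ring up to a power of \<open>m\<close>,
  which is a unit on \<open>X\<close>.\<close>

lemma uniformizerI:
  assumes q: "q \<in> X" and t: "t \<in> R" "t q = 0"
    and x: "ca \<in> R" "ga \<in> R" "ca q \<noteq> 0" "\<And>q'. q' \<in> X \<Longrightarrow> (fst q' - fst q) * ca q' = t q' * ga q'"
    and y: "cb \<in> R" "gb \<in> R" "cb q \<noteq> 0" "\<And>q'. q' \<in> X \<Longrightarrow> (fst (snd q') - fst (snd q)) * cb q' = t q' * gb q'"
    and z: "cc \<in> R" "gc \<in> R" "cc q \<noteq> 0" "\<And>q'. q' \<in> X \<Longrightarrow> (snd (snd q') - snd (snd q)) * cc q' = t q' * gc q'"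
    and e: "k > 0" "e \<in> R" "c \<in> R" "c q \<noteq> 0" "e q \<noteq> 0"
      "\<And>q'. q' \<in> X \<Longrightarrow> (fst q' - fst q) * c q' = t q' ^ k * e q'"
  shows "uniformizer q t"
proof -
  define S where "S = {P \<in> R. \<exists>c\<in>R. \<exists>g\<in>R. c q \<noteq> 0 \<and> (\<forall>q'\<in>X. (P q' - P q) * c q' = t q' * g q')}"
  have S_I: "P \<in> S" if "P \<in> R" "c \<in> R" "g \<in> R" "c q \<noteq> 0"
      "\<And>q'. q' \<in> X \<Longrightarrow> (P q' - P q) * c q' = t q' * g q'" for P c g
    using that unfolding S_def by blast
  have S_const: "(\<lambda>_. a) \<in> S" for a
    by (rule S_I[where c = "\<lambda>_. 1" and g = "\<lambda>_. 0"]) (auto intro: R_const)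
  have S_add: "(\<lambda>q. P q + Q q) \<in> S" if "P \<in> S" "Q \<in> S" for P Q
  proof -
    obtain c g where P: "c \<in> R" "g \<in> R" "c q \<noteq> 0" "\<And>q'. q' \<in> X \<Longrightarrow> (P q' - P q) * c q' = t q' * g q'"
      using \<open>P \<in> S\<close> unfolding S_def by blast
    obtain c' g' where Q: "c' \<in> R" "g' \<in> R" "c' q \<noteq> 0" "\<And>q'. q' \<in> X \<Longrightarrow> (Q q' - Q q) * c' q' = t q' * g' q'"
      using \<open>Q \<in> S\<close> unfolding S_def by blast
    show ?thesis
    proof (rule S_I[where c = "\<lambda>q. c q * c' q" and g = "\<lambda>q. g q * c' q + g' q * c q"])
      show "(\<lambda>q. P q + Q q) \<in> R" using that by (auto simp: S_def intro: R_add)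
      fix q' assume "q' \<in> X"
      show "(P q' + Q q' - (P q + Q q)) * (c q' * c' q') = t q' * (g q' * c' q' + g' q' * c q')"
        using P(4)[OF \<open>q' \<in> X\<close>] Q(4)[OF \<open>q' \<in> X\<close>] by algebra
    qed (use P Q in \<open>auto intro: R_add R_mult\<close>)
  qed
  have S_mult: "(\<lambda>q. P q * Q q) \<in> S" if "P \<in> S" "Q \<in> S" for P Q
  proof -
    obtain c g where P: "c \<in> R" "g \<in> R" "c q \<noteq> 0" "\<And>q'. q' \<in> X \<Longrightarrow> (P q' - P q) * c q' = t q' * g q'"
      using \<open>P \<in> S\<close> unfolding S_def by blast
    obtain c' g' where Q: "c' \<in> R" "g' \<in> R" "c' q \<noteq> 0" "\<And>q'. q' \<in> X \<Longrightarrow> (Q q' - Q q) * c' q' = t q' * g' q'"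
      using \<open>Q \<in> S\<close> unfolding S_def by blast
    have R: "P \<in> R" "Q \<in> R" using that by (auto simp: S_def)
    show ?thesis
    proof (rule S_I[where c = "\<lambda>q. c q * c' q" and g = "\<lambda>p. g p * c' p * Q p + g' p * c p * P q"])
      show "(\<lambda>q. P q * Q q) \<in> R" using R by (intro R_mult)
      fix q' assume "q' \<in> X"
      show "(P q' * Q q' - (P q * Q q)) * (c q' * c' q') = t q' * (g q' * c' q' * Q q' + g' q' * c q' * P q)"
        using P(4)[OF \<open>q' \<in> X\<close>] Q(4)[OF \<open>q' \<in> X\<close>] by algebra
    qed (use P Q R in \<open>auto intro!: R_add R_mult R_const\<close>)
  qed
  have S_poly: "(\<lambda>q. poly p (fst q)) \<in> S" for p
  proof (induction p)
    case (pCons a p)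
    have "(\<lambda>q. fst q) \<in> S"
      by (rule S_I[OF R_x x])
    from S_add[OF S_const[of a] S_mult[OF this pCons(2)]] show ?case by simp
  qed (use S_const[of 0] in simp)
  have "\<exists>c\<in>R. \<exists>g\<in>R. c q \<noteq> 0 \<and> (\<forall>q'\<in>X. P q' * c q' = t q' * g q')" if PR: "P \<in> R" "P q = 0" for P
  proof -
    obtain N a b c d where P: "\<And>x y z. (x, y, z) \<in> X \<Longrightarrow>
      P (x, y, z) * poly m x ^ N = poly a x + poly b x * y + poly c x * z + poly d x * y * z"
      using R_E[OF PR(1)] by blast
    define Q where "Q = (\<lambda>q. poly a (fst q) + poly b (fst q) * fst (snd q) + poly c (fst q) * snd (snd q)
        + poly d (fst q) * fst (snd q) * snd (snd q))"
    have Sy: "(\<lambda>q. fst (snd q)) \<in> S" and Sz: "(\<lambda>q. snd (snd q)) \<in> S"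
      by (rule S_I[OF R_y y] S_I[OF R_z z]; assumption)+
    have "Q \<in> S"
      unfolding Q_def by (intro S_add S_mult S_poly Sy Sz)
    moreover have PQ: "P q' * poly m (fst q') ^ N = Q q'" if "q' \<in> X" for q'
      using P[of "fst q'" "fst (snd q')" "snd (snd q')"] that by (simp add: Q_def)
    moreover have "Q q = 0"
      using PQ[OF q] \<open>P q = 0\<close> by simp
    ultimately obtain c g where c: "c \<in> R" "g \<in> R" "c q \<noteq> 0" "\<And>q'. q' \<in> X \<Longrightarrow> Q q' * c q' = t q' * g q'"
      unfolding S_def by auto
    have "(\<lambda>q. poly m (fst q) ^ N * c q) \<in> R"
      using R_mult[OF R_poly[of "m ^ N"] c(1)] by simp
    moreover have "poly m (fst q) ^ N * c q \<noteq> 0"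
      using c(3) q by (auto simp: X_def)
    moreover have "P q' * (poly m (fst q') ^ N * c q') = t q' * g q'" if "q' \<in> X" for q'
      using c(4)[OF that] PQ[OF that] by (simp add: mult.assoc[symmetric])
    ultimately show ?thesis
      using c(2) by (intro bexI[of _ "\<lambda>q. poly m (fst q) ^ N * c q"] bexI[of _ g]) auto
  qed
  thus ?thesis
    unfolding uniformizer_def using t e by blast
qed

lemma poly_diff_factor: "\<exists>p'. \<forall>x. poly p x - poly p r = (x - r) * poly p' x" for p :: "'k poly"
proof -
  have "[:- r, 1:] dvd p - [:poly p r:]"
    by (simp add: poly_eq_0_iff_dvd[symmetric])
  then obtain p' where p': "p - [:poly p r:] = [:- r, 1:] * p'"
    by blast
  have "poly p x - poly p r = (x - r) * poly p' x" for x
  proof -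
    have "poly p x - poly p r = poly (p - [:poly p r:]) x"
      by simp
    also have "\<dots> = (x - r) * poly p' x"
      unfolding p' by (simp add: algebra_simps)
    finally show ?thesis .
  qed
  thus ?thesis by blast
qed

text \<open>
  If \<open>n1\<close> and \<open>n2\<close> do not vanish at the point, then \<open>x\<close> is a local parameter;
  at a simple root of \<open>n1\<close> the equation \<open>m y\<^sup>2 = n1\<close> makes \<open>y\<close> one.
\<close>

lemma uniformizer_exists:
  assumes q: "q \<in> X"
  shows "\<exists>t. uniformizer q t"
proof -
  obtain x0 y0 z0 where q0: "q = (x0, y0, z0)"
    by (cases q) auto
  note eq0 = X_D[OF q[unfolded q0]]
  have y_x: "\<exists>p. \<forall>x y z. (x, y, z) \<in> X \<longrightarrow> (y - y0) * (poly m x * (y + y0)) = (x - x0) * (poly p x + poly p' x * y0 ^ 2)"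
    if "\<And>x. poly m x - poly m x0 = (x - x0) * - poly p' x" for p'
  proof -
    obtain p where p: "\<And>x. poly n1 x - poly n1 x0 = (x - x0) * poly p x"
      using poly_diff_factor by blast
    have "(y - y0) * (poly m x * (y + y0)) = (x - x0) * (poly p x + poly p' x * y0 ^ 2)" if "(x, y, z) \<in> X" for x y z
    proof -
      \<comment> \<open>The difference of the equation m y^2 = n1 at the two points; both terms on
        the right are divisible by x - x0.\<close>
      have "(y - y0) * (poly m x * (y + y0)) =
          (poly n1 x - poly n1 x0) - (poly m x - poly m x0) * y0 ^ 2"
        unfolding X_D(2)[OF that, symmetric] eq0(2)[symmetric] by algebra
      thus ?thesis
        unfolding p \<open>poly m x - poly m x0 = (x - x0) * - poly p' x\<close> by algebra
    qed
    thus ?thesis by blast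
  qed
  have z_x: "\<exists>p. \<forall>x y z. (x, y, z) \<in> X \<longrightarrow> (z - z0) * (poly m x * (z + z0)) = (x - x0) * (poly p x + poly p' x * z0 ^ 2)"
    if "\<And>x. poly m x - poly m x0 = (x - x0) * - poly p' x" for p'
  proof -
    obtain p where p: "\<And>x. poly n2 x - poly n2 x0 = (x - x0) * poly p x"
      using poly_diff_factor by blast
    have "(z - z0) * (poly m x * (z + z0)) = (x - x0) * (poly p x + poly p' x * z0 ^ 2)" if "(x, y, z) \<in> X" for x y z
    proof -
      have "(z - z0) * (poly m x * (z + z0)) =
          (poly n2 x - poly n2 x0) - (poly m x - poly m x0) * z0 ^ 2"
        unfolding X_D(3)[OF that, symmetric] eq0(3)[symmetric] by algebra
      thus ?thesis
        unfolding p \<open>poly m x - poly m x0 = (x - x0) * - poly p' x\<close> by algebra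
    qed
    thus ?thesis by blast
  qed
  obtain p'' where "\<And>x. poly m x - poly m x0 = (x - x0) * poly p'' x"
    using poly_diff_factor by blast
  then obtain p' where p': "\<And>x. poly m x - poly m x0 = (x - x0) * - poly p' x"
    by (metis minus_minus poly_minus)
  obtain py where py: "\<And>x y z. (x, y, z) \<in> X \<Longrightarrow>
      (y - y0) * (poly m x * (y + y0)) = (x - x0) * (poly py x + poly p' x * y0 ^ 2)"
    using y_x[OF p'] by blast
  obtain pz where pz: "\<And>x y z. (x, y, z) \<in> X \<Longrightarrow>
      (z - z0) * (poly m x * (z + z0)) = (x - x0) * (poly pz x + poly p' x * z0 ^ 2)"
    using z_x[OF p'] by blast
  define gy where "gy = (\<lambda>q :: 'k \<times> 'k \<times> 'k. poly py (fst q) + poly p' (fst q) * y0 ^ 2 :: 'k)"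
  define gz where "gz = (\<lambda>q :: 'k \<times> 'k \<times> 'k. poly pz (fst q) + poly p' (fst q) * z0 ^ 2 :: 'k)"
  have gR: "gy \<in> R" "gz \<in> R"
    unfolding gy_def gz_def by (intro R_add R_mult R_poly R_const)+
  define cy where "cy = (\<lambda>q :: 'k \<times> 'k \<times> 'k. poly m (fst q) * (fst (snd q) + y0) :: 'k)"
  define cz where "cz = (\<lambda>q :: 'k \<times> 'k \<times> 'k. poly m (fst q) * (snd (snd q) + z0) :: 'k)"
  have cR: "cy \<in> R" "cz \<in> R"
    unfolding cy_def cz_def by (intro R_add R_mult R_poly R_const R_y R_z)+
  \<comment> \<open>At the point itself the cofactor m (y + y0) takes the value 2 m y0, so
    characteristic 2 is excluded here.\<close>
  have double: "a + a \<noteq> 0" if "a \<noteq> 0" for a :: 'k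
    using that two by (metis mult_2 no_zero_divisors)
  have root: "n0 \<noteq> 0 \<longleftrightarrow> v0 \<noteq> 0" if "poly m x0 * v0 ^ 2 = n0" for v0 n0
    using that eq0(1) by auto
  have ycz: "(fst (snd q') - fst (snd q)) * cy q' = (fst q' - fst q) * gy q'"
    and zcz: "(snd (snd q') - snd (snd q)) * cz q' = (fst q' - fst q) * gz q'" if "q' \<in> X" for q'
    using py[of "fst q'" "fst (snd q')" "snd (snd q')"] pz[of "fst q'" "fst (snd q')" "snd (snd q')"] that
    by (simp_all add: cy_def gy_def cz_def gz_def q0)
  consider "poly n1 x0 \<noteq> 0" "poly n2 x0 \<noteq> 0" | "poly n1 x0 = 0" | "poly n2 x0 = 0" "poly n1 x0 \<noteq> 0"
    by blast
  thus ?thesis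
  proof cases
    case 1
    hence yz0: "y0 \<noteq> 0" "z0 \<noteq> 0"
      using eq0 by auto
    let ?t = "\<lambda>q'. fst q' - fst q"
    have "uniformizer q ?t"
    proof (rule uniformizerI[OF q, where ca = "\<lambda>_. 1" and ga = "\<lambda>_. 1" and k = 1 and c = "\<lambda>_. 1" and e = "\<lambda>_. 1"
          and cb = cy and gb = gy and cc = cz and gc = gz])
      show "?t \<in> R" by (intro R_diff R_x R_const)
      show "cy q \<noteq> 0" "cz q \<noteq> 0"
        using double yz0 eq0(1) by (auto simp: cy_def cz_def q0)
    qed (use ycz zcz gR cR in \<open>auto intro: R_const\<close>)
    thus ?thesis by blast
  next
    case 2
    hence y0: "y0 = 0" and n2: "poly n2 x0 \<noteq> 0"
      using eq0 simple1[of x0] by auto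
    hence z0: "z0 \<noteq> 0" using eq0 by auto
    obtain n' where n': "n1 = [:- x0, 1:] * n'" "poly n' x0 \<noteq> 0"
      using simple1[of x0] eq0(1) 2 unfolding simple_root_def by blast
    have t: "(\<lambda>q. fst (snd q)) \<in> R" by (rule R_y)
    have x: "(fst q' - fst q) * poly n' (fst q') = fst (snd q') * (poly m (fst q') * fst (snd q'))" if "q' \<in> X" for q'
      using X_D(2)[of "fst q'" "fst (snd q')" "snd (snd q')"] that n'(1)
      by (simp add: q0 power2_eq_square algebra_simps)
    \<comment> \<open>The cover is ramified here: x - x0 is y^2 times a unit, hence
      \<open>k = 2\<close>. The difference z - z0 is first a multiple of x - x0, because z0 \<noteq>
      0, and therefore of y.\<close>
    have "uniformizer q (\<lambda>q. fst (snd q))"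
    proof (rule uniformizerI[OF q, where ca = "\<lambda>q. poly n' (fst q)" and ga = "\<lambda>q. poly m (fst q) * fst (snd q)"
          and k = 2 and c = "\<lambda>q. poly n' (fst q)" and e = "\<lambda>q. poly m (fst q)"
          and cb = "\<lambda>_. 1" and gb = "\<lambda>_. 1" and cc = "\<lambda>q. cz q * poly n' (fst q)"
          and gc = "\<lambda>q. gz q * (poly m (fst q) * fst (snd q))"])
      show "cz q * poly n' (fst q) \<noteq> 0"
        using double z0 eq0(1) n'(2) by (auto simp: cz_def q0)
    next
      fix q' assume "q' \<in> X"
      show "(snd (snd q') - snd (snd q)) * (cz q' * poly n' (fst q')) =
          fst (snd q') * (gz q' * (poly m (fst q') * fst (snd q')))"
        using zcz[OF \<open>q' \<in> X\<close>] x[OF \<open>q' \<in> X\<close>] by algebra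
      show "(fst q' - fst q) * poly n' (fst q') = fst (snd q') ^ 2 * poly m (fst q')"
        using x[OF \<open>q' \<in> X\<close>] by algebra
    qed (use x gR cR n'(2) eq0 y0 in \<open>auto intro!: R_const R_poly R_mult R_y simp: q0\<close>)
    thus ?thesis by blast
  next
    case 3
    hence z0: "z0 = 0" and y0: "y0 \<noteq> 0"
      using eq0 by auto
    obtain n' where n': "n2 = [:- x0, 1:] * n'" "poly n' x0 \<noteq> 0"
      using simple2[of x0] eq0(1) 3 unfolding simple_root_def by blast
    have x: "(fst q' - fst q) * poly n' (fst q') = snd (snd q') * (poly m (fst q') * snd (snd q'))" if "q' \<in> X" for q'
      using X_D(3)[of "fst q'" "fst (snd q')" "snd (snd q')"] that n'(1)
      by (simp add: q0 power2_eq_square algebra_simps)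
    have "uniformizer q (\<lambda>q. snd (snd q))"
    proof (rule uniformizerI[OF q, where ca = "\<lambda>q. poly n' (fst q)" and ga = "\<lambda>q. poly m (fst q) * snd (snd q)"
          and k = 2 and c = "\<lambda>q. poly n' (fst q)" and e = "\<lambda>q. poly m (fst q)"
          and cc = "\<lambda>_. 1" and gc = "\<lambda>_. 1" and cb = "\<lambda>q. cy q * poly n' (fst q)"
          and gb = "\<lambda>q. gy q * (poly m (fst q) * snd (snd q))"])
      show "cy q * poly n' (fst q) \<noteq> 0"
        using double y0 eq0(1) n'(2) by (auto simp: cy_def q0)
    next
      fix q' assume "q' \<in> X"
      show "(fst (snd q') - fst (snd q)) * (cy q' * poly n' (fst q')) =
          snd (snd q') * (gy q' * (poly m (fst q') * snd (snd q')))"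
        using ycz[OF \<open>q' \<in> X\<close>] x[OF \<open>q' \<in> X\<close>] by algebra
      show "(fst q' - fst q) * poly n' (fst q') = snd (snd q') ^ 2 * poly m (fst q')"
        using x[OF \<open>q' \<in> X\<close>] by algebra
    qed (use x gR cR n'(2) eq0 z0 in \<open>auto intro!: R_const R_poly R_mult R_z simp: q0\<close>)
    thus ?thesis by blast
  qed
qed

section \<open>Orders of vanishing\<close>

lemma uniformizer_not_identically_0:
  assumes "q \<in> X" "uniformizer q t"
  shows "\<exists>q'\<in>X. t q' \<noteq> 0"
proof (rule ccontr)
  assume "\<not> ?thesis"
  moreover obtain k e c where k: "k > 0" "e \<in> R" "c \<in> R" "c q \<noteq> 0"
      "\<And>q'. q' \<in> X \<Longrightarrow> (fst q' - fst q) * c q' = t q' ^ k * e q'"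
    using assms unfolding uniformizer_def by blast
  ultimately have "\<And>q'. q' \<in> X \<Longrightarrow> (fst q' - fst q) * c q' = 0"
    by (simp add: zero_power)
  from R_domain[OF R_diff[OF R_x R_const] k(3) this] have "\<forall>q'\<in>X. fst q' = fst q"
    using k(4) assms(1) by auto
  hence "X = {q' \<in> X. fst q' = fst q}"
    by auto
  thus False
    using infinite_X finite_fibre by metis
qed

text \<open>A power of \<open>t\<close> that divides \<open>A\<close> also divides its norm
  \<open>N\<close>, a polynomial in x. The order of \<open>N\<close> in \<open>t\<close> is
  \<open>k0\<close> times the multiplicity of the root x(q), and this is the bound.\<close>

lemma uniformizer_power_bounded:
  assumes q: "q \<in> X" and t: "uniformizer q t" and A: "A \<in> R" "\<exists>q'\<in>X. A q' \<noteq> 0"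
  shows "\<exists>n. \<forall>k A' c. A' \<in> R \<and> c \<in> R \<and> c q \<noteq> 0 \<and> (\<forall>q'\<in>X. A q' * c q' = t q' ^ k * A' q') \<longrightarrow> k \<le> n"
proof -
  have tR: "t \<in> R" "t q = 0"
    using t by (auto simp: uniformizer_def)
  obtain k0 e c0 where k0: "k0 > 0" "e \<in> R" "c0 \<in> R" "c0 q \<noteq> 0" "e q \<noteq> 0"
      "\<And>q'. q' \<in> X \<Longrightarrow> (fst q' - fst q) * c0 q' = t q' ^ k0 * e q'"
    using t q unfolding uniformizer_def by blast
  obtain B N where B: "B \<in> R" "N \<noteq> 0" "\<And>q'. q' \<in> X \<Longrightarrow> A q' * B q' = poly N (fst q')"
    using R_norm[OF A] by blast
  obtain N1 where N1: "N = [:- fst q, 1:] ^ order (fst q) N * N1" "\<not> [:- fst q, 1:] dvd N1"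
    using order_decomp[OF B(2)] by blast
  define M where "M = order (fst q) N"
  have NM: "poly N x = (x - fst q) ^ M * poly N1 x" for x
    by (subst N1(1)) (simp add: M_def)
  have "k \<le> k0 * M" if A': "A' \<in> R" "c \<in> R" "c q \<noteq> 0" "\<And>q'. q' \<in> X \<Longrightarrow> A q' * c q' = t q' ^ k * A' q'" for k A' c
  proof (rule ccontr)
    assume "\<not> ?thesis"
    then obtain j where j: "k = k0 * M + Suc j"
      by (metis less_iff_Suc_add not_le add_Suc_right)
    define L where "L = (\<lambda>q. t q ^ Suc j * A' q * (B q * c0 q ^ M))"
    define U where "U = (\<lambda>q. e q ^ M * poly N1 (fst q) * c q)"
    \<comment> \<open>After cancelling t^(k0 M), the left side still contains a factor
      \<open>t\<close> and vanishes at \<open>q\<close>, whereas the right side is a product of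
      functions that do not.\<close>
    have "L q = U q"
    proof (rule R_cancel[where S = "\<lambda>q. t q ^ (k0 * M)"])
      show "L \<in> R" "U \<in> R" "(\<lambda>q. t q ^ (k0 * M)) \<in> R"
        unfolding L_def U_def by (intro R_mult R_power R_poly A' tR B k0)+
      show "\<exists>q\<in>X. t q ^ (k0 * M) \<noteq> 0"
        using uniformizer_not_identically_0[OF q t] by auto
      fix q' assume q': "q' \<in> X"
      have "t q' ^ (k0 * M) * L q' = (t q' ^ k * A' q') * (B q' * c0 q' ^ M)"
        by (simp add: L_def j power_add)
      also have "\<dots> = (A q' * B q') * (c q' * c0 q' ^ M)"
        by (simp add: A'(4)[OF q', symmetric])
      also have "\<dots> = ((fst q' - fst q) * c0 q') ^ M * (poly N1 (fst q') * c q')"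
        by (simp add: B(3)[OF q'] NM power_mult_distrib)
      also have "\<dots> = t q' ^ (k0 * M) * U q'"
        unfolding k0(6)[OF q'] by (simp add: U_def power_mult_distrib power_mult)
      finally show "t q' ^ (k0 * M) * L q' = t q' ^ (k0 * M) * U q'" .
    qed (rule q)
    moreover have "poly N1 (fst q) \<noteq> 0"
      using N1(2) by (simp add: poly_eq_0_iff_dvd)
    ultimately show False
      using k0(5) A'(3) tR(2) by (simp add: L_def U_def)
  qed
  thus ?thesis by blast
qed

text \<open>Hence every rational function \<open>A / B\<close> extends to a map from \<open>X\<close> to the projective line.\<close>

lemma R_valuation:
  assumes q: "q \<in> X" and AB: "A \<in> R" "B \<in> R" "\<exists>q'\<in>X. A q' \<noteq> 0 \<or> B q' \<noteq> 0"
  shows "\<exists>A1\<in>R. \<exists>B1\<in>R. (\<forall>q'\<in>X. A q' * B1 q' = A1 q' * B q') \<and> (A1 q \<noteq> 0 \<or> B1 q \<noteq> 0)"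
proof -
  obtain t where t: "uniformizer q t"
    using uniformizer_exists[OF q] by blast
  have tR: "t \<in> R" "t q = 0"
    using t by (auto simp: uniformizer_def)
  \<comment> \<open>\<open>Q k\<close> says that t^k divides both \<open>A\<close> and
    \<open>B\<close> in the local ring at \<open>q\<close>. Such \<open>k\<close> are bounded, and
    dividing by the largest common power leaves a pair that is not zero at \<open>q\<close>.\<close>
  define Q where "Q k \<longleftrightarrow> (\<exists>A'\<in>R. \<exists>B'\<in>R. \<exists>c\<in>R. c q \<noteq> 0 \<and>
      (\<forall>q'\<in>X. A q' * c q' = t q' ^ k * A' q') \<and> (\<forall>q'\<in>X. B q' * c q' = t q' ^ k * B' q'))" for k
  have "Q 0"
    unfolding Q_def using AB
    by (intro bexI[where x = A] bexI[where x = B] bexI[where x = "\<lambda>_. 1"]) (auto intro: R_const)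
  moreover have "\<exists>n. \<forall>k. Q k \<longrightarrow> k \<le> n"
  proof (cases "\<exists>q'\<in>X. A q' \<noteq> 0")
    case True
    show ?thesis
      using uniformizer_power_bounded[OF q t AB(1) True] unfolding Q_def by blast
  next
    case False
    hence "\<exists>q'\<in>X. B q' \<noteq> 0"
      using AB(3) by blast
    from uniformizer_power_bounded[OF q t AB(2) this] show ?thesis
      unfolding Q_def by blast
  qed
  ultimately obtain k where k: "Q k" "\<And>k'. Q k' \<Longrightarrow> k' \<le> k"
    using Nat.ex_has_greatest_nat[of Q 0] by metis
  obtain A' B' c where A': "A' \<in> R" "B' \<in> R" "c \<in> R" "c q \<noteq> 0"
      "\<And>q'. q' \<in> X \<Longrightarrow> A q' * c q' = t q' ^ k * A' q'" "\<And>q'. q' \<in> X \<Longrightarrow> B q' * c q' = t q' ^ k * B' q'"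
    using k(1) unfolding Q_def by blast
  have "A' q \<noteq> 0 \<or> B' q \<noteq> 0"
  proof (rule ccontr)
    assume *: "\<not> ?thesis"
    obtain c1 g1 where 1: "c1 \<in> R" "g1 \<in> R" "c1 q \<noteq> 0" "\<And>q'. q' \<in> X \<Longrightarrow> A' q' * c1 q' = t q' * g1 q'"
      using t A'(1) * unfolding uniformizer_def by blast
    obtain c2 g2 where 2: "c2 \<in> R" "g2 \<in> R" "c2 q \<noteq> 0" "\<And>q'. q' \<in> X \<Longrightarrow> B' q' * c2 q' = t q' * g2 q'"
      using t A'(2) * unfolding uniformizer_def by blast
    have "Q (Suc k)"
      unfolding Q_def
    proof (intro bexI conjI ballI)
      fix q' assume q': "q' \<in> X"
      have "A q' * (c q' * (c1 q' * c2 q')) = (A q' * c q') * (c1 q' * c2 q')"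
        by (simp add: mult.assoc)
      also have "\<dots> = t q' ^ k * (A' q' * c1 q') * c2 q'"
        by (simp add: A'(5)[OF q'])
      also have "\<dots> = t q' ^ Suc k * (g1 q' * c2 q')"
        by (simp add: 1(4)[OF q'])
      finally show "A q' * (c q' * (c1 q' * c2 q')) = t q' ^ Suc k * (g1 q' * c2 q')" .
      have "B q' * (c q' * (c1 q' * c2 q')) = (B q' * c q') * (c1 q' * c2 q')"
        by (simp add: mult.assoc)
      also have "\<dots> = t q' ^ k * (B' q' * c2 q') * c1 q'"
        by (simp add: A'(6)[OF q'])
      also have "\<dots> = t q' ^ Suc k * (g2 q' * c1 q')"
        by (simp add: 2(4)[OF q'])
      finally show "B q' * (c q' * (c1 q' * c2 q')) = t q' ^ Suc k * (g2 q' * c1 q')" .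
    qed (use A' 1 2 in \<open>auto intro!: R_mult\<close>)
    thus False using k(2) by fastforce
  qed
  moreover have "A q' * B' q' = A' q' * B q'" if "q' \<in> X" for q'
  proof (rule R_cancel[where S = c and P = "\<lambda>q. A q * B' q" and Q = "\<lambda>q. A' q * B q"])
    fix q' assume q': "q' \<in> X"
    have "c q' * (A q' * B' q') = (A q' * c q') * B' q'" by simp
    also have "\<dots> = A' q' * (B q' * c q')"
      by (simp add: A'(5,6)[OF q'])
    finally show "c q' * (A q' * B' q') = c q' * (A' q' * B q')" by simp
  qed (use A' AB q that in \<open>auto intro!: R_mult\<close>)
  ultimately show ?thesis
    using A' by blast
qed

end

section \<open>Spaces with functions\<close>

definition regular_at :: "('a, 'k) kspace \<Rightarrow> 'a \<Rightarrow> ('a \<Rightarrow> 'k) \<Rightarrow> bool"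
  where "regular_at X p f \<longleftrightarrow> (\<exists>U. openin (zariski X) U \<and> p \<in> U \<and> f \<in> regular X U)"

locale kfun_space =
  fixes X :: "('a, 'k :: field) kspace"
  assumes swf: "space_with_functions X"
begin

lemma open_subset_points: "openin (zariski X) U \<Longrightarrow> U \<subseteq> points X"
  by (simp add: points_def openin_subset)

lemma open_points: "openin (zariski X) (points X)"
  by (simp add: points_def)

lemma regular_local:
  assumes "openin (zariski X) U"
  shows "f \<in> regular X U \<longleftrightarrow>
    (\<forall>p\<in>U. \<exists>V g. openin (zariski X) V \<and> p \<in> V \<and> g \<in> regular X V \<and> (\<forall>q\<in>U \<inter> V. f q = g q))"
  using swf assms unfolding space_with_functions_def by blast

lemma regular_restrict:
  assumes "f \<in> regular X U" "openin (zariski X) U" "openin (zariski X) V" "V \<subseteq> U"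
  shows "f \<in> regular X V"
  unfolding regular_local[OF assms(3)]
proof (intro ballI exI conjI)
  show "openin (zariski X) U" "f \<in> regular X U"
    by fact+
qed (use assms(4) in auto)

lemma regular_iff_at:
  assumes "openin (zariski X) U"
  shows "f \<in> regular X U \<longleftrightarrow> (\<forall>p\<in>U. regular_at X p f)"
proof
  assume "f \<in> regular X U"
  thus "\<forall>p\<in>U. regular_at X p f"
    unfolding regular_at_def using assms by blast
next
  assume *: "\<forall>p\<in>U. regular_at X p f"
  show "f \<in> regular X U"
    unfolding regular_local[OF assms]
  proof
    fix p assume "p \<in> U"
    then obtain V where "openin (zariski X) V" "p \<in> V" "f \<in> regular X V"
      using * unfolding regular_at_def by blast
    thus "\<exists>V g. openin (zariski X) V \<and> p \<in> V \<and> g \<in> regular X V \<and> (\<forall>q\<in>U \<inter> V. f q = g q)"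
      by (intro exI[of _ V] exI[of _ f]) simp
  qed
qed

lemma regular_at_cong:
  assumes "regular_at X p f" "openin (zariski X) N" "p \<in> N" "\<And>q. q \<in> N \<Longrightarrow> g q = f q"
  shows "regular_at X p g"
proof -
  obtain U where U: "openin (zariski X) U" "p \<in> U" "f \<in> regular X U"
    using assms(1) unfolding regular_at_def by blast
  have "g \<in> regular X (U \<inter> N)"
    unfolding regular_local[OF openin_Int[OF U(1) assms(2)]]
  proof (intro ballI exI conjI)
    show "openin (zariski X) U" "f \<in> regular X U"
      by fact+
  qed (use assms(4) in auto)
  thus ?thesis
    unfolding regular_at_def using U assms by blast
qed

lemma regular_const: "openin (zariski X) U \<Longrightarrow> (\<lambda>_. c) \<in> regular X U"
  and regular_add: "openin (zariski X) U \<Longrightarrow> f \<in> regular X U \<Longrightarrow> g \<in> regular X U \<Longrightarrow> (\<lambda>p. f p + g p) \<in> regular X U"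
  and regular_mult: "openin (zariski X) U \<Longrightarrow> f \<in> regular X U \<Longrightarrow> g \<in> regular X U \<Longrightarrow> (\<lambda>p. f p * g p) \<in> regular X U"
  and open_nonzero: "openin (zariski X) U \<Longrightarrow> f \<in> regular X U \<Longrightarrow> openin (zariski X) {p \<in> U. f p \<noteq> 0}"
  and regular_inverse: "openin (zariski X) U \<Longrightarrow> f \<in> regular X U \<Longrightarrow> (\<lambda>p. inverse (f p)) \<in> regular X {p \<in> U. f p \<noteq> 0}"
  using swf[unfolded space_with_functions_def, THEN conjunct2] by simp_all

lemma at_const: "p \<in> points X \<Longrightarrow> regular_at X p (\<lambda>_. c)"
  unfolding regular_at_def using regular_const[OF open_points] open_points by blast

lemma at_add: "regular_at X p f \<Longrightarrow> regular_at X p g \<Longrightarrow> regular_at X p (\<lambda>p. f p + g p)"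
  and at_mult: "regular_at X p f \<Longrightarrow> regular_at X p g \<Longrightarrow> regular_at X p (\<lambda>p. f p * g p)"
proof -
  assume "regular_at X p f" "regular_at X p g"
  then obtain U V where "openin (zariski X) U" "p \<in> U" "f \<in> regular X U"
      "openin (zariski X) V" "p \<in> V" "g \<in> regular X V"
    unfolding regular_at_def by blast
  hence W: "openin (zariski X) (U \<inter> V)" "p \<in> U \<inter> V" "f \<in> regular X (U \<inter> V)" "g \<in> regular X (U \<inter> V)"
    by (auto intro: regular_restrict)
  show "regular_at X p (\<lambda>p. f p + g p)"
    unfolding regular_at_def by (intro exI[of _ "U \<inter> V"] conjI W regular_add)
  show "regular_at X p (\<lambda>p. f p * g p)"
    unfolding regular_at_def by (intro exI[of _ "U \<inter> V"] conjI W regular_mult)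
qed

lemma at_inverse: "regular_at X p f \<Longrightarrow> f p \<noteq> 0 \<Longrightarrow> regular_at X p (\<lambda>p. inverse (f p))"
  unfolding regular_at_def
proof (elim exE conjE)
  fix U assume "f p \<noteq> 0" "openin (zariski X) U" "p \<in> U" "f \<in> regular X U"
  thus "\<exists>U. openin (zariski X) U \<and> p \<in> U \<and> (\<lambda>p. inverse (f p)) \<in> regular X U"
    by (intro exI[of _ "{p \<in> U. f p \<noteq> 0}"] conjI regular_inverse open_nonzero) simp_all
qed

lemma regular_at_points: "regular_at X p f \<Longrightarrow> p \<in> points X"
  unfolding regular_at_def using open_subset_points by blast

lemma at_diff: "regular_at X p f \<Longrightarrow> regular_at X p g \<Longrightarrow> regular_at X p (\<lambda>p. f p - g p)"
  using at_add[OF _ at_mult[OF at_const[of p "-1"]], of f g] regular_at_points by simp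

lemma at_divide: "regular_at X p f \<Longrightarrow> regular_at X p g \<Longrightarrow> g p \<noteq> 0 \<Longrightarrow> regular_at X p (\<lambda>p. f p / g p)"
  using at_mult[OF _ at_inverse, of p f g] by (simp add: divide_inverse)

lemma at_power: "regular_at X p f \<Longrightarrow> regular_at X p (\<lambda>p. f p ^ n)"
  by (induction n) (auto intro: at_mult at_const regular_at_points)

lemma at_sum: "p \<in> points X \<Longrightarrow> (\<And>i. i \<in> I \<Longrightarrow> regular_at X p (f i)) \<Longrightarrow> regular_at X p (\<lambda>p. \<Sum>i\<in>I. f i p)"
  by (induction I rule: infinite_finite_induct) (auto intro: at_const at_add)

lemma at_poly: "regular_at X p f \<Longrightarrow> regular_at X p (\<lambda>p. poly P (f p))"
  by (induction P) (auto intro!: at_add at_mult at_const intro: regular_at_points)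

lemma regular_imp_at: "f \<in> regular X U \<Longrightarrow> openin (zariski X) U \<Longrightarrow> p \<in> U \<Longrightarrow> regular_at X p f"
  unfolding regular_at_def by blast

lemma at_nonzero_nbhd:
  assumes "regular_at X p f" "f p \<noteq> 0"
  obtains N where "openin (zariski X) N" "p \<in> N" "\<And>q. q \<in> N \<Longrightarrow> f q \<noteq> 0"
proof -
  obtain U where U: "openin (zariski X) U" "p \<in> U" "f \<in> regular X U"
    using assms(1) unfolding regular_at_def by blast
  show ?thesis
    by (rule that[OF open_nonzero[OF U(1,3)]]) (use U(2) assms(2) in auto)
qed

lemma open_subspace_zariski:
  assumes "openin (zariski X) U"
  shows "openin (zariski (subspace_on X U)) W \<longleftrightarrow> openin (zariski X) W \<and> W \<subseteq> U"
  using assms by (simp add: subspace_on_def openin_open_subtopology)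

lemma open_subspace_points: "openin (zariski X) U \<Longrightarrow> points (subspace_on X U) = U"
  using open_subset_points by (auto simp: points_def subspace_on_def)

lemma open_subspace_regular:
  assumes "openin (zariski X) W"
  shows "regular (subspace_on X U) W = regular X W"
  using regular_local[OF assms] by (auto simp: subspace_on_def Int_commute)

lemma kfun_space_open_subspace:
  assumes U: "openin (zariski X) U"
  shows "kfun_space (subspace_on X U)"
proof
  show "space_with_functions (subspace_on X U)"
    unfolding space_with_functions_def open_subspace_zariski[OF U]
  proof (intro conjI allI impI ballI)
    fix W f assume W: "openin (zariski X) W \<and> W \<subseteq> U"
    show "f \<in> regular (subspace_on X U) W \<longleftrightarrow> (\<forall>p\<in>W. \<exists>V g. (openin (zariski X) V \<and> V \<subseteq> U) \<and> p \<in> V \<and>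
        g \<in> regular (subspace_on X U) V \<and> (\<forall>q\<in>W \<inter> V. f q = g q))" (is "?l \<longleftrightarrow> ?r")
    proof
      assume ?l
      thus ?r using W by blast
    next
      assume r: ?r
      show ?l
        unfolding open_subspace_regular[OF W[THEN conjunct1]] regular_local[OF W[THEN conjunct1]]
      proof
        fix p assume "p \<in> W"
        from bspec[OF r this] obtain V g where V: "openin (zariski X) V" "p \<in> V" "g \<in> regular (subspace_on X U) V" "\<forall>q\<in>W \<inter> V. f q = g q"
          by (elim exE conjE)
        show "\<exists>V g. openin (zariski X) V \<and> p \<in> V \<and> g \<in> regular X V \<and> (\<forall>q\<in>W \<inter> V. f q = g q)"
          using V open_subspace_regular[OF V(1)] by (intro exI[of _ V] exI[of _ g]) simp
      qed
    qed
  next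
    fix W f assume W: "openin (zariski X) W \<and> W \<subseteq> U" and "f \<in> regular (subspace_on X U) W"
    hence f: "f \<in> regular X W" using open_subspace_regular by blast
    show "openin (zariski X) {p \<in> W. f p \<noteq> 0}"
      using open_nonzero W f by blast
    thus "(\<lambda>p. inverse (f p)) \<in> regular (subspace_on X U) {p \<in> W. f p \<noteq> 0}"
      using regular_inverse W f open_subspace_regular by blast
    show "{p \<in> W. f p \<noteq> 0} \<subseteq> U" using W by blast
  qed (auto simp: open_subspace_regular intro: regular_const regular_add regular_mult)
qed

lemma open_subspace_regular_at:
  assumes "openin (zariski X) U" "p \<in> U"
  shows "regular_at (subspace_on X U) p f \<longleftrightarrow> regular_at X p f"
  unfolding regular_at_def open_subspace_zariski[OF assms(1)]
proof (intro iffI; elim exE conjE)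
  fix W assume "openin (zariski X) W" "p \<in> W" "f \<in> regular (subspace_on X U) W"
  thus "\<exists>U. openin (zariski X) U \<and> p \<in> U \<and> f \<in> regular X U"
    using open_subspace_regular by blast
next
  fix W assume "openin (zariski X) W" "p \<in> W" "f \<in> regular X W"
  thus "\<exists>Ua. (openin (zariski X) Ua \<and> Ua \<subseteq> U) \<and> p \<in> Ua \<and> f \<in> regular (subspace_on X U) Ua"
    using assms open_subspace_regular[of "W \<inter> U"] regular_restrict[of f W "W \<inter> U"]
    by (intro exI[of _ "W \<inter> U"]) auto
qed

end

lemma points_subspace_on: "points (subspace_on X S) = points X \<inter> S"
  by (simp add: points_def subspace_on_def)

lemma regular_subspace_onI:
  assumes "\<And>p. p \<in> W \<Longrightarrow> \<exists>U g. openin (zariski X) U \<and> p \<in> U \<and> g \<in> regular X U \<and> (\<forall>q\<in>U \<inter> W. f q = g q)"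
  shows "f \<in> regular (subspace_on X S) W"
  using assms by (simp add: subspace_on_def)

subsection \<open>Affine and projective space\<close>

lemma generated_topology_basis:
  assumes "\<And>A B. A \<in> \<B> \<Longrightarrow> B \<in> \<B> \<Longrightarrow> A \<inter> B \<in> \<B>"
    and "openin (topology_generated_by \<B>) U" "p \<in> U"
  shows "\<exists>B\<in>\<B>. p \<in> B \<and> B \<subseteq> U"
proof -
  have "generate_topology_on \<B> U"
    using assms(2) by (simp add: openin_topology_generated_by_iff)
  thus ?thesis
    using assms(3)
  proof (induction arbitrary: p)
    case (Int a b)
    hence "p \<in> a" "p \<in> b" by auto
    obtain A where "A \<in> \<B>" "p \<in> A" "A \<subseteq> a"
      using Int.IH(1)[OF \<open>p \<in> a\<close>] by (elim bexE conjE)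
    moreover obtain B where "B \<in> \<B>" "p \<in> B" "B \<subseteq> b"
      using Int.IH(2)[OF \<open>p \<in> b\<close>] by (elim bexE conjE)
    ultimately have "p \<in> A \<inter> B" "A \<inter> B \<subseteq> a \<inter> b"
      by blast+
    thus ?case
      using assms(1)[OF \<open>A \<in> \<B>\<close> \<open>B \<in> \<B>\<close>] by (intro bexI[of _ "A \<inter> B"] conjI)
  next
    case (UN K)
    then obtain k where k: "k \<in> K" "p \<in> k" by blast
    then obtain B where "B \<in> \<B>" "p \<in> B" "B \<subseteq> k"
      using UN.IH by blast
    thus ?case using k by blast
  qed auto
qed

lemma uminus_polynomial_functions: "f \<in> polynomial_functions \<Longrightarrow> (\<lambda>v. - f v) \<in> polynomial_functions"
  using polynomial_functions.mult[OF polynomial_functions.const[of "-1"], of f] by simp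

lemma diff_polynomial_functions:
  "f \<in> polynomial_functions \<Longrightarrow> g \<in> polynomial_functions \<Longrightarrow> (\<lambda>v. f v - g v) \<in> polynomial_functions"
  using polynomial_functions.add[OF _ uminus_polynomial_functions, of f g] by simp

lemma homogeneous_uminus: "homogeneous d f \<Longrightarrow> homogeneous d (\<lambda>v. - f v)"
  using homogeneous.mult[OF homogeneous.const[of "-1"], of d f] by simp

lemma homogeneous_diff: "homogeneous d f \<Longrightarrow> homogeneous d g \<Longrightarrow> homogeneous d (\<lambda>v. f v - g v)"
  using homogeneous.add[OF _ homogeneous_uminus, of d f g] by simp

lemma homogeneous_smult: "homogeneous d f \<Longrightarrow> homogeneous d (\<lambda>v. c * f v)"
  using homogeneous.mult[OF homogeneous.const[of c], of d f] by simp

lemma homogeneous_mult': "homogeneous d f \<Longrightarrow> homogeneous e g \<Longrightarrow> n = d + e \<Longrightarrow> homogeneous n (\<lambda>v. f v * g v)"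
  using homogeneous.mult by blast

lemma homogeneous_power: "homogeneous d f \<Longrightarrow> homogeneous (n * d) (\<lambda>v. f v ^ n)"
proof (induction n)
  case 0
  show ?case using homogeneous.const[of 1] by simp
next
  case (Suc n)
  show ?case using homogeneous.mult[OF Suc(2) Suc(1)[OF Suc(2)]] by simp
qed

lemma homogeneous_scale: "homogeneous d f \<Longrightarrow> f (\<lambda>i. c * v i) = c ^ d * f v"
  by (induction rule: homogeneous.induct) (auto simp: algebra_simps power_add)

lemma points_affine_space: "points (affine_space n) = {v. \<forall>i\<ge>n. v i = 0}"
proof -
  let ?A = "{v :: nat \<Rightarrow> 'a. \<forall>i\<ge>n. v i = 0}"
  have "?A \<in> {{v \<in> ?A. h v \<noteq> 0} | h. h \<in> polynomial_functions}"
    by (rule CollectI, rule exI[of _ "\<lambda>_. 1"]) (auto intro: polynomial_functions.const)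
  thus ?thesis
    by (auto simp: points_def affine_space_def topology_generated_by_topspace)
qed

lemma open_affine_basic:
  "h \<in> polynomial_functions \<Longrightarrow> openin (zariski (affine_space n)) {v \<in> points (affine_space n). h v \<noteq> 0}"
  unfolding points_affine_space
  by (auto simp: affine_space_def intro!: topology_generated_by_Basis)

lemma affine_basis:
  assumes "openin (zariski (affine_space n)) U" "p \<in> U"
  obtains h where "h \<in> polynomial_functions" "h p \<noteq> 0" "{v \<in> points (affine_space n). h v \<noteq> 0} \<subseteq> U"
proof -
  let ?A = "{v :: nat \<Rightarrow> 'a. \<forall>i\<ge>n. v i = 0}"
  let ?B = "{{v \<in> ?A. h v \<noteq> 0} | h. h \<in> polynomial_functions}"
  have Int: "A \<inter> B \<in> ?B" if AB: "A \<in> ?B" "B \<in> ?B" for A B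
  proof -
    obtain g h where "A = {v \<in> ?A. g v \<noteq> 0}" "B = {v \<in> ?A. h v \<noteq> 0}" "g \<in> polynomial_functions" "h \<in> polynomial_functions"
      using AB by blast
    thus ?thesis
      by (auto intro!: exI[of _ "\<lambda>v. g v * h v"] polynomial_functions.mult)
  qed

  have "openin (topology_generated_by ?B) U"
    using assms(1) by (simp add: affine_space_def)
  hence "\<exists>B\<in>?B. p \<in> B \<and> B \<subseteq> U"
    by (rule generated_topology_basis[rotated]) (fact assms(2), rule Int)
  then obtain B where "B \<in> ?B" "p \<in> B" "B \<subseteq> U"
    by (elim bexE conjE)
  thus ?thesis
    using that unfolding points_affine_space by blast
qed

lemma regular_affine_space:
  "f \<in> regular (affine_space n) W \<longleftrightarrow> (\<forall>p\<in>W. \<exists>g\<in>polynomial_functions. \<exists>h\<in>polynomial_functions.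
     h p \<noteq> 0 \<and> (\<forall>q\<in>W. h q \<noteq> 0 \<longrightarrow> f q = g q / h q))"
  by (simp add: affine_space_def)

lemma regular_affine_space_restrict:
  assumes "f \<in> regular (affine_space n) U" "V \<subseteq> U"
  shows "f \<in> regular (affine_space n) V"
  unfolding regular_affine_space
proof
  fix p assume "p \<in> V"
  hence "p \<in> U" using assms(2) by blast
  from bspec[OF assms(1)[unfolded regular_affine_space] this]
  obtain g h where "g \<in> polynomial_functions" "h \<in> polynomial_functions" "h p \<noteq> 0"
      "\<forall>q\<in>U. h q \<noteq> 0 \<longrightarrow> f q = g q / h q"
    by (elim bexE conjE)
  thus "\<exists>g\<in>polynomial_functions. \<exists>h\<in>polynomial_functions. h p \<noteq> 0 \<and> (\<forall>q\<in>V. h q \<noteq> 0 \<longrightarrow> f q = g q / h q)"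
    using assms(2) by (intro bexI[of _ g] bexI[of _ h]) auto
qed

lemma polynomial_regular_affine_space: "f \<in> polynomial_functions \<Longrightarrow> f \<in> regular (affine_space n) U"
  unfolding regular_affine_space
  by (intro ballI bexI[of _ f] bexI[of _ "\<lambda>_. 1"] polynomial_functions.const) auto

lemma closed_point_affine_space: "closedin (zariski (affine_space n)) {v}" if "v \<in> points (affine_space n)"
proof -
  have "openin (zariski (affine_space n)) (\<Union>i. {w \<in> points (affine_space n). w i - v i \<noteq> 0})"
  proof (intro openin_Union ballI)
    fix S assume "S \<in> range (\<lambda>i. {w \<in> points (affine_space n). w i - v i \<noteq> 0})"
    then obtain i where "S = {w \<in> points (affine_space n). w i - v i \<noteq> 0}"
      by blast
    thus "openin (zariski (affine_space n)) S"
      using open_affine_basic[OF diff_polynomial_functions[OF polynomial_functions.coord polynomial_functions.const]]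
      by simp
  qed
  also have "(\<Union>i. {w \<in> points (affine_space n). w i - v i \<noteq> 0}) = points (affine_space n) - {v}"
    by auto
  finally show ?thesis
    using that by (simp add: closedin_def points_def)
qed

lemma points_projective_space:
  "points (projective_space n) = {proj_point v | v. (\<exists>i. v i \<noteq> 0) \<and> (\<forall>i>n. v i = 0)}"
proof -
  let ?P = "{proj_point v | v :: nat \<Rightarrow> 'a. (\<exists>i. v i \<noteq> 0) \<and> (\<forall>i>n. v i = 0)}"
  have "?P \<in> {{p \<in> ?P. \<forall>v\<in>p. h v \<noteq> 0} | h d. homogeneous d h}"
    by (rule CollectI, rule exI[of _ "\<lambda>_. 1"], rule exI[of _ 0]) (auto intro: homogeneous.const)
  thus ?thesis
    by (auto simp: points_def projective_space_def topology_generated_by_topspace)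
qed

lemma open_projective_basic:
  "homogeneous d h \<Longrightarrow> openin (zariski (projective_space n)) {p \<in> points (projective_space n). \<forall>v\<in>p. h v \<noteq> 0}"
  unfolding points_projective_space
  by (auto simp: projective_space_def intro!: topology_generated_by_Basis)

lemma projective_basis:
  assumes "openin (zariski (projective_space n)) U" "p \<in> U"
  obtains d h where "homogeneous d h" "\<And>v. v \<in> p \<Longrightarrow> h v \<noteq> 0" "{q \<in> points (projective_space n). \<forall>v\<in>q. h v \<noteq> 0} \<subseteq> U"
proof -
  let ?P = "{proj_point v | v :: nat \<Rightarrow> 'a. (\<exists>i. v i \<noteq> 0) \<and> (\<forall>i>n. v i = 0)}"
  let ?B = "{{p \<in> ?P. \<forall>v\<in>p. h v \<noteq> 0} | h d. homogeneous d h}"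
  have Int: "A \<inter> B \<in> ?B" if AB: "A \<in> ?B" "B \<in> ?B" for A B
  proof -
    obtain g h d e where "A = {p \<in> ?P. \<forall>v\<in>p. g v \<noteq> 0}" "B = {p \<in> ?P. \<forall>v\<in>p. h v \<noteq> 0}" "homogeneous d g" "homogeneous e h"
      using AB by blast
    moreover from this have "A \<inter> B = {p \<in> ?P. \<forall>v\<in>p. g v * h v \<noteq> 0}"
      by auto
    ultimately show ?thesis
      by (intro CollectI exI[of _ "\<lambda>v. g v * h v"] exI[of _ "d + e"] conjI homogeneous.mult)
  qed

  have "openin (topology_generated_by ?B) U"
    using assms(1) by (simp add: projective_space_def)
  hence "\<exists>B\<in>?B. p \<in> B \<and> B \<subseteq> U"
    by (rule generated_topology_basis[rotated]) (fact assms(2), rule Int)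
  then obtain B where "B \<in> ?B" "p \<in> B" "B \<subseteq> U"
    by (elim bexE conjE)
  thus ?thesis
    using that unfolding points_projective_space by blast
qed

lemma proj_point_self: "v \<in> proj_point v"
  unfolding proj_point_def by (rule CollectI, rule exI[of _ 1]) auto

lemma proj_point_eq: "c \<noteq> 0 \<Longrightarrow> proj_point (\<lambda>i. c * v i) = proj_point v" for c :: "'k :: field"
proof -
  assume c: "c \<noteq> 0"
  have "\<exists>b. (\<lambda>i. a * v i) = (\<lambda>i. b * (c * v i)) \<and> b \<noteq> 0" if "a \<noteq> 0" for a
    using c that by (intro exI[of _ "a / c"]) auto
  moreover have "\<exists>b. (\<lambda>i. a * (c * v i)) = (\<lambda>i. b * v i) \<and> b \<noteq> 0" if "a \<noteq> 0" for a
    using c that by (intro exI[of _ "a * c"]) (auto simp: mult.assoc)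
  ultimately show ?thesis
    by (auto simp: proj_point_def)
qed

lemma proj_point_eqD:
  assumes "proj_point v = proj_point w"
  obtains c where "c \<noteq> 0" "\<And>i. v i = c * w i"
  using proj_point_self[of v] assms unfolding proj_point_def by auto

lemma proj_point_eqI:
  assumes "c \<noteq> 0" "\<And>i. v i = c * w i"
  shows "proj_point v = proj_point w"
proof -
  have "v = (\<lambda>i. c * w i)" using assms(2) by auto
  thus ?thesis using proj_point_eq[OF assms(1)] by blast
qed

lemma homogeneous_nonzero_iff:
  assumes "homogeneous d h"
  shows "(\<forall>v\<in>proj_point w. h v \<noteq> 0) \<longleftrightarrow> h w \<noteq> 0"
  using homogeneous_scale[OF assms] proj_point_self[of w] by (auto simp: proj_point_def)

lemma proj_point_in_points:
  "v i \<noteq> 0 \<Longrightarrow> (\<And>i. i > n \<Longrightarrow> v i = 0) \<Longrightarrow> proj_point v \<in> points (projective_space n)"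
  unfolding points_projective_space by blast

lemma regular_projective_space:
  "f \<in> regular (projective_space n) W \<longleftrightarrow> (\<forall>p\<in>W. \<exists>d g h. homogeneous d g \<and> homogeneous d h \<and> (\<forall>v\<in>p. h v \<noteq> 0) \<and>
     (\<forall>q\<in>W. \<forall>v\<in>q. h v \<noteq> 0 \<longrightarrow> f q = g v / h v))"
  by (simp add: projective_space_def)

lemma regular_projective_space_restrict:
  assumes "f \<in> regular (projective_space n) U" "V \<subseteq> U"
  shows "f \<in> regular (projective_space n) V"
  unfolding regular_projective_space
proof
  fix p assume "p \<in> V"
  hence "p \<in> U" using assms(2) by blast
  from bspec[OF assms(1)[unfolded regular_projective_space] this]
  obtain d g h where "homogeneous d g" "homogeneous d h" "\<forall>v\<in>p. h v \<noteq> 0"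
      "\<forall>q\<in>U. \<forall>v\<in>q. h v \<noteq> 0 \<longrightarrow> f q = g v / h v"
    by (elim exE conjE)
  thus "\<exists>d g h. homogeneous d g \<and> homogeneous d h \<and> (\<forall>v\<in>p. h v \<noteq> 0) \<and> (\<forall>q\<in>V. \<forall>v\<in>q. h v \<noteq> 0 \<longrightarrow> f q = g v / h v)"
    using assms(2) by (intro exI[of _ d] exI[of _ g] exI[of _ h]) auto
qed

lemma closed_point_projective_space: "closedin (zariski (projective_space n)) {p}" if p: "p \<in> points (projective_space n)"
proof -
  obtain v where v: "p = proj_point v" "\<exists>i. v i \<noteq> 0" "\<forall>i>n. v i = 0"
    using p unfolding points_projective_space by blast
  then obtain k where k: "v k \<noteq> 0" by blast
  \<comment> \<open>The 2 by 2 minors against the nonzero coordinate \<open>v k\<close>: all of them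
    vanish exactly at the multiples of \<open>v\<close>.\<close>
  define h where "h = (\<lambda>i w. v k * w i - v i * w k)"
  have hom: "homogeneous 1 (h i)" for i
    unfolding h_def by (intro homogeneous_diff homogeneous_smult homogeneous.coord)
  have "openin (zariski (projective_space n)) (\<Union>i. {q \<in> points (projective_space n). \<forall>w\<in>q. h i w \<noteq> 0})"
    by (intro openin_Union ballI) (auto intro: open_projective_basic[OF hom])
  also have "(\<Union>i. {q \<in> points (projective_space n). \<forall>w\<in>q. h i w \<noteq> 0}) = points (projective_space n) - {p}"
  proof (intro equalityI subsetI)
    fix q assume "q \<in> (\<Union>i. {q \<in> points (projective_space n). \<forall>w\<in>q. h i w \<noteq> 0})"
    moreover have "v \<in> p" by (simp add: v(1) proj_point_self)
    ultimately show "q \<in> points (projective_space n) - {p}"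
      by (auto simp: h_def)
  next
    fix q assume q: "q \<in> points (projective_space n) - {p}"
    then obtain w where w: "q = proj_point w" "\<exists>i. w i \<noteq> 0" "\<forall>i>n. w i = 0"
      unfolding points_projective_space by blast
    have "\<exists>i. h i w \<noteq> 0"
    proof (rule ccontr)
      assume "\<not> ?thesis"
      hence eq: "v k * w i = v i * w k" for i
        by (simp add: h_def)
      have wk: "w k \<noteq> 0"
      proof
        assume "w k = 0"
        hence "w i = 0" for i
          using eq[of i] k by simp
        thus False using w(2) by blast
      qed
      have *: "v i = v k / w k * w i" for i
        using eq[of i] wk by (simp add: nonzero_eq_divide_eq)
      have "proj_point v = proj_point w"
        by (rule proj_point_eqI[OF _ *]) (simp add: k wk)
      thus False using q v(1) w(1) by blast
    qed
    thus "q \<in> (\<Union>i. {q \<in> points (projective_space n). \<forall>w\<in>q. h i w \<noteq> 0})"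
      using q w(1) homogeneous_nonzero_iff[OF hom] by blast
  qed
  finally show ?thesis
    using that by (simp add: closedin_def points_def)
qed

subsection \<open>Criteria for isomorphisms\<close>

text \<open>Replaces the study of the inverse map by two conditions: \<open>opn\<close> makes \<Phi>
  open onto its image, and \<open>push\<close> extends each regular germ on \<open>X\<close> to a
  regular germ of the ambient space. The condition \<open>pull\<close> is local as well, so all of
  this can be checked chart by chart.\<close>

lemma isomorphism_onto_subspace:
  assumes X: "kfun_space X"
    and \<Phi>: "inj_on \<Phi> (points X)" "\<Phi> ` points X = S" "S \<subseteq> points B"
    and restr: "\<And>U V f. f \<in> regular B U \<Longrightarrow> V \<subseteq> U \<Longrightarrow> f \<in> regular B V"
    and cont: "\<And>U. openin (zariski B) U \<Longrightarrow> openin (zariski X) {p \<in> points X. \<Phi> p \<in> U}"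
    and pull: "\<And>U f p. openin (zariski B) U \<Longrightarrow> f \<in> regular B U \<Longrightarrow> p \<in> points X \<Longrightarrow> \<Phi> p \<in> U \<Longrightarrow> regular_at X p (f \<circ> \<Phi>)"
    and opn: "\<And>W. openin (zariski X) W \<Longrightarrow> \<exists>U. openin (zariski B) U \<and> \<Phi> ` W = U \<inter> S"
    and push: "\<And>p f. p \<in> points X \<Longrightarrow> regular_at X p f \<Longrightarrow>
      \<exists>U g N. openin (zariski B) U \<and> \<Phi> p \<in> U \<and> g \<in> regular B U \<and> openin (zariski X) N \<and> p \<in> N \<and>
        (\<forall>q\<in>N. \<Phi> q \<in> U \<longrightarrow> f q = g (\<Phi> q))"
  shows "isomorphism X (subspace_on B S) \<Phi>"
proof -
  interpret kfun_space X by fact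
  have S: "points (subspace_on B S) = S"
    using \<Phi>(3) by (auto simp: points_subspace_on)
  have opS: "openin (zariski (subspace_on B S)) V \<longleftrightarrow> (\<exists>U. openin (zariski B) U \<and> V = U \<inter> S)" for V
    by (auto simp: subspace_on_def openin_subtopology)
  have m1: "morphism X (subspace_on B S) \<Phi>"
    unfolding morphism_def
  proof (intro conjI allI impI)
    have "{p \<in> points X. \<Phi> p \<in> U \<inter> S} = {p \<in> points X. \<Phi> p \<in> U}" for U
      using \<Phi>(2) by blast
    thus "continuous_map (zariski X) (zariski (subspace_on B S)) \<Phi>"
      unfolding continuous_map_def using \<Phi>(2) S cont opS by (auto simp: points_def)
    fix V f assume Vf: "openin (zariski (subspace_on B S)) V \<and> f \<in> regular (subspace_on B S) V"
    then obtain U where U: "openin (zariski B) U" "V = U \<inter> S"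
      using opS by blast
    have eqU: "{p \<in> points X. \<Phi> p \<in> V} = {p \<in> points X. \<Phi> p \<in> U}"
      using \<Phi>(2) U by blast
    show "f \<circ> \<Phi> \<in> regular X {p \<in> points X. \<Phi> p \<in> V}"
      unfolding eqU regular_iff_at[OF cont[OF U(1)]]
    proof
      fix p assume p: "p \<in> {p \<in> points X. \<Phi> p \<in> U}"
      hence pV: "\<Phi> p \<in> V" using U \<Phi> by auto
      obtain W g where W: "openin (zariski B) W" "\<Phi> p \<in> W" "g \<in> regular B W" "\<And>q. q \<in> W \<inter> V \<Longrightarrow> f q = g q"
        using Vf pV by (auto simp: subspace_on_def)
      show "regular_at X p (f \<circ> \<Phi>)"
      proof (rule regular_at_cong[OF pull[OF W(1,3)]])
        show "openin (zariski X) {p \<in> points X. \<Phi> p \<in> W \<inter> U}"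
          using cont[OF openin_Int[OF W(1) U(1)]] .
      qed (use p W U \<Phi> in auto)
    qed
  qed
  define \<psi> where "\<psi> = inv_into (points X) \<Phi>"
  have \<psi>: "\<psi> (\<Phi> p) = p" if "p \<in> points X" for p
    using \<Phi>(1) that by (simp add: \<psi>_def)
  have \<psi>': "\<psi> q \<in> points X" "\<Phi> (\<psi> q) = q" if "q \<in> S" for q
    using \<Phi>(2) that \<psi> by auto
  have pre: "{q \<in> S. \<psi> q \<in> W} = \<Phi> ` W" if "openin (zariski X) W" for W
    using open_subset_points[OF that] \<psi> \<psi>' \<Phi>(2) by force
  have m2: "morphism (subspace_on B S) X \<psi>"
    unfolding morphism_def
  proof (intro conjI allI impI)
    show "continuous_map (zariski (subspace_on B S)) (zariski X) \<psi>"
      unfolding continuous_map_def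
    proof (intro conjI allI impI)
      show "\<psi> \<in> topspace (zariski (subspace_on B S)) \<rightarrow> topspace (zariski X)"
        using \<psi>' S by (auto simp: points_def)
      fix W assume W: "openin (zariski X) W"
      have "{q \<in> topspace (zariski (subspace_on B S)). \<psi> q \<in> W} = \<Phi> ` W"
        using pre[OF W] S by (simp add: points_def)
      thus "openin (zariski (subspace_on B S)) {q \<in> topspace (zariski (subspace_on B S)). \<psi> q \<in> W}"
        using opn[OF W] opS by auto
    qed
    fix W f assume Wf: "openin (zariski X) W \<and> f \<in> regular X W"
    show "f \<circ> \<psi> \<in> regular (subspace_on B S) {p \<in> points (subspace_on B S). \<psi> p \<in> W}"
      unfolding S
    proof (rule regular_subspace_onI)
      fix q assume q: "q \<in> {p \<in> S. \<psi> p \<in> W}"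
      hence p: "\<psi> q \<in> points X" "\<psi> q \<in> W" "\<Phi> (\<psi> q) = q"
        using \<psi>' by auto
      obtain U g N where U: "openin (zariski B) U" "q \<in> U" "g \<in> regular B U" "openin (zariski X) N" "\<psi> q \<in> N"
          "\<And>p'. p' \<in> N \<Longrightarrow> \<Phi> p' \<in> U \<Longrightarrow> f p' = g (\<Phi> p')"
        using push[OF p(1) regular_imp_at[of f W]] Wf p(2,3) by metis
      obtain U' where U': "openin (zariski B) U'" "\<Phi> ` N = U' \<inter> S"
        using opn[OF U(4)] by blast
      show "\<exists>U g. openin (zariski B) U \<and> q \<in> U \<and> g \<in> regular B U \<and>
          (\<forall>q\<in>U \<inter> {p \<in> S. \<psi> p \<in> W}. (f \<circ> \<psi>) q = g q)"
      proof (intro exI conjI ballI)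
        show "openin (zariski B) (U \<inter> U')" using U U' by blast
        show "q \<in> U \<inter> U'" using U U' p(3) q by (metis IntD1 IntI imageI)
        show "g \<in> regular B (U \<inter> U')" using restr[OF U(3)] by blast
        fix q' assume q': "q' \<in> U \<inter> U' \<inter> {p \<in> S. \<psi> p \<in> W}"
        hence "q' \<in> \<Phi> ` N" using U'(2) by blast
        hence "\<psi> q' \<in> N" using \<psi> open_subset_points[OF U(4)] by auto
        thus "(f \<circ> \<psi>) q' = g q'"
          using U(6)[of "\<psi> q'"] q' \<psi>' by simp
      qed
    qed
  qed
  show ?thesis
    unfolding isomorphism_def using m1 m2 \<psi> \<psi>' S by metis
qed

text \<open>The target of the birational map is an open piece of a plane curve, which is itself a
  subspace of the plane. The two topologies agree, and composing two local extensions of a regular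
  function gives a single one.\<close>

lemma isomorphism_subspace_of_subspace:
  assumes iso: "isomorphism X (subspace_on B (S \<inter> V)) \<Phi>"
    and restr: "\<And>U V f. f \<in> regular B U \<Longrightarrow> V \<subseteq> U \<Longrightarrow> f \<in> regular B V"
  shows "isomorphism X (subspace_on (subspace_on B S) V) \<Phi>"
proof -
  let ?Y = "subspace_on B (S \<inter> V)" and ?Z = "subspace_on (subspace_on B S) V"
  have top: "zariski ?Z = zariski ?Y"
    by (simp add: subspace_on_def subtopology_subtopology)
  have reg: "regular ?Z W = regular ?Y W" if W: "W \<subseteq> S" for W
  proof (intro equalityI subsetI)
    fix f assume f: "f \<in> regular ?Z W"
    show "f \<in> regular ?Y W"
    proof (rule regular_subspace_onI)
      fix p assume p: "p \<in> W"
      obtain U1 g where U1: "openin (zariski (subspace_on B S)) U1" "p \<in> U1" "g \<in> regular (subspace_on B S) U1"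
          "\<forall>q\<in>U1 \<inter> W. f q = g q"
        using f p by (auto simp: subspace_on_def)
      obtain U0 where U0: "openin (zariski B) U0" "U1 = U0 \<inter> S"
        using U1(1) by (auto simp: subspace_on_def openin_subtopology)
      obtain U2 g' where U2: "openin (zariski B) U2" "p \<in> U2" "g' \<in> regular B U2" "\<forall>q\<in>U2 \<inter> U1. g q = g' q"
        using U1(2,3) by (auto simp: subspace_on_def)
      show "\<exists>U g. openin (zariski B) U \<and> p \<in> U \<and> g \<in> regular B U \<and> (\<forall>q\<in>U \<inter> W. f q = g q)"
        using U0 U1 U2 W restr[OF U2(3), of "U2 \<inter> U0"]
        by (intro exI[of _ "U2 \<inter> U0"] exI[of _ g']) auto
    qed
  next
    fix f assume f: "f \<in> regular ?Y W"
    show "f \<in> regular ?Z W"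
    proof (rule regular_subspace_onI)
      fix p assume p: "p \<in> W"
      obtain U g where U: "openin (zariski B) U" "p \<in> U" "g \<in> regular B U" "\<forall>q\<in>U \<inter> W. f q = g q"
        using f p by (auto simp: subspace_on_def)
      have "openin (zariski (subspace_on B S)) (U \<inter> S)" "p \<in> U \<inter> S"
        using U p W by (auto simp: subspace_on_def openin_subtopology)
      moreover have "g \<in> regular (subspace_on B S) (U \<inter> S)"
        by (rule regular_subspace_onI) (use U in blast)
      ultimately show "\<exists>U g. openin (zariski (subspace_on B S)) U \<and> p \<in> U \<and> g \<in> regular (subspace_on B S) U \<and> (\<forall>q\<in>U \<inter> W. f q = g q)"
        using U(4) by blast
    qed
  qed
  have pts: "points ?Z = points ?Y"
    by (simp add: points_def top)
  have sub: "W \<subseteq> S" if "openin (zariski ?Y) W" for W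
    using openin_subset[OF that] by (auto simp: subspace_on_def)
  have sub': "W \<subseteq> S" if "W \<subseteq> points ?Y" for W
    using that by (auto simp: points_subspace_on)
  have regY: "regular ?Z W = regular ?Y W" if "openin (zariski ?Y) W" for W
    using reg[OF sub[OF that]] .
  have "morphism X ?Z \<phi> \<longleftrightarrow> morphism X ?Y \<phi>" for \<phi>
    unfolding morphism_def top using regY by (intro conj_cong refl iff_allI) blast
  moreover have "morphism ?Z X \<phi> \<longleftrightarrow> morphism ?Y X \<phi>" for \<phi>
  proof -
    have "regular ?Z {p \<in> points ?Y. \<phi> p \<in> V} = regular ?Y {p \<in> points ?Y. \<phi> p \<in> V}" for V
      by (rule reg, rule sub') blast
    thus ?thesis
      unfolding morphism_def top pts by simp
  qed
  ultimately show ?thesis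
    using iso unfolding isomorphism_def pts by simp
qed

subsection \<open>Irreducible spaces and affine open sets\<close>

lemma (in kfun_space) regular_polynomial_function:
  assumes "h \<in> polynomial_functions" "openin (zariski X) U" "\<And>i. (\<lambda>p. \<phi> p i) \<in> regular X U"
  shows "(\<lambda>p. h (\<phi> p)) \<in> regular X U"
  using assms(1) by induction (auto intro: regular_const regular_add regular_mult assms)

text \<open>Unpacks the isomorphism with a closed set once and for all: coordinates that are regular
  on \<open>U\<close>, germs as fractions of polynomials in them, and a base of the topology by
  nonvanishing loci.\<close>

lemma (in kfun_space) affine_coordinates:
  assumes U: "openin (zariski X) U" and aff: "is_affine (subspace_on X U)"
  obtains n Z \<phi> where "closedin (zariski (affine_space n)) Z" "\<phi> ` U = Z" "inj_on \<phi> U"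
    "\<And>i. (\<lambda>p. \<phi> p i) \<in> regular X U"
    "\<And>p f. p \<in> U \<Longrightarrow> regular_at X p f \<Longrightarrow> \<exists>g\<in>polynomial_functions. \<exists>h\<in>polynomial_functions.
       \<exists>N. openin (zariski X) N \<and> p \<in> N \<and> N \<subseteq> U \<and> (\<forall>q\<in>N. h (\<phi> q) \<noteq> 0 \<and> f q = g (\<phi> q) / h (\<phi> q))"
    "\<And>p N. p \<in> U \<Longrightarrow> openin (zariski X) N \<Longrightarrow> p \<in> N \<Longrightarrow>
       \<exists>h\<in>polynomial_functions. h (\<phi> p) \<noteq> 0 \<and> (\<forall>q\<in>U. h (\<phi> q) \<noteq> 0 \<longrightarrow> q \<in> N)"
proof -
  obtain n Z \<phi> where Z: "closedin (zariski (affine_space n)) Z"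
      and iso: "isomorphism (subspace_on X U) (subspace_on (affine_space n) Z) \<phi>"
    using aff unfolding is_affine_def isomorphic_def by auto
  obtain \<psi> where m: "morphism (subspace_on X U) (subspace_on (affine_space n) Z) \<phi>"
      "morphism (subspace_on (affine_space n) Z) (subspace_on X U) \<psi>"
      and inv: "\<forall>p\<in>points (subspace_on X U). \<psi> (\<phi> p) = p" "\<forall>q\<in>points (subspace_on (affine_space n) Z). \<phi> (\<psi> q) = q"
    using iso unfolding isomorphism_def by auto
  have ptU: "points (subspace_on X U) = U"
    using open_subspace_points[OF U] .
  have Zsub: "Z \<subseteq> points (affine_space n)"
    using closedin_subset[OF Z] by (simp add: points_def)
  have ptZ: "points (subspace_on (affine_space n) Z) = Z"
    using Zsub by (auto simp: points_subspace_on)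
  have \<phi>Z: "\<phi> p \<in> Z" if "p \<in> U" for p
    using m(1) that ptU ptZ unfolding morphism_def continuous_map_def points_def by auto
  have \<psi>U: "\<psi> q \<in> U" if "q \<in> Z" for q
    using m(2) that ptU ptZ unfolding morphism_def continuous_map_def points_def by auto
  note inv = inv[unfolded ptU ptZ]
  have opZ: "openin (zariski (subspace_on (affine_space n) Z)) (W \<inter> Z)" if "openin (zariski (affine_space n)) W" for W
    using that by (auto simp: subspace_on_def openin_subtopology)
  have pre: "openin (zariski X) {p \<in> U. \<phi> p \<in> W}" if W: "openin (zariski (affine_space n)) W" for W
  proof -
    have "openin (zariski (subspace_on X U)) {p \<in> topspace (zariski (subspace_on X U)). \<phi> p \<in> W \<inter> Z}"
      using m(1) opZ[OF W] unfolding morphism_def continuous_map_def by blast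
    moreover have "{p \<in> topspace (zariski (subspace_on X U)). \<phi> p \<in> W \<inter> Z} = {p \<in> U. \<phi> p \<in> W}"
      using ptU \<phi>Z unfolding points_def by auto
    ultimately show ?thesis
      using open_subspace_zariski[OF U] by simp
  qed
  have im: "\<phi> ` U = Z"
    using inv(2) \<phi>Z \<psi>U by force
  have inj: "inj_on \<phi> U"
    using inv(1) by (intro inj_on_inverseI[where g = \<psi>]) simp
  have co: "(\<lambda>p. \<phi> p i) \<in> regular X U" for i
  proof -
    let ?c = "\<lambda>v :: nat \<Rightarrow> 'k. v i"
    have "openin (zariski (affine_space n)) (points (affine_space n))"
      by (simp add: points_def)
    hence "?c \<in> regular (subspace_on (affine_space n) Z) Z"
      using Zsub polynomial_regular_affine_space[OF polynomial_functions.coord]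
      by (intro regular_subspace_onI exI[of _ "points (affine_space n)"] exI[of _ ?c]) auto
    moreover have "openin (zariski (subspace_on (affine_space n) Z)) Z"
      using ptZ unfolding points_def by (metis openin_topspace)
    ultimately have "?c \<circ> \<phi> \<in> regular (subspace_on X U) {p \<in> points (subspace_on X U). \<phi> p \<in> Z}"
      using m(1) unfolding morphism_def by blast
    moreover have "{p \<in> points (subspace_on X U). \<phi> p \<in> Z} = U"
      using ptU \<phi>Z by auto
    ultimately show ?thesis
      using open_subspace_regular[OF U, of U] by (simp add: comp_def)
  qed
  have loc: "\<exists>g\<in>polynomial_functions. \<exists>h\<in>polynomial_functions.
       \<exists>N. openin (zariski X) N \<and> p \<in> N \<and> N \<subseteq> U \<and> (\<forall>q\<in>N. h (\<phi> q) \<noteq> 0 \<and> f q = g (\<phi> q) / h (\<phi> q))"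
    if p: "p \<in> U" and f: "regular_at X p f" for p f
  proof -
    obtain W where W: "openin (zariski X) W" "p \<in> W" "f \<in> regular X W"
      using f unfolding regular_at_def by auto
    let ?W = "W \<inter> U"
    have W': "openin (zariski X) ?W" "f \<in> regular X ?W"
      using W U by (auto intro: regular_restrict)
    have "openin (zariski (subspace_on X U)) ?W" "f \<in> regular (subspace_on X U) ?W"
      using W' open_subspace_zariski[OF U] open_subspace_regular[OF W'(1)] by auto
    from m(2)[unfolded morphism_def ptZ, THEN conjunct2, rule_format, OF conjI[OF this]]
    have "f \<circ> \<psi> \<in> regular (subspace_on (affine_space n) Z) {q \<in> Z. \<psi> q \<in> ?W}" .
    moreover have "\<phi> p \<in> {q \<in> Z. \<psi> q \<in> ?W}"
      using p W \<phi>Z inv by auto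
    ultimately obtain U1 g where U1: "openin (zariski (affine_space n)) U1" "\<phi> p \<in> U1"
        "g \<in> regular (affine_space n) U1" "\<forall>q\<in>U1 \<inter> {q \<in> Z. \<psi> q \<in> ?W}. (f \<circ> \<psi>) q = g q"
      by (auto simp: subspace_on_def)
    from bspec[OF U1(3)[unfolded regular_affine_space] U1(2)]
    obtain G H where GH: "G \<in> polynomial_functions" "H \<in> polynomial_functions" "H (\<phi> p) \<noteq> 0"
        "\<forall>q\<in>U1. H q \<noteq> 0 \<longrightarrow> g q = G q / H q"
      by (elim bexE conjE)
    let ?N = "?W \<inter> {q \<in> U. \<phi> q \<in> U1} \<inter> {q \<in> U. H (\<phi> q) \<noteq> 0}"
    have "openin (zariski X) ?N"
      using openin_Int[OF openin_Int[OF W'(1) pre[OF U1(1)]]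
          open_nonzero[OF U regular_polynomial_function[OF GH(2) U co]]] .
    moreover have "f q = G (\<phi> q) / H (\<phi> q)" if q: "q \<in> ?N" for q
    proof -
      have "\<phi> q \<in> U1 \<inter> {q \<in> Z. \<psi> q \<in> ?W}" "\<psi> (\<phi> q) = q"
        using q \<phi>Z inv(1) by auto
      hence "f q = g (\<phi> q)"
        using bspec[OF U1(4), of "\<phi> q"] by simp
      thus ?thesis
        using GH(4) q by simp
    qed
    ultimately show ?thesis
      using GH p W U1 by (intro bexI[of _ G] bexI[of _ H] exI[of _ ?N]) auto
  qed
  have bas: "\<exists>h\<in>polynomial_functions. h (\<phi> p) \<noteq> 0 \<and> (\<forall>q\<in>U. h (\<phi> q) \<noteq> 0 \<longrightarrow> q \<in> N)"
    if p: "p \<in> U" "openin (zariski X) N" "p \<in> N" for p N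
  proof -
    have "openin (zariski (subspace_on X U)) (N \<inter> U)"
      using p U open_subspace_zariski[OF U] by auto
    hence "openin (zariski (subspace_on (affine_space n) Z)) {q \<in> Z. \<psi> q \<in> N \<inter> U}"
      using m(2) ptZ unfolding morphism_def continuous_map_def points_def by auto
    then obtain W where W: "openin (zariski (affine_space n)) W" "{q \<in> Z. \<psi> q \<in> N \<inter> U} = W \<inter> Z"
      by (auto simp: subspace_on_def openin_subtopology)
    have "\<phi> p \<in> W"
      using W(2) p \<phi>Z inv(1) by auto
    from affine_basis[OF W(1) this] obtain h where h: "h \<in> polynomial_functions" "h (\<phi> p) \<noteq> 0"
        "{v \<in> points (affine_space n). h v \<noteq> 0} \<subseteq> W" .
    have "q \<in> N" if "q \<in> U" "h (\<phi> q) \<noteq> 0" for q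
    proof -
      have "\<phi> q \<in> W \<inter> Z"
        using h(3) that \<phi>Z Zsub by auto
      hence "\<psi> (\<phi> q) \<in> N" using W(2) by auto
      thus ?thesis using inv(1) that by simp
    qed
    thus ?thesis using h by (intro bexI[of _ h]) auto
  qed
  show ?thesis
    by (rule that[OF Z im inj co loc bas])
qed

context kfun_space
begin

lemma affine_separates:
  assumes U: "openin (zariski X) U" "is_affine (subspace_on X U)" "p \<in> U" "q \<in> U" "p \<noteq> q"
  obtains f where "f \<in> regular X U" "f p \<noteq> f q"
proof -
  obtain n Z \<phi> where \<phi>: "inj_on \<phi> U" "\<And>i :: nat. (\<lambda>p. \<phi> p i) \<in> regular X U"
    using affine_coordinates[OF U(1,2)] by metis
  have "\<phi> p \<noteq> \<phi> q"
    using \<phi>(1) U(3-5) by (auto dest: inj_onD)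
  then obtain i where "\<phi> p i \<noteq> \<phi> q i"
    by auto
  thus ?thesis using that[OF \<phi>(2)] by simp
qed

lemma affine_fraction:
  assumes U: "openin (zariski X) U" "is_affine (subspace_on X U)" "p \<in> U" and f: "regular_at X p f"
  obtains g h N where "g \<in> regular X U" "h \<in> regular X U" "openin (zariski X) N" "p \<in> N" "N \<subseteq> U"
    "\<And>q. q \<in> N \<Longrightarrow> h q \<noteq> 0 \<and> f q * h q = g q"
proof -
  obtain n Z \<phi> where \<phi>: "\<And>i :: nat. (\<lambda>p. \<phi> p i) \<in> regular X U"
    and loc: "\<And>p f. p \<in> U \<Longrightarrow> regular_at X p f \<Longrightarrow> \<exists>g\<in>polynomial_functions. \<exists>h\<in>polynomial_functions.
       \<exists>N. openin (zariski X) N \<and> p \<in> N \<and> N \<subseteq> U \<and> (\<forall>q\<in>N. h (\<phi> q) \<noteq> 0 \<and> f q = g (\<phi> q) / h (\<phi> q))"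
    by (rule affine_coordinates[OF U(1,2)]) (rule that, assumption+)
  obtain g h N where gh: "g \<in> polynomial_functions" "h \<in> polynomial_functions" "openin (zariski X) N" "p \<in> N" "N \<subseteq> U"
      "\<forall>q\<in>N. h (\<phi> q) \<noteq> 0 \<and> f q = g (\<phi> q) / h (\<phi> q)"
    using loc[OF U(3) f] by (elim bexE exE conjE)
  show ?thesis
    by (rule that[OF regular_polynomial_function[OF gh(1) U(1) \<phi>] regular_polynomial_function[OF gh(2) U(1) \<phi>] gh(3-5)])
       (use gh(6) in auto)
qed

lemma affine_basic_open:
  assumes U: "openin (zariski X) U" "is_affine (subspace_on X U)" "p \<in> U" and N: "openin (zariski X) N" "p \<in> N"
  obtains h where "h \<in> regular X U" "h p \<noteq> 0" "\<And>q. q \<in> U \<Longrightarrow> h q \<noteq> 0 \<Longrightarrow> q \<in> N"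
proof -
  obtain n Z \<phi> where \<phi>: "\<And>i :: nat. (\<lambda>p. \<phi> p i) \<in> regular X U"
    and bas: "\<And>p N. p \<in> U \<Longrightarrow> openin (zariski X) N \<Longrightarrow> p \<in> N \<Longrightarrow>
       \<exists>h\<in>polynomial_functions. h (\<phi> p) \<noteq> 0 \<and> (\<forall>q\<in>U. h (\<phi> q) \<noteq> 0 \<longrightarrow> q \<in> N)"
    by (rule affine_coordinates[OF U(1,2)]) (rule that, assumption+)
  obtain h where h: "h \<in> polynomial_functions" "h (\<phi> p) \<noteq> 0" "\<forall>q\<in>U. h (\<phi> q) \<noteq> 0 \<longrightarrow> q \<in> N"
    using bas[OF U(3) N] by (elim bexE conjE)
  show ?thesis
    by (rule that[OF regular_polynomial_function[OF h(1) U(1) \<phi>]]) (use h in auto)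
qed

end

section \<open>Irreducible spaces: identity principle, points from homomorphisms, square roots by
  normality\<close>

locale irreducible_space = kfun_space +
  assumes irred: "irreducible_subset (zariski X) (points X)"
begin

lemma opens_meet:
  assumes "openin (zariski X) U" "openin (zariski X) V" "U \<noteq> {}" "V \<noteq> {}"
  shows "U \<inter> V \<noteq> {}"
proof
  assume "U \<inter> V = {}"
  hence cover: "points X \<subseteq> (points X - U) \<union> (points X - V)"
    by auto
  have closed: "closedin (zariski X) (points X - U)" "closedin (zariski X) (points X - V)"
    using assms by (auto simp: points_def intro!: openin_closedin_eq[THEN iffD1, THEN conjunct2])
  have "points X \<subseteq> points X - U \<or> points X \<subseteq> points X - V"
    using irred cover closed unfolding irreducible_subset_def by simp
  thus False
    using assms open_subset_points by auto
qed

text \<open>The locus near \<open>p\<close> where \<open>f - g\<close> is nonzero is open, so it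
  would meet \<open>N\<close>.\<close>

lemma identity_at:
  assumes "regular_at X p f" "regular_at X p g" "openin (zariski X) N" "N \<noteq> {}" "\<And>q. q \<in> N \<Longrightarrow> f q = g q"
  shows "f p = g p"
proof (rule ccontr)
  assume "f p \<noteq> g p"
  then obtain M where M: "openin (zariski X) M" "p \<in> M" "\<And>q. q \<in> M \<Longrightarrow> f q - g q \<noteq> 0"
    using at_nonzero_nbhd[OF at_diff[OF assms(1,2)]] by auto
  obtain q where "q \<in> M" "q \<in> N"
    using opens_meet[OF M(1) assms(3)] M(2) assms(4) by auto
  thus False using M(3) assms(5) by auto
qed

lemma dense_open: "openin (zariski X) U \<Longrightarrow> U \<noteq> {} \<Longrightarrow> zariski X closure_of U = points X"
  using opens_meet[of U] by (force simp: closure_of_def points_def)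

text \<open>The images of the coordinate functions under \<open>E\<close> form a vector
  \<open>v\<close>, and every polynomial vanishing on the closed set \<open>Z\<close> vanishes at
  \<open>v\<close>, so \<open>v\<close> is a point of \<open>Z\<close>. In this way points of the
  abstract curve are produced from places of the explicit model.\<close>

lemma affine_point_of_hom:
  fixes E :: "('a \<Rightarrow> 'b) \<Rightarrow> 'b"
  assumes U: "openin (zariski X) U" "is_affine (subspace_on X U)" "U \<noteq> {}"
    and const: "\<And>c. E (\<lambda>_. c) = c"
    and add: "\<And>f g. f \<in> regular X U \<Longrightarrow> g \<in> regular X U \<Longrightarrow> E (\<lambda>p. f p + g p) = E f + E g"
    and mult: "\<And>f g. f \<in> regular X U \<Longrightarrow> g \<in> regular X U \<Longrightarrow> E (\<lambda>p. f p * g p) = E f * E g"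
    and cong: "\<And>f g. f \<in> regular X U \<Longrightarrow> g \<in> regular X U \<Longrightarrow> (\<And>p. p \<in> U \<Longrightarrow> f p = g p) \<Longrightarrow> E f = E g"
  obtains p where "p \<in> U" "\<And>f. f \<in> regular X U \<Longrightarrow> E f = f p"
proof -
  obtain n Z \<phi> where Z: "closedin (zariski (affine_space n)) Z" "\<phi> ` U = Z"
    and \<phi>: "\<And>i. (\<lambda>p. \<phi> p i) \<in> regular X U"
    and loc: "\<And>p f. p \<in> U \<Longrightarrow> regular_at X p f \<Longrightarrow> \<exists>g\<in>polynomial_functions. \<exists>h\<in>polynomial_functions.
       \<exists>N. openin (zariski X) N \<and> p \<in> N \<and> N \<subseteq> U \<and> (\<forall>q\<in>N. h (\<phi> q) \<noteq> 0 \<and> f q = g (\<phi> q) / h (\<phi> q))"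
    by (rule affine_coordinates[OF U(1,2)]) (rule that, assumption+)
  define v where "v = (\<lambda>i. E (\<lambda>p. \<phi> p i))"
  have E: "E (\<lambda>p. h (\<phi> p)) = h v" if "h \<in> polynomial_functions" for h
    using that by induction
      (simp_all add: const add mult regular_polynomial_function U \<phi> v_def)
  have reg: "(\<lambda>p. h (\<phi> p)) \<in> regular X U" if "h \<in> polynomial_functions" for h
    using regular_polynomial_function[OF that U(1) \<phi>] .
  have ZA: "Z \<subseteq> points (affine_space n)"
    using closedin_subset[OF Z(1)] by (simp add: points_def)
  have "v i = 0" if "i \<ge> n" for i
  proof -
    have "\<phi> p i = 0" if "p \<in> U" for p
      using ZA Z(2) that \<open>i \<ge> n\<close> unfolding points_affine_space by auto
    hence "E (\<lambda>p. \<phi> p i) = E (\<lambda>_. 0)"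
      using \<phi> regular_const[OF U(1)] by (intro cong) auto
    thus ?thesis by (simp add: const v_def)
  qed
  hence vA: "v \<in> points (affine_space n)"
    unfolding points_affine_space by simp
  have "v \<in> Z"
  proof (rule ccontr)
    assume "v \<notin> Z"
    moreover have "openin (zariski (affine_space n)) (points (affine_space n) - Z)"
      using Z(1) by (simp add: closedin_def points_def)
    ultimately obtain h where h: "h \<in> polynomial_functions" "h v \<noteq> 0"
        "{v \<in> points (affine_space n). h v \<noteq> 0} \<subseteq> points (affine_space n) - Z"
      using affine_basis[of n "points (affine_space n) - Z" v] vA by blast
    have "h (\<phi> p) = 0" if "p \<in> U" for p
      using h(3) ZA Z(2) that by auto
    hence "E (\<lambda>p. h (\<phi> p)) = E (\<lambda>_. 0)"
      using reg[OF h(1)] regular_const[OF U(1)] by (intro cong) auto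
    thus False using E[OF h(1)] const h(2) by simp
  qed
  then obtain p where p: "p \<in> U" "\<phi> p = v"
    using Z(2) by auto
  have "E f = f p" if f: "f \<in> regular X U" for f
  proof -
    obtain g h N where gh: "g \<in> polynomial_functions" "h \<in> polynomial_functions" "openin (zariski X) N" "p \<in> N" "N \<subseteq> U"
        "\<forall>q\<in>N. h (\<phi> q) \<noteq> 0 \<and> f q = g (\<phi> q) / h (\<phi> q)"
      using loc[OF p(1) regular_imp_at[OF f U(1) p(1)]] by (elim bexE exE conjE)
    \<comment> \<open>The fraction represents \<open>f\<close> only near \<open>p\<close>;
      irreducibility carries the identity to all of \<open>U\<close>, where \<open>E\<close> can be
      applied to it.\<close>
    have "f q * h (\<phi> q) = g (\<phi> q)" if "q \<in> U" for q
    proof (rule identity_at[where f = "\<lambda>q. f q * h (\<phi> q)" and g = "\<lambda>q. g (\<phi> q)" and N = N])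
      show "regular_at X q (\<lambda>q. f q * h (\<phi> q))" "regular_at X q (\<lambda>q. g (\<phi> q))"
        using regular_imp_at[OF _ U(1) that] f reg gh(1,2) by (auto intro!: at_mult)
    qed (use gh in auto)
    hence "E (\<lambda>q. f q * h (\<phi> q)) = E (\<lambda>q. g (\<phi> q))"
      using f reg gh(1,2) regular_mult U(1) by (intro cong) auto
    hence "E f * h v = g v"
      using mult[OF f reg[OF gh(2)]] E gh(1,2) by simp
    moreover have "h v \<noteq> 0" "f p * h v = g v"
      using gh(4,6) p(2) by auto
    ultimately show ?thesis
      by (metis mult_right_cancel)
  qed
  thus ?thesis using that p(1) by blast
qed

text \<open>The quotient a / b is a root of T^2 - c and hence integral. Since integral closedness
  concerns functions regular on all of \<open>U\<close>, the three germs are first written as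
  fractions of such functions.\<close>

lemma normal_square_root:
  assumes U: "openin (zariski X) U" "is_affine (subspace_on X U)" "integrally_closed_on U (regular X U)" "p \<in> U"
    and abc: "regular_at X p a" "regular_at X p b" "regular_at X p c"
    and N: "openin (zariski X) N" "p \<in> N" "\<And>q. q \<in> N \<Longrightarrow> a q ^ 2 = c q * b q ^ 2"
    and b: "openin (zariski X) M" "M \<noteq> {}" "\<And>q. q \<in> M \<Longrightarrow> b q \<noteq> 0"
  obtains r N' where "regular_at X p r" "openin (zariski X) N'" "p \<in> N'" "\<And>q. q \<in> N' \<Longrightarrow> a q = r q * b q"
proof -
  obtain g1 h1 N1 where 1: "g1 \<in> regular X U" "h1 \<in> regular X U" "openin (zariski X) N1" "p \<in> N1" "N1 \<subseteq> U"
    "\<And>q. q \<in> N1 \<Longrightarrow> h1 q \<noteq> 0 \<and> a q * h1 q = g1 q"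
    using affine_fraction[OF U(1,2,4) abc(1)] by blast
  obtain g2 h2 N2 where 2: "g2 \<in> regular X U" "h2 \<in> regular X U" "openin (zariski X) N2" "p \<in> N2" "N2 \<subseteq> U"
    "\<And>q. q \<in> N2 \<Longrightarrow> h2 q \<noteq> 0 \<and> b q * h2 q = g2 q"
    using affine_fraction[OF U(1,2,4) abc(2)] by blast
  obtain g3 h3 N3 where 3: "g3 \<in> regular X U" "h3 \<in> regular X U" "openin (zariski X) N3" "p \<in> N3" "N3 \<subseteq> U"
    "\<And>q. q \<in> N3 \<Longrightarrow> h3 q \<noteq> 0 \<and> c q * h3 q = g3 q"
    using affine_fraction[OF U(1,2,4) abc(3)] by blast
  \<comment> \<open>With a = g1 / h1, b = g2 / h2 and c = g3 / h3, the quotient A / B is h3 a / b.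
    Its square is h3 g3 = - D, which is regular on \<open>U\<close>.\<close>
  define A where "A = (\<lambda>q. g1 q * (h2 q * h3 q))"
  define B where "B = (\<lambda>q. g2 q * h1 q)"
  define D where "D = (\<lambda>q. - 1 * (g3 q * h3 q))"
  have reg: "A \<in> regular X U" "B \<in> regular X U" "D \<in> regular X U"
    unfolding A_def B_def D_def by (intro regular_mult U 1 2 3 regular_const)+
  define N0 where "N0 = N \<inter> N1 \<inter> N2 \<inter> N3"
  have N0: "openin (zariski X) N0" "p \<in> N0"
    unfolding N0_def using N 1 2 3 by auto
  have eq: "A q ^ 2 + D q * B q ^ 2 = 0" if "q \<in> N0" for q
  proof -
    have "q \<in> N" "q \<in> N1" "q \<in> N2" "q \<in> N3"
      using that by (auto simp: N0_def)
    thus ?thesis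
      unfolding A_def B_def D_def
      using N(3)[of q] 1(6)[of q, THEN conjunct2, symmetric] 2(6)[of q, THEN conjunct2, symmetric]
        3(6)[of q, THEN conjunct2, symmetric]
      by (simp add: power_mult_distrib) (simp add: power2_eq_square)
  qed
  have eqU: "A q ^ 2 + D q * B q ^ 2 = 0" if "q \<in> U" for q
  proof (rule identity_at[where f = "\<lambda>q. A q ^ 2 + D q * B q ^ 2" and g = "\<lambda>_. 0" and N = N0])
    show "regular_at X q (\<lambda>q. A q ^ 2 + D q * B q ^ 2)" "regular_at X q (\<lambda>_. 0)"
      using reg U(1) that open_subset_points by (auto intro!: at_add at_mult at_power at_const intro: regular_imp_at)
  qed (use N0 eq in auto)
  obtain q0 where "q0 \<in> M" "q0 \<in> N0"
    using opens_meet[OF b(1) N0(1)] b(2) N0(2) by auto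
  hence q0: "q0 \<in> M" "q0 \<in> N1" "q0 \<in> N2"
    by (auto simp: N0_def)
  hence "B q0 \<noteq> 0"
    using b(3)[OF q0(1)] 1(6)[OF q0(2)] 2(6)[OF q0(3)] unfolding B_def by (metis mult_eq_0_iff)
  moreover have "q0 \<in> U" using q0 1(5) by auto
  moreover have "\<exists>n c. n > 0 \<and> (\<forall>i<n. c i \<in> regular X U) \<and>
             (\<forall>p\<in>U. A p ^ n + (\<Sum>i<n. c i p * A p ^ i * B p ^ (n - i)) = 0)"
  \<comment> \<open>The monic equation T^2 + D = 0: constant coefficient \<open>D\<close>, linear
    coefficient 0.\<close>
  proof (intro exI[of _ "2::nat"] exI[of _ "\<lambda>i. if i = 0 then D else (\<lambda>_. 0)"] conjI allI impI ballI)
    fix i :: nat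
    show "(if i = 0 then D else (\<lambda>_. 0)) \<in> regular X U"
      using reg regular_const[OF U(1)] by simp
  next
    fix q assume "q \<in> U"
    thus "A q ^ 2 + (\<Sum>i<2. (if i = 0 then D else (\<lambda>_. 0)) q * A q ^ i * B q ^ (2 - i)) = 0"
      using eqU by (simp add: eval_nat_numeral)
  qed simp
  ultimately have "\<exists>r\<in>regular X U. \<forall>p\<in>U. A p = r p * B p"
    using U(3) reg unfolding integrally_closed_on_def by blast
  then obtain r where r: "r \<in> regular X U" "\<And>q. q \<in> U \<Longrightarrow> A q = r q * B q"
    by blast
  show ?thesis
  proof (rule that[of "\<lambda>q. r q / h3 q" N0])
    show "regular_at X p (\<lambda>q. r q / h3 q)"
      using r(1) 3(2,4,6) U(1,4) by (intro at_divide) (auto intro: regular_imp_at)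
    fix q assume "q \<in> N0"
    hence q: "q \<in> N" "q \<in> N1" "q \<in> N2" "q \<in> N3" "q \<in> U"
      using 1(5) by (auto simp: N0_def)
    have "(a q * h3 q) * (h1 q * h2 q) = (r q * b q) * (h1 q * h2 q)"
      using r(2)[OF q(5)] 1(6)[OF q(2)] 2(6)[OF q(3)] unfolding A_def B_def by algebra
    hence "a q * h3 q = r q * b q"
      using 1(6)[OF q(2)] 2(6)[OF q(3)] by simp
    thus "a q = r q / h3 q * b q"
      using 3(6)[OF q(4)] by (simp add: field_simps)
  qed (use N0 in auto)
qed

end

subsection \<open>Charts of a curve\<close>

text \<open>
  The last three assumptions are what
  birationality, finiteness and separation by affine open sets provide; together with the
  valuation property of the model they force \<open>u\<close> to be an isomorphism.
\<close>

locale charted_space = irreducible_space C + chart m n1 n2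
  for C :: "('c, 'k :: alg_closed_field) kspace" and m n1 n2 :: "'k poly" +
  fixes D :: "'c set" and u :: "'c \<Rightarrow> 'k \<times> 'k \<times> 'k"
  assumes D: "openin (zariski C) D" "D \<noteq> {}"
    and u_X: "p \<in> D \<Longrightarrow> u p \<in> X"
    and u_regular: "p \<in> D \<Longrightarrow> regular_at C p (\<lambda>p. fst (u p))"
      "p \<in> D \<Longrightarrow> regular_at C p (\<lambda>p. fst (snd (u p)))"
      "p \<in> D \<Longrightarrow> regular_at C p (\<lambda>p. snd (snd (u p)))"
    and u_infinite: "openin (zariski C) U \<Longrightarrow> U \<noteq> {} \<Longrightarrow> U \<subseteq> D \<Longrightarrow> infinite (u ` U)"
    and generic: "openin (zariski C) U \<Longrightarrow> U \<noteq> {} \<Longrightarrow> f \<in> regular C U \<Longrightarrow>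
      \<exists>A\<in>R. \<exists>B\<in>R. \<exists>N. openin (zariski C) N \<and> N \<noteq> {} \<and> N \<subseteq> U \<inter> D \<and>
        (\<forall>p\<in>N. B (u p) \<noteq> 0 \<and> f p * B (u p) = A (u p))"
    and places: "q \<in> X \<Longrightarrow> \<exists>U. openin (zariski C) U \<and> U \<noteq> {} \<and> is_affine (subspace_on C U) \<and>
      (\<forall>f\<in>regular C U. \<exists>n A B N. n > 0 \<and> (\<forall>i<n. A i \<in> R \<and> B i \<in> R \<and> B i q \<noteq> 0) \<and>
         openin (zariski C) N \<and> N \<noteq> {} \<and> N \<subseteq> U \<inter> D \<and>
         (\<forall>p\<in>N. (\<forall>i<n. B i (u p) \<noteq> 0) \<and> f p ^ n + (\<Sum>i<n. A i (u p) / B i (u p) * f p ^ i) = 0)) \<and>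
      (\<forall>p\<in>U. (\<forall>f\<in>regular C U. \<forall>A\<in>R. \<forall>B\<in>R. \<forall>N. B q \<noteq> 0 \<and> openin (zariski C) N \<and> N \<noteq> {} \<and> N \<subseteq> D \<and>
          (\<forall>p\<in>N. f p * B (u p) = A (u p)) \<longrightarrow> f p * B q = A q) \<longrightarrow> p \<in> D)"
    and common_affine: "p \<in> D \<Longrightarrow> p' \<in> D \<Longrightarrow> u p = u p' \<Longrightarrow>
      \<exists>U. openin (zariski C) U \<and> is_affine (subspace_on C U) \<and> p \<in> U \<and> p' \<in> U"
begin

section \<open>A chart is a bijection onto its model\<close>

lemma R_regular:
  assumes "P \<in> R" "p \<in> D"
  shows "regular_at C p (\<lambda>p. P (u p))"
proof -
  obtain N a b c d where P: "\<And>x y z. (x, y, z) \<in> X \<Longrightarrow>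
    P (x, y, z) * poly m x ^ N = poly a x + poly b x * y + poly c x * z + poly d x * y * z"
    using R_E[OF assms(1)] by blast
  define F where "F = (\<lambda>p. (poly a (fst (u p)) + poly b (fst (u p)) * fst (snd (u p)) +
    poly c (fst (u p)) * snd (snd (u p)) + poly d (fst (u p)) * fst (snd (u p)) * snd (snd (u p))) / poly m (fst (u p)) ^ N)"
  have m0: "poly m (fst (u p)) \<noteq> 0" if "p \<in> D" for p
    using u_X[OF that] by (auto simp: X_def)
  have F: "regular_at C p F"
    unfolding F_def using m0[OF assms(2)]
    by (intro at_divide at_add at_mult at_power at_poly u_regular assms) simp
  have eq: "P (u q) = F q" if "q \<in> D" for q
    unfolding F_def using P[of "fst (u q)" "fst (snd (u q))" "snd (snd (u q))"] u_X[OF that] m0[OF that]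
    by (intro nonzero_eq_divide_eq[THEN iffD2]) simp_all
  show ?thesis
    by (rule regular_at_cong[OF F D(1) assms(2) eq])
qed

lemma R_eq_0I:
  assumes "P \<in> R" "openin (zariski C) N" "N \<noteq> {}" "N \<subseteq> D" "\<And>p. p \<in> N \<Longrightarrow> P (u p) = 0" "q \<in> X"
  shows "P q = 0"
  by (rule R_eq_0_if_infinite[OF assms(1) u_infinite[OF assms(2-4)]]) (use assms u_X in auto)

text \<open>The fraction given by \<open>generic\<close> may read 0 / 0 at \<open>u p\<close>. By
  \<open>R_valuation\<close> it can be replaced by \<open>A\<close> over \<open>B\<close> with not
  both zero there; as f B = A persists at \<open>p\<close> and \<open>f\<close> is finite,
  \<open>B\<close> cannot vanish.\<close>

lemma regular_is_fraction:
  assumes "p \<in> D" "regular_at C p f"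
  obtains A B N where "A \<in> R" "B \<in> R" "B (u p) \<noteq> 0" "openin (zariski C) N" "p \<in> N" "N \<subseteq> D"
    "\<And>p'. p' \<in> N \<Longrightarrow> B (u p') \<noteq> 0 \<and> f p' * B (u p') = A (u p')"
proof -
  obtain U where U: "openin (zariski C) U" "p \<in> U" "f \<in> regular C U"
    using assms(2) unfolding regular_at_def by blast
  have "U \<noteq> {}" using U by auto
  obtain A0 B0 N0 where 0: "A0 \<in> R" "B0 \<in> R" "openin (zariski C) N0" "N0 \<noteq> {}" "N0 \<subseteq> U \<inter> D"
      "\<forall>p\<in>N0. B0 (u p) \<noteq> 0 \<and> f p * B0 (u p) = A0 (u p)"
    using generic[OF U(1) \<open>U \<noteq> {}\<close> U(3)] by (elim bexE exE conjE)
  obtain p0 where "p0 \<in> N0" using 0 by auto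
  hence "\<exists>q'\<in>X. A0 q' \<noteq> 0 \<or> B0 q' \<noteq> 0"
    using 0 u_X by blast
  from R_valuation[OF u_X[OF assms(1)] 0(1,2) this]
  obtain A B where AB: "A \<in> R" "B \<in> R" "\<forall>q'\<in>X. A0 q' * B q' = A q' * B0 q'" "A (u p) \<noteq> 0 \<or> B (u p) \<noteq> 0"
    by (elim bexE conjE)
  have gen: "f q * B (u q) = A (u q)" if "q \<in> N0" for q
  proof -
    have "u q \<in> X" using that 0(5) u_X by auto
    hence "A0 (u q) * B (u q) = A (u q) * B0 (u q)"
      using AB(3) by blast
    hence "(f q * B (u q)) * B0 (u q) = A (u q) * B0 (u q)"
      using 0(6) that by (metis mult.assoc mult.commute)
    thus ?thesis using 0(6) that by simp
  qed
  have all: "f q * B (u q) = A (u q)" if "q \<in> U \<inter> D" for q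
    by (rule identity_at[where N = N0 and f = "\<lambda>q. f q * B (u q)" and g = "\<lambda>q. A (u q)"])
       (use that U 0 gen AB in \<open>auto intro!: at_mult R_regular intro: regular_imp_at\<close>)
  hence "B (u p) \<noteq> 0"
    using AB(4) U(2) assms(1) by (metis IntI mult_zero_right)
  from at_nonzero_nbhd[OF R_regular[OF AB(2) assms(1)] this]
  obtain M where M: "openin (zariski C) M" "p \<in> M" "\<And>q. q \<in> M \<Longrightarrow> B (u q) \<noteq> 0"
    by blast
  show ?thesis
    by (rule that[OF AB(1,2) \<open>B (u p) \<noteq> 0\<close>, of "M \<inter> (U \<inter> D)"]) (use M U D assms all in auto)
qed

text \<open>A function separating the two points is a fraction \<open>A\<close> over
  \<open>B\<close> in terms of \<open>u\<close>, and f B = A holds at both points, where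
  \<open>u\<close> and therefore \<open>A\<close> and \<open>B\<close> take the same values.\<close>

lemma inj_on_u: "inj_on u D"
proof (rule inj_onI, rule ccontr)
  fix p p' assume p: "p \<in> D" "p' \<in> D" "u p = u p'" "p \<noteq> p'"
  obtain U where U: "openin (zariski C) U" "is_affine (subspace_on C U)" "p \<in> U" "p' \<in> U"
    using common_affine[OF p(1-3)] by blast
  obtain f where f: "f \<in> regular C U" "f p \<noteq> f p'"
    using affine_separates[OF U p(4)] by blast
  obtain A B N where AB: "A \<in> R" "B \<in> R" "B (u p) \<noteq> 0" "openin (zariski C) N" "p \<in> N" "N \<subseteq> D"
    "\<And>p'. p' \<in> N \<Longrightarrow> B (u p') \<noteq> 0 \<and> f p' * B (u p') = A (u p')"
    using regular_is_fraction[OF p(1) regular_imp_at[OF f(1) U(1,3)]] by blast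
  have "f p' * B (u p') = A (u p')"
    by (rule identity_at[where N = N and f = "\<lambda>q. f q * B (u q)" and g = "\<lambda>q. A (u q)"])
       (use p U AB f in \<open>auto intro!: at_mult R_regular intro: regular_imp_at\<close>)
  moreover have "f p * B (u p) = A (u p)"
    using AB by blast
  ultimately have "f p * B (u p) = f p' * B (u p)"
    using p(3) by simp
  thus False
    using f(2) AB(3) by simp
qed

text \<open>A point \<open>q\<close> of the model is a place of the common function field. By
  \<open>places\<close>, functions on some affine open \<open>U\<close> are integral over functions
  without pole at \<open>q\<close>, so they have none either; taking values at \<open>q\<close> is a
  homomorphism \<open>E\<close>, hence evaluation at a point of \<open>U\<close>. The clause
  \<open>centre\<close> puts this point into \<open>D\<close>, and the coordinates show that
  \<open>u\<close> maps it to \<open>q\<close>.\<close>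

lemma u_surj: "u ` D = X"
proof (intro equalityI subsetI)
  fix q assume "q \<in> u ` D"
  thus "q \<in> X" using u_X by auto
next
  fix q assume q: "q \<in> X"
  define eqgen where "eqgen f A B \<longleftrightarrow> (\<exists>N. openin (zariski C) N \<and> N \<noteq> {} \<and> N \<subseteq> D \<and> (\<forall>p\<in>N. f p * B (u p) = A (u p)))"
    for f :: "'c \<Rightarrow> 'k" and A B
  from places[OF q] obtain U where U: "openin (zariski C) U" "U \<noteq> {}" "is_affine (subspace_on C U)"
    and integral: "\<forall>f\<in>regular C U. \<exists>n A B N. n > 0 \<and> (\<forall>i<n. A i \<in> R \<and> B i \<in> R \<and> B i q \<noteq> 0) \<and>
         openin (zariski C) N \<and> N \<noteq> {} \<and> N \<subseteq> U \<inter> D \<and>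
         (\<forall>p\<in>N. (\<forall>i<n. B i (u p) \<noteq> 0) \<and> f p ^ n + (\<Sum>i<n. A i (u p) / B i (u p) * f p ^ i) = 0)"
    and centre: "\<forall>p\<in>U. (\<forall>f\<in>regular C U. \<forall>A\<in>R. \<forall>B\<in>R. \<forall>N. B q \<noteq> 0 \<and> openin (zariski C) N \<and> N \<noteq> {} \<and> N \<subseteq> D \<and>
          (\<forall>p\<in>N. f p * B (u p) = A (u p)) \<longrightarrow> f p * B q = A q) \<longrightarrow> p \<in> D"
    by (elim exE conjE)
  have meet: "\<exists>p. p \<in> N \<inter> N'" if "openin (zariski C) N" "N \<noteq> {}" "openin (zariski C) N'" "N' \<noteq> {}" for N N'
    using opens_meet[OF that(1,3,2,4)] by auto
  have frac: "\<exists>A\<in>R. \<exists>B\<in>R. B q \<noteq> 0 \<and> eqgen f A B" if f: "f \<in> regular C U" for f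
  proof -
    obtain A0 B0 N0 where 0: "A0 \<in> R" "B0 \<in> R" "openin (zariski C) N0" "N0 \<noteq> {}" "N0 \<subseteq> U \<inter> D"
        "\<forall>p\<in>N0. B0 (u p) \<noteq> 0 \<and> f p * B0 (u p) = A0 (u p)"
      using generic[OF U(1,2) f] by (elim bexE exE conjE)
    obtain p0 where "p0 \<in> N0" using 0 by auto
    hence "\<exists>q'\<in>X. A0 q' \<noteq> 0 \<or> B0 q' \<noteq> 0"
      using 0 u_X by blast
    from R_valuation[OF q 0(1,2) this]
    obtain A1 B1 where AB: "A1 \<in> R" "B1 \<in> R" "\<forall>q'\<in>X. A0 q' * B1 q' = A1 q' * B0 q'" "A1 q \<noteq> 0 \<or> B1 q \<noteq> 0"
      by (elim bexE conjE)
    have gen: "f p * B1 (u p) = A1 (u p)" if "p \<in> N0" for p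
    proof -
      have "u p \<in> X" using that 0(5) u_X by auto
      hence "A0 (u p) * B1 (u p) = A1 (u p) * B0 (u p)"
        using AB(3) by blast
      hence "(f p * B1 (u p)) * B0 (u p) = A1 (u p) * B0 (u p)"
        using 0(6) that by (metis mult.assoc mult.commute)
      thus ?thesis using 0(6) that by simp
    qed
    \<comment> \<open>Otherwise \<open>f\<close> has a pole at \<open>q\<close>. Multiplying its
      integral equation by \<open>B1\<close> to the power n and by all denominators, and then
      evaluating at \<open>q\<close>, leaves only the leading term, which is not zero.\<close>
    have "B1 q \<noteq> 0"
    proof
      assume B1: "B1 q = 0"
      hence A1: "A1 q \<noteq> 0" using AB(4) by auto
      obtain n A B N where n: "n > 0" "\<forall>i<n. A i \<in> R \<and> B i \<in> R \<and> B i q \<noteq> 0"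
         "openin (zariski C) N" "N \<noteq> {}" "N \<subseteq> U \<inter> D"
         "\<forall>p\<in>N. (\<forall>i<n. B i (u p) \<noteq> 0) \<and> f p ^ n + (\<Sum>i<n. A i (u p) / B i (u p) * f p ^ i) = 0"
        using bspec[OF integral f] by (elim exE conjE)
      define P where "P = (\<lambda>x. A1 x ^ n * (\<Prod>j<n. B j x) +
          (\<Sum>i<n. A i x * (\<Prod>j\<in>{..<n} - {i}. B j x) * (A1 x ^ i * B1 x ^ (n - i))))"
      have PR: "P \<in> R"
        unfolding P_def using n AB by (intro R_add R_mult R_power R_prod R_sum) auto
      have Pu: "P (u p) = 0" if p: "p \<in> N \<inter> N0" for p
      proof -
        let ?f = "f p" and ?b = "B1 (u p)"
        have B0: "B i (u p) \<noteq> 0" if "i < n" for i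
          using n(6) p that by auto
        have 1: "A i (u p) * (\<Prod>j\<in>{..<n} - {i}. B j (u p)) * (A1 (u p) ^ i * ?b ^ (n - i)) =
            ?b ^ n * (\<Prod>j<n. B j (u p)) * (A i (u p) / B i (u p) * ?f ^ i)" if i: "i < n" for i
        proof -
          have "(\<Prod>j<n. B j (u p)) = B i (u p) * (\<Prod>j\<in>{..<n} - {i}. B j (u p))"
            using i by (intro prod.remove) auto
          moreover have "A1 (u p) ^ i * ?b ^ (n - i) = ?f ^ i * ?b ^ n"
          proof -
            have "?b ^ n = ?b ^ i * ?b ^ (n - i)"
              using i by (simp flip: power_add)
            moreover have "A1 (u p) = ?f * ?b"
              using gen p by auto
            ultimately show ?thesis
              by (simp add: power_mult_distrib)
          qed
          ultimately show ?thesis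
            using B0[OF i] by (simp add: field_simps)
        qed
        have "P (u p) = ?b ^ n * (\<Prod>j<n. B j (u p)) * (?f ^ n + (\<Sum>i<n. A i (u p) / B i (u p) * ?f ^ i))"
        proof -
          have "A1 (u p) = ?f * ?b"
            using gen p by auto
          hence "A1 (u p) ^ n * (\<Prod>j<n. B j (u p)) = ?b ^ n * (\<Prod>j<n. B j (u p)) * ?f ^ n"
            by (simp add: power_mult_distrib)
          thus ?thesis
            unfolding P_def distrib_left sum_distrib_left using 1 by simp
        qed
        thus ?thesis using n(6) p by auto
      qed
      have "P q = 0"
      proof (rule R_eq_0I[OF PR, of "N \<inter> N0"])
        show "openin (zariski C) (N \<inter> N0)" "N \<inter> N0 \<noteq> {}" "N \<inter> N0 \<subseteq> D"
          using n(3,5) 0(3) meet[OF n(3,4) 0(3,4)] by auto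
      qed (use Pu q in auto)
      moreover have "(\<Sum>i<n. A i q * (\<Prod>j\<in>{..<n} - {i}. B j q) * (A1 q ^ i * B1 q ^ (n - i))) = 0"
        by (rule sum.neutral) (simp add: B1 zero_power)
      ultimately have "A1 q ^ n * (\<Prod>j<n. B j q) = 0"
        by (simp add: P_def)
      thus False using A1 n(2) by auto
    qed
    moreover have "eqgen f A1 B1"
      unfolding eqgen_def using 0 gen by (intro exI[of _ N0]) auto
    ultimately show ?thesis using AB by blast
  qed
  have unique: "A q * B' q = A' q * B q"
    if "A \<in> R" "B \<in> R" "A' \<in> R" "B' \<in> R" "eqgen f A B" "eqgen f A' B'" for f A B A' B'
  proof -
    obtain N N' where N: "openin (zariski C) N" "N \<noteq> {}" "N \<subseteq> D" "\<forall>p\<in>N. f p * B (u p) = A (u p)"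
      "openin (zariski C) N'" "N' \<noteq> {}" "N' \<subseteq> D" "\<forall>p\<in>N'. f p * B' (u p) = A' (u p)"
      using \<open>eqgen f A B\<close> \<open>eqgen f A' B'\<close> unfolding eqgen_def by (elim exE conjE)
    have "(\<lambda>x. A x * B' x - A' x * B x) q = 0"
    proof (rule R_eq_0I)
      show "(\<lambda>x. A x * B' x - A' x * B x) \<in> R"
        using that by (intro R_diff R_mult)
      show "openin (zariski C) (N \<inter> N')" "N \<inter> N' \<noteq> {}" "N \<inter> N' \<subseteq> D"
        using N meet[OF N(1,2,5,6)] by auto
      fix p assume "p \<in> N \<inter> N'"
      hence "A (u p) = f p * B (u p)" "A' (u p) = f p * B' (u p)"
        using N by auto
      thus "A (u p) * B' (u p) - A' (u p) * B (u p) = 0"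
        by simp
    qed (rule q)
    thus ?thesis by simp
  qed
  \<comment> \<open>\<open>E f\<close> is the value of \<open>f\<close> at the place
    \<open>q\<close>: existence comes from \<open>frac\<close>, independence of the fraction from
    \<open>unique\<close>.\<close>
  define E where "E f = (SOME c. \<exists>A\<in>R. \<exists>B\<in>R. B q \<noteq> 0 \<and> eqgen f A B \<and> A q = c * B q)" for f
  have E: "E f * B q = A q" if f: "f \<in> regular C U" and AB: "A \<in> R" "B \<in> R" "eqgen f A B" for f A B
  proof -
    obtain A0 B0 where "A0 \<in> R" "B0 \<in> R" "B0 q \<noteq> 0" "eqgen f A0 B0"
      using frac[OF f] by blast
    hence "\<exists>c. \<exists>A\<in>R. \<exists>B\<in>R. B q \<noteq> 0 \<and> eqgen f A B \<and> A q = c * B q"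
      by (intro exI[of _ "A0 q / B0 q"] bexI[of _ A0] bexI[of _ B0]) auto
    hence "\<exists>A\<in>R. \<exists>B\<in>R. B q \<noteq> 0 \<and> eqgen f A B \<and> A q = E f * B q"
      unfolding E_def by (rule someI_ex)
    then obtain A1 B1 where 1: "A1 \<in> R" "B1 \<in> R" "B1 q \<noteq> 0" "eqgen f A1 B1" "A1 q = E f * B1 q"
      by (elim bexE conjE)
    have "A q * B1 q = A1 q * B q"
      using unique[OF AB(1,2) 1(1,2) AB(3) 1(4)] .
    hence "(E f * B q) * B1 q = A q * B1 q"
      using 1(5) by (metis mult.assoc mult.commute)
    thus ?thesis using 1(3) by (metis mult_right_cancel)
  qed
  have eqgen_op: "eqgen (\<lambda>p. f p + g p) (\<lambda>x. A x * B' x + A' x * B x) (\<lambda>x. B x * B' x)"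
      "eqgen (\<lambda>p. f p * g p) (\<lambda>x. A x * A' x) (\<lambda>x. B x * B' x)"
    if eg: "eqgen f A B" "eqgen g A' B'" for f g A B A' B'
  proof -
    obtain N N' where N: "openin (zariski C) N" "N \<noteq> {}" "N \<subseteq> D" "\<forall>p\<in>N. f p * B (u p) = A (u p)"
      "openin (zariski C) N'" "N' \<noteq> {}" "N' \<subseteq> D" "\<forall>p\<in>N'. g p * B' (u p) = A' (u p)"
      using eg unfolding eqgen_def by (elim exE conjE)
    have M: "openin (zariski C) (N \<inter> N')" "N \<inter> N' \<noteq> {}" "N \<inter> N' \<subseteq> D"
      using N meet[OF N(1,2,5,6)] by auto
    have "(f p + g p) * (B (u p) * B' (u p)) = A (u p) * B' (u p) + A' (u p) * B (u p)"
      "(f p * g p) * (B (u p) * B' (u p)) = A (u p) * A' (u p)" if "p \<in> N \<inter> N'" for p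
    proof -
      have 1: "A (u p) = f p * B (u p)" "A' (u p) = g p * B' (u p)"
        using N that by auto
      show "(f p + g p) * (B (u p) * B' (u p)) = A (u p) * B' (u p) + A' (u p) * B (u p)"
        "(f p * g p) * (B (u p) * B' (u p)) = A (u p) * A' (u p)"
        unfolding 1 by (simp_all add: algebra_simps)
    qed
    thus "eqgen (\<lambda>p. f p + g p) (\<lambda>x. A x * B' x + A' x * B x) (\<lambda>x. B x * B' x)"
      "eqgen (\<lambda>p. f p * g p) (\<lambda>x. A x * A' x) (\<lambda>x. B x * B' x)"
      unfolding eqgen_def using M by blast+
  qed
  obtain p where p: "p \<in> U" "\<And>f. f \<in> regular C U \<Longrightarrow> E f = f p"
  proof (rule affine_point_of_hom[OF U(1,3,2), of E])
    fix c
    have "eqgen (\<lambda>_. c) (\<lambda>_. c) (\<lambda>_. 1)"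
      unfolding eqgen_def using D by (intro exI[of _ D]) auto
    from E[OF regular_const[OF U(1)] R_const R_const this] show "E (\<lambda>_. c) = c"
      by simp
  next
    fix f g assume fg: "f \<in> regular C U" "g \<in> regular C U"
    obtain A B where AB: "A \<in> R" "B \<in> R" "B q \<noteq> 0" "eqgen f A B"
      using frac[OF fg(1)] by blast
    obtain A' B' where AB': "A' \<in> R" "B' \<in> R" "B' q \<noteq> 0" "eqgen g A' B'"
      using frac[OF fg(2)] by blast
    have Ef: "E f * B q = A q" "E g * B' q = A' q"
      using E fg AB AB' by auto
    have BB: "B q * B' q \<noteq> 0" using AB AB' by simp
    have "E (\<lambda>p. f p + g p) * (B q * B' q) = A q * B' q + A' q * B q"
      by (rule E[OF regular_add[OF U(1) fg] _ _ eqgen_op(1)[OF AB(4) AB'(4)]])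
         (use AB AB' in \<open>auto intro!: R_add R_mult\<close>)
    also have "\<dots> = (E f + E g) * (B q * B' q)"
      unfolding Ef[symmetric] by (simp add: algebra_simps)
    finally show "E (\<lambda>p. f p + g p) = E f + E g"
      using BB by (metis mult_right_cancel)
    have "E (\<lambda>p. f p * g p) * (B q * B' q) = A q * A' q"
      by (rule E[OF regular_mult[OF U(1) fg] _ _ eqgen_op(2)[OF AB(4) AB'(4)]])
         (use AB AB' in \<open>auto intro!: R_add R_mult\<close>)
    also have "\<dots> = (E f * E g) * (B q * B' q)"
      unfolding Ef[symmetric] by (simp add: algebra_simps)
    finally show "E (\<lambda>p. f p * g p) = E f * E g"
      using BB by (metis mult_right_cancel)
    assume eq: "\<And>p. p \<in> U \<Longrightarrow> f p = g p"
    obtain N where N: "openin (zariski C) N" "N \<noteq> {}" "N \<subseteq> D" "\<forall>p\<in>N. f p * B (u p) = A (u p)"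
      using AB(4) unfolding eqgen_def by (elim exE conjE)
    have "eqgen g A B"
      unfolding eqgen_def using N U eq meet[OF N(1,2) U(1,2)]
      by (intro exI[of _ "N \<inter> U"]) auto
    hence "E g * B q = A q"
      using E fg(2) AB by blast
    thus "E f = E g"
      using Ef(1) AB(3) by (metis mult_right_cancel)
  qed blast
  have "p \<in> D"
  proof (rule bspec[OF centre p(1), THEN mp], intro ballI allI impI, elim conjE)
    fix f A B N assume f: "f \<in> regular C U" "A \<in> R" "B \<in> R" and N: "openin (zariski C) N" "N \<noteq> {}" "N \<subseteq> D"
      "\<forall>p\<in>N. f p * B (u p) = A (u p)"
    have "eqgen f A B"
      unfolding eqgen_def using N by blast
    from E[OF f this] show "f p * B q = A q"
      using p(2)[OF f(1)] by simp
  qed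
  \<comment> \<open>\<open>E\<close> is controlled only on functions regular on \<open>U\<close>;
    near \<open>p\<close> the composite of \<open>P\<close> with \<open>u\<close> is a quotient g /
    h of two of these, and E g = P(q) E h.\<close>
  have coord: "P (u p) = P q" if P: "P \<in> R" for P
  proof -
    obtain g h N where gh: "g \<in> regular C U" "h \<in> regular C U" "openin (zariski C) N" "p \<in> N" "N \<subseteq> U"
      "\<And>q. q \<in> N \<Longrightarrow> h q \<noteq> 0 \<and> P (u q) * h q = g q"
      using affine_fraction[OF U(1,3) p(1) R_regular[OF P \<open>p \<in> D\<close>]] by blast
    obtain A B where AB: "A \<in> R" "B \<in> R" "B q \<noteq> 0" "eqgen h A B"
      using frac[OF gh(2)] by blast
    obtain N' where N': "openin (zariski C) N'" "N' \<noteq> {}" "N' \<subseteq> D" "\<forall>p\<in>N'. h p * B (u p) = A (u p)"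
      using AB(4) unfolding eqgen_def by (elim exE conjE)
    have "eqgen g (\<lambda>x. P x * A x) B"
      unfolding eqgen_def
    proof (intro exI[of _ "N \<inter> N'"] conjI ballI)
      show "N \<inter> N' \<noteq> {}" using meet[OF gh(3) _ N'(1,2)] gh(4) by auto
      fix q assume "q \<in> N \<inter> N'"
      hence "g q = P (u q) * h q" "A (u q) = h q * B (u q)"
        using gh(6) N'(4) by auto
      thus "g q * B (u q) = P (u q) * A (u q)" by simp
    qed (use gh N' in auto)
    hence "E g * B q = P q * A q"
      using E[OF gh(1) R_mult[OF P AB(1)] AB(2)] by blast
    moreover have "E h * B q = A q"
      using E[OF gh(2) AB(1,2,4)] .
    ultimately have "g p * B q = P q * (h p * B q)"
      using p(2) gh(1,2) by simp
    hence "g p = P q * h p"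
      using AB(3) by simp
    moreover have "P (u p) * h p = g p" "h p \<noteq> 0"
      using gh(6)[OF gh(4)] by auto
    ultimately have "P (u p) * h p = P q * h p"
      by simp
    thus ?thesis using \<open>h p \<noteq> 0\<close> by simp
  qed
  have "u p = q"
    using coord[OF R_x] coord[OF R_y] coord[OF R_z] by (simp add: prod_eq_iff)
  thus "q \<in> u ` D"
    using \<open>p \<in> D\<close> by blast
qed

end

section \<open>Normalizations of fibre products of plane curves\<close>

lemma regular_subspace_onE:
  assumes "f \<in> regular (subspace_on X S) W" "p \<in> W"
  obtains U g where "openin (zariski X) U" "p \<in> U" "g \<in> regular X U" "\<And>q. q \<in> U \<Longrightarrow> q \<in> W \<Longrightarrow> f q = g q"
proof -
  have "\<forall>p\<in>W. \<exists>U g. openin (zariski X) U \<and> p \<in> U \<and> g \<in> regular X U \<and> (\<forall>q\<in>U \<inter> W. f q = g q)"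
    using assms(1) by (simp add: subspace_on_def)
  from bspec[OF this assms(2)] obtain U g where "openin (zariski X) U" "p \<in> U" "g \<in> regular X U" "\<forall>q\<in>U \<inter> W. f q = g q"
    by (elim exE conjE)
  thus ?thesis using that by simp
qed

text \<open>Meant for the fibre product, which is never shown to satisfy
  \<open>space_with_functions\<close>; so the coordinates of the affine target are pulled back
  directly from the definition of a morphism.\<close>

lemma affine_open_separates:
  assumes "is_affine (subspace_on Y V)" "V \<subseteq> points Y" "z \<in> V" "z' \<in> V" "z \<noteq> z'"
  obtains f where "f \<in> regular (subspace_on Y V) V" "f z \<noteq> f z'"
proof -
  have ptV: "points (subspace_on Y V) = V"
    using assms(2) by (auto simp: points_subspace_on)
  obtain n Z \<phi> where Z: "closedin (zariski (affine_space n)) Z"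
      and iso: "isomorphism (subspace_on Y V) (subspace_on (affine_space n) Z) \<phi>"
    using assms(1) unfolding is_affine_def isomorphic_def by auto
  then obtain \<psi> where m: "morphism (subspace_on Y V) (subspace_on (affine_space n) Z) \<phi>"
      and inv: "\<forall>p\<in>points (subspace_on Y V). \<psi> (\<phi> p) = p"
    unfolding isomorphism_def by auto
  have Zsub: "Z \<subseteq> points (affine_space n)"
    using closedin_subset[OF Z] by (simp add: points_def)
  have ptZ: "points (subspace_on (affine_space n) Z) = Z"
    using Zsub by (auto simp: points_subspace_on)
  have "\<phi> z \<noteq> \<phi> z'"
    using inv assms(3-5) ptV by metis
  then obtain i where i: "\<phi> z i \<noteq> \<phi> z' i"
    by auto
  let ?c = "\<lambda>v :: nat \<Rightarrow> 'b. v i"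
  have "openin (zariski (affine_space n)) (points (affine_space n))"
    by (simp add: points_def)
  hence c: "?c \<in> regular (subspace_on (affine_space n) Z) Z"
    using Zsub polynomial_regular_affine_space[OF polynomial_functions.coord]
    by (intro regular_subspace_onI exI[of _ "points (affine_space n)"] exI[of _ ?c]) auto
  have "openin (zariski (subspace_on (affine_space n) Z)) Z"
    using ptZ unfolding points_def by (metis openin_topspace)
  from m[unfolded morphism_def, THEN conjunct2, rule_format, OF conjI[OF this c]]
  have "?c \<circ> \<phi> \<in> regular (subspace_on Y V) {p \<in> points (subspace_on Y V). \<phi> p \<in> Z}" .
  moreover have "{p \<in> points (subspace_on Y V). \<phi> p \<in> Z} = V"
    using m ptV ptZ unfolding morphism_def continuous_map_def points_def by auto
  ultimately show ?thesis
    using that i by auto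
qed

lemma (in chart) R_homogeneous:
  assumes "homogeneous d G" "\<And>i. (\<lambda>q. L q i) \<in> R"
  shows "(\<lambda>q. G (L q)) \<in> R"
  using assms(1) by induction (auto intro: R_const R_add R_mult assms(2))

text \<open>Separates what follows from finiteness and birationality of \<open>\<nu>\<close> from
  the equations of the two cubics.\<close>

locale plane_cover = irreducible_space C
  for C :: "('c, 'k :: alg_closed_field) kspace" +
  fixes \<nu> :: "'c \<Rightarrow> (nat \<Rightarrow> 'k) set \<times> (nat \<Rightarrow> 'k) set"
    and S1 S2 :: "(nat \<Rightarrow> 'k) set set"
    and \<phi>1 \<phi>2 :: "(nat \<Rightarrow> 'k) set \<Rightarrow> 'b"
  assumes S12: "S1 \<subseteq> points (projective_space 2)" "S2 \<subseteq> points (projective_space 2)"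
    and var: "variety C"
    and fin: "finite_morphism C
      (fibre_product (subspace_on (projective_space 2) S1) \<phi>1 (subspace_on (projective_space 2) S2) \<phi>2) \<nu>"
    and birat: "birational_morphism C
      (fibre_product (subspace_on (projective_space 2) S1) \<phi>1 (subspace_on (projective_space 2) S2) \<phi>2) \<nu>"
begin

section \<open>Passage between the plane, the fibre product and its normalization\<close>

abbreviation "E1 \<equiv> subspace_on (projective_space 2) S1"
abbreviation "E2 \<equiv> subspace_on (projective_space 2) S2"
abbreviation "F \<equiv> fibre_product E1 \<phi>1 E2 \<phi>2"

lemma points_E: "points E1 = S1" "points E2 = S2"
  using S12 by (auto simp: points_subspace_on)

lemma points_F: "points F = {(p, q). p \<in> S1 \<and> q \<in> S2 \<and> \<phi>1 p = \<phi>2 q}"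
proof -
  have S: "openin (zariski E1) S1" "openin (zariski E2) S2"
    using points_E unfolding points_def by (metis openin_topspace)+
  \<comment> \<open>The point set of the product is the union of its generating open sets; the
    constant tensor 1 exhibits S1 x S2 as one of them.\<close>
  have "S1 \<times> S2 \<subseteq> points (product_space E1 E2)"
  proof -
    let ?h = "\<lambda>(p, q). \<Sum>i<(1::nat). (1 :: 'k)"
    have "(\<lambda>_. 1) \<in> regular E1 S1" "(\<lambda>_. 1) \<in> regular E2 S2"
      using polynomial_functions.const[of 1] homogeneous.const[of 1]
      by (intro regular_subspace_onI exI[of _ "points (projective_space 2)"] exI[of _ "\<lambda>_. 1"];
          use S12 in \<open>auto simp: regular_projective_space points_def intro!: exI[of _ 0] exI[of _ "\<lambda>_. 1"]\<close>)+
    hence "?h \<in> tensor_functions E1 E2 S1 S2"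
      unfolding tensor_functions_def
      by (intro CollectI exI[of _ "1::nat"] exI[of _ "\<lambda>_ _. 1"]) auto
    hence "{z \<in> S1 \<times> S2. ?h z \<noteq> 0} \<in> {{z \<in> U \<times> V. h z \<noteq> 0} | U V h. openin (zariski E1) U \<and> openin (zariski E2) V \<and>
         h \<in> tensor_functions E1 E2 U V}"
      using S by blast
    hence "{z \<in> S1 \<times> S2. ?h z \<noteq> 0} \<subseteq> points (product_space E1 E2)"
      unfolding product_space_def points_def by (auto simp: topology_generated_by_topspace)
    thus ?thesis by auto
  qed
  thus ?thesis
    unfolding fibre_product_def points_subspace_on points_E using S12 by auto
qed

lemma const_regular_E: "(\<lambda>_. c) \<in> regular E1 U" "(\<lambda>_. c) \<in> regular E2 U" if "U \<subseteq> points (projective_space 2)" for U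
proof -
  have "(\<lambda>_. c) \<in> regular (projective_space 2) (points (projective_space 2))"
    unfolding regular_projective_space
    by (intro ballI exI[of _ 0] exI[of _ "\<lambda>_. c"] exI[of _ "\<lambda>_. 1"]) (auto intro: homogeneous.const)
  moreover have "openin (zariski (projective_space 2)) (points (projective_space 2))"
    by (simp add: points_def)
  ultimately show "(\<lambda>_. c) \<in> regular E1 U" "(\<lambda>_. c) \<in> regular E2 U"
    using that by (intro regular_subspace_onI exI[of _ "points (projective_space 2)"] exI[of _ "\<lambda>_. c"]; auto)+
qed

lemma open_E: "openin (zariski E1) (W \<inter> S1)" "openin (zariski E2) (W \<inter> S2)"
  if "openin (zariski (projective_space 2)) W"
  using that by (auto simp: subspace_on_def openin_subtopology)

lemma E_sub: "openin (zariski E1) U \<Longrightarrow> U \<subseteq> S1" "openin (zariski E2) U \<Longrightarrow> U \<subseteq> S2"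
  using points_E openin_subset unfolding points_def by blast+

lemma tensorI:
  assumes "f \<in> regular E1 U" "g \<in> regular E2 V"
  shows "(\<lambda>z. f (fst z) * g (snd z)) \<in> tensor_functions E1 E2 U V"
  unfolding tensor_functions_def
  by (intro CollectI exI[of _ "1::nat"] exI[of _ "\<lambda>_. f"] exI[of _ "\<lambda>_. g"]) (use assms in auto)

lemma open_product_basic:
  assumes "openin (zariski E1) U" "openin (zariski E2) V" "h \<in> tensor_functions E1 E2 U V"
  shows "openin (zariski (product_space E1 E2)) {z \<in> U \<times> V. h z \<noteq> 0}"
  unfolding product_space_def using assms by (auto intro!: topology_generated_by_Basis)

lemma open_F_basic:
  assumes "openin (zariski E1) U" "openin (zariski E2) V" "h \<in> tensor_functions E1 E2 U V"
  shows "openin (zariski F) {z \<in> points F. z \<in> U \<times> V \<and> h z \<noteq> 0}"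
proof -
  note open_product_basic[OF assms]
  moreover have "{z \<in> points F. z \<in> U \<times> V \<and> h z \<noteq> 0} =
      {z \<in> U \<times> V. h z \<noteq> 0} \<inter> {(p, q). p \<in> points E1 \<and> q \<in> points E2 \<and> \<phi>1 p = \<phi>2 q}"
    unfolding points_F points_E using E_sub assms by auto
  ultimately show ?thesis
    unfolding fibre_product_def by (auto simp: subspace_on_def openin_subtopology)
qed

lemma open_F_box:
  assumes "openin (zariski E1) U" "openin (zariski E2) V"
  shows "openin (zariski F) {z \<in> points F. z \<in> U \<times> V}"
proof -
  have "U \<subseteq> points (projective_space 2)" "V \<subseteq> points (projective_space 2)"
    using E_sub(1)[OF assms(1)] E_sub(2)[OF assms(2)] S12 by auto
  from open_F_basic[OF assms tensorI[OF const_regular_E(1)[OF this(1), of 1] const_regular_E(2)[OF this(2), of 1]]]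
  show ?thesis by simp
qed

lemma open_F_projective_box:
  assumes "openin (zariski (projective_space 2)) U" "openin (zariski (projective_space 2)) V"
  shows "openin (zariski F) {z \<in> points F. fst z \<in> U \<and> snd z \<in> V}"
proof -
  have "{z \<in> points F. fst z \<in> U \<and> snd z \<in> V} = {z \<in> points F. z \<in> (U \<inter> S1) \<times> (V \<inter> S2)}"
    unfolding points_F by auto
  thus ?thesis
    using open_F_box[OF open_E(1)[OF assms(1)] open_E(2)[OF assms(2)]] by simp
qed

lemma \<nu>_continuous: "openin (zariski F) W \<Longrightarrow> openin (zariski C) {p \<in> points C. \<nu> p \<in> W}"
  and \<nu>_points: "p \<in> points C \<Longrightarrow> \<nu> p \<in> points F"
  and \<nu>_regular: "openin (zariski F) W \<Longrightarrow> f \<in> regular F W \<Longrightarrow> f \<circ> \<nu> \<in> regular C {p \<in> points C. \<nu> p \<in> W}"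
  using fin unfolding finite_morphism_def morphism_def continuous_map_def points_def by auto

lemma \<nu>_regular_at:
  assumes "openin (zariski F) W" "f \<in> regular F W" "p \<in> points C" "\<nu> p \<in> W"
  shows "regular_at C p (f \<circ> \<nu>)"
  using regular_imp_at[OF \<nu>_regular[OF assms(1,2)] \<nu>_continuous[OF assms(1)]] assms(3,4) by simp

lemma homogeneous_ratio_regular:
  assumes "homogeneous d G" "homogeneous d H"
    and f: "\<And>e v. e \<in> points (projective_space 2) \<Longrightarrow> v \<in> e \<Longrightarrow> H v \<noteq> 0 \<Longrightarrow> f e = G v / H v"
    and p: "p \<in> points C"
  shows "\<forall>v\<in>fst (\<nu> p). H v \<noteq> 0 \<Longrightarrow> regular_at C p (\<lambda>p. f (fst (\<nu> p)))"
    and "\<forall>v\<in>snd (\<nu> p). H v \<noteq> 0 \<Longrightarrow> regular_at C p (\<lambda>p. f (snd (\<nu> p)))"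
proof -
  let ?U = "{e \<in> points (projective_space 2). \<forall>v\<in>e. H v \<noteq> 0}"
  have U: "openin (zariski (projective_space 2)) ?U"
    using open_projective_basic[OF assms(2)] .
  have fU: "f \<in> regular (projective_space 2) ?U"
    unfolding regular_projective_space using assms by (intro ballI exI[of _ d] exI[of _ G] exI[of _ H]) auto
  have fE: "f \<in> regular E1 (?U \<inter> S1)" "f \<in> regular E2 (?U \<inter> S2)"
    by (intro regular_subspace_onI exI[of _ ?U] exI[of _ f]; use U fU in auto)+
  have \<nu>p: "fst (\<nu> p) \<in> S1" "snd (\<nu> p) \<in> S2"
    using \<nu>_points[OF p] unfolding points_F by auto
  have S: "openin (zariski E1) S1" "openin (zariski E2) S2"
    using points_E unfolding points_def by (metis openin_topspace)+
  have one: "(\<lambda>_. 1) \<in> regular E1 S1" "(\<lambda>_. 1) \<in> regular E2 S2"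
    using const_regular_E(1)[OF S12(1), of 1] const_regular_E(2)[OF S12(2), of 1] .
  show "regular_at C p (\<lambda>p. f (fst (\<nu> p)))" if "\<forall>v\<in>fst (\<nu> p). H v \<noteq> 0"
  proof -
    let ?V = "?U \<inter> S1"
    let ?W = "{z \<in> points F. z \<in> ?V \<times> S2}"
    have V: "openin (zariski E1) ?V" using open_E(1)[OF U] .
    have W: "openin (zariski F) ?W" using open_F_box[OF V S(2)] .
    have one': "(\<lambda>_. 1) \<in> regular E1 ?V" using S12 by (intro const_regular_E) auto
    let ?P = "{z \<in> ?V \<times> S2. (\<lambda>_. 1 :: 'k) (fst z) * (\<lambda>_. 1) (snd z) \<noteq> 0}"
    have P: "openin (zariski (product_space E1 E2)) ?P"
      using open_product_basic[OF V S(2) tensorI[OF one' one(2)]] .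
    have "(\<lambda>z. f (fst z)) \<in> regular (product_space E1 E2) ?P"
      unfolding product_space_def kspace.simps
    proof (intro CollectI ballI exI conjI impI)
      fix z assume "z \<in> ?P"
      thus "z \<in> ?V \<times> S2" by simp
      show "(\<lambda>z. f (fst z) * (\<lambda>_. 1) (snd z)) \<in> tensor_functions E1 E2 ?V S2"
        using tensorI[OF fE(1) one(2)] .
      show "(\<lambda>z. (\<lambda>_. 1) (fst z) * (\<lambda>_. 1) (snd z)) \<in> tensor_functions E1 E2 ?V S2"
        using tensorI[OF one' one(2)] .
    qed (use V S in auto)
    hence "(\<lambda>z. f (fst z)) \<in> regular F ?W"
      unfolding fibre_product_def using P
      by (intro regular_subspace_onI exI[of _ ?P] exI[of _ "\<lambda>z. f (fst z)"]) auto
    from \<nu>_regular_at[OF W this p] show ?thesis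
      using that \<nu>p \<nu>_points[OF p] S12 by (auto simp: comp_def mem_Times_iff)
  qed
  show "regular_at C p (\<lambda>p. f (snd (\<nu> p)))" if "\<forall>v\<in>snd (\<nu> p). H v \<noteq> 0"
  proof -
    let ?V = "?U \<inter> S2"
    let ?W = "{z \<in> points F. z \<in> S1 \<times> ?V}"
    have V: "openin (zariski E2) ?V" using open_E(2)[OF U] .
    have W: "openin (zariski F) ?W" using open_F_box[OF S(1) V] .
    have one': "(\<lambda>_. 1) \<in> regular E2 ?V" using S12 by (intro const_regular_E) auto
    let ?P = "{z \<in> S1 \<times> ?V. (\<lambda>_. 1 :: 'k) (fst z) * (\<lambda>_. 1) (snd z) \<noteq> 0}"
    have P: "openin (zariski (product_space E1 E2)) ?P"
      using open_product_basic[OF S(1) V tensorI[OF one(1) one']] .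
    have "(\<lambda>z. f (snd z)) \<in> regular (product_space E1 E2) ?P"
      unfolding product_space_def kspace.simps
    proof (intro CollectI ballI exI conjI impI)
      fix z assume "z \<in> ?P"
      thus "z \<in> S1 \<times> ?V" by simp
      show "(\<lambda>z. (\<lambda>_. 1) (fst z) * f (snd z)) \<in> tensor_functions E1 E2 S1 ?V"
        using tensorI[OF one(1) fE(2)] .
      show "(\<lambda>z. (\<lambda>_. 1) (fst z) * (\<lambda>_. 1) (snd z)) \<in> tensor_functions E1 E2 S1 ?V"
        using tensorI[OF one(1) one'] .
    qed (use V S in auto)
    hence "(\<lambda>z. f (snd z)) \<in> regular F ?W"
      unfolding fibre_product_def using P
      by (intro regular_subspace_onI exI[of _ ?P] exI[of _ "\<lambda>z. f (snd z)"]) auto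
    from \<nu>_regular_at[OF W this p] show ?thesis
      using that \<nu>p \<nu>_points[OF p] S12 by (auto simp: comp_def mem_Times_iff)
  qed
qed

section \<open>Points of \<open>C\<close> and the locus where \<open>\<nu>\<close> is an
  isomorphism\<close>

lemma separate_points:
  assumes "p \<in> points C" "p' \<in> points C" "p \<noteq> p'"
  obtains N where "openin (zariski C) N" "p' \<in> N" "p \<notin> N"
proof -
  obtain U where U: "openin (zariski C) U" "is_affine (subspace_on C U)" "p' \<in> U"
    using var assms(2) unfolding variety_def by blast
  show ?thesis
  proof (cases "p \<in> U")
    case True
    obtain f where f: "f \<in> regular C U" "f p' \<noteq> f p"
      using affine_separates[OF U True] assms(3) by metis
    have "regular_at C p' (\<lambda>q. f q - f p)"
      using regular_imp_at[OF f(1) U(1,3)] at_const[OF assms(2)] at_diff by blast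
    from at_nonzero_nbhd[OF this] f(2) obtain N where "openin (zariski C) N" "p' \<in> N" "\<And>q. q \<in> N \<Longrightarrow> f q - f p \<noteq> 0"
      by auto
    thus ?thesis using that by fastforce
  qed (use that U in blast)
qed

lemma closed_points: "p \<in> points C \<Longrightarrow> closedin (zariski C) {p}"
proof -
  assume p: "p \<in> points C"
  have "openin (zariski C) (points C - {p})"
    unfolding openin_subopen[of _ "points C - {p}"]
  proof
    fix q assume "q \<in> points C - {p}"
    then obtain N where "openin (zariski C) N" "q \<in> N" "p \<notin> N"
      using separate_points[OF p, of q] by auto
    thus "\<exists>T. openin (zariski C) T \<and> q \<in> T \<and> T \<subseteq> points C - {p}"
      using open_subset_points by (intro exI[of _ N]) auto
  qed
  thus ?thesis
    using p by (simp add: closedin_def points_def)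
qed

text \<open>In a finite open set every point would itself be open; an open point lies in every
  nonempty open set, which contradicts the separation of points.\<close>

lemma infinite_open:
  assumes two_points: "\<exists>p\<in>points C. \<exists>p'\<in>points C. p \<noteq> p'" and U: "openin (zariski C) U" "U \<noteq> {}"
  shows "infinite U"
proof
  assume fU: "finite U"
  obtain p p' where p: "p \<in> points C" "p' \<in> points C" "p \<noteq> p'"
    using two_points by blast
  have "closedin (zariski C) (\<Union>q\<in>U - {r}. {q})" for r
    using open_subset_points[OF U(1)] fU by (intro closedin_Union) (auto intro: closed_points)
  hence cl: "closedin (zariski C) (U - {r})" for r
    by simp
  have op: "openin (zariski C) {r}" if "r \<in> U" for r
  proof -
    have "openin (zariski C) (U - (U - {r}))"
      using U(1) cl by (intro openin_diff)
    moreover have "U - (U - {r}) = {r}" using that by auto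
    ultimately show ?thesis by simp
  qed
  obtain r where r: "r \<in> U" using U(2) by auto
  obtain s where s: "s \<in> points C" "s \<noteq> r"
    using p by metis
  obtain N where "openin (zariski C) N" "s \<in> N" "r \<notin> N"
    using separate_points[of r s] s r open_subset_points[OF U(1)] by auto
  thus False
    using opens_meet[OF op[OF r], of N] by auto
qed

text \<open>Over a dense open \<open>V\<close> the map \<open>\<nu>\<close> has the inverse \<psi>,
  so germs on \<open>C\<close> at points over \<open>V\<close> descend to germs on the fibre
  product. Density of \<open>V\<close> is recorded in the form that \<open>\<nu>\<close> reaches
  every nonempty open set.\<close>

lemma birational_data:
  obtains V \<psi> where "openin (zariski F) V" "V \<subseteq> points F" "openin (zariski C) {p \<in> points C. \<nu> p \<in> V}"
    "\<And>W. openin (zariski F) W \<Longrightarrow> W \<noteq> {} \<Longrightarrow> \<exists>p\<in>points C. \<nu> p \<in> V \<inter> W"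
    "\<And>p. p \<in> points C \<Longrightarrow> \<nu> p \<in> V \<Longrightarrow> \<psi> (\<nu> p) = p"
    "\<And>p f. p \<in> points C \<Longrightarrow> \<nu> p \<in> V \<Longrightarrow> regular_at C p f \<Longrightarrow>
      \<exists>W g. openin (zariski F) W \<and> \<nu> p \<in> W \<and> g \<in> regular F W \<and>
        (\<exists>N. openin (zariski C) N \<and> p \<in> N \<and> (\<forall>q\<in>N. \<nu> q \<in> W \<longrightarrow> f q = g (\<nu> q)))"
proof -
  obtain V where V: "openin (zariski F) V" "zariski F closure_of V = points F"
     "isomorphism (subspace_on C {p \<in> points C. \<nu> p \<in> V}) (subspace_on F V) \<nu>"
    using birat unfolding birational_morphism_def Let_def by auto
  let ?U = "{p \<in> points C. \<nu> p \<in> V}"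
  have U: "openin (zariski C) ?U" using \<nu>_continuous[OF V(1)] .
  have Vs: "V \<subseteq> points F" using openin_subset[OF V(1)] by (simp add: points_def)
  have ptV: "points (subspace_on F V) = V" using Vs by (auto simp: points_subspace_on)
  note ptU = open_subspace_points[OF U]
  obtain \<psi> where \<psi>: "morphism (subspace_on F V) (subspace_on C ?U) \<psi>" "\<forall>p\<in>?U. \<psi> (\<nu> p) = p" "\<forall>z\<in>V. \<nu> (\<psi> z) = z"
    using V(3) unfolding isomorphism_def ptU ptV by auto
  have \<psi>U: "\<psi> z \<in> ?U" if "z \<in> V" for z
    using \<psi>(1) that ptV ptU unfolding morphism_def continuous_map_def points_def by blast
  show ?thesis
  proof (rule that[OF V(1) Vs U])
    fix W assume W: "openin (zariski F) W" "W \<noteq> {}"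
    then obtain z where "z \<in> W" by auto
    moreover have "z \<in> zariski F closure_of V"
      using V(2) openin_subset[OF W(1)] \<open>z \<in> W\<close> by (auto simp: points_def)
    ultimately obtain z' where z': "z' \<in> V" "z' \<in> W"
      using W(1) unfolding in_closure_of by auto
    thus "\<exists>p\<in>points C. \<nu> p \<in> V \<inter> W"
      using \<psi>U[OF z'(1)] \<psi>(3) by (intro bexI[of _ "\<psi> z'"]) auto
  next
    fix p assume "p \<in> points C" "\<nu> p \<in> V"
    thus "\<psi> (\<nu> p) = p" using \<psi>(2) by auto
  next
    fix p f assume p: "p \<in> points C" "\<nu> p \<in> V" and f: "regular_at C p f"
    obtain M where M: "openin (zariski C) M" "p \<in> M" "f \<in> regular C M"
      using f unfolding regular_at_def by auto
    let ?M = "M \<inter> ?U"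
    have M': "openin (zariski C) ?M" using M U by auto
    have "openin (zariski (subspace_on C ?U)) ?M" "f \<in> regular (subspace_on C ?U) ?M"
      using M' open_subspace_zariski[OF U] open_subspace_regular[OF M'] regular_restrict[OF M(3,1) M'] by auto
    from \<psi>(1)[unfolded morphism_def ptV, THEN conjunct2, rule_format, OF conjI[OF this]]
    have fr: "f \<circ> \<psi> \<in> regular (subspace_on F V) {z \<in> V. \<psi> z \<in> ?M}" .
    have "\<nu> p \<in> {z \<in> V. \<psi> z \<in> ?M}"
      using p M \<psi>(2) by auto
    from regular_subspace_onE[OF fr this] obtain W g where W: "openin (zariski F) W" "\<nu> p \<in> W" "g \<in> regular F W"
        "\<And>z. z \<in> W \<Longrightarrow> z \<in> {z \<in> V. \<psi> z \<in> ?M} \<Longrightarrow> (f \<circ> \<psi>) z = g z"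
      by blast
    have "f q = g (\<nu> q)" if q: "q \<in> ?M" "\<nu> q \<in> W" for q
    proof -
      have "\<psi> (\<nu> q) = q" using \<psi>(2) q by auto
      thus ?thesis using W(4)[of "\<nu> q"] q by auto
    qed
    thus "\<exists>W g. openin (zariski F) W \<and> \<nu> p \<in> W \<and> g \<in> regular F W \<and>
        (\<exists>N. openin (zariski C) N \<and> p \<in> N \<and> (\<forall>q\<in>N. \<nu> q \<in> W \<longrightarrow> f q = g (\<nu> q)))"
      using W(1-3) M' M(2) p by (intro exI[of _ W] exI[of _ g] conjI exI[of _ ?M]) auto
  qed
qed

text \<open>
  \<open>R\<close>-valued lifts of the two components of a map to the fibre product express regular functions on
  the fibre product as fractions of elements of \<open>R\<close>.
\<close>

lemma fibre_regular_lift: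
  assumes chart: "chart m n1 n2"
    and L: "\<And>i. (\<lambda>q. L1 q i) \<in> chart.R m n1 n2" "\<And>i. (\<lambda>q. L2 q i) \<in> chart.R m n1 n2"
    and \<mu>: "\<mu> = (\<lambda>q. (proj_point (L1 q), proj_point (L2 q)))"
    and g: "g \<in> regular F W" "q \<in> chart.X m n1 n2" "\<mu> q \<in> W" "openin (zariski F) W"
  obtains A B N where "A \<in> chart.R m n1 n2" "B \<in> chart.R m n1 n2" "openin (zariski F) N" "\<mu> q \<in> N" "N \<subseteq> W"
    "\<And>q'. q' \<in> chart.X m n1 n2 \<Longrightarrow> \<mu> q' \<in> N \<Longrightarrow> B q' \<noteq> 0 \<and> g (\<mu> q') * B q' = A q'"
proof -
  interpret chart m n1 n2 by fact
  let ?P2 = "projective_space 2 :: ((nat \<Rightarrow> 'k) set, 'k) kspace"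
  have WF: "W \<subseteq> points F"
    using openin_subset[OF g(4)] by (simp add: points_def)
  have \<mu>P: "proj_point (L1 q) \<in> points ?P2" "proj_point (L2 q) \<in> points ?P2"
    using WF g(3) S12 unfolding points_F \<mu> by auto
  have P: "openin (zariski ?P2) (points ?P2)"
    by (simp add: points_def)
  \<comment> \<open>\<open>fr U V t\<close> says that the pullback of \<open>t\<close> along \<mu>
    is a fraction of elements of \<open>R\<close> near \<open>q\<close>. The boxes W1 x W2 may
    shrink, so the property passes to sums and thus to all tensors.\<close>
  define fr where "fr U V t \<longleftrightarrow> (\<exists>A\<in>R. \<exists>B\<in>R. \<exists>W1 W2. openin (zariski ?P2) W1 \<and> openin (zariski ?P2) W2 \<and>
     proj_point (L1 q) \<in> W1 \<and> proj_point (L2 q) \<in> W2 \<and>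
     (\<forall>q'\<in>X. proj_point (L1 q') \<in> W1 \<inter> U \<and> proj_point (L2 q') \<in> W2 \<inter> V \<longrightarrow> B q' \<noteq> 0 \<and> t (\<mu> q') * B q' = A q'))" for U V t
  have single: "\<exists>A\<in>R. \<exists>B\<in>R. \<exists>W1. openin (zariski ?P2) W1 \<and> proj_point (L q) \<in> W1 \<and>
     (\<forall>q'\<in>X. proj_point (L q') \<in> W1 \<inter> U \<longrightarrow> B q' \<noteq> 0 \<and> f (proj_point (L q')) * B q' = A q')"
    if L: "\<And>i. (\<lambda>q. L q i) \<in> R" and f: "f \<in> regular (subspace_on ?P2 S) U" "proj_point (L q) \<in> U" for L f S U
  proof -
    obtain W0 f' where W0: "openin (zariski ?P2) W0" "proj_point (L q) \<in> W0" "f' \<in> regular ?P2 W0"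
        "\<And>e. e \<in> W0 \<Longrightarrow> e \<in> U \<Longrightarrow> f e = f' e"
      using regular_subspace_onE[OF f] by blast
    from bspec[OF W0(3)[unfolded regular_projective_space] W0(2)] obtain d G H where
      GH: "homogeneous d G" "homogeneous d H" "\<forall>v\<in>proj_point (L q). H v \<noteq> 0"
        "\<forall>e\<in>W0. \<forall>v\<in>e. H v \<noteq> 0 \<longrightarrow> f' e = G v / H v"
      by (elim exE conjE)
    let ?W = "W0 \<inter> {e \<in> points ?P2. \<forall>v\<in>e. H v \<noteq> 0}"
    have "f (proj_point (L q')) * H (L q') = G (L q')" "H (L q') \<noteq> 0" if q': "proj_point (L q') \<in> ?W \<inter> U" for q'
    proof -
      show H: "H (L q') \<noteq> 0" using q' proj_point_self[of "L q'"] by auto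
      have "f (proj_point (L q')) = f' (proj_point (L q'))"
        using W0(4) q' by auto
      also have "\<dots> = G (L q') / H (L q')"
        using GH(4) q' H proj_point_self[of "L q'"] by auto
      finally show "f (proj_point (L q')) * H (L q') = G (L q')"
        using H by simp
    qed
    moreover have "openin (zariski ?P2) ?W" "proj_point (L q) \<in> ?W"
      using W0(1,2) open_projective_basic[OF GH(2)] openin_subset[OF W0(1)] GH(3) by (auto simp: points_def)
    ultimately show ?thesis
      using R_homogeneous[OF GH(1) L] R_homogeneous[OF GH(2) L]
      by (intro bexI[of _ "\<lambda>q. G (L q)"] bexI[of _ "\<lambda>q. H (L q)"] exI[of _ ?W] conjI ballI impI) simp_all
  qed
  have fr_I: "fr U V t" if "A \<in> R" "B \<in> R" "openin (zariski ?P2) W1" "openin (zariski ?P2) W2"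
     "proj_point (L1 q) \<in> W1" "proj_point (L2 q) \<in> W2"
     "\<And>q'. q' \<in> X \<Longrightarrow> proj_point (L1 q') \<in> W1 \<inter> U \<Longrightarrow> proj_point (L2 q') \<in> W2 \<inter> V \<Longrightarrow> B q' \<noteq> 0 \<and> t (\<mu> q') * B q' = A q'"
    for A B W1 W2 U V t
    unfolding fr_def using that by (intro bexI[of _ A] bexI[of _ B] exI[of _ W1] exI[of _ W2]) auto
  have combine: "fr U V (\<lambda>z. t z + t' z)" if t: "fr U V t" and t': "fr U V t'" for U V t t'
  proof -
    obtain A B W1 W2 where 1: "A \<in> R" "B \<in> R" "openin (zariski ?P2) W1" "openin (zariski ?P2) W2"
       "proj_point (L1 q) \<in> W1" "proj_point (L2 q) \<in> W2"
       "\<forall>q'\<in>X. proj_point (L1 q') \<in> W1 \<inter> U \<and> proj_point (L2 q') \<in> W2 \<inter> V \<longrightarrow> B q' \<noteq> 0 \<and> t (\<mu> q') * B q' = A q'"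
      using t unfolding fr_def by (elim bexE exE conjE)
    obtain A' B' W1' W2' where 2: "A' \<in> R" "B' \<in> R" "openin (zariski ?P2) W1'" "openin (zariski ?P2) W2'"
       "proj_point (L1 q) \<in> W1'" "proj_point (L2 q) \<in> W2'"
       "\<forall>q'\<in>X. proj_point (L1 q') \<in> W1' \<inter> U \<and> proj_point (L2 q') \<in> W2' \<inter> V \<longrightarrow> B' q' \<noteq> 0 \<and> t' (\<mu> q') * B' q' = A' q'"
      using t' unfolding fr_def by (elim bexE exE conjE)
    show ?thesis
    proof (rule fr_I[where A = "\<lambda>x. A x * B' x + A' x * B x" and B = "\<lambda>x. B x * B' x" and ?W1.0 = "W1 \<inter> W1'" and ?W2.0 = "W2 \<inter> W2'"])
      fix q' assume q': "q' \<in> X" "proj_point (L1 q') \<in> W1 \<inter> W1' \<inter> U" "proj_point (L2 q') \<in> W2 \<inter> W2' \<inter> V"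
      have "B q' \<noteq> 0" "A q' = t (\<mu> q') * B q'" "B' q' \<noteq> 0" "A' q' = t' (\<mu> q') * B' q'"
        using 1(7) 2(7) q' by auto
      thus "B q' * B' q' \<noteq> 0 \<and> (t (\<mu> q') + t' (\<mu> q')) * (B q' * B' q') = A q' * B' q' + A' q' * B q'"
        by (simp add: algebra_simps)
    qed (use 1 2 in \<open>auto intro!: R_add R_mult\<close>)
  qed
  have tensor: "fr U V t" if t: "t \<in> tensor_functions E1 E2 U V" and UV: "\<mu> q \<in> U \<times> V" for t U V
  proof -
    obtain n f g where fg: "t = (\<lambda>(p, q). \<Sum>i<(n::nat). f i p * g i q)" "\<And>i. i < n \<Longrightarrow> f i \<in> regular E1 U"
        "\<And>i. i < n \<Longrightarrow> g i \<in> regular E2 V"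
      using t unfolding tensor_functions_def by auto
    have "k \<le> n \<Longrightarrow> fr U V (\<lambda>(p, q). \<Sum>i<k. f i p * g i q)" for k
    proof (induction k)
      case 0
      show ?case
        by (rule fr_I[where A = "\<lambda>_. 0" and B = "\<lambda>_. 1" and ?W1.0 = "points ?P2" and ?W2.0 = "points ?P2"])
          (use P \<mu>P in \<open>auto simp: R_const\<close>)
    next
      case (Suc k)
      have fk: "f k \<in> regular E1 U" "g k \<in> regular E2 V"
        using fg(2,3) Suc.prems by auto
      have \<mu>UV: "proj_point (L1 q) \<in> U" "proj_point (L2 q) \<in> V"
        using UV by (auto simp: \<mu>)
      obtain A B W1 where 1: "A \<in> R" "B \<in> R" "openin (zariski ?P2) W1" "proj_point (L1 q) \<in> W1"
         "\<forall>q'\<in>X. proj_point (L1 q') \<in> W1 \<inter> U \<longrightarrow> B q' \<noteq> 0 \<and> f k (proj_point (L1 q')) * B q' = A q'"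
        using single[of L1, OF L(1) fk(1) \<mu>UV(1)] by (elim bexE exE conjE)
      obtain A' B' W2 where 2: "A' \<in> R" "B' \<in> R" "openin (zariski ?P2) W2" "proj_point (L2 q) \<in> W2"
         "\<forall>q'\<in>X. proj_point (L2 q') \<in> W2 \<inter> V \<longrightarrow> B' q' \<noteq> 0 \<and> g k (proj_point (L2 q')) * B' q' = A' q'"
        using single[of L2, OF L(2) fk(2) \<mu>UV(2)] by (elim bexE exE conjE)
      have "fr U V (\<lambda>(p, q). f k p * g k q)"
      proof (rule fr_I[where A = "\<lambda>x. A x * A' x" and B = "\<lambda>x. B x * B' x"])
        fix q' assume q': "q' \<in> X" "proj_point (L1 q') \<in> W1 \<inter> U" "proj_point (L2 q') \<in> W2 \<inter> V"
        have "B q' \<noteq> 0" "A q' = f k (proj_point (L1 q')) * B q'" "B' q' \<noteq> 0" "A' q' = g k (proj_point (L2 q')) * B' q'"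
          using 1(5) 2(5) q' by auto
        thus "B q' * B' q' \<noteq> 0 \<and> (case \<mu> q' of (p, q) \<Rightarrow> f k p * g k q) * (B q' * B' q') = A q' * A' q'"
          by (simp add: \<mu>)
      qed (use 1 2 in \<open>auto intro!: R_mult\<close>)
      from combine[OF Suc.IH this] Suc.prems show ?case
        by (simp add: case_prod_unfold)
    qed
    thus ?thesis using fg(1) by simp
  qed
  obtain W' g' where W': "openin (zariski (product_space E1 E2)) W'" "\<mu> q \<in> W'" "g' \<in> regular (product_space E1 E2) W'"
      "\<And>z. z \<in> W' \<Longrightarrow> z \<in> W \<Longrightarrow> g z = g' z"
    using regular_subspace_onE[OF g(1)[unfolded fibre_product_def] g(3)] by blast
  have "\<forall>z\<in>W'. \<exists>U V a h. openin (zariski E1) U \<and> openin (zariski E2) V \<and>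
          a \<in> tensor_functions E1 E2 U V \<and> h \<in> tensor_functions E1 E2 U V \<and>
          z \<in> U \<times> V \<and> h z \<noteq> 0 \<and> (\<forall>w \<in> W' \<inter> U \<times> V. h w \<noteq> 0 \<longrightarrow> g' w = a w / h w)"
    using W'(3) unfolding product_space_def by simp
  from bspec[OF this W'(2)] obtain U V a h where UV: "openin (zariski E1) U" "openin (zariski E2) V"
     "a \<in> tensor_functions E1 E2 U V" "h \<in> tensor_functions E1 E2 U V" "\<mu> q \<in> U \<times> V" "h (\<mu> q) \<noteq> 0"
     "\<forall>w \<in> W' \<inter> U \<times> V. h w \<noteq> 0 \<longrightarrow> g' w = a w / h w"
    by (elim exE conjE)
  obtain A B W1 W2 where 1: "A \<in> R" "B \<in> R" "openin (zariski ?P2) W1" "openin (zariski ?P2) W2"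
     "proj_point (L1 q) \<in> W1" "proj_point (L2 q) \<in> W2"
     "\<forall>q'\<in>X. proj_point (L1 q') \<in> W1 \<inter> U \<and> proj_point (L2 q') \<in> W2 \<inter> V \<longrightarrow> B q' \<noteq> 0 \<and> a (\<mu> q') * B q' = A q'"
    using tensor[OF UV(3,5)] unfolding fr_def by (elim bexE exE conjE)
  obtain A' B' W1' W2' where 2: "A' \<in> R" "B' \<in> R" "openin (zariski ?P2) W1'" "openin (zariski ?P2) W2'"
     "proj_point (L1 q) \<in> W1'" "proj_point (L2 q) \<in> W2'"
     "\<forall>q'\<in>X. proj_point (L1 q') \<in> W1' \<inter> U \<and> proj_point (L2 q') \<in> W2' \<inter> V \<longrightarrow> B' q' \<noteq> 0 \<and> h (\<mu> q') * B' q' = A' q'"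
    using tensor[OF UV(4,5)] unfolding fr_def by (elim bexE exE conjE)
  have subF: "W' \<inter> points F = {z \<in> points F. z \<in> W'}" by auto
  have W'F: "openin (zariski F) (W' \<inter> points F)"
  proof -
    have "W' \<inter> points F = W' \<inter> {(p, q). p \<in> points E1 \<and> q \<in> points E2 \<and> \<phi>1 p = \<phi>2 q}"
      unfolding points_F points_E by auto
    thus ?thesis
      unfolding fibre_product_def using W'(1) by (auto simp: subspace_on_def openin_subtopology)
  qed
  define N where "N = W \<inter> (W' \<inter> points F) \<inter> {z \<in> points F. z \<in> U \<times> V \<and> h z \<noteq> 0} \<inter>
      {z \<in> points F. fst z \<in> W1 \<inter> W1' \<and> snd z \<in> W2 \<inter> W2'}"
  show ?thesis
  proof (rule that[of "\<lambda>x. A x * B' x" "\<lambda>x. B x * A' x" N])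
    show "(\<lambda>x. A x * B' x) \<in> R" "(\<lambda>x. B x * A' x) \<in> R"
      using 1 2 by (auto intro!: R_mult)
    show "openin (zariski F) N"
      unfolding N_def
      by (intro openin_Int[OF openin_Int[OF openin_Int[OF g(4) W'F] open_F_basic[OF UV(1,2,4)]]]
          open_F_projective_box openin_Int 1 2)
    show "\<mu> q \<in> N"
      using g(3) W'(2) UV(5,6) 1(5,6) 2(5,6) WF by (auto simp: N_def \<mu>)
    show "N \<subseteq> W" by (auto simp: N_def)
    fix q' assume q': "q' \<in> X" "\<mu> q' \<in> N"
    have b: "B q' \<noteq> 0 \<and> a (\<mu> q') * B q' = A q'" "B' q' \<noteq> 0 \<and> h (\<mu> q') * B' q' = A' q'"
      using 1(7) 2(7) q' by (auto simp: N_def \<mu>)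
    have h: "h (\<mu> q') \<noteq> 0" "g (\<mu> q') = a (\<mu> q') / h (\<mu> q')"
      using q'(2) UV(7) W'(4) by (auto simp: N_def)
    have "A' q' \<noteq> 0" using b h by auto
    moreover have "g (\<mu> q') * (B q' * A' q') = A q' * B' q'"
      unfolding h(2) b(1)[THEN conjunct2, symmetric] b(2)[THEN conjunct2, symmetric] using h(1) by simp
    ultimately show "B q' * A' q' \<noteq> 0 \<and> g (\<mu> q') * (B q' * A' q') = A q' * B' q'"
      using b by simp
  qed
qed

section \<open>From the normalization to the chart axioms\<close>

lemma preimage_nonempty:
  assumes "openin (zariski F) W" "W \<noteq> {}"
  obtains p where "p \<in> points C" "\<nu> p \<in> W"
proof (rule birational_data)
  fix V
  assume "\<And>W. openin (zariski F) W \<Longrightarrow> W \<noteq> {} \<Longrightarrow> \<exists>p\<in>points C. \<nu> p \<in> V \<inter> W"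
  from this[OF assms] show thesis
    using that by blast
qed

text \<open>For a concrete chart it remains to give homogeneous lifts \<open>L1\<close>,
  \<open>L2\<close> of the map \<mu> from the model to the fibre product, a map \<open>u\<close>
  with \<mu> o u = \<open>\<nu>\<close>, and to check that \<open>D\<close> contains the whole
  preimage of the image of \<mu>. Birationality then yields \<open>generic\<close>; the affine
  neighbourhoods of a finite morphism yield \<open>places\<close> and
  \<open>common_affine\<close>.\<close>

lemma charted_spaceI:
  assumes two_points: "\<exists>p\<in>points C. \<exists>p'\<in>points C. p \<noteq> p'"
    and chart: "chart m n1 n2"
    and L: "\<And>i. (\<lambda>q. L1 q i) \<in> chart.R m n1 n2" "\<And>i. (\<lambda>q. L2 q i) \<in> chart.R m n1 n2"
    and \<mu>: "\<mu> = (\<lambda>q. (proj_point (L1 q), proj_point (L2 q)))"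
    and D: "openin (zariski C) D" "D \<noteq> {}"
    and u_X: "\<And>p. p \<in> D \<Longrightarrow> u p \<in> chart.X m n1 n2"
    and u_regular: "\<And>p. p \<in> D \<Longrightarrow> regular_at C p (\<lambda>p. fst (u p))"
      "\<And>p. p \<in> D \<Longrightarrow> regular_at C p (\<lambda>p. fst (snd (u p)))"
      "\<And>p. p \<in> D \<Longrightarrow> regular_at C p (\<lambda>p. snd (snd (u p)))"
    and \<mu>u: "\<And>p. p \<in> D \<Longrightarrow> \<nu> p = \<mu> (u p)"
    and \<mu>F: "\<And>q. q \<in> chart.X m n1 n2 \<Longrightarrow> \<mu> q \<in> points F"
    and D_iff: "\<And>q p. q \<in> chart.X m n1 n2 \<Longrightarrow> p \<in> points C \<Longrightarrow> \<nu> p = \<mu> q \<Longrightarrow> p \<in> D"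
  shows "charted_space C m n1 n2 D u"
proof -
  interpret chart m n1 n2 by fact
  have DC: "D \<subseteq> points C" using open_subset_points[OF D(1)] .
  obtain V \<psi> where V: "openin (zariski F) V" "V \<subseteq> points F" "openin (zariski C) {p \<in> points C. \<nu> p \<in> V}"
    and Vdense: "\<And>W. openin (zariski F) W \<Longrightarrow> W \<noteq> {} \<Longrightarrow> \<exists>p\<in>points C. \<nu> p \<in> V \<inter> W"
    and \<psi>: "\<And>p. p \<in> points C \<Longrightarrow> \<nu> p \<in> V \<Longrightarrow> \<psi> (\<nu> p) = p"
    and push: "\<And>p f. p \<in> points C \<Longrightarrow> \<nu> p \<in> V \<Longrightarrow> regular_at C p f \<Longrightarrow>
      \<exists>W g. openin (zariski F) W \<and> \<nu> p \<in> W \<and> g \<in> regular F W \<and>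
        (\<exists>N. openin (zariski C) N \<and> p \<in> N \<and> (\<forall>q\<in>N. \<nu> q \<in> W \<longrightarrow> f q = g (\<nu> q)))"
    using birational_data by blast
  let ?U0 = "{p \<in> points C. \<nu> p \<in> V}"
  have "points F \<noteq> {}" using \<nu>_points DC D(2) by blast
  hence U0: "?U0 \<noteq> {}"
    using Vdense[of "points F"] by (auto simp: points_def)
  have preimage_meets: "{p \<in> D. \<nu> p \<in> W} \<noteq> {}" "openin (zariski C) {p \<in> D. \<nu> p \<in> W}"
    if W: "openin (zariski F) W" "W \<noteq> {}" for W
  proof -
    have eq: "{p \<in> D. \<nu> p \<in> W} = D \<inter> {p \<in> points C. \<nu> p \<in> W}" using DC by auto
    have "{p \<in> points C. \<nu> p \<in> W} \<noteq> {}"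
      using Vdense[OF W] by auto
    from opens_meet[OF D(1) \<nu>_continuous[OF W(1)] D(2) this] show "{p \<in> D. \<nu> p \<in> W} \<noteq> {}"
      unfolding eq .
    show "openin (zariski C) {p \<in> D. \<nu> p \<in> W}"
      unfolding eq using D(1) \<nu>_continuous[OF W(1)] by blast
  qed
  have affine_nbhd: "\<exists>W. openin (zariski F) W \<and> z \<in> W \<and> is_affine (subspace_on F W) \<and>
      is_affine (subspace_on C {p \<in> points C. \<nu> p \<in> W}) \<and>
      (\<forall>f\<in>regular C {p \<in> points C. \<nu> p \<in> W}. \<exists>n c. n > 0 \<and> (\<forall>i<n. c i \<in> regular F W) \<and>
           (\<forall>p\<in>{p \<in> points C. \<nu> p \<in> W}. f p ^ n + (\<Sum>i<n. c i (\<nu> p) * f p ^ i) = 0))" if "z \<in> points F" for z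
    using bspec[OF fin[unfolded finite_morphism_def, THEN conjunct2] that] unfolding Let_def .
  show ?thesis
  proof (unfold_locales)
    fix U assume U: "openin (zariski C) U" "U \<noteq> {}" "U \<subseteq> D"
    have op: "openin (zariski C) (U \<inter> ?U0)" "U \<inter> ?U0 \<noteq> {}"
      using opens_meet[OF U(1) V(3) U(2) U0] U(1) V(3) by auto
    \<comment> \<open>Over \<open>V\<close> the map \<open>\<nu>\<close> is injective, and it
      factors through \<open>u\<close>.\<close>
    have "inj_on u (U \<inter> ?U0)"
    proof (rule inj_onI)
      fix p p' assume p: "p \<in> U \<inter> ?U0" "p' \<in> U \<inter> ?U0" "u p = u p'"
      hence "p \<in> D" "p' \<in> D" using U(3) by auto
      hence "\<nu> p = \<nu> p'" using \<mu>u p(3) by metis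
      thus "p = p'" using \<psi> p by (metis (mono_tags, lifting) IntE mem_Collect_eq)
    qed
    hence "infinite (u ` (U \<inter> ?U0))"
      using infinite_open[OF two_points op] finite_imageD by blast
    thus "infinite (u ` U)"
      by (meson Int_lower1 finite_subset image_mono)
  next
    fix U f assume U: "openin (zariski C) U" "U \<noteq> {}" and f: "f \<in> regular C U"
    have "U \<inter> ?U0 \<noteq> {}" "openin (zariski C) (U \<inter> ?U0)"
      using opens_meet[OF U(1) V(3) U(2) U0] U(1) V(3) by auto
    hence "U \<inter> ?U0 \<inter> D \<noteq> {}"
      using opens_meet[OF _ D(1) _ D(2)] by blast
    then obtain p0 where p0: "p0 \<in> U" "p0 \<in> points C" "\<nu> p0 \<in> V" "p0 \<in> D"
      by auto
    obtain W g N where W: "openin (zariski F) W" "\<nu> p0 \<in> W" "g \<in> regular F W" "openin (zariski C) N" "p0 \<in> N"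
        "\<forall>q\<in>N. \<nu> q \<in> W \<longrightarrow> f q = g (\<nu> q)"
      using push[OF p0(2,3) regular_imp_at[OF f U(1) p0(1)]] by (elim exE conjE)
    have q: "u p0 \<in> X" "\<mu> (u p0) \<in> W" "\<nu> p0 = \<mu> (u p0)"
      using u_X \<mu>u p0(4) W(2) by auto
    obtain A B M where AB: "A \<in> R" "B \<in> R" "openin (zariski F) M" "\<mu> (u p0) \<in> M" "M \<subseteq> W"
      "\<And>q'. q' \<in> X \<Longrightarrow> \<mu> q' \<in> M \<Longrightarrow> B q' \<noteq> 0 \<and> g (\<mu> q') * B q' = A q'"
      using fibre_regular_lift[OF chart L \<mu> W(3) q(1,2) W(1)] by blast
    let ?N = "N \<inter> U \<inter> D \<inter> {p \<in> points C. \<nu> p \<in> M}"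
    have op: "openin (zariski C) ?N"
      using W(4) U(1) D(1) \<nu>_continuous[OF AB(3)] by (intro openin_Int)
    have "p0 \<in> ?N"
      using p0 W(5) AB(4) q(3) by simp
    moreover have "B (u p) \<noteq> 0 \<and> f p * B (u p) = A (u p)" if p: "p \<in> ?N" for p
    proof -
      have "p \<in> D" "\<nu> p \<in> M" "p \<in> N" using p by auto
      hence "u p \<in> X" "\<mu> (u p) \<in> M" "f p = g (\<mu> (u p))"
        using u_X \<mu>u W(6) AB(5) by auto
      thus ?thesis using AB(6) by simp
    qed
    ultimately show "\<exists>A\<in>R. \<exists>B\<in>R. \<exists>N. openin (zariski C) N \<and> N \<noteq> {} \<and> N \<subseteq> U \<inter> D \<and>
        (\<forall>p\<in>N. B (u p) \<noteq> 0 \<and> f p * B (u p) = A (u p))"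
      using op AB(1,2) by (intro bexI[of _ A] bexI[of _ B] exI[of _ ?N]) auto
  next
    fix q assume q: "q \<in> X"
    obtain W where W: "openin (zariski F) W" "\<mu> q \<in> W" "is_affine (subspace_on F W)"
      "is_affine (subspace_on C {p \<in> points C. \<nu> p \<in> W})"
      "\<forall>f\<in>regular C {p \<in> points C. \<nu> p \<in> W}. \<exists>n c. n > 0 \<and> (\<forall>i<n. c i \<in> regular F W) \<and>
           (\<forall>p\<in>{p \<in> points C. \<nu> p \<in> W}. f p ^ n + (\<Sum>i<n. c i (\<nu> p) * f p ^ i) = 0)"
      using affine_nbhd[OF \<mu>F[OF q]] by (elim exE conjE)
    let ?U = "{p \<in> points C. \<nu> p \<in> W}"
    have WF: "W \<subseteq> points F" using openin_subset[OF W(1)] by (simp add: points_def)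
    have U: "openin (zariski C) ?U" using \<nu>_continuous[OF W(1)] .
    have Une: "?U \<noteq> {}" using preimage_meets(1)[OF W(1)] W(2) DC by auto
    \<comment> \<open>The integral equation has coefficients regular near \<mu>(q) on the fibre
      product; lifted to the model they become fractions whose denominators do not vanish at
      \<open>q\<close>.\<close>
    have integral: "\<exists>n A B N. n > 0 \<and> (\<forall>i<n. A i \<in> R \<and> B i \<in> R \<and> B i q \<noteq> 0) \<and>
         openin (zariski C) N \<and> N \<noteq> {} \<and> N \<subseteq> ?U \<inter> D \<and>
         (\<forall>p\<in>N. (\<forall>i<n. B i (u p) \<noteq> 0) \<and> f p ^ n + (\<Sum>i<n. A i (u p) / B i (u p) * f p ^ i) = 0)"
      if f: "f \<in> regular C ?U" for f
    proof -
      obtain n c where n: "n > (0::nat)" "\<forall>i<n. c i \<in> regular F W"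
           "\<forall>p\<in>?U. f p ^ n + (\<Sum>i<n. c i (\<nu> p) * f p ^ i) = 0"
        using bspec[OF W(5) f] by (elim exE conjE)
      have "\<exists>A B M. A \<in> R \<and> B \<in> R \<and> openin (zariski F) M \<and> \<mu> q \<in> M \<and> M \<subseteq> W \<and>
        (\<forall>q'. q' \<in> X \<longrightarrow> \<mu> q' \<in> M \<longrightarrow> B q' \<noteq> 0 \<and> c i (\<mu> q') * B q' = A q')" if i: "i < n" for i
        using fibre_regular_lift[OF chart L \<mu> n(2)[rule_format, OF i] q W(2,1)] by metis
      then obtain A B M where AB: "\<And>i. i < n \<Longrightarrow> A i \<in> R \<and> B i \<in> R \<and> openin (zariski F) (M i) \<and> \<mu> q \<in> M i \<and> M i \<subseteq> W \<and>
        (\<forall>q'. q' \<in> X \<longrightarrow> \<mu> q' \<in> M i \<longrightarrow> B i q' \<noteq> 0 \<and> c i (\<mu> q') * B i q' = A i q')"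
        by metis
      let ?M = "\<Inter>i\<in>{..<n}. M i"
      have M: "openin (zariski F) ?M" "\<mu> q \<in> ?M"
        using AB n(1) by (auto intro!: openin_INT2)
      let ?N = "{p \<in> D. \<nu> p \<in> ?M}"
      have "?M \<noteq> {}" using M(2) by blast
      note N = preimage_meets[OF M(1) this]
      have MW: "?M \<subseteq> W" using AB n(1) by blast
      have "(\<forall>i<n. B i (u p) \<noteq> 0) \<and> f p ^ n + (\<Sum>i<n. A i (u p) / B i (u p) * f p ^ i) = 0" if p: "p \<in> ?N" for p
      proof -
        have up: "u p \<in> X" "\<mu> (u p) = \<nu> p" using p u_X \<mu>u by auto
        have B: "B i (u p) \<noteq> 0" "c i (\<nu> p) = A i (u p) / B i (u p)" if i: "i < n" for i
        proof -
          have "\<mu> (u p) \<in> M i" using p up i by auto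
          hence "B i (u p) \<noteq> 0 \<and> c i (\<mu> (u p)) * B i (u p) = A i (u p)"
            using AB[OF i] up(1) by blast
          thus "B i (u p) \<noteq> 0" "c i (\<nu> p) = A i (u p) / B i (u p)"
            using up(2) by (auto simp: nonzero_eq_divide_eq)
        qed
        have "p \<in> ?U" using p DC MW by auto
        hence "f p ^ n + (\<Sum>i<n. c i (\<nu> p) * f p ^ i) = 0" using n(3) by blast
        thus ?thesis using B by simp
      qed
      moreover have "?N \<subseteq> ?U \<inter> D" using DC MW by auto
      moreover have "B i q \<noteq> 0" if "i < n" for i using AB[OF that] q by blast
      ultimately show ?thesis
        using n(1) N AB by (intro exI[of _ n] exI[of _ A] exI[of _ B] exI[of _ ?N]) auto
    qed
    have centre: "p \<in> D" if p: "p \<in> ?U" and compat: "\<forall>f\<in>regular C ?U. \<forall>A\<in>R. \<forall>B\<in>R. \<forall>N. B q \<noteq> 0 \<and> openin (zariski C) N \<and> N \<noteq> {} \<and> N \<subseteq> D \<and>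
          (\<forall>p\<in>N. f p * B (u p) = A (u p)) \<longrightarrow> f p * B q = A q" for p
    proof -
      \<comment> \<open>A function on the affine set \<open>W\<close> that separates the two points
        pulls back to \<open>C\<close>. Its value at \<open>p\<close> is f(\<open>\<nu>\<close> p),
        whereas the compatibility with \<open>q\<close> forces the value f(\<mu> q).\<close>
      have "\<nu> p = \<mu> q"
      proof (rule ccontr)
        assume "\<nu> p \<noteq> \<mu> q"
        then obtain f where f: "f \<in> regular (subspace_on F W) W" "f (\<nu> p) \<noteq> f (\<mu> q)"
          using affine_open_separates[OF W(3) WF _ W(2), of "\<nu> p"] p by blast
        have "regular_at C p' (f \<circ> \<nu>)" if p': "p' \<in> ?U" for p'
        proof -
          have "\<nu> p' \<in> W" using p' by auto
          from regular_subspace_onE[OF f(1) this] obtain W' g where W': "openin (zariski F) W'" "\<nu> p' \<in> W'" "g \<in> regular F W'"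
              "\<And>z. z \<in> W' \<Longrightarrow> z \<in> W \<Longrightarrow> f z = g z"
            by blast
          have 1: "regular_at C p' (g \<circ> \<nu>)"
            using \<nu>_regular_at[OF W'(1,3) _ W'(2)] p' by blast
          show ?thesis
            by (rule regular_at_cong[OF 1 openin_Int[OF \<nu>_continuous[OF W'(1)] U]]) (use p' W' in auto)
        qed
        hence fr: "f \<circ> \<nu> \<in> regular C ?U"
          unfolding regular_iff_at[OF U] by blast
        obtain W' g where W': "openin (zariski F) W'" "\<mu> q \<in> W'" "g \<in> regular F W'"
              "\<And>z. z \<in> W' \<Longrightarrow> z \<in> W \<Longrightarrow> f z = g z"
          using regular_subspace_onE[OF f(1) W(2)] by blast
        obtain A B M where AB: "A \<in> R" "B \<in> R" "openin (zariski F) M" "\<mu> q \<in> M" "M \<subseteq> W'"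
          "\<And>q'. q' \<in> X \<Longrightarrow> \<mu> q' \<in> M \<Longrightarrow> B q' \<noteq> 0 \<and> g (\<mu> q') * B q' = A q'"
          using fibre_regular_lift[OF chart L \<mu> W'(3) q W'(2,1)] by blast
        let ?M = "M \<inter> W"
        have M: "openin (zariski F) ?M" "?M \<noteq> {}" using AB W by auto
        note N = preimage_meets[OF M]
        have "(f \<circ> \<nu>) p' * B (u p') = A (u p')" if p': "p' \<in> {p \<in> D. \<nu> p \<in> ?M}" for p'
        proof -
          have "u p' \<in> X" "\<mu> (u p') = \<nu> p'" using p' u_X \<mu>u by auto
          moreover have "f (\<nu> p') = g (\<nu> p')" using p' AB(5) W'(4)[of "\<nu> p'"] by auto
          ultimately show ?thesis using AB(6)[of "u p'"] p' by simp
        qed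
        hence "(f \<circ> \<nu>) p * B q = A q"
          using compat[rule_format, OF fr AB(1,2), of "{p \<in> D. \<nu> p \<in> ?M}"] N AB(6)[OF q AB(4)] by auto
        moreover have "f (\<mu> q) * B q = A q" "B q \<noteq> 0"
          using AB(6)[OF q AB(4)] W'(4)[OF W'(2) W(2)] by auto
        ultimately show False using f(2) by (metis comp_apply mult_right_cancel)
      qed
      thus ?thesis using D_iff[OF q] p by blast
    qed
    show "\<exists>U. openin (zariski C) U \<and> U \<noteq> {} \<and> is_affine (subspace_on C U) \<and>
      (\<forall>f\<in>regular C U. \<exists>n A B N. n > 0 \<and> (\<forall>i<n. A i \<in> R \<and> B i \<in> R \<and> B i q \<noteq> 0) \<and>
         openin (zariski C) N \<and> N \<noteq> {} \<and> N \<subseteq> U \<inter> D \<and>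
         (\<forall>p\<in>N. (\<forall>i<n. B i (u p) \<noteq> 0) \<and> f p ^ n + (\<Sum>i<n. A i (u p) / B i (u p) * f p ^ i) = 0)) \<and>
      (\<forall>p\<in>U. (\<forall>f\<in>regular C U. \<forall>A\<in>R. \<forall>B\<in>R. \<forall>N. B q \<noteq> 0 \<and> openin (zariski C) N \<and> N \<noteq> {} \<and> N \<subseteq> D \<and>
          (\<forall>p\<in>N. f p * B (u p) = A (u p)) \<longrightarrow> f p * B q = A q) \<longrightarrow> p \<in> D)"
    proof (intro exI[of _ ?U] conjI ballI impI)
      fix f assume "f \<in> regular C ?U"
      from integral[OF this] show "\<exists>n A B N. n > 0 \<and> (\<forall>i<n. A i \<in> R \<and> B i \<in> R \<and> B i q \<noteq> 0) \<and>
         openin (zariski C) N \<and> N \<noteq> {} \<and> N \<subseteq> ?U \<inter> D \<and>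
         (\<forall>p\<in>N. (\<forall>i<n. B i (u p) \<noteq> 0) \<and> f p ^ n + (\<Sum>i<n. A i (u p) / B i (u p) * f p ^ i) = 0)" .
    qed (fact U, fact Une, fact W(4), erule centre, assumption)
  next
    fix p p' assume p: "p \<in> D" "p' \<in> D" "u p = u p'"
    \<comment> \<open>Both points lie over the same point of the fibre product, and the preimage of
      an affine neighbourhood of it is affine.\<close>
    obtain W where W: "openin (zariski F) W" "\<nu> p \<in> W" "is_affine (subspace_on C {p \<in> points C. \<nu> p \<in> W})"
      using affine_nbhd[OF \<nu>_points[OF subsetD[OF DC p(1)]]] by (elim exE conjE)
    moreover have "\<nu> p' = \<nu> p" using p \<mu>u by simp
    ultimately show "\<exists>U. openin (zariski C) U \<and> is_affine (subspace_on C U) \<and> p \<in> U \<and> p' \<in> U"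
      using \<nu>_continuous[OF W(1)] p DC by (intro exI[of _ "{p \<in> points C. \<nu> p \<in> W}"]) auto
  qed (use D u_X u_regular in auto)
qed

end

section \<open>The three charts\<close>

definition quad :: "'k :: field \<Rightarrow> 'k \<Rightarrow> 'k poly"
  where "quad a b = [:a * b, - (a + b), 1:]"

text \<open>The reciprocal polynomial of \<open>quad a b\<close>; it describes the cubic in the
  coordinate 1 / x.\<close>

definition rquad :: "'k :: field \<Rightarrow> 'k \<Rightarrow> 'k poly"
  where "rquad a b = [:1, - (a + b), a * b:]"

lemma poly_quad: "poly (quad a b) x = (x - a) * (x - b)"
  by (simp add: quad_def algebra_simps)

lemma poly_rquad: "poly (rquad a b) x = (1 - a * x) * (1 - b * x)"
  by (simp add: rquad_def algebra_simps)

lemma quad_factor: "quad a b = [:- a, 1:] * [:- b, 1:]"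
  by (simp add: quad_def algebra_simps)

lemma rquad_factor: "a \<noteq> 0 \<Longrightarrow> rquad a b = [:- inverse a, 1:] * smult (- a) [:1, - b:]"
  by (simp add: rquad_def algebra_simps)

lemma simple_rootI: "p = [:- r, 1:] * p' \<Longrightarrow> poly p' r \<noteq> 0 \<Longrightarrow> simple_root r p"
  unfolding simple_root_def by blast

lemma simple_root_mult: "simple_root r p \<Longrightarrow> poly q r \<noteq> 0 \<Longrightarrow> simple_root r (p * q)"
  unfolding simple_root_def
  by (metis (no_types, lifting) mult.assoc no_zero_divisors poly_mult)

lemma simple_root_X: "simple_root 0 [:0, 1:]"
  by (rule simple_rootI[where p' = 1]) auto

lemma simple_root_quad: "a \<noteq> b \<Longrightarrow> simple_root a (quad a b)"
  by (rule simple_rootI[OF quad_factor]) simp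

lemma quad_commute: "quad a b = quad b a" and rquad_commute: "rquad a b = rquad b a"
  by (simp_all add: quad_def rquad_def algebra_simps)

lemma simple_root_rquad: "a \<noteq> 0 \<Longrightarrow> a \<noteq> b \<Longrightarrow> simple_root (inverse a) (rquad a b)"
  by (rule simple_rootI[OF rquad_factor]) (auto simp: field_simps)

locale four_points =
  fixes a b c d :: "'k :: alg_closed_field"
  assumes two: "(2 :: 'k) \<noteq> 0"
    and nonzero: "a \<noteq> 0" "b \<noteq> 0" "c \<noteq> 0" "d \<noteq> 0"
    and distinct: "a \<noteq> b" "a \<noteq> c" "a \<noteq> d" "b \<noteq> c" "b \<noteq> d" "c \<noteq> d"
begin

lemma quad_roots: "poly (quad a b) r = 0 \<longleftrightarrow> r = a \<or> r = b" "poly (quad c d) r = 0 \<longleftrightarrow> r = c \<or> r = d"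
  by (auto simp: poly_quad)

lemma rquad_roots: "poly (rquad a b) r = 0 \<longleftrightarrow> r = inverse a \<or> r = inverse b"
    "poly (rquad c d) r = 0 \<longleftrightarrow> r = inverse c \<or> r = inverse d"
  using nonzero by (auto simp: poly_rquad inverse_eq_divide nonzero_eq_divide_eq mult.commute[of r])

lemma simple_roots: "simple_root a (quad a b)" "simple_root b (quad a b)" "simple_root c (quad c d)" "simple_root d (quad c d)"
    "simple_root (inverse a) (rquad a b)" "simple_root (inverse b) (rquad a b)"
    "simple_root (inverse c) (rquad c d)" "simple_root (inverse d) (rquad c d)"
  using simple_root_quad[of a b] simple_root_quad[of b a] simple_root_quad[of c d] simple_root_quad[of d c]
    simple_root_rquad[of a b] simple_root_rquad[of b a] simple_root_rquad[of c d] simple_root_rquad[of d c]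
    nonzero distinct quad_commute[of b a] quad_commute[of d c] rquad_commute[of b a] rquad_commute[of d c]
  by simp_all

text \<open>Coordinates x, y1 / x, y2 / x: the cubic equations divided by x^2.\<close>

lemma chart_I: "chart [:0, 1:] (quad a b) (quad c d)"
proof
  show "\<exists>r. simple_root r ([:0, 1:] * quad a b)" "\<exists>r. simple_root r ([:0, 1:] * quad c d)"
    using nonzero by (intro exI[of _ 0] simple_root_mult simple_root_X; simp add: poly_quad)+
  show "\<exists>r. simple_root r (quad a b * quad c d)"
    using distinct by (intro exI[of _ a] simple_root_mult simple_roots) (simp add: poly_quad)
  show "simple_root r (quad a b) \<and> poly (quad c d) r \<noteq> 0" if "poly (quad a b) r = 0" for r
    using that distinct simple_roots unfolding quad_roots by auto
  show "simple_root r (quad c d)" if "poly (quad c d) r = 0" for r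
    using that simple_roots unfolding quad_roots by auto
qed (rule two)

text \<open>Coordinates x, x / y1, y2 / y1, used where x is finite and differs from a and b. The
  first cubic gives (x - a) (x - b) (x / y1)^2 = x, and x cancels in the quotient of the two cubic
  equations.\<close>

lemma chart_II: "chart (quad a b) [:0, 1:] (quad c d)"
proof
  show "\<exists>r. simple_root r (quad a b * [:0, 1:])"
    using nonzero by (intro exI[of _ a] simple_root_mult simple_roots) simp
  show "\<exists>r. simple_root r ([:0, 1:] * quad c d)"
    using nonzero by (intro exI[of _ 0] simple_root_mult simple_root_X; simp add: poly_quad)
  show "\<exists>r. simple_root r (quad a b * quad c d)"
    using distinct by (intro exI[of _ a] simple_root_mult simple_roots) (simp add: poly_quad)
  show "simple_root r [:0, 1:] \<and> poly (quad c d) r \<noteq> 0" if "poly [:0, 1:] r = 0" for r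
    using that nonzero simple_root_X by (auto simp: poly_quad)
  show "simple_root r (quad c d)" if "poly (quad c d) r = 0" for r
    using that simple_roots unfolding quad_roots by auto
qed (rule two)

text \<open>Coordinates 1 / x, x / y1, y2 / y1, used around infinity: the second chart with each
  quadratic replaced by its reciprocal polynomial.\<close>

lemma chart_III: "chart (rquad a b) [:0, 1:] (rquad c d)"
proof
  have "inverse a \<noteq> inverse c" "inverse a \<noteq> inverse d"
    using distinct nonzero by auto
  thus "\<exists>r. simple_root r (rquad a b * rquad c d)"
    by (intro exI[of _ "inverse a"] simple_root_mult simple_roots) (simp add: rquad_roots)
  show "\<exists>r. simple_root r (rquad a b * [:0, 1:])"
    using nonzero by (intro exI[of _ "inverse a"] simple_root_mult simple_roots) simp
  show "\<exists>r. simple_root r ([:0, 1:] * rquad c d)"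
    using nonzero by (intro exI[of _ 0] simple_root_mult simple_root_X; simp add: poly_rquad)
  show "simple_root r [:0, 1:] \<and> poly (rquad c d) r \<noteq> 0" if "poly [:0, 1:] r = 0" for r
    using that nonzero simple_root_X by (auto simp: poly_rquad)
  show "simple_root r (rquad c d)" if "poly (rquad c d) r = 0" for r
    using that simple_roots unfolding rquad_roots by auto
qed (rule two)

lemma swapped: "four_points c d a b"
  using two nonzero distinct by unfold_locales auto

end

subsection \<open>Points of the elliptic curves and of the fibre product\<close>

lemma vec_of_3: "vec_of [a, b, c] = (\<lambda>i. if i = 0 then a else if i = 1 then b else if i = 2 then c else 0)"
proof
  fix i :: nat
  consider "i = 0" | "i = 1" | "i = 2" | "i \<ge> 3" by linarith
  thus "vec_of [a, b, c] i = (if i = 0 then a else if i = 1 then b else if i = 2 then c else 0)"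
    by cases (auto simp: vec_of_def)
qed

lemma vec_of_2: "vec_of [a, b] = (\<lambda>i. if i = 0 then a else if i = 1 then b else 0)"
proof
  fix i :: nat
  consider "i = 0" | "i = 1" | "i \<ge> 2" by linarith
  thus "vec_of [a, b] i = (if i = 0 then a else if i = 1 then b else 0)"
    by cases (auto simp: vec_of_def)
qed

lemma (in chart) R_vec_of_3:
  assumes "f \<in> R" "g \<in> R" "h \<in> R"
  shows "(\<lambda>q. vec_of [f q, g q, h q] i) \<in> R"
proof -
  consider "i = 0" | "i = 1" | "i = 2" | "i > 2" by linarith
  thus ?thesis
    by cases (use assms R_const in \<open>simp_all add: vec_of_3\<close>)
qed

abbreviation infinite_point :: "(nat \<Rightarrow> 'k :: field) set"
  where "infinite_point \<equiv> proj_point (vec_of [0, 0, 1])"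

definition cubic_closure :: "'k :: field \<Rightarrow> 'k \<Rightarrow> (nat \<Rightarrow> 'k) set set"
  where "cubic_closure a b = zariski (projective_space 2) closure_of
    {proj_point (vec_of [1, x, y]) | x y. y ^ 2 - x * (x - a) * (x - b) = 0}"

lemma elliptic_cubic_eq: "elliptic_cubic a b = subspace_on (projective_space 2) (cubic_closure a b)"
  by (simp add: elliptic_cubic_def projective_plane_curve_def cubic_closure_def)

lemma cubic_closure_points: "cubic_closure a b \<subseteq> points (projective_space 2)"
  by (simp add: cubic_closure_def points_def closure_of_subset_topspace)

lemma affine_point_in_P2: "proj_point (vec_of [1, x, y]) \<in> points (projective_space 2)"
  by (rule proj_point_in_points[of _ 0]) (auto simp: vec_of_3)

lemma affine_point_in_cubic: "y ^ 2 = x * (x - a) * (x - b) \<Longrightarrow> proj_point (vec_of [1, x, y]) \<in> cubic_closure a b"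
proof -
  assume "y ^ 2 = x * (x - a) * (x - b)"
  hence "proj_point (vec_of [1, x, y]) \<in> {proj_point (vec_of [1, x, y]) | x y. y ^ 2 - x * (x - a) * (x - b) = 0}"
    by auto
  moreover have "{proj_point (vec_of [1, x, y]) | x y. y ^ 2 - x * (x - a) * (x - b) = 0} \<subseteq> topspace (zariski (projective_space 2))"
    using affine_point_in_P2 unfolding points_def by auto
  ultimately show ?thesis
    unfolding cubic_closure_def using closure_of_subset by blast
qed

text \<open>The homogenized equation \<open>h\<close> persists in the closure, and on v0 = 0 it
  reduces to v1^3 = 0.\<close>

lemma cubic_closure_cases:
  assumes "e \<in> cubic_closure a b"
  shows "(\<exists>x y. e = proj_point (vec_of [1, x, y]) \<and> y ^ 2 = x * (x - a) * (x - b)) \<or> e = infinite_point"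
proof -
  let ?A = "{proj_point (vec_of [1, x, y]) | x y. y ^ 2 - x * (x - a) * (x - b) = 0}"
  obtain v where v: "e = proj_point v" "\<exists>i. v i \<noteq> 0" "\<forall>i>2. v i = 0"
    using assms cubic_closure_points unfolding points_projective_space by blast
  define h where "h = (\<lambda>v :: nat \<Rightarrow> 'a. v 0 * v 2 ^ 2 - v 1 * ((v 1 - a * v 0) * (v 1 - b * v 0)))"
  have sq: "homogeneous 2 (\<lambda>v :: nat \<Rightarrow> 'a. v 2 ^ 2)"
    using homogeneous_power[OF homogeneous.coord[of 2], of 2] by simp
  have hom: "homogeneous 3 h"
    unfolding h_def
    by (intro homogeneous_diff homogeneous_mult'[OF homogeneous.coord sq]
       homogeneous_mult'[OF homogeneous.coord homogeneous_mult'[of 1 _ 1 _ 2]] homogeneous_smult homogeneous.coord) auto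
  have "h v = 0"
  proof (rule ccontr)
    assume "h v \<noteq> 0"
    hence "e \<in> {p \<in> points (projective_space 2). \<forall>v\<in>p. h v \<noteq> 0}"
      using homogeneous_nonzero_iff[OF hom] assms cubic_closure_points unfolding v(1) by blast
    moreover have "e \<in> zariski (projective_space 2) closure_of ?A"
      using assms unfolding cubic_closure_def .
    ultimately obtain e' where e': "e' \<in> ?A" "e' \<in> {p \<in> points (projective_space 2). \<forall>v\<in>p. h v \<noteq> 0}"
      using open_projective_basic[OF hom, of 2] unfolding in_closure_of by meson
    then obtain x y where xy: "e' = proj_point (vec_of [1, x, y])" "y ^ 2 - x * (x - a) * (x - b) = 0"
      by blast
    hence "h (vec_of [1, x, y]) = 0"
      by (simp add: h_def vec_of_3 mult.assoc)
    thus False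
      using e'(2) xy(1) proj_point_self by blast
  qed
  hence eq: "v 0 * v 2 ^ 2 = v 1 * ((v 1 - a * v 0) * (v 1 - b * v 0))"
    by (simp add: h_def)
  show ?thesis
  proof (cases "v 0 = 0")
    case True
    hence v1: "v 1 = 0" using eq by simp
    have v2: "v 2 \<noteq> 0"
    proof
      assume "v 2 = 0"
      moreover obtain i where "v i \<noteq> 0" using v(2) by blast
      moreover consider "i = 0" | "i = 1" | "i = 2" | "i > 2" by linarith
      ultimately show False
        by cases (use True v1 v(3) in auto)
    qed
    have "v i = v 2 * vec_of [0, 0, 1] i" for i
    proof -
      consider "i = 0" | "i = 1" | "i = 2" | "i > 2" by linarith
      thus ?thesis by cases (use True v1 v(3) in \<open>simp_all add: vec_of_3\<close>)
    qed
    from proj_point_eqI[of "v 2" v "vec_of [0, 0, 1]", OF v2 this] show ?thesis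
      using v(1) by blast
  next
    case False
    have "v i = v 0 * vec_of [1, v 1 / v 0, v 2 / v 0] i" for i
    proof -
      consider "i = 0" | "i = 1" | "i = 2" | "i > 2" by linarith
      thus ?thesis by cases (use False v(3) in \<open>simp_all add: vec_of_3\<close>)
    qed
    from proj_point_eqI[of "v 0" v "vec_of [1, v 1 / v 0, v 2 / v 0]", OF False this] have "e = proj_point (vec_of [1, v 1 / v 0, v 2 / v 0])"
      using v(1) by blast
    moreover have "(v 2 / v 0) ^ 2 = (v 1 / v 0) * (v 1 / v 0 - a) * (v 1 / v 0 - b)"
    proof -
      have "v 1 / v 0 - a = (v 1 - a * v 0) / v 0" "v 1 / v 0 - b = (v 1 - b * v 0) / v 0"
        using False by (simp_all add: diff_divide_distrib)
      hence "(v 1 / v 0) * (v 1 / v 0 - a) * (v 1 / v 0 - b) = (v 0 * v 2 ^ 2) / (v 0 * v 0 * v 0)"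
        unfolding eq by simp
      also have "\<dots> = (v 2 / v 0) ^ 2"
        using False by (simp add: power2_eq_square)
      finally show ?thesis by simp
    qed
    ultimately show ?thesis by blast
  qed
qed

text \<open>The third chart parametrizes the cubic near infinity by [x y : y : 1], which is the
  point at infinity for x = 0. A neighbourhood of this point misses only finitely many points of the
  infinite curve, so it contains one with x \<noteq> 0, which is an affine point of the
  cubic.\<close>

lemma (in four_points) infinite_point_in_cubic: "infinite_point \<in> cubic_closure a b"
proof -
  interpret chart "rquad a b" "[:0, 1:]" "rquad c d" by (rule chart_III)
  let ?A = "{proj_point (vec_of [1, x, y]) | x y. y ^ 2 - x * (x - a) * (x - b) = 0}"
  define L :: "'k \<times> 'k \<times> 'k \<Rightarrow> nat \<Rightarrow> 'k" where "L = (\<lambda>q. vec_of [fst q * fst (snd q), fst (snd q), 1])"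
  have LR: "(\<lambda>q. L q i) \<in> R" for i
    unfolding L_def by (intro R_vec_of_3 R_mult R_x R_y R_const)
  have top: "infinite_point \<in> topspace (zariski (projective_space 2 :: ((nat \<Rightarrow> 'k) set, 'k) kspace))"
    unfolding points_def[symmetric] by (rule proj_point_in_points[of _ 2]) (auto simp: vec_of_3)
  have "\<exists>e. e \<in> ?A \<and> e \<in> U" if U: "openin (zariski (projective_space 2)) U" "infinite_point \<in> U" for U
  proof -
    obtain n h where h: "homogeneous n h" "\<And>v. v \<in> infinite_point \<Longrightarrow> h v \<noteq> 0"
        "{q \<in> points (projective_space 2). \<forall>v\<in>q. h v \<noteq> 0} \<subseteq> U"
      using projective_basis[OF U] by blast
    obtain z where q0: "(0, 0, z) \<in> X"
      using X_over[of 0] by (auto simp: X_def poly_rquad)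
    have "h (L (0, 0, z)) \<noteq> 0"
      unfolding L_def using h(2)[OF proj_point_self] by simp
    hence fin: "finite ({q \<in> X. h (L q) = 0} \<union> {q \<in> X. fst q = 0})"
      using finite_zeros[OF R_homogeneous[OF h(1), of L, OF LR]] q0 finite_fibre by blast
    have "\<not> X \<subseteq> {q \<in> X. h (L q) = 0} \<union> {q \<in> X. fst q = 0}"
      using fin infinite_X finite_subset by blast
    then obtain x y z where q: "(x, y, z) \<in> X" "h (L (x, y, z)) \<noteq> 0" "x \<noteq> 0"
      by force
    have y: "poly (rquad a b) x * y ^ 2 = x"
      using X_D(2)[OF q(1)] by simp
    hence y0: "y \<noteq> 0" using q(3) by auto
    have "L (x, y, z) i = (x * y) * vec_of [1, 1 / x, 1 / (x * y)] i" for i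
      using q(3) y0 by (simp add: L_def vec_of_3)
    from proj_point_eqI[of "x * y" "L (x, y, z)" "vec_of [1, 1 / x, 1 / (x * y)]", OF _ this] have e: "proj_point (L (x, y, z)) = proj_point (vec_of [1, 1 / x, 1 / (x * y)])"
      using q(3) y0 by simp
    have "(1 / (x * y)) ^ 2 = 1 / x * (1 / x - a) * (1 / x - b)"
    proof -
      have "x ^ 3 * y ^ 2 * (1 / x * (1 / x - a) * (1 / x - b)) = (x * (1 / x - a)) * (x * (1 / x - b)) * y ^ 2"
        using q(3) by (simp add: power3_eq_cube)
      also have "\<dots> = x"
        using y q(3) by (simp add: poly_rquad right_diff_distrib mult.commute)
      also have "\<dots> = x ^ 3 * y ^ 2 * (1 / (x * y)) ^ 2"
        using q(3) y0 by (simp add: power2_eq_square power3_eq_cube)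
      finally have "x ^ 3 * y ^ 2 * (1 / (x * y)) ^ 2 = x ^ 3 * y ^ 2 * (1 / x * (1 / x - a) * (1 / x - b))"
        by simp
      moreover have "x ^ 3 * y ^ 2 \<noteq> 0" using q(3) y0 by simp
      ultimately show ?thesis by (metis mult_left_cancel)
    qed
    hence "proj_point (L (x, y, z)) \<in> ?A"
      unfolding e by (intro CollectI exI[of _ "1 / x"] exI[of _ "1 / (x * y)"] conjI refl) simp
    moreover have "proj_point (L (x, y, z)) \<in> U"
    proof -
      have "\<forall>v\<in>proj_point (L (x, y, z)). h v \<noteq> 0"
        using homogeneous_nonzero_iff[OF h(1)] q(2) by blast
      moreover have "proj_point (L (x, y, z)) \<in> points (projective_space 2)"
        unfolding e by (rule affine_point_in_P2)
      ultimately show ?thesis using h(3) by blast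
    qed
    ultimately show ?thesis by blast
  qed
  thus ?thesis
    unfolding cubic_closure_def in_closure_of using top by blast
qed

lemma x_cover_affine: "x_cover (proj_point (vec_of [1, x, y])) = proj_point (vec_of [1, x])"
proof -
  have "\<exists>v\<in>proj_point (vec_of [1, x, y]). v 0 \<noteq> 0"
    by (rule bexI[OF _ proj_point_self]) (simp add: vec_of_3)
  moreover have "{vec_of [v 0, v 1] | v. v \<in> proj_point (vec_of [1, x, y])} = proj_point (vec_of [1, x])"
  proof -
    have "vec_of [k, k * x] = (\<lambda>i. k * vec_of [1, x] i)" for k
      by (auto simp: vec_of_2)
    hence "vec_of [v 0, v 1] \<in> proj_point (vec_of [1, x])" if "v \<in> proj_point (vec_of [1, x, y])" for v
      using that unfolding proj_point_def by (auto simp: vec_of_3)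
    moreover have "\<exists>v. (\<lambda>i. k * vec_of [1, x] i) = vec_of [v 0, v 1] \<and> v \<in> proj_point (vec_of [1, x, y])" if "k \<noteq> 0" for k
      using that by (intro exI[of _ "\<lambda>i. k * vec_of [1, x, y] i"]) (auto simp: proj_point_def vec_of_2 vec_of_3)
    ultimately show ?thesis
      unfolding proj_point_def[of "vec_of [1, x]"] by blast
  qed
  ultimately show ?thesis
    by (simp add: x_cover_def)
qed

lemma x_cover_infinite_point: "x_cover infinite_point = proj_point (vec_of [0, 1])"
  by (auto simp: x_cover_def proj_point_def vec_of_3)

lemma proj_line_eq: "proj_point (vec_of [1, x]) = proj_point (vec_of [1, x']) \<longleftrightarrow> x = x'"
proof
  assume "proj_point (vec_of [1, x]) = proj_point (vec_of [1, x'])"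
  then obtain c where "c \<noteq> 0" "\<And>i. vec_of [1, x] i = c * vec_of [1, x'] i"
    by (rule proj_point_eqD) auto
  from this(2)[of 0] this(2)[of 1] show "x = x'"
    by (simp add: vec_of_2)
qed simp

lemma proj_line_infinite: "proj_point (vec_of [1, x]) \<noteq> proj_point (vec_of [0, 1])"
proof
  assume "proj_point (vec_of [1, x]) = proj_point (vec_of [0, 1 :: 'a])"
  then obtain c where "c \<noteq> 0" "\<And>i. vec_of [1, x] i = c * vec_of [0, 1] i"
    by (rule proj_point_eqD) auto
  from this(2)[of 0] show False by (simp add: vec_of_2)
qed

text \<open>An arbitrary representative is chosen; for \<open>G\<close> and \<open>H\<close>
  homogeneous of the same degree the quotient does not depend on the choice.\<close>

definition coord_quot :: "((nat \<Rightarrow> 'k :: field) \<Rightarrow> 'k) \<Rightarrow> ((nat \<Rightarrow> 'k) \<Rightarrow> 'k) \<Rightarrow> (nat \<Rightarrow> 'k) set \<Rightarrow> 'k"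
  where "coord_quot G H e = (let v = SOME v. v \<in> e in G v / H v)"

lemma coord_quot_proj_point:
  assumes "homogeneous d G" "homogeneous d H"
  shows "coord_quot G H (proj_point w) = G w / H w"
proof -
  have "(SOME v. v \<in> proj_point w) \<in> proj_point w"
    by (rule someI[where P = "\<lambda>v. v \<in> proj_point w", OF proj_point_self])
  then obtain c where "c \<noteq> 0" "(SOME v. v \<in> proj_point w) = (\<lambda>i. c * w i)"
    unfolding proj_point_def by auto
  thus ?thesis
    by (simp add: coord_quot_def homogeneous_scale[OF assms(1)] homogeneous_scale[OF assms(2)])
qed

lemma coord_quot_eq:
  assumes "homogeneous d G" "homogeneous d H" "e \<in> points (projective_space n)" "v \<in> e"
  shows "coord_quot G H e = G v / H v"
proof -
  obtain w where w: "e = proj_point w"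
    using assms(3) unfolding points_projective_space by blast
  then obtain c where "c \<noteq> 0" "v = (\<lambda>i. c * w i)"
    using assms(4) unfolding proj_point_def by auto
  hence "e = proj_point v"
    using proj_point_eq w by metis
  thus ?thesis
    using coord_quot_proj_point[OF assms(1,2)] by simp
qed

text \<open>The set \<open>D\<close> is dense, so local extensions agree on overlaps; taking at each
  point the value of the extension chosen there gives a function regular on
  \<open>S\<close>.\<close>

lemma (in irreducible_space) regular_extension:
  assumes D: "openin (zariski X) D" "D \<noteq> {}" "D \<subseteq> S"
    and ext: "\<And>p. p \<in> S \<Longrightarrow> \<exists>r N. regular_at X p r \<and> openin (zariski X) N \<and> p \<in> N \<and> (\<forall>q\<in>N \<inter> D. r q = f q)"
    and S: "openin (zariski X) S"
  obtains T where "\<And>p. p \<in> D \<Longrightarrow> T p = f p" "\<And>p. p \<in> S \<Longrightarrow> regular_at X p T"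
proof -
  obtain r N where rN: "\<And>p. p \<in> S \<Longrightarrow> regular_at X p (r p) \<and> openin (zariski X) (N p) \<and> p \<in> N p \<and> (\<forall>q\<in>N p \<inter> D. r p q = f q)"
    using ext by metis
  define T where "T p = r p p" for p
  have "T p = f p" if "p \<in> D" for p
    using rN[of p] that D(3) by (auto simp: T_def)
  moreover have "regular_at X p T" if p: "p \<in> S" for p
  proof -
    obtain U where U: "openin (zariski X) U" "p \<in> U" "r p \<in> regular X U"
      using rN[OF p] unfolding regular_at_def by blast
    have eq: "T q = r p q" if q: "q \<in> U \<inter> N p \<inter> S" for q
      unfolding T_def
    proof (rule identity_at[where f = "r q" and g = "r p" and N = "N q \<inter> N p \<inter> D"])
      have op: "openin (zariski X) (N q)" "openin (zariski X) (N p)"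
        using rN[of q] rN[OF p] q by blast+
      thus "openin (zariski X) (N q \<inter> N p \<inter> D)" using D(1) by auto
      have "q \<in> N q \<inter> N p"
        using rN[of q] q by blast
      hence "N q \<inter> N p \<noteq> {}" by blast
      thus "N q \<inter> N p \<inter> D \<noteq> {}"
        using opens_meet[OF openin_Int[OF op] D(1) _ D(2)] by blast
      show "regular_at X q (r q)" using rN[of q] q by blast
      show "regular_at X q (r p)" using regular_imp_at[OF U(3,1)] q by auto
      fix x assume "x \<in> N q \<inter> N p \<inter> D"
      thus "r q x = r p x" using rN[of q] rN[OF p] q by auto
    qed
    show ?thesis
    proof (rule regular_at_cong[OF _ _ _ eq])
      show "regular_at X p (r p)" "openin (zariski X) (U \<inter> N p \<inter> S)" "p \<in> U \<inter> N p \<inter> S"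
        using rN[OF p] U S p by auto
    qed
  qed
  ultimately show ?thesis using that by blast
qed

section \<open>The curve \<open>C\<close>: coordinates and open cover\<close>

locale biquadratic_cover = four_points \<alpha>2 \<alpha>3 \<beta>2 \<beta>3
  for \<alpha>2 \<alpha>3 \<beta>2 \<beta>3 :: "'k :: alg_closed_field" +
  fixes C :: "('c, 'k) kspace" and \<nu> :: "'c \<Rightarrow> (nat \<Rightarrow> 'k) set \<times> (nat \<Rightarrow> 'k) set"
  assumes norm: "is_normalization C \<nu>
    (fibre_product (elliptic_cubic \<alpha>2 \<alpha>3) x_cover (elliptic_cubic \<beta>2 \<beta>3) x_cover)"

sublocale biquadratic_cover \<subseteq> plane_cover C \<nu> "cubic_closure \<alpha>2 \<alpha>3" "cubic_closure \<beta>2 \<beta>3" x_cover x_cover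
proof -
  note n = norm[unfolded is_normalization_def elliptic_cubic_eq]
  have "variety C" "irreducible_subset (zariski C) (points C)" "space_with_functions C"
    using n unfolding normal_variety_def irreducible_variety_def variety_def by auto
  thus "plane_cover C \<nu> (cubic_closure \<alpha>2 \<alpha>3) (cubic_closure \<beta>2 \<beta>3) x_cover x_cover"
    unfolding plane_cover_def plane_cover_axioms_def irreducible_space_def irreducible_space_axioms_def kfun_space_def
    using n cubic_closure_points by blast
qed

context biquadratic_cover
begin

abbreviation "pt x y \<equiv> proj_point (vec_of [1, x, y]) :: (nat \<Rightarrow> 'k) set"

lemma normal_nbhd:
  assumes "p \<in> points C"
  obtains U where "openin (zariski C) U" "p \<in> U" "is_affine (subspace_on C U)" "integrally_closed_on U (regular C U)"
proof -
  have "\<forall>p\<in>points C. \<exists>U. openin (zariski C) U \<and> p \<in> U \<and> is_affine (subspace_on C U) \<and> integrally_closed_on U (regular C U)"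
    using norm unfolding is_normalization_def normal_variety_def by blast
  from bspec[OF this assms] show ?thesis
    using that by (elim exE conjE)
qed

lemma points_F_iff:
  "z \<in> points F \<longleftrightarrow> (\<exists>x y1 y2. z = (pt x y1, pt x y2) \<and> y1 ^ 2 = x * (x - \<alpha>2) * (x - \<alpha>3) \<and> y2 ^ 2 = x * (x - \<beta>2) * (x - \<beta>3))
     \<or> z = (infinite_point, infinite_point)" (is "?l \<longleftrightarrow> ?r")
proof
  assume ?l
  then obtain e1 e2 where e: "z = (e1, e2)" "e1 \<in> cubic_closure \<alpha>2 \<alpha>3" "e2 \<in> cubic_closure \<beta>2 \<beta>3" "x_cover e1 = x_cover e2"
    unfolding points_F by auto
  show ?r
    using cubic_closure_cases[OF e(2)] cubic_closure_cases[OF e(3)] e(1,4)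
    by (auto simp: x_cover_affine x_cover_infinite_point proj_line_eq proj_line_infinite proj_line_infinite[symmetric])
next
  interpret S: four_points \<beta>2 \<beta>3 \<alpha>2 \<alpha>3 by (rule swapped)
  assume ?r
  thus ?l
    unfolding points_F
    using affine_point_in_cubic infinite_point_in_cubic S.infinite_point_in_cubic by (auto simp: x_cover_affine)
qed

definition affp :: "'c \<Rightarrow> 'k \<Rightarrow> 'k \<Rightarrow> 'k \<Rightarrow> bool"
  where "affp p x y1 y2 \<longleftrightarrow> p \<in> points C \<and> \<nu> p = (pt x y1, pt x y2) \<and>
    y1 ^ 2 = x * poly (quad \<alpha>2 \<alpha>3) x \<and> y2 ^ 2 = x * poly (quad \<beta>2 \<beta>3) x"

definition infp :: "'c \<Rightarrow> bool"
  where "infp p \<longleftrightarrow> p \<in> points C \<and> \<nu> p = (infinite_point, infinite_point)"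

lemma point_cases:
  assumes "p \<in> points C"
  obtains x y1 y2 where "affp p x y1 y2" | "infp p"
  using \<nu>_points[OF assms] that assms unfolding points_F_iff affp_def infp_def poly_quad
  by (metis mult.assoc)

definition "cx p = coord_quot (\<lambda>v. v 1) (\<lambda>v. v 0) (fst (\<nu> p))"
definition "cy1 p = coord_quot (\<lambda>v. v 2) (\<lambda>v. v 0) (fst (\<nu> p))"
definition "cy2 p = coord_quot (\<lambda>v. v 2) (\<lambda>v. v 0) (snd (\<nu> p))"
definition "cw1 p = coord_quot (\<lambda>v. v 1) (\<lambda>v. v 2) (fst (\<nu> p))"
definition "cw2 p = coord_quot (\<lambda>v. v 1) (\<lambda>v. v 2) (snd (\<nu> p))"

text \<open>
  On the cubic, \<open>v0 / v1\<close> equals \<open>v1\<^sup>2 / (v2\<^sup>2 + (a + b) v1\<^sup>2 - a b v0 v1)\<close>; unlike the former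
  expression, the latter is defined at infinity.
\<close>

definition inv_den :: "(nat \<Rightarrow> 'k) \<Rightarrow> 'k"
  where "inv_den = (\<lambda>v. v 2 ^ 2 + (\<alpha>2 + \<alpha>3) * v 1 ^ 2 - \<alpha>2 * \<alpha>3 * (v 0 * v 1))"

definition "cxi p = coord_quot (\<lambda>v. v 1 ^ 2) inv_den (fst (\<nu> p))"

lemma hom1: "homogeneous 1 (\<lambda>v :: nat \<Rightarrow> 'k. v i)"
  by (rule homogeneous.coord)

lemma hom2: "homogeneous 2 (\<lambda>v :: nat \<Rightarrow> 'k. v i ^ 2)" "homogeneous 2 (\<lambda>v :: nat \<Rightarrow> 'k. v i * v j)"
  using homogeneous_power[OF hom1, of 2] homogeneous.mult[OF hom1 hom1] by (simp_all add: numeral_2_eq_2)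

lemma hom_inv_den: "homogeneous 2 inv_den"
  unfolding inv_den_def by (intro homogeneous_diff homogeneous.add homogeneous_smult hom2)

lemma affp_coords:
  assumes "affp p x y1 y2"
  shows "cx p = x" "cy1 p = y1" "cy2 p = y2" "cw1 p = x / y1" "cw2 p = x / y2" "cxi p = 1 / x"
proof -
  have \<nu>p: "\<nu> p = (pt x y1, pt x y2)" and y1: "y1 ^ 2 = x * poly (quad \<alpha>2 \<alpha>3) x"
    using assms unfolding affp_def by auto
  show "cx p = x" "cy1 p = y1" "cy2 p = y2" "cw1 p = x / y1" "cw2 p = x / y2"
    by (simp_all only: cx_def cy1_def cy2_def cw1_def cw2_def \<nu>p fst_conv snd_conv coord_quot_proj_point[OF hom1 hom1])
       (simp_all add: vec_of_3)
  have "cxi p = x ^ 2 / (y1 ^ 2 + (\<alpha>2 + \<alpha>3) * x ^ 2 - \<alpha>2 * \<alpha>3 * x)"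
    by (simp only: cxi_def \<nu>p fst_conv coord_quot_proj_point[OF hom2(1) hom_inv_den]) (simp add: vec_of_3 inv_den_def)
  also have "y1 ^ 2 + (\<alpha>2 + \<alpha>3) * x ^ 2 - \<alpha>2 * \<alpha>3 * x = x ^ 2 * x"
    unfolding y1 poly_quad by algebra
  finally show "cxi p = 1 / x"
    by simp
qed

lemma infp_coords:
  assumes "infp p"
  shows "cw1 p = 0" "cw2 p = 0" "cxi p = 0"
proof -
  have \<nu>p: "\<nu> p = (infinite_point, infinite_point)"
    using assms unfolding infp_def by auto
  show "cw1 p = 0" "cw2 p = 0"
    by (simp_all only: cw1_def cw2_def \<nu>p fst_conv snd_conv coord_quot_proj_point[OF hom1 hom1])
       (simp_all add: vec_of_3)
  show "cxi p = 0"
    by (simp only: cxi_def \<nu>p fst_conv coord_quot_proj_point[OF hom2(1) hom_inv_den]) (simp add: vec_of_3 inv_den_def)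
qed

lemma open_fst_nonzero:
  assumes "homogeneous d H"
  shows "openin (zariski C) {p \<in> points C. \<forall>v\<in>fst (\<nu> p). H v \<noteq> 0}"
    "openin (zariski F) {z \<in> points F. \<forall>v\<in>fst z. H v \<noteq> 0}"
proof -
  let ?P2 = "projective_space 2 :: ((nat \<Rightarrow> 'k) set, 'k) kspace"
  let ?U = "{e \<in> points ?P2. \<forall>v\<in>e. H v \<noteq> 0}"
  have "openin (zariski ?P2) (points ?P2)" by (simp add: points_def)
  from open_F_projective_box[OF open_projective_basic[OF assms] this]
  have "openin (zariski F) {z \<in> points F. fst z \<in> ?U \<and> snd z \<in> points ?P2}" .
  moreover have "{z \<in> points F. fst z \<in> ?U \<and> snd z \<in> points ?P2} = {z \<in> points F. \<forall>v\<in>fst z. H v \<noteq> 0}"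
    using S12 unfolding points_F by auto
  ultimately show F: "openin (zariski F) {z \<in> points F. \<forall>v\<in>fst z. H v \<noteq> 0}" by simp
  have "{p \<in> points C. \<nu> p \<in> {z \<in> points F. \<forall>v\<in>fst z. H v \<noteq> 0}} = {p \<in> points C. \<forall>v\<in>fst (\<nu> p). H v \<noteq> 0}"
    using \<nu>_points by auto
  thus "openin (zariski C) {p \<in> points C. \<forall>v\<in>fst (\<nu> p). H v \<noteq> 0}"
    using \<nu>_continuous[OF F] by simp
qed

text \<open>In terms of x: the loci x \<noteq> 0, \<infinity>, then x \<noteq> \<infinity>,
  \<alpha>2, \<alpha>3, then x \<noteq> 0, \<alpha>2, \<alpha>3 with infinity included, and finally
  \<open>Dy\<close>, the intersection of the three.\<close>

definition "D1 = {p \<in> points C. \<forall>v\<in>fst (\<nu> p). v 0 * v 1 \<noteq> 0}"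
definition "D2 = {p \<in> points C. \<forall>v\<in>fst (\<nu> p). v 0 * ((v 1 - \<alpha>2 * v 0) * (v 1 - \<alpha>3 * v 0)) \<noteq> 0}"
definition "D3 = {p \<in> points C. \<forall>v\<in>fst (\<nu> p). v 2 \<noteq> 0}"
definition "Dy = {p \<in> points C. \<forall>v\<in>fst (\<nu> p). v 0 * v 2 \<noteq> 0}"

lemma hom_D2: "homogeneous 3 (\<lambda>v :: nat \<Rightarrow> 'k. v 0 * ((v 1 - \<alpha>2 * v 0) * (v 1 - \<alpha>3 * v 0)))"
  by (intro homogeneous_mult'[OF hom1 homogeneous_mult'[of 1 _ 1 _ 2]] homogeneous_diff homogeneous_smult hom1) auto

lemma open_D: "openin (zariski C) D1" "openin (zariski C) D2" "openin (zariski C) D3" "openin (zariski C) Dy"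
  unfolding D1_def D2_def D3_def Dy_def
  by (rule open_fst_nonzero[OF hom2(2)] open_fst_nonzero[OF hom_D2] open_fst_nonzero[OF hom1])+

lemma affp_D:
  assumes "affp p x y1 y2"
  shows "p \<in> D1 \<longleftrightarrow> x \<noteq> 0" "p \<in> D2 \<longleftrightarrow> poly (quad \<alpha>2 \<alpha>3) x \<noteq> 0" "p \<in> D3 \<longleftrightarrow> y1 \<noteq> 0" "p \<in> Dy \<longleftrightarrow> y1 \<noteq> 0"
proof -
  have p: "p \<in> points C" "fst (\<nu> p) = pt x y1"
    using assms unfolding affp_def by auto
  show "p \<in> D1 \<longleftrightarrow> x \<noteq> 0" "p \<in> D2 \<longleftrightarrow> poly (quad \<alpha>2 \<alpha>3) x \<noteq> 0" "p \<in> D3 \<longleftrightarrow> y1 \<noteq> 0" "p \<in> Dy \<longleftrightarrow> y1 \<noteq> 0"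
    unfolding D1_def D2_def D3_def Dy_def mem_Collect_eq p(2)
      homogeneous_nonzero_iff[OF hom2(2)] homogeneous_nonzero_iff[OF hom_D2] homogeneous_nonzero_iff[OF hom1]
    using p(1) by (simp_all add: vec_of_3 poly_quad)
qed

lemma infp_D:
  assumes "infp p"
  shows "p \<notin> D1" "p \<notin> D2" "p \<in> D3" "p \<notin> Dy"
proof -
  have p: "p \<in> points C" "fst (\<nu> p) = infinite_point"
    using assms unfolding infp_def by auto
  show "p \<notin> D1" "p \<notin> D2" "p \<in> D3" "p \<notin> Dy"
    unfolding D1_def D2_def D3_def Dy_def mem_Collect_eq p(2)
      homogeneous_nonzero_iff[OF hom2(2)] homogeneous_nonzero_iff[OF hom_D2] homogeneous_nonzero_iff[OF hom1]
    using p(1) by (simp_all add: vec_of_3)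
qed

lemma D_points: "D1 \<subseteq> points C" "D2 \<subseteq> points C" "D3 \<subseteq> points C" "Dy \<subseteq> points C"
  by (auto simp: D1_def D2_def D3_def Dy_def)

lemma D1_E: "p \<in> D1 \<Longrightarrow> (\<And>x y1 y2. affp p x y1 y2 \<Longrightarrow> x \<noteq> 0 \<Longrightarrow> thesis) \<Longrightarrow> thesis"
  and D2_E: "p \<in> D2 \<Longrightarrow> (\<And>x y1 y2. affp p x y1 y2 \<Longrightarrow> poly (quad \<alpha>2 \<alpha>3) x \<noteq> 0 \<Longrightarrow> thesis) \<Longrightarrow> thesis"
  and Dy_E: "p \<in> Dy \<Longrightarrow> (\<And>x y1 y2. affp p x y1 y2 \<Longrightarrow> y1 \<noteq> 0 \<Longrightarrow> thesis) \<Longrightarrow> thesis"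
  and D3_E: "p \<in> D3 \<Longrightarrow> (\<And>x y1 y2. affp p x y1 y2 \<Longrightarrow> y1 \<noteq> 0 \<Longrightarrow> thesis) \<Longrightarrow> (infp p \<Longrightarrow> thesis) \<Longrightarrow> thesis"
  using point_cases[of p] affp_D infp_D D_points by (meson subsetD)+

lemma Dy_sub: "Dy \<subseteq> D1" "Dy \<subseteq> D2" "Dy \<subseteq> D3"
  using affp_D affp_def by (auto elim!: Dy_E)

lemma D_cover: "p \<in> points C \<Longrightarrow> p \<in> D1 \<or> p \<in> D2 \<or> p \<in> D3"
  using affp_D infp_D nonzero by (auto elim!: point_cases simp: poly_quad)

text \<open>Surjectivity of \<open>\<nu>\<close> is not at hand, only that it reaches every nonempty
  open set of the fibre product. So an explicit point of the fibre product is used to show that the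
  locus where \<open>H\<close> is nonzero is such a set.\<close>

lemma finite_point_exists:
  assumes "homogeneous d H" "H (vec_of [1, x, y1]) \<noteq> 0" "y1 ^ 2 = x * (x - \<alpha>2) * (x - \<alpha>3)"
  obtains p where "p \<in> points C" "\<forall>v\<in>fst (\<nu> p). H v \<noteq> 0"
proof -
  obtain y2 where "y2 ^ 2 = x * (x - \<beta>2) * (x - \<beta>3)"
    using nth_root_exists[of 2] by (metis pos2)
  hence "(pt x y1, pt x y2) \<in> points F"
    using assms(3) unfolding points_F_iff by blast
  moreover have "\<forall>v\<in>pt x y1. H v \<noteq> 0"
    using homogeneous_nonzero_iff[OF assms(1)] assms(2) by blast
  ultimately have "{z \<in> points F. \<forall>v\<in>fst z. H v \<noteq> 0} \<noteq> {}"
    by force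
  from preimage_nonempty[OF open_fst_nonzero(2)[OF assms(1)] this] show ?thesis
    using that by blast
qed

lemma exists_avoiding: "finite A \<Longrightarrow> \<exists>x :: 'k. x \<notin> A"
  using infinite_alg_closed ex_new_if_finite by blast

lemma sqrt_exists: "\<exists>y :: 'k. y ^ 2 = c"
  using nth_root_exists[of 2] by (metis pos2)

lemma Dy_nonempty: "Dy \<noteq> {}"
proof -
  obtain x where x: "x \<notin> {0, \<alpha>2, \<alpha>3}"
    using exists_avoiding[of "{0, \<alpha>2, \<alpha>3}"] by blast
  obtain y where y: "y ^ 2 = x * (x - \<alpha>2) * (x - \<alpha>3)"
    using sqrt_exists by blast
  hence "y \<noteq> 0" using x by auto
  hence "vec_of [1, x, y] 0 * vec_of [1, x, y] 2 \<noteq> 0"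
    by (simp add: vec_of_3)
  from finite_point_exists[OF hom2(2) this y] show ?thesis
    unfolding Dy_def by blast
qed

lemma two_points: "\<exists>p\<in>points C. \<exists>p'\<in>points C. p \<noteq> p'"
proof -
  obtain p where p: "p \<in> Dy" using Dy_nonempty by blast
  then obtain x0 y1 y2 where p0: "affp p x0 y1 y2" by (rule Dy_E)
  obtain x where x: "x \<noteq> x0"
    using exists_avoiding[of "{x0}"] by blast
  obtain y where y: "y ^ 2 = x * (x - \<alpha>2) * (x - \<alpha>3)"
    using sqrt_exists by blast
  have hom: "homogeneous 1 (\<lambda>v :: nat \<Rightarrow> 'k. v 1 - x0 * v 0)"
    by (intro homogeneous_diff homogeneous_smult hom1)
  have "vec_of [1, x, y] 1 - x0 * vec_of [1, x, y] 0 \<noteq> 0"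
    using x by (simp add: vec_of_3)
  from finite_point_exists[OF hom this y] obtain p' where p': "p' \<in> points C" "\<forall>v\<in>fst (\<nu> p'). v 1 - x0 * v 0 \<noteq> 0" .
  have "p \<noteq> p'"
  proof
    assume "p = p'"
    hence "vec_of [1, x0, y1] \<in> fst (\<nu> p')"
      using p0 proj_point_self unfolding affp_def by auto
    from bspec[OF p'(2) this] show False by (simp add: vec_of_3)
  qed
  thus ?thesis using p p'(1) D_points by blast
qed

lemma coord_quot_regular:
  assumes "homogeneous d G" "homogeneous d H" "p \<in> points C"
  shows "\<forall>v\<in>fst (\<nu> p). H v \<noteq> 0 \<Longrightarrow> regular_at C p (\<lambda>p. coord_quot G H (fst (\<nu> p)))"
    and "\<forall>v\<in>snd (\<nu> p). H v \<noteq> 0 \<Longrightarrow> regular_at C p (\<lambda>p. coord_quot G H (snd (\<nu> p)))"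
  using homogeneous_ratio_regular[of d G H "coord_quot G H" p] coord_quot_eq[OF assms(1,2)] assms by blast+

lemma affp_regular:
  assumes "affp p x y1 y2"
  shows "regular_at C p cx" "regular_at C p cy1" "regular_at C p cy2"
proof -
  have p: "p \<in> points C" "fst (\<nu> p) = pt x y1" "snd (\<nu> p) = pt x y2"
    using assms unfolding affp_def by auto
  have v0: "\<forall>v\<in>fst (\<nu> p). v 0 \<noteq> 0" "\<forall>v\<in>snd (\<nu> p). v 0 \<noteq> 0"
    unfolding p(2,3) homogeneous_nonzero_iff[OF hom1] by (simp_all add: vec_of_3)
  show "regular_at C p cx" "regular_at C p cy1" "regular_at C p cy2"
    unfolding cx_def[abs_def] cy1_def[abs_def] cy2_def[abs_def]
    by (rule coord_quot_regular[OF hom1 hom1 p(1)], fact v0)+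
qed

lemma D3_regular:
  assumes "p \<in> D3"
  shows "regular_at C p cw1" "regular_at C p cxi"
proof -
  have p: "p \<in> points C" "\<forall>v\<in>fst (\<nu> p). v 2 \<noteq> 0"
    using assms by (auto simp: D3_def)
  show "regular_at C p cw1"
    unfolding cw1_def[abs_def]
    by (rule coord_quot_regular(1)[OF hom1 hom1 p(1)]) (fact p(2))
  have "\<forall>v\<in>fst (\<nu> p). inv_den v \<noteq> 0"
    using assms
  proof (rule D3_E)
    fix x y1 y2 assume a: "affp p x y1 y2" and "y1 \<noteq> 0"
    hence y1: "y1 ^ 2 = x * poly (quad \<alpha>2 \<alpha>3) x" and \<nu>p: "fst (\<nu> p) = pt x y1" and "x \<noteq> 0"
      unfolding affp_def by auto
    have "inv_den (vec_of [1, x, y1]) = y1 ^ 2 + (\<alpha>2 + \<alpha>3) * x ^ 2 - \<alpha>2 * \<alpha>3 * x"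
      by (simp add: inv_den_def vec_of_3)
    also have "\<dots> = x ^ 2 * x"
      unfolding y1 poly_quad by algebra
    finally show ?thesis
      unfolding \<nu>p homogeneous_nonzero_iff[OF hom_inv_den] using \<open>x \<noteq> 0\<close> by simp
  next
    assume "infp p"
    hence "fst (\<nu> p) = infinite_point" by (simp add: infp_def)
    thus ?thesis
      by (simp only: homogeneous_nonzero_iff[OF hom_inv_den]) (simp add: inv_den_def vec_of_3)
  qed
  thus "regular_at C p cxi"
    unfolding cxi_def[abs_def]
    by (rule coord_quot_regular(1)[OF hom2(1) hom_inv_den p(1)])
qed

lemma infp_regular: "infp p \<Longrightarrow> regular_at C p cw2"
proof -
  assume "infp p"
  hence p: "p \<in> points C" "snd (\<nu> p) = infinite_point"
    unfolding infp_def by auto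
  have "\<forall>v\<in>snd (\<nu> p). v 2 \<noteq> 0"
    unfolding p(2) homogeneous_nonzero_iff[OF hom1] by (simp add: vec_of_3)
  thus "regular_at C p cw2"
    unfolding cw2_def[abs_def]
    by (rule coord_quot_regular(2)[OF hom1 hom1 p(1)])
qed

section \<open>Extension of y2 / y1 by normality\<close>

lemma poly_rquad_inverse: "x \<noteq> 0 \<Longrightarrow> poly (rquad a b) (1 / x) * x ^ 2 = poly (quad a b) x"
  by (simp add: poly_rquad poly_quad power2_eq_square left_diff_distrib right_diff_distrib mult.commute)

text \<open>
  The squares of \<open>y2 / y1\<close> at \<open>x = 0\<close> and of \<open>w1 / w2\<close> at infinity are units of the fibre product, so
  normality extends \<open>y2 / y1\<close> to these points.
\<close>

lemma T_extension:
  assumes "p \<in> D2 \<union> D3"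
  shows "\<exists>r N. regular_at C p r \<and> openin (zariski C) N \<and> p \<in> N \<and> (\<forall>q\<in>N \<inter> Dy. r q = cy2 q / cy1 q)"
proof (cases "p \<in> Dy")
  case True
  then obtain x y1 y2 where p: "affp p x y1 y2" "y1 \<noteq> 0" by (rule Dy_E)
  have "regular_at C p (\<lambda>q. cy2 q / cy1 q)"
    using affp_regular[OF p(1)] affp_coords[OF p(1)] p(2) by (intro at_divide) auto
  thus ?thesis using True open_D by blast
next
  case False
  have pC: "p \<in> points C" using assms D_points by blast
  obtain U where U: "openin (zariski C) U" "p \<in> U" "is_affine (subspace_on C U)" "integrally_closed_on U (regular C U)"
    using normal_nbhd[OF pC] .
  show ?thesis
  proof (cases "p \<in> D2")
    case True
    then obtain x y1 y2 where p: "affp p x y1 y2" "poly (quad \<alpha>2 \<alpha>3) x \<noteq> 0" by (rule D2_E)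
    let ?c = "\<lambda>q. poly (quad \<beta>2 \<beta>3) (cx q) / poly (quad \<alpha>2 \<alpha>3) (cx q)"
    have reg: "regular_at C p cy2" "regular_at C p cy1" "regular_at C p ?c"
      using affp_regular[OF p(1)] affp_coords[OF p(1)] p(2) by (auto intro!: at_divide at_poly)
    have sq: "cy2 q ^ 2 = ?c q * cy1 q ^ 2" if "q \<in> D2" for q
      using that by (rule D2_E) (simp add: affp_coords, simp add: affp_def)
    have ny: "cy1 q \<noteq> 0" if "q \<in> Dy" for q
      using that by (rule Dy_E) (simp add: affp_coords)
    obtain r N where r: "regular_at C p r" "openin (zariski C) N" "p \<in> N" "\<And>q. q \<in> N \<Longrightarrow> cy2 q = r q * cy1 q"
      using normal_square_root[OF U(1,3,4,2) reg open_D(2) True sq open_D(4) Dy_nonempty ny] by blast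
    have "r q = cy2 q / cy1 q" if "q \<in> N \<inter> Dy" for q
      using r(4)[of q] ny[of q] that by simp
    thus ?thesis using r(1-3) by blast
  next
    case F2: False
    hence D3: "p \<in> D3" using assms by blast
    hence inf: "infp p"
    proof (rule D3_E)
      fix x y1 y2 assume "affp p x y1 y2" "y1 \<noteq> 0"
      thus ?thesis using False affp_D by blast
    qed
    have reg0: "regular_at C p (\<lambda>q. poly (rquad \<beta>2 \<beta>3) (cxi q))" "regular_at C p (\<lambda>q. poly (rquad \<alpha>2 \<alpha>3) (cxi q))"
      by (intro at_poly D3_regular(2) D3)+
    have val: "poly (rquad \<beta>2 \<beta>3) (cxi p) \<noteq> 0" "poly (rquad \<alpha>2 \<alpha>3) (cxi p) \<noteq> 0"
      by (simp_all add: infp_coords[OF inf] poly_rquad)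
    \<comment> \<open>This removes the points over \<beta>2 and \<beta>3, where y2 = 0 and
      \<open>cw2\<close>, being x / y2, would take the default value 0 of division.\<close>
    obtain N0 where N0: "openin (zariski C) N0" "p \<in> N0" "\<And>q. q \<in> N0 \<Longrightarrow> poly (rquad \<beta>2 \<beta>3) (cxi q) \<noteq> 0"
      using at_nonzero_nbhd[OF reg0(1) val(1)] by blast
    let ?N = "N0 \<inter> D3" and ?M = "N0 \<inter> D3 \<inter> Dy"
    let ?c = "\<lambda>q. poly (rquad \<beta>2 \<beta>3) (cxi q) / poly (rquad \<alpha>2 \<alpha>3) (cxi q)"
    have reg: "regular_at C p cw1" "regular_at C p cw2" "regular_at C p ?c"
      using D3_regular(1)[OF D3] infp_regular[OF inf] reg0 val by (auto intro!: at_divide)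
    have y2: "x \<noteq> 0 \<and> y2 \<noteq> 0" if "affp q x y1 y2" "y1 \<noteq> 0" "q \<in> N0" for q x y1 y2
    proof -
      have a: "y1 ^ 2 = x * poly (quad \<alpha>2 \<alpha>3) x" "y2 ^ 2 = x * poly (quad \<beta>2 \<beta>3) x"
        using that(1) by (auto simp: affp_def)
      have x: "x \<noteq> 0" using a(1) that(2) by auto
      have "poly (quad \<beta>2 \<beta>3) x \<noteq> 0"
        using N0(3)[OF that(3)] poly_rquad_inverse[OF x, of \<beta>2 \<beta>3] x by (auto simp: affp_coords[OF that(1)])
      thus ?thesis using x a(2) by auto
    qed
    have sq: "cw1 q ^ 2 = ?c q * cw2 q ^ 2" if q: "q \<in> ?N" for q
    proof -
      have "q \<in> D3" "q \<in> N0" using q by auto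
      show ?thesis
        using \<open>q \<in> D3\<close>
      proof (rule D3_E)
        fix x y1 y2 assume a: "affp q x y1 y2" "y1 \<noteq> 0"
        hence a': "y1 ^ 2 = x * poly (quad \<alpha>2 \<alpha>3) x" "y2 ^ 2 = x * poly (quad \<beta>2 \<beta>3) x"
          by (auto simp: affp_def)
        have xy: "x \<noteq> 0" "y2 \<noteq> 0" using y2[OF a \<open>q \<in> N0\<close>] by auto
        have r: "poly (rquad \<alpha>2 \<alpha>3) (1 / x) = y1 ^ 2 / x ^ 3" "poly (rquad \<beta>2 \<beta>3) (1 / x) = y2 ^ 2 / x ^ 3"
          using poly_rquad_inverse[OF xy(1), of \<alpha>2 \<alpha>3] poly_rquad_inverse[OF xy(1), of \<beta>2 \<beta>3] xy(1) a'
          by (simp_all add: nonzero_eq_divide_eq power2_eq_square power3_eq_cube mult.assoc mult.left_commute)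
        show ?thesis
          unfolding affp_coords[OF a(1)] r using xy a(2) by (simp add: power_divide)
      next
        assume "infp q"
        thus ?thesis by (simp add: infp_coords)
      qed
    qed
    have ny: "cw2 q \<noteq> 0" if q: "q \<in> ?M" for q
    proof -
      have "q \<in> Dy" "q \<in> N0" using q by auto
      show ?thesis
        using \<open>q \<in> Dy\<close> by (rule Dy_E) (use y2 \<open>q \<in> N0\<close> affp_coords in fastforce)
    qed
    have M: "openin (zariski C) ?M" "?M \<noteq> {}" "openin (zariski C) ?N" "p \<in> ?N"
      using N0 D3 open_D opens_meet[OF openin_Int[OF N0(1) open_D(3)] open_D(4) _ Dy_nonempty] by auto
    obtain r N where r: "regular_at C p r" "openin (zariski C) N" "p \<in> N" "\<And>q. q \<in> N \<Longrightarrow> cw1 q = r q * cw2 q"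
      using normal_square_root[OF U(1,3,4,2) reg M(3,4) sq M(1,2) ny] by blast
    have "r q = cy2 q / cy1 q" if q: "q \<in> N \<inter> ?N \<inter> Dy" for q
    proof -
      have "q \<in> Dy" "q \<in> N0" "q \<in> N" using q by auto
      obtain x y1 y2 where a: "affp q x y1 y2" "y1 \<noteq> 0"
        using \<open>q \<in> Dy\<close> by (rule Dy_E)
      have "x / y1 = r q * (x / y2)"
        using r(4)[OF \<open>q \<in> N\<close>] affp_coords[OF a(1)] by simp
      moreover have "x \<noteq> 0" "y2 \<noteq> 0" using y2[OF a \<open>q \<in> N0\<close>] by auto
      ultimately show ?thesis
        unfolding affp_coords[OF a(1)] using a(2) by (simp add: field_simps)
    qed
    thus ?thesis
      using r(1-3) M(3,4) by (intro exI[of _ r] exI[of _ "N \<inter> ?N"]) auto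
  qed
qed

definition "T = (SOME T. (\<forall>p\<in>Dy. T p = cy2 p / cy1 p) \<and> (\<forall>p\<in>D2 \<union> D3. regular_at C p T))"

lemma T: "p \<in> Dy \<Longrightarrow> T p = cy2 p / cy1 p" "p \<in> D2 \<union> D3 \<Longrightarrow> regular_at C p T"
proof -
  obtain T0 where "\<And>p. p \<in> Dy \<Longrightarrow> T0 p = cy2 p / cy1 p" "\<And>p. p \<in> D2 \<union> D3 \<Longrightarrow> regular_at C p T0"
    using regular_extension[OF open_D(4) Dy_nonempty _ T_extension openin_Un[OF open_D(2,3)]] Dy_sub by blast
  hence "\<exists>T. (\<forall>p\<in>Dy. T p = cy2 p / cy1 p) \<and> (\<forall>p\<in>D2 \<union> D3. regular_at C p T)"
    by blast
  from someI_ex[OF this]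
  show "p \<in> Dy \<Longrightarrow> T p = cy2 p / cy1 p" "p \<in> D2 \<union> D3 \<Longrightarrow> regular_at C p T"
    unfolding T_def[symmetric] by auto
qed

text \<open>On \<open>Dy\<close> this is the quotient of the two cubic equations, and both sides are
  regular on \<open>D2\<close>.\<close>

lemma T_square2: "p \<in> D2 \<Longrightarrow> poly (quad \<alpha>2 \<alpha>3) (cx p) * T p ^ 2 = poly (quad \<beta>2 \<beta>3) (cx p)"
proof -
  assume p: "p \<in> D2"
  then obtain x y1 y2 where a: "affp p x y1 y2" by (rule D2_E)
  show ?thesis
  proof (rule identity_at[where f = "\<lambda>p. poly (quad \<alpha>2 \<alpha>3) (cx p) * T p ^ 2" and g = "\<lambda>p. poly (quad \<beta>2 \<beta>3) (cx p)"])
    show "regular_at C p (\<lambda>p. poly (quad \<alpha>2 \<alpha>3) (cx p) * T p ^ 2)" "regular_at C p (\<lambda>p. poly (quad \<beta>2 \<beta>3) (cx p))"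
      using affp_regular[OF a] T(2) p by (auto intro!: at_mult at_poly at_power)
    show "openin (zariski C) Dy" "Dy \<noteq> {}" using open_D Dy_nonempty by auto
    fix q assume q: "q \<in> Dy"
    then obtain x y1 y2 where b: "affp q x y1 y2" "y1 \<noteq> 0" by (rule Dy_E)
    hence b': "y1 ^ 2 = x * poly (quad \<alpha>2 \<alpha>3) x" "y2 ^ 2 = x * poly (quad \<beta>2 \<beta>3) x"
      by (auto simp: affp_def)
    have "x \<noteq> 0" "poly (quad \<alpha>2 \<alpha>3) x \<noteq> 0" using b' b(2) by auto
    thus "poly (quad \<alpha>2 \<alpha>3) (cx q) * T q ^ 2 = poly (quad \<beta>2 \<beta>3) (cx q)"
      unfolding T(1)[OF q] affp_coords[OF b(1)] power_divide b' by simp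
  qed
qed

lemma T_square3: "p \<in> D3 \<Longrightarrow> poly (rquad \<alpha>2 \<alpha>3) (cxi p) * T p ^ 2 = poly (rquad \<beta>2 \<beta>3) (cxi p)"
proof -
  assume p: "p \<in> D3"
  show ?thesis
  proof (rule identity_at[where f = "\<lambda>p. poly (rquad \<alpha>2 \<alpha>3) (cxi p) * T p ^ 2" and g = "\<lambda>p. poly (rquad \<beta>2 \<beta>3) (cxi p)"])
    show "regular_at C p (\<lambda>p. poly (rquad \<alpha>2 \<alpha>3) (cxi p) * T p ^ 2)" "regular_at C p (\<lambda>p. poly (rquad \<beta>2 \<beta>3) (cxi p))"
      using D3_regular[OF p] T(2) p by (auto intro!: at_mult at_poly at_power)
    show "openin (zariski C) Dy" "Dy \<noteq> {}" using open_D Dy_nonempty by auto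
    fix q assume q: "q \<in> Dy"
    then obtain x y1 y2 where b: "affp q x y1 y2" "y1 \<noteq> 0" by (rule Dy_E)
    hence b': "y1 ^ 2 = x * poly (quad \<alpha>2 \<alpha>3) x" "y2 ^ 2 = x * poly (quad \<beta>2 \<beta>3) x"
      by (auto simp: affp_def)
    have x: "x \<noteq> 0" "poly (quad \<alpha>2 \<alpha>3) x \<noteq> 0" using b' b(2) by auto
    have "(poly (rquad \<alpha>2 \<alpha>3) (1 / x) * (y2 / y1) ^ 2) * x ^ 2 = poly (rquad \<beta>2 \<beta>3) (1 / x) * x ^ 2"
    proof -
      have "(poly (rquad \<alpha>2 \<alpha>3) (1 / x) * (y2 / y1) ^ 2) * x ^ 2 = poly (quad \<alpha>2 \<alpha>3) x * (y2 / y1) ^ 2"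
        by (simp add: poly_rquad_inverse[OF x(1), symmetric])
      also have "\<dots> = poly (quad \<beta>2 \<beta>3) x"
        unfolding power_divide b' using x by simp
      finally show ?thesis by (simp add: poly_rquad_inverse[OF x(1)])
    qed
    thus "poly (rquad \<alpha>2 \<alpha>3) (cxi q) * T q ^ 2 = poly (rquad \<beta>2 \<beta>3) (cxi q)"
      unfolding T(1)[OF q] affp_coords[OF b(1)] using x(1) by simp
  qed
qed

section \<open>Verification of the three charts\<close>

definition "u1 p = (cx p, cy1 p / cx p, cy2 p / cx p)"
text \<open>The second entry is x / y1 wherever y1 \<noteq> 0, written so that it stays defined at x
  = 0.\<close>

definition "u2 p = (cx p, cy1 p / poly (quad \<alpha>2 \<alpha>3) (cx p), T p)"
definition "u3 p = (cxi p, cw1 p, T p)"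

end

sublocale biquadratic_cover \<subseteq> I: charted_space C "[:0, 1:]" "quad \<alpha>2 \<alpha>3" "quad \<beta>2 \<beta>3" D1 u1
proof -
  interpret K: chart "[:0, 1:]" "quad \<alpha>2 \<alpha>3" "quad \<beta>2 \<beta>3" by (rule chart_I)
  \<comment> \<open>The model is sent to the fibre product by y1 = x y and y2 = x z.\<close>
  let ?L1 = "\<lambda>q :: 'k \<times> 'k \<times> 'k. vec_of [1, fst q, fst q * fst (snd q)]"
  let ?L2 = "\<lambda>q :: 'k \<times> 'k \<times> 'k. vec_of [1, fst q, fst q * snd (snd q)]"
  show "charted_space C [:0, 1:] (quad \<alpha>2 \<alpha>3) (quad \<beta>2 \<beta>3) D1 u1"
  proof (rule charted_spaceI[OF two_points chart_I, of ?L1 ?L2, OF _ _ refl open_D(1)])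
    show "(\<lambda>q. ?L1 q i) \<in> K.R" "(\<lambda>q. ?L2 q i) \<in> K.R" for i
      by (intro K.R_vec_of_3 K.R_const K.R_mult K.R_x K.R_y K.R_z)+
    show "D1 \<noteq> {}" using Dy_nonempty Dy_sub by auto
  next
    fix p assume "p \<in> D1"
    then obtain x y1 y2 where a: "affp p x y1 y2" "x \<noteq> 0" by (rule D1_E)
    note c = affp_coords[OF a(1)]
    have b: "y1 ^ 2 = x * poly (quad \<alpha>2 \<alpha>3) x" "y2 ^ 2 = x * poly (quad \<beta>2 \<beta>3) x" "\<nu> p = (pt x y1, pt x y2)"
      using a by (auto simp: affp_def)
    show "u1 p \<in> K.X"
      unfolding u1_def K.X_def c using a(2) b by (simp add: power_divide) (simp add: power2_eq_square)
    show "regular_at C p (\<lambda>p. fst (u1 p))" "regular_at C p (\<lambda>p. fst (snd (u1 p)))" "regular_at C p (\<lambda>p. snd (snd (u1 p)))"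
      unfolding u1_def fst_conv snd_conv using affp_regular[OF a(1)] a(2) c by (auto intro!: at_divide)
    show "\<nu> p = (proj_point (?L1 (u1 p)), proj_point (?L2 (u1 p)))"
      unfolding b(3) u1_def c using a(2) by simp
  next
    fix q assume q: "q \<in> K.X"
    obtain x y z where xyz: "q = (x, y, z)" by (cases q) auto
    have e: "x \<noteq> 0" "x * y ^ 2 = (x - \<alpha>2) * (x - \<alpha>3)" "x * z ^ 2 = (x - \<beta>2) * (x - \<beta>3)"
      using K.X_D[OF q[unfolded xyz]] by (simp_all add: poly_quad)
    have "(x * y) ^ 2 = x * (x - \<alpha>2) * (x - \<alpha>3)" "(x * z) ^ 2 = x * (x - \<beta>2) * (x - \<beta>3)"
      using e(2,3) by algebra+
    thus "(proj_point (?L1 q), proj_point (?L2 q)) \<in> points F"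
      unfolding points_F_iff xyz by (intro disjI1 exI[of _ x] exI[of _ "x * y"] exI[of _ "x * z"]) simp
    fix p assume p: "p \<in> points C" "\<nu> p = (proj_point (?L1 q), proj_point (?L2 q))"
    show "p \<in> D1"
      unfolding D1_def mem_Collect_eq p(2) fst_conv homogeneous_nonzero_iff[OF hom2(2)]
      using p(1) e(1) by (simp add: vec_of_3 xyz)
  qed
qed

sublocale biquadratic_cover \<subseteq> II: charted_space C "quad \<alpha>2 \<alpha>3" "[:0, 1:]" "quad \<beta>2 \<beta>3" D2 u2
proof -
  interpret K: chart "quad \<alpha>2 \<alpha>3" "[:0, 1:]" "quad \<beta>2 \<beta>3" by (rule chart_II)
  \<comment> \<open>Here y stands for y1 divided by the quadratic of the first cubic and z for y2 /
    y1, which is solved for y1 and y2.\<close>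
  let ?L1 = "\<lambda>q :: 'k \<times> 'k \<times> 'k. vec_of [1, fst q, fst (snd q) * poly (quad \<alpha>2 \<alpha>3) (fst q)]"
  let ?L2 = "\<lambda>q :: 'k \<times> 'k \<times> 'k. vec_of [1, fst q, fst (snd q) * snd (snd q) * poly (quad \<alpha>2 \<alpha>3) (fst q)]"
  show "charted_space C (quad \<alpha>2 \<alpha>3) [:0, 1:] (quad \<beta>2 \<beta>3) D2 u2"
  proof (rule charted_spaceI[OF two_points chart_II, of ?L1 ?L2, OF _ _ refl open_D(2)])
    show "(\<lambda>q. ?L1 q i) \<in> K.R" "(\<lambda>q. ?L2 q i) \<in> K.R" for i
      by (intro K.R_vec_of_3 K.R_const K.R_mult K.R_x K.R_y K.R_z K.R_poly)+
    show "D2 \<noteq> {}" using Dy_nonempty Dy_sub by auto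
  next
    fix p assume D: "p \<in> D2"
    then obtain x y1 y2 where a: "affp p x y1 y2" "poly (quad \<alpha>2 \<alpha>3) x \<noteq> 0" by (rule D2_E)
    note c = affp_coords[OF a(1)]
    have b: "y1 ^ 2 = x * poly (quad \<alpha>2 \<alpha>3) x" "y2 ^ 2 = x * poly (quad \<beta>2 \<beta>3) x" "\<nu> p = (pt x y1, pt x y2)"
      using a by (auto simp: affp_def)
    show "u2 p \<in> K.X"
      unfolding u2_def K.X_def using T_square2[OF D] a(2) b unfolding c
      by (simp add: power_divide) (simp add: power2_eq_square)
    show "regular_at C p (\<lambda>p. fst (u2 p))" "regular_at C p (\<lambda>p. fst (snd (u2 p)))" "regular_at C p (\<lambda>p. snd (snd (u2 p)))"
      unfolding u2_def fst_conv snd_conv using affp_regular[OF a(1)] a(2) c T(2) D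
      by (auto intro!: at_divide at_poly)
    \<comment> \<open>\<open>T\<close> is known to be the quotient only on \<open>Dy\<close>; at the
      other points of \<open>D2\<close> one has x = 0, and both ordinates vanish.\<close>
    have "y1 * T p = y2"
    proof (cases "y1 = 0")
      case True
      hence "x = 0" using b(1) a(2) by simp
      thus ?thesis using b(2) True by simp
    next
      case False
      hence "p \<in> Dy" using affp_D[OF a(1)] by simp
      thus ?thesis using T(1) c False by simp
    qed
    thus "\<nu> p = (proj_point (?L1 (u2 p)), proj_point (?L2 (u2 p)))"
      unfolding b(3) u2_def c using a(2) by simp
  next
    fix q assume q: "q \<in> K.X"
    obtain x y z where xyz: "q = (x, y, z)" by (cases q) auto
    let ?P = "poly (quad \<alpha>2 \<alpha>3) x"
    have e: "?P \<noteq> 0" "?P * y ^ 2 = x" "?P * z ^ 2 = (x - \<beta>2) * (x - \<beta>3)"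
      using K.X_D[OF q[unfolded xyz]] by (simp_all add: poly_quad)
    have "(y * ?P) ^ 2 = (?P * y ^ 2) * ?P" "(y * z * ?P) ^ 2 = (?P * y ^ 2) * (?P * z ^ 2)"
      by algebra+
    hence "(y * ?P) ^ 2 = x * (x - \<alpha>2) * (x - \<alpha>3)" "(y * z * ?P) ^ 2 = x * (x - \<beta>2) * (x - \<beta>3)"
      unfolding e(2,3) by (simp_all add: poly_quad)
    thus "(proj_point (?L1 q), proj_point (?L2 q)) \<in> points F"
      unfolding points_F_iff xyz by (intro disjI1 exI[of _ x] exI[of _ "y * ?P"] exI[of _ "y * z * ?P"]) simp
    fix p assume p: "p \<in> points C" "\<nu> p = (proj_point (?L1 q), proj_point (?L2 q))"
    show "p \<in> D2"
      unfolding D2_def mem_Collect_eq p(2) fst_conv homogeneous_nonzero_iff[OF hom_D2]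
      using p(1) e(1) by (simp add: vec_of_3 xyz poly_quad)
  qed
qed

sublocale biquadratic_cover \<subseteq> III: charted_space C "rquad \<alpha>2 \<alpha>3" "[:0, 1:]" "rquad \<beta>2 \<beta>3" D3 u3
proof -
  interpret K: chart "rquad \<alpha>2 \<alpha>3" "[:0, 1:]" "rquad \<beta>2 \<beta>3" by (rule chart_III)
  \<comment> \<open>The vectors (1, x, y1) and (1, x, y2), both divided by y1. The second one keeps
    the entry y2 / y1, which does not vanish at infinity.\<close>
  let ?L1 = "\<lambda>q :: 'k \<times> 'k \<times> 'k. vec_of [fst q * fst (snd q), fst (snd q), 1]"
  let ?L2 = "\<lambda>q :: 'k \<times> 'k \<times> 'k. vec_of [fst q * fst (snd q), fst (snd q), snd (snd q)]"
  have scale: "proj_point (vec_of [k * a, k * b, k * c]) = proj_point (vec_of [a, b, c])" if "k \<noteq> 0" for k a b c :: 'k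
    by (rule proj_point_eqI[OF that]) (simp add: vec_of_3)
  show "charted_space C (rquad \<alpha>2 \<alpha>3) [:0, 1:] (rquad \<beta>2 \<beta>3) D3 u3"
  proof (rule charted_spaceI[OF two_points chart_III, of ?L1 ?L2, OF _ _ refl open_D(3)])
    show "(\<lambda>q. ?L1 q i) \<in> K.R" "(\<lambda>q. ?L2 q i) \<in> K.R" for i
      by (intro K.R_vec_of_3 K.R_const K.R_mult K.R_x K.R_y K.R_z)+
    show "D3 \<noteq> {}" using Dy_nonempty Dy_sub by auto
  next
    fix p assume D: "p \<in> D3"
    have "u3 p \<in> K.X \<and> \<nu> p = (proj_point (?L1 (u3 p)), proj_point (?L2 (u3 p)))"
      using D
    proof (rule D3_E)
      fix x y1 y2 assume a: "affp p x y1 y2" "y1 \<noteq> 0"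
      note c = affp_coords[OF a(1)]
      have b: "y1 ^ 2 = x * poly (quad \<alpha>2 \<alpha>3) x" "y2 ^ 2 = x * poly (quad \<beta>2 \<beta>3) x" "\<nu> p = (pt x y1, pt x y2)"
        using a by (auto simp: affp_def)
      have x: "x \<noteq> 0" using b(1) a(2) by auto
      have "p \<in> Dy" using affp_D[OF a(1)] a(2) by simp
      hence t: "T p = y2 / y1" using T(1) c by simp
      have r: "poly (rquad \<alpha>2 \<alpha>3) (1 / x) = y1 ^ 2 / x ^ 3"
        using poly_rquad_inverse[OF x, of \<alpha>2 \<alpha>3] x b(1)
        by (simp add: nonzero_eq_divide_eq power2_eq_square power3_eq_cube mult.assoc mult.left_commute)
      have "poly (rquad \<alpha>2 \<alpha>3) (1 / x) \<noteq> 0" "poly (rquad \<alpha>2 \<alpha>3) (1 / x) * (x / y1) ^ 2 = 1 / x"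
        unfolding r using x a(2) by (simp_all add: power_divide power2_eq_square power3_eq_cube)
      hence "u3 p \<in> K.X"
        unfolding u3_def K.X_def using T_square3[OF D] unfolding c by simp
      moreover have "\<nu> p = (proj_point (?L1 (u3 p)), proj_point (?L2 (u3 p)))"
        using scale[of "1 / y1" 1 x y1] scale[of "1 / y1" 1 x y2] x a(2) unfolding b(3) u3_def c t by simp
      ultimately show ?thesis by blast
    next
      assume inf: "infp p"
      \<comment> \<open>Over infinity \<open>T\<close> takes the values 1 and -1, so the second
        component is still the point at infinity.\<close>
      have t2: "T p ^ 2 = 1"
        using T_square3[OF D] by (simp add: infp_coords[OF inf] poly_rquad)
      hence "T p \<noteq> 0" by auto
      hence "proj_point (vec_of [0, 0, T p]) = infinite_point"
        using scale[of "T p" 0 0 1] by simp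
      moreover have "\<nu> p = (infinite_point, infinite_point)" using inf by (simp add: infp_def)
      ultimately show ?thesis
        unfolding u3_def K.X_def using t2 by (simp add: infp_coords[OF inf] poly_rquad)
    qed
    thus "u3 p \<in> K.X" "\<nu> p = (proj_point (?L1 (u3 p)), proj_point (?L2 (u3 p)))" by blast+
    show "regular_at C p (\<lambda>p. fst (u3 p))" "regular_at C p (\<lambda>p. fst (snd (u3 p)))" "regular_at C p (\<lambda>p. snd (snd (u3 p)))"
      unfolding u3_def fst_conv snd_conv using D3_regular[OF D] T(2) D by auto
  next
    fix q assume q: "q \<in> K.X"
    obtain x y z where xyz: "q = (x, y, z)" by (cases q) auto
    let ?P = "poly (rquad \<alpha>2 \<alpha>3) x"
    have e: "?P \<noteq> 0" "?P * y ^ 2 = x" "?P * z ^ 2 = poly (rquad \<beta>2 \<beta>3) x"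
      using K.X_D[OF q[unfolded xyz]] by simp_all
    show "(proj_point (?L1 q), proj_point (?L2 q)) \<in> points F"
    proof (cases "x = 0")
      case True
      hence "y = 0" "z ^ 2 = 1" using e by (auto simp: poly_rquad)
      hence "proj_point (vec_of [0, 0, z]) = infinite_point"
        using scale[of z 0 0 1] by (cases "z = 0") auto
      thus ?thesis unfolding points_F_iff xyz using True \<open>y = 0\<close> by simp
    next
      case False
      hence y: "y \<noteq> 0" using e by auto
      have P: "?P = x / y ^ 2" using e(2) y by (simp add: nonzero_eq_divide_eq)
      have x3: "w ^ 2 = 1 / x * (1 / x - a) * (1 / x - b)"
        if "w ^ 2 * x ^ 3 = poly (rquad a b) x" for w a b
      proof -
        have "(1 / x * (1 / x - a) * (1 / x - b)) * x ^ 3 = (x * (1 / x - a)) * (x * (1 / x - b))"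
          using False by (simp add: power3_eq_cube)
        also have "\<dots> = poly (rquad a b) x"
          using False by (simp add: poly_rquad right_diff_distrib mult.commute)
        finally have "w ^ 2 * x ^ 3 = (1 / x * (1 / x - a) * (1 / x - b)) * x ^ 3"
          using that by simp
        moreover have "x ^ 3 \<noteq> 0" using False by simp
        ultimately show ?thesis by (metis mult_right_cancel)
      qed
      have A: "(1 / (x * y)) ^ 2 * x ^ 3 = ?P"
        unfolding P using False y by (simp add: power_divide power_mult_distrib power2_eq_square power3_eq_cube)
      have B: "(z / (x * y)) ^ 2 * x ^ 3 = poly (rquad \<beta>2 \<beta>3) x"
        unfolding e(3)[symmetric] P using False y
        by (simp add: power_divide power_mult_distrib power2_eq_square power3_eq_cube)
      have pts: "proj_point (?L1 q) = pt (1 / x) (1 / (x * y))" "proj_point (?L2 q) = pt (1 / x) (z / (x * y))"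
        using scale[of "x * y" 1 "1 / x" "1 / (x * y)"] scale[of "x * y" 1 "1 / x" "z / (x * y)"] False y
        by (simp_all add: xyz)
      show ?thesis
        unfolding points_F_iff pts
        by (rule disjI1, rule exI[of _ "1 / x"], rule exI[of _ "1 / (x * y)"], rule exI[of _ "z / (x * y)"])
          (rule conjI[OF refl conjI[OF x3[OF A] x3[OF B]]])
    qed
    fix p assume p: "p \<in> points C" "\<nu> p = (proj_point (?L1 q), proj_point (?L2 q))"
    show "p \<in> D3"
      unfolding D3_def mem_Collect_eq p(2) fst_conv homogeneous_nonzero_iff[OF hom1]
      using p(1) by (simp add: vec_of_3 xyz)
  qed
qed

section \<open>Consequences of the charts\<close>

context charted_space
begin

text \<open>With h = A / B in terms of \<open>u\<close>, zeros of \<open>h\<close> are sent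
  injectively to zeros of \<open>A\<close>, an element of \<open>R\<close> that is not identically
  zero.\<close>

lemma finite_zeros_regular:
  assumes U: "openin (zariski C) U" "h \<in> regular C U" "p \<in> U" "h p \<noteq> 0"
  shows "finite {q \<in> U \<inter> D. h q = 0}"
proof -
  have "U \<noteq> {}" using U by auto
  obtain A B N where AB: "A \<in> R" "B \<in> R" "openin (zariski C) N" "N \<noteq> {}" "N \<subseteq> U \<inter> D"
      "\<forall>p\<in>N. B (u p) \<noteq> 0 \<and> h p * B (u p) = A (u p)"
    using generic[OF U(1) \<open>U \<noteq> {}\<close> U(2)] by (elim bexE exE conjE)
  have A: "A (u q) = h q * B (u q)" if q: "q \<in> U \<inter> D" for q
    by (rule identity_at[where f = "\<lambda>q. A (u q)" and g = "\<lambda>q. h q * B (u q)" and N = N])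
       (use q U AB in \<open>auto intro!: at_mult R_regular intro: regular_imp_at\<close>)
  have "\<exists>q\<in>X. A q \<noteq> 0"
  proof (rule ccontr)
    assume *: "\<not> ?thesis"
    have "h q = 0" if "q \<in> N" for q
      using AB(5,6) that * u_X by fastforce
    hence "h p = 0"
      using identity_at[of p h "\<lambda>_. 0" N] regular_imp_at[OF U(2,1,3)] at_const AB(3,4) open_subset_points[OF U(1)] U(3)
      by blast
    thus False using U(4) by simp
  qed
  hence "finite {x \<in> X. A x = 0}"
    using finite_zeros[OF AB(1)] by blast
  moreover have "u ` {q \<in> U \<inter> D. h q = 0} \<subseteq> {x \<in> X. A x = 0}"
    using A u_X by auto
  ultimately have "finite (u ` {q \<in> U \<inter> D. h q = 0})"
    using finite_subset by blast
  moreover have "inj_on u {q \<in> U \<inter> D. h q = 0}"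
    using inj_on_u by (rule inj_on_subset) auto
  ultimately show ?thesis
    using finite_imageD by blast
qed

lemma vanishing_iff: "f \<in> vanishing_at C p \<longleftrightarrow> f p = 0 \<and> regular_at C p f"
  by (simp add: vanishing_at_def regular_at_def)

text \<open>The pullback \<open>s\<close> of a uniformizer divides every germ vanishing at
  \<open>p\<close>, so it spans the cotangent space. It is not in the square of the maximal ideal:
  cancelling \<open>s\<close> in c s = s e with e(p) = 0 gives c = 0.\<close>

lemma cotangent_dim_1:
  assumes p: "p \<in> D"
  shows "cotangent_dim C p 1"
proof -
  obtain t where t: "uniformizer (u p) t"
    using uniformizer_exists[OF u_X[OF p]] by blast
  define s where "s = (\<lambda>q. t (u q))"
  have tR: "t \<in> R" "t (u p) = 0" using t by (auto simp: uniformizer_def)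
  have s: "regular_at C p s" "s p = 0" "s \<in> vanishing_at C p"
    using R_regular[OF tR(1) p] tR(2) by (auto simp: s_def vanishing_iff)
  have factor: "\<exists>g N. regular_at C p g \<and> openin (zariski C) N \<and> p \<in> N \<and> (\<forall>q\<in>N. f q = s q * g q)"
    if f: "f \<in> vanishing_at C p" for f
  proof -
    have f': "f p = 0" "regular_at C p f" using f by (auto simp: vanishing_iff)
    obtain A B N where AB: "A \<in> R" "B \<in> R" "B (u p) \<noteq> 0" "openin (zariski C) N" "p \<in> N" "N \<subseteq> D"
      "\<And>p'. p' \<in> N \<Longrightarrow> B (u p') \<noteq> 0 \<and> f p' * B (u p') = A (u p')"
      using regular_is_fraction[OF p f'(2)] by blast
    have "A (u p) = 0" using AB(7)[OF AB(5)] f'(1) by simp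
    hence "\<exists>c\<in>R. \<exists>g\<in>R. c (u p) \<noteq> 0 \<and> (\<forall>x\<in>X. A x * c x = t x * g x)"
      using t AB(1) unfolding uniformizer_def by simp
    then obtain c g where cg: "c \<in> R" "g \<in> R" "c (u p) \<noteq> 0" "\<And>x. x \<in> X \<Longrightarrow> A x * c x = t x * g x"
      by blast
    obtain N' where N': "openin (zariski C) N'" "p \<in> N'" "\<And>q. q \<in> N' \<Longrightarrow> c (u q) \<noteq> 0"
      using at_nonzero_nbhd[OF R_regular[OF cg(1) p] cg(3)] by blast
    have "f q = s q * (g (u q) / (B (u q) * c (u q)))" if "q \<in> N \<inter> N'" for q
    proof -
      have "f q * B (u q) * c (u q) = s q * g (u q)"
        using AB(6) AB(7)[of q] cg(4)[of "u q"] u_X[of q] that by (auto simp: s_def)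
      thus ?thesis using AB(7)[of q] N'(3)[of q] that by (simp add: nonzero_eq_divide_eq mult.assoc)
    qed
    moreover have "regular_at C p (\<lambda>q. g (u q) / (B (u q) * c (u q)))"
      by (rule at_divide[OF R_regular[OF cg(2) p] at_mult[OF R_regular[OF AB(2) p] R_regular[OF cg(1) p]]])
         (use AB(3) cg(3) in simp)
    ultimately show ?thesis
      using AB(4,5) N'(1,2) by (intro exI[of _ "\<lambda>q. g (u q) / (B (u q) * c (u q))"] exI[of _ "N \<inter> N'"]) auto
  qed
  show ?thesis
    unfolding cotangent_dim_def
  proof (intro exI[of _ "\<lambda>_. s"] conjI allI impI ballI)
    show "s \<in> vanishing_at C p" by fact
  next
    fix f assume "f \<in> vanishing_at C p"
    then obtain g N where g: "regular_at C p g" "openin (zariski C) N" "p \<in> N" "\<forall>q\<in>N. f q = s q * g q"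
      using factor by blast
    have b: "(\<lambda>q. g q - g p) \<in> vanishing_at C p"
      using at_diff[OF g(1) at_const[OF regular_at_points[OF g(1)]]] by (simp add: vanishing_iff)
    \<comment> \<open>With f = s g the difference f - g(p) s equals s (g - g(p)), a product of two
      germs vanishing at \<open>p\<close>.\<close>
    have "(\<lambda>q. f q - (\<Sum>i<(1::nat). (\<lambda>_. g p) i * s q)) \<in> vanishing_doubly_at C p"
      unfolding vanishing_doubly_at_def
      by (rule CollectI, rule exI[of _ N], rule exI[of _ 1], rule exI[of _ "\<lambda>_. s"],
          rule exI[of _ "\<lambda>_ q. g q - g p"]) (use g b s in \<open>auto simp: lessThan_Suc algebra_simps\<close>)
    thus "\<exists>c. (\<lambda>q. f q - (\<Sum>i<(1::nat). c i * s q)) \<in> vanishing_doubly_at C p"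
      by (rule exI[of _ "\<lambda>_. g p"])
  next
    fix c :: "nat \<Rightarrow> 'k" and i :: nat
    assume "(\<lambda>q. \<Sum>i<1. c i * s q) \<in> vanishing_doubly_at C p" and i: "i < 1"
    then obtain U n a b where ab: "openin (zariski C) U" "p \<in> U" "\<forall>i<(n::nat). a i \<in> vanishing_at C p \<and> b i \<in> vanishing_at C p"
        "\<forall>q\<in>U. (\<Sum>i<1. c i * s q) = (\<Sum>i<n. a i q * b i q)"
      unfolding vanishing_doubly_at_def mem_Collect_eq by (elim exE conjE)
    have "\<forall>i. \<exists>g N. i < n \<longrightarrow> regular_at C p g \<and> openin (zariski C) N \<and> p \<in> N \<and> (\<forall>q\<in>N. a i q = s q * g q)"
      "\<forall>i. \<exists>g N. i < n \<longrightarrow> regular_at C p g \<and> openin (zariski C) N \<and> p \<in> N \<and> (\<forall>q\<in>N. b i q = s q * g q)"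
      using factor ab(3) by blast+
    then obtain a' N b' N' where
        a': "\<And>i. i < n \<Longrightarrow> regular_at C p (a' i) \<and> openin (zariski C) (N i) \<and> p \<in> N i \<and> (\<forall>q\<in>N i. a i q = s q * a' i q)"
      and b': "\<And>i. i < n \<Longrightarrow> regular_at C p (b' i) \<and> openin (zariski C) (N' i) \<and> p \<in> N' i \<and> (\<forall>q\<in>N' i. b i q = s q * b' i q)"
      by metis
    define e where "e = (\<lambda>q. s q * (\<Sum>i<n. a' i q * b' i q))"
    have e: "regular_at C p e"
      unfolding e_def using a' b' s regular_at_points[OF s(1)] by (intro at_mult at_sum) auto
    define M where "M = (U \<inter> D) \<inter> (\<Inter>i\<in>{..<n}. N i \<inter> N' i)"
    have M: "openin (zariski C) M" "p \<in> M"
    proof -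
      have "openin (zariski C) (\<Inter>i\<in>{..<n}. N i \<inter> N' i)" if "n \<noteq> 0"
        using a' b' that by (intro openin_INT2) auto
      thus "openin (zariski C) M"
        unfolding M_def using ab(1) D(1) by (cases "n = 0") auto
      show "p \<in> M" unfolding M_def using ab(2) p a' b' by auto
    qed
    obtain q0 where q0: "q0 \<in> X" "t q0 \<noteq> 0"
      using uniformizer_not_identically_0[OF u_X[OF p] t] by blast
    \<comment> \<open>Cancelling \<open>s\<close> requires a nonempty open set on which it has no
      zeros; the resulting identity is carried back to \<open>p\<close> by irreducibility.\<close>
    obtain p0 where p0: "p0 \<in> M" "t (u p0) \<noteq> 0"
      using R_eq_0I[OF tR(1) M(1) _ _ _ q0(1)] q0(2) M(2) by (auto simp: M_def)
    hence "p0 \<in> D" by (auto simp: M_def)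
    obtain M' where M': "openin (zariski C) M'" "p0 \<in> M'" "\<And>q. q \<in> M' \<Longrightarrow> t (u q) \<noteq> 0"
      using at_nonzero_nbhd[OF R_regular[OF tR(1) \<open>p0 \<in> D\<close>] p0(2)] by blast
    have "c 0 = e q" if q: "q \<in> M \<inter> M'" for q
    proof -
      have "c 0 * s q = (\<Sum>i<n. a i q * b i q)"
        using ab(4) q by (auto simp: M_def)
      also have "\<dots> = s q * e q"
        unfolding e_def sum_distrib_left
      proof (rule sum.cong)
        fix i assume "i \<in> {..<n}"
        hence "a i q = s q * a' i q" "b i q = s q * b' i q"
          using a' b' q by (auto simp: M_def)
        thus "a i q * b i q = s q * (s q * (a' i q * b' i q))" by simp
      qed simp
      finally show ?thesis using M'(3)[of q] q by (simp add: s_def)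
    qed
    hence "c 0 = e p"
      using identity_at[of p "\<lambda>_. c 0" e "M \<inter> M'"] at_const[OF regular_at_points[OF e]] e M M' p0 by blast
    thus "c i = 0" using i s(2) by (simp add: e_def)
  qed
qed

end

section \<open>Regular functions as fractions of embedding coordinates\<close>

text \<open>A pair \<open>(G, H)\<close> stands for the fraction \<open>G / H\<close>.\<close>

definition fraction_class :: "(((nat \<Rightarrow> 'k :: field) \<Rightarrow> 'k) \<times> ((nat \<Rightarrow> 'k) \<Rightarrow> 'k)) set \<Rightarrow> bool"
  where "fraction_class \<G> \<longleftrightarrow> (\<forall>c. (\<lambda>_. c, \<lambda>_. 1) \<in> \<G>) \<and> (\<forall>(G, H)\<in>\<G>. (H, G) \<in> \<G>) \<and>
    (\<forall>(G, H)\<in>\<G>. \<forall>(G', H')\<in>\<G>. (\<lambda>v. G v * H' v + G' v * H v, \<lambda>v. H v * H' v) \<in> \<G> \<and>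
       (\<lambda>v. G v * G' v, \<lambda>v. H v * H' v) \<in> \<G>)"

definition projective_fractions :: "(((nat \<Rightarrow> 'k :: field) \<Rightarrow> 'k) \<times> ((nat \<Rightarrow> 'k) \<Rightarrow> 'k)) set"
  where "projective_fractions = {(G, H). \<exists>d. homogeneous d G \<and> homogeneous d H}"

definition affine_fractions :: "(((nat \<Rightarrow> 'k :: field) \<Rightarrow> 'k) \<times> ((nat \<Rightarrow> 'k) \<Rightarrow> 'k)) set"
  where "affine_fractions = polynomial_functions \<times> polynomial_functions"

lemma fraction_class_projective: "fraction_class projective_fractions"
  unfolding fraction_class_def projective_fractions_def
proof (intro conjI allI ballI; clarsimp)
  show "\<exists>d. homogeneous d (\<lambda>_ :: nat \<Rightarrow> 'a. c) \<and> homogeneous d (\<lambda>_ :: nat \<Rightarrow> 'a. 1)" for c :: 'a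
    using homogeneous.const by blast
  fix G H :: "(nat \<Rightarrow> 'a) \<Rightarrow> 'a" and d and G' H' :: "(nat \<Rightarrow> 'a) \<Rightarrow> 'a" and d'
  assume h: "homogeneous d G" "homogeneous d H" "homogeneous d' G'" "homogeneous d' H'"
  have "homogeneous (d + d') (\<lambda>v. G v * H' v + G' v * H v)" "homogeneous (d + d') (\<lambda>v. H v * H' v)"
    "homogeneous (d + d') (\<lambda>v. G v * G' v)"
    using homogeneous.mult[OF h(1,4)] homogeneous.mult[OF h(3,2)] homogeneous.mult[OF h(2,4)] homogeneous.mult[OF h(1,3)]
    by (auto intro!: homogeneous.add simp: add.commute)
  thus "(\<exists>d. homogeneous d (\<lambda>v. G v * H' v + G' v * H v) \<and> homogeneous d (\<lambda>v. H v * H' v)) \<and>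
      (\<exists>d. homogeneous d (\<lambda>v. G v * G' v) \<and> homogeneous d (\<lambda>v. H v * H' v))"
    by blast
qed blast

lemma fraction_class_affine: "fraction_class affine_fractions"
  unfolding fraction_class_def affine_fractions_def
  by (auto intro: polynomial_functions.intros)

definition (in chart) expressible ::
    "(((nat \<Rightarrow> 'k) \<Rightarrow> 'k) \<times> ((nat \<Rightarrow> 'k) \<Rightarrow> 'k)) set \<Rightarrow> ('k \<times> 'k \<times> 'k \<Rightarrow> nat \<Rightarrow> 'k) \<Rightarrow> ('k \<times> 'k \<times> 'k \<Rightarrow> 'k) \<Rightarrow> bool"
  where "expressible \<G> L P \<longleftrightarrow> (\<exists>(G, H)\<in>\<G>. \<forall>q\<in>X. H (L q) \<noteq> 0 \<and> P q = G (L q) / H (L q))"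

context chart
begin

lemma expressibleI:
  assumes "(G, H) \<in> \<G>" "\<And>q. q \<in> X \<Longrightarrow> H (L q) \<noteq> 0 \<and> P q = G (L q) / H (L q)"
  shows "expressible \<G> L P"
  using assms unfolding expressible_def by blast

lemma expressibleE:
  assumes "expressible \<G> L P"
  obtains G H where "(G, H) \<in> \<G>" "\<And>q. q \<in> X \<Longrightarrow> H (L q) \<noteq> 0 \<and> P q = G (L q) / H (L q)"
  using assms unfolding expressible_def by blast

text \<open>The fractions are closed under sums, products and exchange of the two terms. Inversion
  occurs only for \<open>m\<close>, which has no zero on \<open>X\<close>.\<close>

lemma expressible_R:
  assumes \<G>: "fraction_class \<G>"
    and xyz: "expressible \<G> L fst" "expressible \<G> L (\<lambda>q. fst (snd q))" "expressible \<G> L (\<lambda>q. snd (snd q))"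
    and P: "P \<in> R"
  shows "expressible \<G> L P"
proof -
  have const: "expressible \<G> L (\<lambda>_. c)" for c
    by (rule expressibleI[of "\<lambda>_. c" "\<lambda>_. 1"]) (use \<G> in \<open>auto simp: fraction_class_def\<close>)
  have ops: "expressible \<G> L (\<lambda>q. A q + B q)" "expressible \<G> L (\<lambda>q. A q * B q)"
    if A: "expressible \<G> L A" and B: "expressible \<G> L B" for A B
  proof -
    obtain G H where 1: "(G, H) \<in> \<G>" "\<And>q. q \<in> X \<Longrightarrow> H (L q) \<noteq> 0 \<and> A q = G (L q) / H (L q)"
      using expressibleE[OF A] by blast
    obtain G' H' where 2: "(G', H') \<in> \<G>" "\<And>q. q \<in> X \<Longrightarrow> H' (L q) \<noteq> 0 \<and> B q = G' (L q) / H' (L q)"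
      using expressibleE[OF B] by blast
    have "(\<lambda>v. G v * H' v + G' v * H v, \<lambda>v. H v * H' v) \<in> \<G>" "(\<lambda>v. G v * G' v, \<lambda>v. H v * H' v) \<in> \<G>"
      using \<G> 1(1) 2(1) unfolding fraction_class_def by blast+
    note G = this
    show "expressible \<G> L (\<lambda>q. A q + B q)"
      by (rule expressibleI[OF G(1)]) (use 1(2) 2(2) in \<open>simp add: add_frac_eq\<close>)
    show "expressible \<G> L (\<lambda>q. A q * B q)"
      by (rule expressibleI[OF G(2)]) (use 1(2) 2(2) in simp)
  qed
  have poly: "expressible \<G> L (\<lambda>q. poly p (fst q))" for p
  proof (induction p)
    case (pCons a p)
    show ?case using ops(1)[OF const[of a] ops(2)[OF xyz(1) pCons(2)]] by simp
  qed (use const[of 0] in simp)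
  have inv: "expressible \<G> L (\<lambda>q. inverse (poly m (fst q)))"
  proof -
    obtain G H where GH: "(G, H) \<in> \<G>" "\<And>q. q \<in> X \<Longrightarrow> H (L q) \<noteq> 0 \<and> poly m (fst q) = G (L q) / H (L q)"
      using expressibleE[OF poly[of m]] by blast
    have "(H, G) \<in> \<G>" using \<G> GH(1) unfolding fraction_class_def by blast
    moreover have "G (L q) \<noteq> 0 \<and> inverse (poly m (fst q)) = H (L q) / G (L q)" if "q \<in> X" for q
      using GH(2)[OF that] that by (auto simp: X_def)
    ultimately show ?thesis by (rule expressibleI)
  qed
  have pow: "expressible \<G> L (\<lambda>q. inverse (poly m (fst q)) ^ N)" for N
    by (induction N) (use const[of 1] ops(2)[OF inv] in auto)
  obtain N a b c d where Pq: "\<And>x y z. (x, y, z) \<in> X \<Longrightarrow>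
    P (x, y, z) * poly m x ^ N = poly a x + poly b x * y + poly c x * z + poly d x * y * z"
    using R_E[OF P] by blast
  let ?Q = "\<lambda>q. (poly a (fst q) + poly b (fst q) * fst (snd q) + poly c (fst q) * snd (snd q)
     + poly d (fst q) * fst (snd q) * snd (snd q)) * inverse (poly m (fst q)) ^ N"
  have "expressible \<G> L ?Q"
    by (intro ops poly xyz pow)
  moreover have "?Q q = P q" if "q \<in> X" for q
  proof -
    obtain x y z where q: "q = (x, y, z)" by (cases q) auto
    have "poly m x \<noteq> 0" using that q by (auto simp: X_def)
    hence "poly m x ^ N * inverse (poly m x) ^ N = 1"
      by (simp add: power_mult_distrib[symmetric])
    thus ?thesis
      unfolding q fst_conv snd_conv Pq[OF that[unfolded q], symmetric] by (simp add: mult.assoc)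
  qed
  ultimately show ?thesis
    unfolding expressible_def by auto
qed

end

lemma (in charted_space) regular_expressible:
  assumes \<G>: "fraction_class \<G>"
    and xyz: "expressible \<G> L fst" "expressible \<G> L (\<lambda>q. fst (snd q))" "expressible \<G> L (\<lambda>q. snd (snd q))"
    and f: "p \<in> D" "regular_at C p f"
  obtains G H N where "(G, H) \<in> \<G>" "H (L (u p)) \<noteq> 0" "openin (zariski C) N" "p \<in> N"
    "\<And>q. q \<in> N \<Longrightarrow> H (L (u q)) \<noteq> 0 \<and> f q = G (L (u q)) / H (L (u q))"
proof -
  obtain A B N where AB: "A \<in> R" "B \<in> R" "B (u p) \<noteq> 0" "openin (zariski C) N" "p \<in> N" "N \<subseteq> D"
    "\<And>p'. p' \<in> N \<Longrightarrow> B (u p') \<noteq> 0 \<and> f p' * B (u p') = A (u p')"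
    using regular_is_fraction[OF f] by blast
  obtain G H where 1: "(G, H) \<in> \<G>" "\<And>q. q \<in> X \<Longrightarrow> H (L q) \<noteq> 0 \<and> A q = G (L q) / H (L q)"
    using expressibleE[OF expressible_R[OF \<G> xyz AB(1)]] by blast
  obtain G' H' where 2: "(G', H') \<in> \<G>" "\<And>q. q \<in> X \<Longrightarrow> H' (L q) \<noteq> 0 \<and> B q = G' (L q) / H' (L q)"
    using expressibleE[OF expressible_R[OF \<G> xyz AB(2)]] by blast
  have "(\<lambda>v. G v * H' v, \<lambda>v. H v * G' v) \<in> \<G>"
    using \<G> 1(1) 2(1) unfolding fraction_class_def by blast
  moreover have main: "H (L (u q)) * G' (L (u q)) \<noteq> 0 \<and> f q = G (L (u q)) * H' (L (u q)) / (H (L (u q)) * G' (L (u q)))"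
    if q: "q \<in> N" for q
  proof -
    have "u q \<in> X" using q AB(6) u_X by auto
    hence *: "H (L (u q)) \<noteq> 0" "A (u q) = G (L (u q)) / H (L (u q))" "H' (L (u q)) \<noteq> 0" "B (u q) = G' (L (u q)) / H' (L (u q))"
      using 1(2) 2(2) by auto
    have B: "B (u q) \<noteq> 0" "f q = A (u q) / B (u q)"
      using AB(7)[OF q] by (auto simp: nonzero_eq_divide_eq)
    hence "G' (L (u q)) \<noteq> 0" using * by auto
    thus ?thesis using * B by simp
  qed
  ultimately show ?thesis
    using that[of "\<lambda>v. G v * H' v" "\<lambda>v. H v * G' v" N] AB(4,5) by blast
qed

section \<open>Maps given on one chart\<close>

lemma (in chart) R_polynomial_function:
  assumes "h \<in> polynomial_functions" "\<And>i. (\<lambda>q. L q i) \<in> R"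
  shows "(\<lambda>q. h (L q)) \<in> R"
  using assms(1) by induction (auto intro: R_const R_add R_mult assms(2))

text \<open>Provides \<open>cont\<close>, \<open>pull\<close> and \<open>push\<close> of the
  isomorphism criterion on a single chart. The inverse map enters only through expressing the three
  chart coordinates by homogeneous fractions of \<open>L\<close>.\<close>

lemma (in charted_space) projective_lift:
  assumes L: "\<And>i. (\<lambda>q. L q i) \<in> R" "\<And>q. q \<in> X \<Longrightarrow> proj_point (L q) \<in> points (projective_space n)"
    and xyz: "expressible projective_fractions L fst" "expressible projective_fractions L (\<lambda>q. fst (snd q))"
      "expressible projective_fractions L (\<lambda>q. snd (snd q))"
    and \<Phi>: "\<And>p. p \<in> D \<Longrightarrow> \<Phi> p = proj_point (L (u p))"
    and p: "p \<in> D"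
  shows "openin (zariski (projective_space n)) U \<Longrightarrow> \<Phi> p \<in> U \<Longrightarrow>
      \<exists>N. openin (zariski C) N \<and> p \<in> N \<and> N \<subseteq> D \<and> (\<forall>q\<in>N. \<Phi> q \<in> U)"
    and "openin (zariski (projective_space n)) U \<Longrightarrow> f \<in> regular (projective_space n) U \<Longrightarrow> \<Phi> p \<in> U \<Longrightarrow> regular_at C p (f \<circ> \<Phi>)"
    and "regular_at C p f' \<Longrightarrow> \<exists>U g N. openin (zariski (projective_space n)) U \<and> \<Phi> p \<in> U \<and> g \<in> regular (projective_space n) U \<and>
      openin (zariski C) N \<and> p \<in> N \<and> (\<forall>q\<in>N. \<Phi> q \<in> U \<longrightarrow> f' q = g (\<Phi> q))"
proof -
  have hom: "regular_at C p (\<lambda>q. h (L (u q)))" if "homogeneous d h" "p \<in> D" for d h p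
    using R_regular[OF R_homogeneous[OF that(1), of L, OF L(1)] that(2)] .
  have cont: "\<exists>N. openin (zariski C) N \<and> p \<in> N \<and> N \<subseteq> D \<and> (\<forall>q\<in>N. \<Phi> q \<in> U)"
    if U: "openin (zariski (projective_space n)) U" "\<Phi> p \<in> U" for U
  proof -
    obtain d h where h: "homogeneous d h" "\<And>v. v \<in> \<Phi> p \<Longrightarrow> h v \<noteq> 0"
        "{e \<in> points (projective_space n). \<forall>v\<in>e. h v \<noteq> 0} \<subseteq> U"
      using projective_basis[OF U] by blast
    have "h (L (u p)) \<noteq> 0" using h(2)[of "L (u p)"] \<Phi>[OF p] proj_point_self[of "L (u p)"] by simp
    then obtain N where N: "openin (zariski C) N" "p \<in> N" "\<And>q. q \<in> N \<Longrightarrow> h (L (u q)) \<noteq> 0"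
      using at_nonzero_nbhd[OF hom[OF h(1) p]] by blast
    have "\<Phi> q \<in> U" if "q \<in> N \<inter> D" for q
    proof -
      have "\<forall>v\<in>\<Phi> q. h v \<noteq> 0"
        using \<Phi>[of q] homogeneous_nonzero_iff[OF h(1)] N(3)[of q] that by auto
      moreover have "\<Phi> q \<in> points (projective_space n)"
        using \<Phi>[of q] L(2)[of "u q"] u_X[of q] that by auto
      ultimately show ?thesis using h(3) by blast
    qed
    thus ?thesis using N D p by (intro exI[of _ "N \<inter> D"]) auto
  qed
  thus "openin (zariski (projective_space n)) U \<Longrightarrow> \<Phi> p \<in> U \<Longrightarrow>
      \<exists>N. openin (zariski C) N \<and> p \<in> N \<and> N \<subseteq> D \<and> (\<forall>q\<in>N. \<Phi> q \<in> U)" .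
  show "regular_at C p (f \<circ> \<Phi>)"
    if U: "openin (zariski (projective_space n)) U" "f \<in> regular (projective_space n) U" "\<Phi> p \<in> U"
  proof -
    from bspec[OF U(2)[unfolded regular_projective_space] U(3)] obtain d g h where
      gh: "homogeneous d g" "homogeneous d h" "\<forall>v\<in>\<Phi> p. h v \<noteq> 0" "\<forall>q\<in>U. \<forall>v\<in>q. h v \<noteq> 0 \<longrightarrow> f q = g v / h v"
      by (elim exE conjE)
    have h: "h (L (u p)) \<noteq> 0" using gh(3) \<Phi>[OF p] proj_point_self[of "L (u p)"] by simp
    obtain N where N: "openin (zariski C) N" "p \<in> N" "N \<subseteq> D" "\<forall>q\<in>N. \<Phi> q \<in> U"
      using cont[OF U(1,3)] by blast
    obtain N' where N': "openin (zariski C) N'" "p \<in> N'" "\<And>q. q \<in> N' \<Longrightarrow> h (L (u q)) \<noteq> 0"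
      using at_nonzero_nbhd[OF hom[OF gh(2) p] h] by blast
    have reg: "regular_at C p (\<lambda>q. g (L (u q)) / h (L (u q)))"
      by (rule at_divide[OF hom[OF gh(1) p] hom[OF gh(2) p] h])
    show ?thesis
    proof (rule regular_at_cong[OF reg, of "N \<inter> N'"])
      fix q assume q: "q \<in> N \<inter> N'"
      have "L (u q) \<in> \<Phi> q" using \<Phi>[of q] N(3) q proj_point_self by auto
      thus "(f \<circ> \<Phi>) q = g (L (u q)) / h (L (u q))"
        using gh(4) N(4) N'(3) q by auto
    qed (use N N' in auto)
  qed
  show "\<exists>U g N. openin (zariski (projective_space n)) U \<and> \<Phi> p \<in> U \<and> g \<in> regular (projective_space n) U \<and>
      openin (zariski C) N \<and> p \<in> N \<and> (\<forall>q\<in>N. \<Phi> q \<in> U \<longrightarrow> f' q = g (\<Phi> q))" if f: "regular_at C p f'"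
  proof -
    obtain G H N where G: "(G, H) \<in> projective_fractions" "H (L (u p)) \<noteq> 0" "openin (zariski C) N" "p \<in> N"
      "\<And>q. q \<in> N \<Longrightarrow> H (L (u q)) \<noteq> 0 \<and> f' q = G (L (u q)) / H (L (u q))"
      using regular_expressible[OF fraction_class_projective xyz p f] by blast
    obtain d where d: "homogeneous d G" "homogeneous d H"
      using G(1) unfolding projective_fractions_def by blast
    let ?U = "{e \<in> points (projective_space n). \<forall>v\<in>e. H v \<noteq> 0}"
    have "coord_quot G H \<in> regular (projective_space n) ?U"
      unfolding regular_projective_space using d coord_quot_eq[OF d]
      by (intro ballI exI[of _ d] exI[of _ G] exI[of _ H]) auto
    moreover have "\<Phi> p \<in> ?U"
      using \<Phi>[OF p] L(2)[OF u_X[OF p]] homogeneous_nonzero_iff[OF d(2)] G(2) by simp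
    moreover have "f' q = coord_quot G H (\<Phi> q)" if "q \<in> N \<inter> D" for q
      using G(5)[of q] \<Phi>[of q] coord_quot_proj_point[OF d] that by simp
    ultimately show ?thesis
      using open_projective_basic[OF d(2)] G(3,4) D p
      by (intro exI[of _ ?U] exI[of _ "coord_quot G H"] exI[of _ "N \<inter> D"]) auto
  qed
qed

text \<open>Openness onto the image comes from \<open>cof\<close>: a nonempty open set omits
  finitely many points, whose images form a closed set because points of affine space are
  closed.\<close>

lemma (in charted_space) affine_embedding:
  assumes cof: "\<And>U. openin (zariski C) U \<Longrightarrow> U \<noteq> {} \<Longrightarrow> finite (points C - U)"
    and L: "\<And>i. (\<lambda>q. L q i) \<in> R" "\<And>q. q \<in> X \<Longrightarrow> L q \<in> points (affine_space n)" "inj_on L X"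
    and xyz: "expressible affine_fractions L fst" "expressible affine_fractions L (\<lambda>q. fst (snd q))"
      "expressible affine_fractions L (\<lambda>q. snd (snd q))"
  shows "isomorphism (subspace_on C D) (subspace_on (affine_space n) (L ` X)) (\<lambda>p. L (u p))"
proof (rule isomorphism_onto_subspace)
  note ptD = open_subspace_points[OF D(1)]
  note opD = open_subspace_zariski[OF D(1)]
  note regD = open_subspace_regular_at[OF D(1)]
  have poly: "regular_at C p (\<lambda>q. h (L (u q)))" if "h \<in> polynomial_functions" "p \<in> D" for h p
    using R_regular[OF R_polynomial_function[OF that(1), of L, OF L(1)] that(2)] .
  show "kfun_space (subspace_on C D)"
    by (rule kfun_space_open_subspace[OF D(1)])
  show "inj_on (\<lambda>p. L (u p)) (points (subspace_on C D))"
    unfolding ptD using comp_inj_on[OF inj_on_u, of L] L(3) u_surj by (simp add: comp_def)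
  show "(\<lambda>p. L (u p)) ` points (subspace_on C D) = L ` X"
    unfolding ptD by (simp add: u_surj[symmetric] image_image)
  show "L ` X \<subseteq> points (affine_space n)" using L(2) by auto
  show "f \<in> regular (affine_space n) V" if "f \<in> regular (affine_space n) U" "V \<subseteq> U" for U V f
    using regular_affine_space_restrict[OF that] .
  have cont: "\<exists>N. openin (zariski C) N \<and> p \<in> N \<and> N \<subseteq> D \<and> (\<forall>q\<in>N. L (u q) \<in> U)"
    if U: "openin (zariski (affine_space n)) U" "L (u p) \<in> U" and p: "p \<in> D" for U p
  proof -
    obtain h where h: "h \<in> polynomial_functions" "h (L (u p)) \<noteq> 0" "{v \<in> points (affine_space n). h v \<noteq> 0} \<subseteq> U"
      using affine_basis[OF U] by blast
    obtain N where N: "openin (zariski C) N" "p \<in> N" "\<And>q. q \<in> N \<Longrightarrow> h (L (u q)) \<noteq> 0"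
      using at_nonzero_nbhd[OF poly[OF h(1) p] h(2)] by blast
    have "L (u q) \<in> U" if "q \<in> N \<inter> D" for q
      using N(3)[of q] L(2)[OF u_X[of q]] h(3) that by auto
    thus ?thesis using N D p by (intro exI[of _ "N \<inter> D"]) auto
  qed
  show "openin (zariski (subspace_on C D)) {p \<in> points (subspace_on C D). L (u p) \<in> U}"
    if U: "openin (zariski (affine_space n)) U" for U
    unfolding opD ptD
  proof
    show "openin (zariski C) {p \<in> D. L (u p) \<in> U}"
      unfolding openin_subopen[of _ "{p \<in> D. L (u p) \<in> U}"]
    proof
      fix p assume "p \<in> {p \<in> D. L (u p) \<in> U}"
      then obtain N where "openin (zariski C) N" "p \<in> N" "N \<subseteq> D" "\<forall>q\<in>N. L (u q) \<in> U"
        using cont[OF U] by blast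
      thus "\<exists>T. openin (zariski C) T \<and> p \<in> T \<and> T \<subseteq> {p \<in> D. L (u p) \<in> U}"
        by (intro exI[of _ N]) auto
    qed
  qed auto
  show "regular_at (subspace_on C D) p (f \<circ> (\<lambda>p. L (u p)))"
    if U: "openin (zariski (affine_space n)) U" "f \<in> regular (affine_space n) U" "p \<in> points (subspace_on C D)" "L (u p) \<in> U"
    for U f p
  proof -
    have p: "p \<in> D" using U(3) ptD by simp
    from bspec[OF U(2)[unfolded regular_affine_space] U(4)] obtain g h where
      gh: "g \<in> polynomial_functions" "h \<in> polynomial_functions" "h (L (u p)) \<noteq> 0" "\<forall>q\<in>U. h q \<noteq> 0 \<longrightarrow> f q = g q / h q"
      by (elim bexE conjE)
    obtain N where N: "openin (zariski C) N" "p \<in> N" "N \<subseteq> D" "\<forall>q\<in>N. L (u q) \<in> U"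
      using cont[OF U(1,4) p] by blast
    obtain N' where N': "openin (zariski C) N'" "p \<in> N'" "\<And>q. q \<in> N' \<Longrightarrow> h (L (u q)) \<noteq> 0"
      using at_nonzero_nbhd[OF poly[OF gh(2) p] gh(3)] by blast
    have reg: "regular_at C p (\<lambda>q. g (L (u q)) / h (L (u q)))"
      by (rule at_divide[OF poly[OF gh(1) p] poly[OF gh(2) p] gh(3)])
    show ?thesis
      unfolding regD[OF p]
      by (rule regular_at_cong[OF reg, of "N \<inter> N'"]) (use N N' gh(4) in auto)
  qed
  show "\<exists>U. openin (zariski (affine_space n)) U \<and> (\<lambda>p. L (u p)) ` W = U \<inter> L ` X"
    if W: "openin (zariski (subspace_on C D)) W" for W
  proof (cases "W = {}")
    case True
    thus ?thesis by (intro exI[of _ "{}"]) auto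
  next
    case False
    have W': "openin (zariski C) W" "W \<subseteq> D" using W opD by auto
    let ?Z = "(\<lambda>p. L (u p)) ` (D - W)"
    have "finite (D - W)"
      using finite_subset[OF _ cof[OF W'(1) False]] open_subset_points[OF D(1)] by blast
    hence "finite ?Z" by simp
    moreover have LX: "L (u p) \<in> points (affine_space n)" if "p \<in> D" for p
      using L(2)[OF u_X[OF that]] .
    hence "?Z \<subseteq> points (affine_space n)" by auto
    ultimately have "closedin (zariski (affine_space n)) (\<Union>v\<in>?Z. {v})"
      by (intro closedin_Union) (auto intro: closed_point_affine_space)
    hence "openin (zariski (affine_space n)) (points (affine_space n) - ?Z)"
      by (simp add: closedin_def points_def)
    moreover have "(\<lambda>p. L (u p)) ` W = (points (affine_space n) - ?Z) \<inter> L ` X"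
    proof -
      have inj: "inj_on (\<lambda>p. L (u p)) D"
        using comp_inj_on[OF inj_on_u, of L] L(3) u_surj by (simp add: comp_def)
      have "L ` X = (\<lambda>p. L (u p)) ` D" by (simp add: u_surj[symmetric] image_image)
      thus ?thesis
        using LX W'(2) inj_on_image_set_diff[OF inj, of D W] by auto
    qed
    ultimately show ?thesis by blast
  qed
  show "\<exists>U g N. openin (zariski (affine_space n)) U \<and> L (u p) \<in> U \<and> g \<in> regular (affine_space n) U \<and>
      openin (zariski (subspace_on C D)) N \<and> p \<in> N \<and> (\<forall>q\<in>N. L (u q) \<in> U \<longrightarrow> f q = g (L (u q)))"
    if p: "p \<in> points (subspace_on C D)" and f: "regular_at (subspace_on C D) p f" for p f
  proof -
    have pD: "p \<in> D" "regular_at C p f" using p f ptD regD by auto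
    obtain G H N where G: "(G, H) \<in> affine_fractions" "H (L (u p)) \<noteq> 0" "openin (zariski C) N" "p \<in> N"
      "\<And>q. q \<in> N \<Longrightarrow> H (L (u q)) \<noteq> 0 \<and> f q = G (L (u q)) / H (L (u q))"
      using regular_expressible[OF fraction_class_affine xyz pD] by blast
    have GH: "G \<in> polynomial_functions" "H \<in> polynomial_functions"
      using G(1) by (auto simp: affine_fractions_def)
    let ?U = "{v \<in> points (affine_space n). H v \<noteq> 0}"
    have "(\<lambda>v. G v / H v) \<in> regular (affine_space n) ?U"
      unfolding regular_affine_space using GH by (intro ballI bexI[of _ G] bexI[of _ H]) auto
    moreover have "openin (zariski (subspace_on C D)) (N \<inter> D)"
      using opD G(3) D(1) by auto
    ultimately show ?thesis
      using open_affine_basic[OF GH(2)] G pD(1) L(2)[OF u_X[OF pD(1)]]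
      by (intro exI[of _ ?U] exI[of _ "\<lambda>v. G v / H v"] exI[of _ "N \<inter> D"]) auto
  qed
qed

section \<open>Topology, dimension and smoothness of \<open>C\<close>\<close>

context biquadratic_cover
begin

text \<open>An affine open \<open>V\<close> meets \<open>U\<close>, so some regular \<open>h\<close>
  is nonzero at a common point and vanishes on \<open>V - U\<close>. Its zeros are finite in number
  on each of the three charts, and finitely many such \<open>V\<close> cover
  \<open>C\<close>.\<close>

lemma cofinite:
  assumes U: "openin (zariski C) U" "U \<noteq> {}"
  shows "finite (points C - U)"
proof -
  obtain \<U> where \<U>: "finite \<U>" "\<Union>\<U> = points C" "\<forall>V\<in>\<U>. openin (zariski C) V \<and> is_affine (subspace_on C V)"
    using var unfolding variety_def by blast
  have "finite (V - U)" if V: "V \<in> \<U>" for V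
  proof (cases "V = {}")
    case False
    have V': "openin (zariski C) V" "is_affine (subspace_on C V)" using \<U>(3) V by auto
    obtain p where p: "p \<in> U" "p \<in> V" using opens_meet[OF U(1) V'(1) U(2) False] by auto
    obtain h where h: "h \<in> regular C V" "h p \<noteq> 0" "\<And>q. q \<in> V \<Longrightarrow> h q \<noteq> 0 \<Longrightarrow> q \<in> U"
      using affine_basic_open[OF V' p(2) U(1) p(1)] by blast
    have "V - U \<subseteq> {q \<in> V \<inter> D1. h q = 0} \<union> {q \<in> V \<inter> D2. h q = 0} \<union> {q \<in> V \<inter> D3. h q = 0}"
      using h(3) D_cover open_subset_points[OF V'(1)] by blast
    moreover have "finite \<dots>"
      using I.finite_zeros_regular[OF V'(1) h(1) p(2) h(2)] II.finite_zeros_regular[OF V'(1) h(1) p(2) h(2)]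
        III.finite_zeros_regular[OF V'(1) h(1) p(2) h(2)] by blast
    ultimately show ?thesis using finite_subset by blast
  qed simp
  hence "finite (\<Union>V\<in>\<U>. V - U)" using \<U>(1) by blast
  moreover have "points C - U \<subseteq> (\<Union>V\<in>\<U>. V - U)" using \<U>(2) by blast
  ultimately show ?thesis using finite_subset by blast
qed

lemma cotangent_dim_C: "p \<in> points C \<Longrightarrow> cotangent_dim C p 1"
  using D_cover I.cotangent_dim_1 II.cotangent_dim_1 III.cotangent_dim_1 by blast

text \<open>Proper closed subsets are finite, and a finite irreducible set of closed points is a
  single point; so a chain has at most the two terms point and curve.\<close>

lemma krull_dim_C: "krull_dim (zariski C) 1"
proof -
  obtain p0 where p0: "p0 \<in> points C" using two_points by blast
  have inf: "infinite (points C)" using infinite_open[OF two_points open_points] p0 by blast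
  have irr1: "irreducible_subset (zariski C) {p0}"
    using p0 unfolding irreducible_subset_def points_def by auto
  have cl: "closedin (zariski C) (points C)" by (simp add: points_def)
  have chain1: "\<exists>Z :: nat \<Rightarrow> 'c set. (\<forall>i\<le>1. closedin (zariski C) (Z i) \<and> irreducible_subset (zariski C) (Z i)) \<and>
     (\<forall>i<1. Z i \<subset> Z (Suc i))"
  proof (intro exI[of _ "\<lambda>i. if i = 0 then {p0} else points C"] conjI allI impI)
    fix i :: nat
    show "closedin (zariski C) (if i = 0 then {p0} else points C)"
      using closed_points[OF p0] cl by auto
    show "irreducible_subset (zariski C) (if i = 0 then {p0} else points C)"
      using irr1 irred by auto
    show "(if i = 0 then {p0} else points C) \<subset> (if Suc i = 0 then {p0} else points C)" if "i < 1"
      using that p0 inf by (auto simp: psubset_eq) (metis finite.emptyI finite.insertI)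
  qed
  have chain2: False if Z: "\<forall>i\<le>Suc 1. closedin (zariski C) (Z i) \<and> irreducible_subset (zariski C) (Z i)"
      "\<forall>i<Suc 1. Z i \<subset> Z (Suc i)" for Z :: "nat \<Rightarrow> 'c set"
  proof -
    have Z01: "Z 0 \<subset> Z 1" "Z 1 \<subset> Z 2" using Z(2)[rule_format, of 0] Z(2)[rule_format, of 1] by (auto simp: numeral_2_eq_2)
    have c: "closedin (zariski C) (Z 1)" "closedin (zariski C) (Z 2)" "irreducible_subset (zariski C) (Z 0)" "irreducible_subset (zariski C) (Z 1)"
      using Z(1)[rule_format, of 0] Z(1)[rule_format, of 1] Z(1)[rule_format, of 2] by auto
    have sub: "Z 1 \<subseteq> points C" "Z 2 \<subseteq> points C"
      using closedin_subset[OF c(1)] closedin_subset[OF c(2)] by (auto simp: points_def)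
    have "openin (zariski C) (points C - Z 1)" "points C - Z 1 \<noteq> {}"
      using c(1) Z01(2) sub(2) by (auto simp: points_def)
    hence "finite (points C - (points C - Z 1))" by (rule cofinite)
    hence fin: "finite (Z 1)" using sub(1) by (simp add: double_diff)
    obtain a where a: "a \<in> Z 0" using c(3) unfolding irreducible_subset_def by blast
    have "closedin (zariski C) (\<Union>q\<in>Z 1 - {a}. {q})"
      using fin sub(1) by (intro closedin_Union) (auto intro: closed_points)
    hence "closedin (zariski C) (Z 1 - {a})" by simp
    moreover have "closedin (zariski C) {a}" using a Z01 sub by (intro closed_points) auto
    moreover have "Z 1 \<subseteq> {a} \<union> (Z 1 - {a})" by auto
    ultimately have "Z 1 \<subseteq> {a} \<or> Z 1 \<subseteq> Z 1 - {a}"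
      using c(4) unfolding irreducible_subset_def by meson
    thus False using a Z01(1) by auto
  qed
  show ?thesis
    unfolding krull_dim_def Let_def using chain1 chain2 by blast
qed

lemma smooth_C: "smooth_variety C"
  unfolding smooth_variety_def irreducible_variety_def
  using var irred krull_dim_C cotangent_dim_C by blast

text \<open>The local conditions are inherited from the three charts; openness onto the image holds
  because nonempty open sets are cofinite and points of projective space are closed.\<close>

lemma projective_embedding:
  assumes inj: "inj_on \<Phi> (points C)"
    and L1: "\<And>i. (\<lambda>q. L1 q i) \<in> I.R" "\<And>q. q \<in> I.X \<Longrightarrow> proj_point (L1 q) \<in> points (projective_space n)"
      "I.expressible projective_fractions L1 fst" "I.expressible projective_fractions L1 (\<lambda>q. fst (snd q))"
      "I.expressible projective_fractions L1 (\<lambda>q. snd (snd q))" "\<And>p. p \<in> D1 \<Longrightarrow> \<Phi> p = proj_point (L1 (u1 p))"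
    and L2: "\<And>i. (\<lambda>q. L2 q i) \<in> II.R" "\<And>q. q \<in> II.X \<Longrightarrow> proj_point (L2 q) \<in> points (projective_space n)"
      "II.expressible projective_fractions L2 fst" "II.expressible projective_fractions L2 (\<lambda>q. fst (snd q))"
      "II.expressible projective_fractions L2 (\<lambda>q. snd (snd q))" "\<And>p. p \<in> D2 \<Longrightarrow> \<Phi> p = proj_point (L2 (u2 p))"
    and L3: "\<And>i. (\<lambda>q. L3 q i) \<in> III.R" "\<And>q. q \<in> III.X \<Longrightarrow> proj_point (L3 q) \<in> points (projective_space n)"
      "III.expressible projective_fractions L3 fst" "III.expressible projective_fractions L3 (\<lambda>q. fst (snd q))"
      "III.expressible projective_fractions L3 (\<lambda>q. snd (snd q))" "\<And>p. p \<in> D3 \<Longrightarrow> \<Phi> p = proj_point (L3 (u3 p))"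
  shows "isomorphism C (subspace_on (projective_space n) (\<Phi> ` points C)) \<Phi>"
proof (rule isomorphism_onto_subspace[OF kfun_space_axioms inj refl])
  have 1: "\<And>p U. p \<in> D1 \<Longrightarrow> openin (zariski (projective_space n)) U \<Longrightarrow> \<Phi> p \<in> U \<Longrightarrow>
      \<exists>N. openin (zariski C) N \<and> p \<in> N \<and> N \<subseteq> D1 \<and> (\<forall>q\<in>N. \<Phi> q \<in> U)"
    "\<And>p U f. p \<in> D1 \<Longrightarrow> openin (zariski (projective_space n)) U \<Longrightarrow> f \<in> regular (projective_space n) U \<Longrightarrow> \<Phi> p \<in> U \<Longrightarrow> regular_at C p (f \<circ> \<Phi>)"
    "\<And>p f. p \<in> D1 \<Longrightarrow> regular_at C p f \<Longrightarrow> \<exists>U g N. openin (zariski (projective_space n)) U \<and> \<Phi> p \<in> U \<and> g \<in> regular (projective_space n) U \<and>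
      openin (zariski C) N \<and> p \<in> N \<and> (\<forall>q\<in>N. \<Phi> q \<in> U \<longrightarrow> f q = g (\<Phi> q))"
    by (rule I.projective_lift[of L1 n \<Phi>]; (assumption | rule L1)+)+
  have 2: "\<And>p U. p \<in> D2 \<Longrightarrow> openin (zariski (projective_space n)) U \<Longrightarrow> \<Phi> p \<in> U \<Longrightarrow>
      \<exists>N. openin (zariski C) N \<and> p \<in> N \<and> N \<subseteq> D2 \<and> (\<forall>q\<in>N. \<Phi> q \<in> U)"
    "\<And>p U f. p \<in> D2 \<Longrightarrow> openin (zariski (projective_space n)) U \<Longrightarrow> f \<in> regular (projective_space n) U \<Longrightarrow> \<Phi> p \<in> U \<Longrightarrow> regular_at C p (f \<circ> \<Phi>)"
    "\<And>p f. p \<in> D2 \<Longrightarrow> regular_at C p f \<Longrightarrow> \<exists>U g N. openin (zariski (projective_space n)) U \<and> \<Phi> p \<in> U \<and> g \<in> regular (projective_space n) U \<and>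
      openin (zariski C) N \<and> p \<in> N \<and> (\<forall>q\<in>N. \<Phi> q \<in> U \<longrightarrow> f q = g (\<Phi> q))"
    by (rule II.projective_lift[of L2 n \<Phi>]; (assumption | rule L2)+)+
  have 3: "\<And>p U. p \<in> D3 \<Longrightarrow> openin (zariski (projective_space n)) U \<Longrightarrow> \<Phi> p \<in> U \<Longrightarrow>
      \<exists>N. openin (zariski C) N \<and> p \<in> N \<and> N \<subseteq> D3 \<and> (\<forall>q\<in>N. \<Phi> q \<in> U)"
    "\<And>p U f. p \<in> D3 \<Longrightarrow> openin (zariski (projective_space n)) U \<Longrightarrow> f \<in> regular (projective_space n) U \<Longrightarrow> \<Phi> p \<in> U \<Longrightarrow> regular_at C p (f \<circ> \<Phi>)"
    "\<And>p f. p \<in> D3 \<Longrightarrow> regular_at C p f \<Longrightarrow> \<exists>U g N. openin (zariski (projective_space n)) U \<and> \<Phi> p \<in> U \<and> g \<in> regular (projective_space n) U \<and>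
      openin (zariski C) N \<and> p \<in> N \<and> (\<forall>q\<in>N. \<Phi> q \<in> U \<longrightarrow> f q = g (\<Phi> q))"
    by (rule III.projective_lift[of L3 n \<Phi>]; (assumption | rule L3)+)+
  show P: "\<Phi> ` points C \<subseteq> points (projective_space n)"
  proof
    fix e assume "e \<in> \<Phi> ` points C"
    then obtain p where p: "p \<in> points C" "e = \<Phi> p" by blast
    from D_cover[OF p(1)] show "e \<in> points (projective_space n)"
      unfolding p(2) using L1(2)[OF I.u_X] L1(6) L2(2)[OF II.u_X] L2(6) L3(2)[OF III.u_X] L3(6) by (elim disjE) simp_all
  qed
  show "f \<in> regular (projective_space n) V" if "f \<in> regular (projective_space n) U" "V \<subseteq> U" for U V f
    using regular_projective_space_restrict[OF that] .
  show "openin (zariski C) {p \<in> points C. \<Phi> p \<in> U}" if U: "openin (zariski (projective_space n)) U" for U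
    unfolding openin_subopen[of _ "{p \<in> points C. \<Phi> p \<in> U}"]
  proof
    fix p assume p: "p \<in> {p \<in> points C. \<Phi> p \<in> U}"
    have "\<exists>N. openin (zariski C) N \<and> p \<in> N \<and> (\<forall>q\<in>N. \<Phi> q \<in> U)"
      using D_cover[of p] p 1(1)[OF _ U, of p] 2(1)[OF _ U, of p] 3(1)[OF _ U, of p] by blast
    then obtain N where "openin (zariski C) N" "p \<in> N" "\<forall>q\<in>N. \<Phi> q \<in> U" by blast
    thus "\<exists>T. openin (zariski C) T \<and> p \<in> T \<and> T \<subseteq> {p \<in> points C. \<Phi> p \<in> U}"
      using open_subset_points by (intro exI[of _ N]) auto
  qed
  show "regular_at C p (f \<circ> \<Phi>)"
    if "openin (zariski (projective_space n)) U" "f \<in> regular (projective_space n) U" "p \<in> points C" "\<Phi> p \<in> U" for U f p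
    using D_cover[OF that(3)] 1(2)[OF _ that(1,2,4)] 2(2)[OF _ that(1,2,4)] 3(2)[OF _ that(1,2,4)] by (elim disjE)
  show "\<exists>U. openin (zariski (projective_space n)) U \<and> \<Phi> ` W = U \<inter> \<Phi> ` points C" if W: "openin (zariski C) W" for W
  proof (cases "W = {}")
    case True
    thus ?thesis by (intro exI[of _ "{}"]) auto
  next
    case False
    let ?Z = "\<Phi> ` (points C - W)"
    have "finite ?Z" using cofinite[OF W False] by simp
    moreover have "?Z \<subseteq> points (projective_space n)" using P by auto
    ultimately have "closedin (zariski (projective_space n)) (\<Union>v\<in>?Z. {v})"
      by (intro closedin_Union) (auto intro: closed_point_projective_space)
    hence "openin (zariski (projective_space n)) (points (projective_space n) - ?Z)"
      by (simp add: closedin_def points_def)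
    moreover have "\<Phi> ` W = (points (projective_space n) - ?Z) \<inter> \<Phi> ` points C"
      using P open_subset_points[OF W] inj_on_image_set_diff[OF inj, of "points C" W] by auto
    ultimately show ?thesis by blast
  qed
  show "\<exists>U g N. openin (zariski (projective_space n)) U \<and> \<Phi> p \<in> U \<and> g \<in> regular (projective_space n) U \<and>
      openin (zariski C) N \<and> p \<in> N \<and> (\<forall>q\<in>N. \<Phi> q \<in> U \<longrightarrow> f q = g (\<Phi> q))" if "p \<in> points C" "regular_at C p f" for p f
    using D_cover[OF that(1)] 1(3)[OF _ that(2)] 2(3)[OF _ that(2)] 3(3)[OF _ that(2)] by (elim disjE)
qed

end

section \<open>Projective models\<close>

lemma vec_of_point:
  assumes "length xs = Suc n" "x \<in> set xs" "x \<noteq> 0"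
  shows "proj_point (vec_of xs) \<in> points (projective_space n)"
proof -
  obtain i where "i < length xs" "xs ! i = x"
    using assms(2) by (auto simp: in_set_conv_nth)
  thus ?thesis
    using assms by (intro proj_point_in_points[of _ i]) (auto simp: vec_of_def)
qed

lemma vec_of_scale: "k \<noteq> 0 \<Longrightarrow> proj_point (vec_of (map (\<lambda>x. k * x) xs)) = proj_point (vec_of xs)"
  by (rule proj_point_eqI[of k]) (auto simp: vec_of_def)

lemma vec_of_nth_eqI:
  assumes "\<And>i. i > n \<Longrightarrow> v i = 0" "length xs = Suc n" "\<And>i. i \<le> n \<Longrightarrow> v i = xs ! i"
  shows "v = vec_of xs"
  using assms by (auto simp: vec_of_def fun_eq_iff not_less)

lemma vec_of_6: "vec_of [a0, a1, a2, a3, a4, a5] 0 = a0" "vec_of [a0, a1, a2, a3, a4, a5] (Suc 0) = a1"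
  "vec_of [a0, a1, a2, a3, a4, a5] 1 = a1"
  "vec_of [a0, a1, a2, a3, a4, a5] 2 = a2" "vec_of [a0, a1, a2, a3, a4, a5] 3 = a3"
  "vec_of [a0, a1, a2, a3, a4, a5] 4 = a4" "vec_of [a0, a1, a2, a3, a4, a5] 5 = a5"
  by (simp_all add: vec_of_def)

lemma (in chart) R_vec_of:
  assumes "\<And>f. f \<in> set fs \<Longrightarrow> f \<in> R"
  shows "(\<lambda>q. vec_of (map (\<lambda>f. f q) fs) i) \<in> R"
proof (cases "i < length fs")
  case True
  thus ?thesis using assms[of "fs ! i"] by (simp add: vec_of_def)
next
  case False
  thus ?thesis using R_const[of 0] by (simp add: vec_of_def)
qed

lemma (in chart) R_vec_of_6:
  assumes "f0 \<in> R" "f1 \<in> R" "f2 \<in> R" "f3 \<in> R" "f4 \<in> R" "f5 \<in> R"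
  shows "(\<lambda>q. vec_of [f0 q, f1 q, f2 q, f3 q, f4 q, f5 q] i) \<in> R"
  using R_vec_of[of "[f0, f1, f2, f3, f4, f5]" i] assms by auto

text \<open>Homogeneous fractions depend only on the projective point, and they recover all three
  coordinates.\<close>

lemma (in chart) expressible_inj:
  assumes "expressible projective_fractions L fst" "expressible projective_fractions L (\<lambda>q. fst (snd q))"
    "expressible projective_fractions L (\<lambda>q. snd (snd q))"
    and q: "q \<in> X" "q' \<in> X" "proj_point (L q) = proj_point (L q')"
  shows "q = q'"
proof -
  have eq: "P q = P q'" if P: "expressible projective_fractions L P" for P :: "'k \<times> 'k \<times> 'k \<Rightarrow> 'k"
  proof -
    obtain G H where GH: "(G, H) \<in> projective_fractions" "\<And>q. q \<in> X \<Longrightarrow> H (L q) \<noteq> 0 \<and> P q = G (L q) / H (L q)"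
      using expressibleE[OF P] by blast
    then obtain d where d: "homogeneous d G" "homogeneous d H"
      unfolding projective_fractions_def by blast
    show ?thesis
      using GH(2)[OF q(1)] GH(2)[OF q(2)] coord_quot_proj_point[OF d, of "L q"] coord_quot_proj_point[OF d, of "L q'"] q(3)
      by simp
  qed
  show ?thesis
    using eq[OF assms(1)] eq[OF assms(2)] eq[OF assms(3)] by (simp add: prod_eq_iff)
qed

lemma projective_fractionsI: "homogeneous d G \<Longrightarrow> homogeneous d H \<Longrightarrow> (G, H) \<in> projective_fractions"
  unfolding projective_fractions_def by blast

section \<open>Gluing three local maps to projective space\<close>

context biquadratic_cover
begin

lemma u_values:
  assumes "affp p x y1 y2"
  shows "u1 p = (x, y1 / x, y2 / x)" "u2 p = (x, y1 / poly (quad \<alpha>2 \<alpha>3) x, T p)" "u3 p = (1 / x, x / y1, T p)"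
  using affp_coords[OF assms] by (simp_all add: u1_def u2_def u3_def)

lemma u_values':
  assumes a: "affp p x y1 y2" and y1: "y1 \<noteq> 0"
  shows "x \<noteq> 0" "poly (quad \<alpha>2 \<alpha>3) x = y1 ^ 2 / x" "u2 p = (x, x / y1, y2 / y1)" "u3 p = (1 / x, x / y1, y2 / y1)"
    "poly (rquad \<alpha>2 \<alpha>3) (1 / x) = y1 ^ 2 / x ^ 3"
proof -
  have y: "y1 ^ 2 = x * poly (quad \<alpha>2 \<alpha>3) x" using a by (simp add: affp_def)
  show x: "x \<noteq> 0" using y y1 by auto
  show P: "poly (quad \<alpha>2 \<alpha>3) x = y1 ^ 2 / x" using y x by simp
  have "p \<in> Dy" using affp_D[OF a] y1 by simp
  hence "T p = y2 / y1" using T(1) affp_coords[OF a] by simp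
  thus "u2 p = (x, x / y1, y2 / y1)" "u3 p = (1 / x, x / y1, y2 / y1)"
    using u_values[OF a] x y1 P by (simp_all add: power2_eq_square)
  show "poly (rquad \<alpha>2 \<alpha>3) (1 / x) = y1 ^ 2 / x ^ 3"
    using poly_rquad_inverse[OF x, of \<alpha>2 \<alpha>3] x P
    by (simp add: nonzero_eq_divide_eq power2_eq_square power3_eq_cube mult.assoc mult.left_commute)
qed

definition glue :: "('k \<times> 'k \<times> 'k \<Rightarrow> nat \<Rightarrow> 'k) \<Rightarrow> ('k \<times> 'k \<times> 'k \<Rightarrow> nat \<Rightarrow> 'k) \<Rightarrow> ('k \<times> 'k \<times> 'k \<Rightarrow> nat \<Rightarrow> 'k) \<Rightarrow> 'c \<Rightarrow> (nat \<Rightarrow> 'k) set"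
  where "glue L1 L2 L3 p = (if p \<in> D1 then proj_point (L1 (u1 p)) else if p \<in> D2 then proj_point (L2 (u2 p)) else proj_point (L3 (u3 p)))"

lemma boundary_cases:
  assumes "p \<in> points C"
  obtains "p \<in> D1" "u1 p \<in> I.X" | "p \<notin> D1" "p \<in> D2" "u2 p \<in> II.X" "fst (u2 p) = 0" | "p \<notin> D1" "p \<notin> D2" "p \<in> D3" "u3 p \<in> III.X" "fst (u3 p) = 0"
  using assms
proof (rule point_cases)
  fix x y1 y2 assume a: "affp p x y1 y2"
  show thesis
  proof (cases "x = 0")
    case True
    hence "p \<in> D2" "p \<notin> D1" using affp_D[OF a] nonzero by (auto simp: poly_quad)
    moreover have "fst (u2 p) = 0" using u_values(2)[OF a] True by simp
    ultimately show ?thesis using that(2) II.u_X[of p] by blast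
  next
    case False
    hence "p \<in> D1" using affp_D[OF a] by simp
    thus ?thesis using that(1) I.u_X[of p] by blast
  qed
next
  assume a: "infp p"
  moreover have "fst (u3 p) = 0" using infp_coords[OF a] by (simp add: u3_def)
  ultimately show thesis using that(3) III.u_X[of p] infp_D[OF a] by blast
qed

text \<open>The overlaps of \<open>D1\<close> with \<open>D2\<close> and with \<open>D3\<close>
  consist of points with y1 \<noteq> 0, hence the form of \<open>compat\<close>. For injectivity,
  the zeroth coordinate tells \<open>D1\<close> apart from the points over x = 0 and x =
  \<infinity>, and \<open>L23\<close> tells the latter apart from each other.\<close>

lemma glued_embedding:
  assumes L1: "\<And>i. (\<lambda>q. L1 q i) \<in> I.R" "\<And>q. q \<in> I.X \<Longrightarrow> proj_point (L1 q) \<in> points (projective_space n)"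
      "I.expressible projective_fractions L1 fst" "I.expressible projective_fractions L1 (\<lambda>q. fst (snd q))"
      "I.expressible projective_fractions L1 (\<lambda>q. snd (snd q))"
    and L2: "\<And>i. (\<lambda>q. L2 q i) \<in> II.R" "\<And>q. q \<in> II.X \<Longrightarrow> proj_point (L2 q) \<in> points (projective_space n)"
      "II.expressible projective_fractions L2 fst" "II.expressible projective_fractions L2 (\<lambda>q. fst (snd q))"
      "II.expressible projective_fractions L2 (\<lambda>q. snd (snd q))"
    and L3: "\<And>i. (\<lambda>q. L3 q i) \<in> III.R" "\<And>q. q \<in> III.X \<Longrightarrow> proj_point (L3 q) \<in> points (projective_space n)"
      "III.expressible projective_fractions L3 fst" "III.expressible projective_fractions L3 (\<lambda>q. fst (snd q))"
      "III.expressible projective_fractions L3 (\<lambda>q. snd (snd q))"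
    and compat: "\<And>x y1 y2. x \<noteq> 0 \<Longrightarrow> y1 \<noteq> 0 \<Longrightarrow> poly (quad \<alpha>2 \<alpha>3) x = y1 ^ 2 / x \<Longrightarrow> poly (rquad \<alpha>2 \<alpha>3) (1 / x) = y1 ^ 2 / x ^ 3 \<Longrightarrow>
      proj_point (L2 (x, x / y1, y2 / y1)) = proj_point (L1 (x, y1 / x, y2 / x)) \<and>
      proj_point (L3 (1 / x, x / y1, y2 / y1)) = proj_point (L1 (x, y1 / x, y2 / x))"
    and L0: "\<And>q. q \<in> I.X \<Longrightarrow> L1 q 0 \<noteq> 0" "\<And>q. q \<in> II.X \<Longrightarrow> fst q = 0 \<Longrightarrow> L2 q 0 = 0"
      "\<And>q. q \<in> III.X \<Longrightarrow> fst q = 0 \<Longrightarrow> L3 q 0 = 0"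
    and L23: "\<And>q q'. q \<in> II.X \<Longrightarrow> fst q = 0 \<Longrightarrow> q' \<in> III.X \<Longrightarrow> fst q' = 0 \<Longrightarrow> proj_point (L2 q) \<noteq> proj_point (L3 q')"
  shows "isomorphism C (subspace_on (projective_space n) (glue L1 L2 L3 ` points C)) (glue L1 L2 L3)"
    and "glue L1 L2 L3 ` points C = (\<lambda>q. proj_point (L1 q)) ` I.X \<union> (\<lambda>q. proj_point (L2 q)) ` {q \<in> II.X. fst q = 0} \<union>
      (\<lambda>q. proj_point (L3 q)) ` {q \<in> III.X. fst q = 0}"
    and "glue L1 L2 L3 ` D1 = (\<lambda>q. proj_point (L1 q)) ` I.X"
proof -
  let ?\<Phi> = "glue L1 L2 L3"
  have \<Phi>1: "?\<Phi> p = proj_point (L1 (u1 p))" if "p \<in> D1" for p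
    using that by (simp add: glue_def)
  have yy: "proj_point (L2 (u2 p)) = proj_point (L1 (u1 p)) \<and> proj_point (L3 (u3 p)) = proj_point (L1 (u1 p))"
    if "affp p x y1 y2" "y1 \<noteq> 0" for p x y1 y2
    using compat u_values'[OF that] u_values(1)[OF that(1)] that(2) by simp
  have \<Phi>2: "?\<Phi> p = proj_point (L2 (u2 p))" if p: "p \<in> D2" for p
  proof (cases "p \<in> D1")
    case True
    obtain x y1 y2 where a: "affp p x y1 y2" "poly (quad \<alpha>2 \<alpha>3) x \<noteq> 0" using p by (rule D2_E)
    have "x \<noteq> 0" "y1 ^ 2 = x * poly (quad \<alpha>2 \<alpha>3) x" using a(1) affp_D[OF a(1)] True by (auto simp: affp_def)
    hence "y1 \<noteq> 0" using a(2) by auto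
    thus ?thesis using yy[OF a(1)] True by (simp add: glue_def)
  qed (use p in \<open>simp add: glue_def\<close>)
  have \<Phi>3: "?\<Phi> p = proj_point (L3 (u3 p))" if p: "p \<in> D3" for p
    using p
  proof (rule D3_E)
    fix x y1 y2 assume a: "affp p x y1 y2" "y1 \<noteq> 0"
    hence "p \<in> D1" using affp_D[OF a(1)] u_values'(1)[OF a] by simp
    thus ?thesis using yy[OF a] by (simp add: glue_def)
  next
    assume "infp p"
    thus ?thesis using infp_D by (simp add: glue_def)
  qed
  have v0: "v 0 = 0 \<longleftrightarrow> w 0 = 0" if "proj_point v = proj_point w" for v w :: "nat \<Rightarrow> 'k"
    using proj_point_eqD[OF that] by (metis mult_eq_0_iff)
  have inj: "inj_on ?\<Phi> (points C)"
  proof (rule inj_onI)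
    fix p p' assume p: "p \<in> points C" "p' \<in> points C" "?\<Phi> p = ?\<Phi> p'"
    note i1 = I.expressible_inj[OF L1(3-5)] I.inj_on_u[THEN inj_onD]
    note i2 = II.expressible_inj[OF L2(3-5)] II.inj_on_u[THEN inj_onD]
    note i3 = III.expressible_inj[OF L3(3-5)] III.inj_on_u[THEN inj_onD]
    from p(1) show "p = p'"
    proof (rule boundary_cases)
      assume 1: "p \<in> D1" "u1 p \<in> I.X"
      from p(2) show ?thesis
      proof (rule boundary_cases)
        assume "p' \<in> D1" "u1 p' \<in> I.X"
        thus ?thesis using p(3) 1 \<Phi>1 i1 by metis
      next
        assume "p' \<notin> D1" "p' \<in> D2" "u2 p' \<in> II.X" "fst (u2 p') = 0"
        thus ?thesis using v0[of "L1 (u1 p)" "L2 (u2 p')"] p(3) \<Phi>1[OF 1(1)] \<Phi>2 L0(1)[OF 1(2)] L0(2) by simp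
      next
        assume "p' \<in> D3" "u3 p' \<in> III.X" "fst (u3 p') = 0"
        thus ?thesis using v0[of "L1 (u1 p)" "L3 (u3 p')"] p(3) \<Phi>1[OF 1(1)] \<Phi>3 L0(1)[OF 1(2)] L0(3) by simp
      qed
    next
      assume 1: "p \<notin> D1" "p \<in> D2" "u2 p \<in> II.X" "fst (u2 p) = 0"
      from p(2) show ?thesis
      proof (rule boundary_cases)
        assume 2: "p' \<in> D1" "u1 p' \<in> I.X"
        thus ?thesis using v0[of "L1 (u1 p')" "L2 (u2 p)"] p(3) \<Phi>1[OF 2(1)] \<Phi>2[OF 1(2)] L0(1)[OF 2(2)] L0(2)[OF 1(3,4)] by simp
      next
        assume "p' \<notin> D1" "p' \<in> D2" "u2 p' \<in> II.X" "fst (u2 p') = 0"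
        thus ?thesis using p(3) 1 \<Phi>2 i2 by metis
      next
        assume "p' \<in> D3" "u3 p' \<in> III.X" "fst (u3 p') = 0"
        thus ?thesis using L23[OF 1(3,4), of "u3 p'"] p(3) \<Phi>2[OF 1(2)] \<Phi>3 by simp
      qed
    next
      assume 1: "p \<notin> D1" "p \<notin> D2" "p \<in> D3" "u3 p \<in> III.X" "fst (u3 p) = 0"
      from p(2) show ?thesis
      proof (rule boundary_cases)
        assume 2: "p' \<in> D1" "u1 p' \<in> I.X"
        thus ?thesis using v0[of "L1 (u1 p')" "L3 (u3 p)"] p(3) \<Phi>1[OF 2(1)] \<Phi>3[OF 1(3)] L0(1)[OF 2(2)] L0(3)[OF 1(4,5)] by simp
      next
        assume 2: "p' \<notin> D1" "p' \<in> D2" "u2 p' \<in> II.X" "fst (u2 p') = 0"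
        thus ?thesis using L23[OF 2(3,4) 1(4,5)] p(3) \<Phi>2[OF 2(2)] \<Phi>3[OF 1(3)] by simp
      next
        assume "p' \<in> D3" "u3 p' \<in> III.X" "fst (u3 p') = 0"
        thus ?thesis using p(3) 1 \<Phi>3 i3 by metis
      qed
    qed
  qed
  show "isomorphism C (subspace_on (projective_space n) (?\<Phi> ` points C)) ?\<Phi>"
    by (rule projective_embedding[OF inj, of L1 n L2 L3];
        (assumption | rule L1 L2 L3 \<Phi>1 \<Phi>2 \<Phi>3)+)
  show D1: "?\<Phi> ` D1 = (\<lambda>q. proj_point (L1 q)) ` I.X"
    using \<Phi>1 by (simp add: I.u_surj[symmetric] image_image)
  show "?\<Phi> ` points C = (\<lambda>q. proj_point (L1 q)) ` I.X \<union> (\<lambda>q. proj_point (L2 q)) ` {q \<in> II.X. fst q = 0} \<union>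
      (\<lambda>q. proj_point (L3 q)) ` {q \<in> III.X. fst q = 0}"
  proof (intro equalityI subsetI)
    fix e assume "e \<in> ?\<Phi> ` points C"
    then obtain p where p: "p \<in> points C" "e = ?\<Phi> p" by blast
    from p(1) show "e \<in> (\<lambda>q. proj_point (L1 q)) ` I.X \<union> (\<lambda>q. proj_point (L2 q)) ` {q \<in> II.X. fst q = 0} \<union>
      (\<lambda>q. proj_point (L3 q)) ` {q \<in> III.X. fst q = 0}"
      unfolding p(2) by (rule boundary_cases) (use \<Phi>1 \<Phi>2 \<Phi>3 in blast)+
  next
    fix e assume "e \<in> (\<lambda>q. proj_point (L1 q)) ` I.X \<union> (\<lambda>q. proj_point (L2 q)) ` {q \<in> II.X. fst q = 0} \<union>
      (\<lambda>q. proj_point (L3 q)) ` {q \<in> III.X. fst q = 0}"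
    then consider q where "q \<in> I.X" "e = proj_point (L1 q)" | q where "q \<in> II.X" "e = proj_point (L2 q)" | q where "q \<in> III.X" "e = proj_point (L3 q)"
      by blast
    thus "e \<in> ?\<Phi> ` points C"
    proof cases
      case 1
      from 1(1)[unfolded I.u_surj[symmetric]] obtain p where p: "q = u1 p" "p \<in> D1" by (elim imageE)
      have "p \<in> points C" using p(2) D_points by auto
      thus ?thesis using 1(2) p(1) \<Phi>1[OF p(2)] by (intro image_eqI[of _ _ p]) simp_all
    next
      case 2
      from 2(1)[unfolded II.u_surj[symmetric]] obtain p where p: "q = u2 p" "p \<in> D2" by (elim imageE)
      have "p \<in> points C" using p(2) D_points by auto
      thus ?thesis using 2(2) p(1) \<Phi>2[OF p(2)] by (intro image_eqI[of _ _ p]) simp_all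
    next
      case 3
      from 3(1)[unfolded III.u_surj[symmetric]] obtain p where p: "q = u3 p" "p \<in> D3" by (elim imageE)
      have "p \<in> points C" using p(2) D_points by auto
      thus ?thesis using 3(2) p(1) \<Phi>3[OF p(2)] by (intro image_eqI[of _ _ p]) simp_all
    qed
  qed
qed

subsection \<open>The bicanonical model in \<open>\<P>\<^sup>5\<close>\<close>

lemma I_X_iff: "(x, y, z) \<in> I.X \<longleftrightarrow> x \<noteq> 0 \<and> x * y ^ 2 = (x - \<alpha>2) * (x - \<alpha>3) \<and> x * z ^ 2 = (x - \<beta>2) * (x - \<beta>3)"
  by (simp add: I.X_def poly_quad)

lemma II_X_iff: "(x, y, z) \<in> II.X \<longleftrightarrow> (x - \<alpha>2) * (x - \<alpha>3) \<noteq> 0 \<and> (x - \<alpha>2) * (x - \<alpha>3) * y ^ 2 = x \<and>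
    (x - \<alpha>2) * (x - \<alpha>3) * z ^ 2 = (x - \<beta>2) * (x - \<beta>3)"
  by (simp add: II.X_def poly_quad)

lemma III_X_iff: "(x, y, z) \<in> III.X \<longleftrightarrow> (1 - \<alpha>2 * x) * (1 - \<alpha>3 * x) \<noteq> 0 \<and> (1 - \<alpha>2 * x) * (1 - \<alpha>3 * x) * y ^ 2 = x \<and>
    (1 - \<alpha>2 * x) * (1 - \<alpha>3 * x) * z ^ 2 = (1 - \<beta>2 * x) * (1 - \<beta>3 * x)"
  by (simp add: III.X_def poly_rquad)

definition M1 :: "'k \<times> 'k \<times> 'k \<Rightarrow> nat \<Rightarrow> 'k"
  where "M1 = (\<lambda>q. vec_of [1, fst (snd q), snd (snd q), fst (snd q) * snd (snd q), fst q, inverse (poly [:0, 1:] (fst q))])"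

text \<open>The vector \<open>M1\<close> multiplied by (x / y1)^2 and rewritten in the second chart,
  which removes the poles over x = 0. The vector \<open>M3\<close> is the same multiple in the third
  chart; there x times this factor is the inverse of \<open>rquad\<close> at 1 / x.\<close>

definition M2 :: "'k \<times> 'k \<times> 'k \<Rightarrow> nat \<Rightarrow> 'k"
  where "M2 = (\<lambda>q. vec_of [fst (snd q) * fst (snd q), fst (snd q), fst (snd q) * snd (snd q), snd (snd q),
    fst q * (fst (snd q) * fst (snd q)), inverse (poly (quad \<alpha>2 \<alpha>3) (fst q))])"

definition M3 :: "'k \<times> 'k \<times> 'k \<Rightarrow> nat \<Rightarrow> 'k"
  where "M3 = (\<lambda>q. vec_of [fst (snd q) * fst (snd q), fst (snd q), fst (snd q) * snd (snd q), snd (snd q),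
    inverse (poly (rquad \<alpha>2 \<alpha>3) (fst q)), fst q * (fst (snd q) * fst (snd q))])"

lemma M_R: "(\<lambda>q. M1 q i) \<in> I.R" "(\<lambda>q. M2 q i) \<in> II.R" "(\<lambda>q. M3 q i) \<in> III.R"
  unfolding M1_def M2_def M3_def
  by (intro I.R_vec_of_6 I.R_const I.R_mult I.R_x I.R_y I.R_z I.R_inverse_m
      II.R_vec_of_6 II.R_const II.R_mult II.R_x II.R_y II.R_z II.R_inverse_m
      III.R_vec_of_6 III.R_const III.R_mult III.R_x III.R_y III.R_z III.R_inverse_m)+

lemma M_points: "proj_point (M1 q) \<in> points (projective_space 5)"
  "q \<in> II.X \<Longrightarrow> proj_point (M2 q) \<in> points (projective_space 5)"
  "q \<in> III.X \<Longrightarrow> proj_point (M3 q) \<in> points (projective_space 5)"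
proof -
  show "proj_point (M1 q) \<in> points (projective_space 5)"
    unfolding M1_def by (rule vec_of_point[of _ _ 1]) auto
  show "proj_point (M2 q) \<in> points (projective_space 5)" if "q \<in> II.X"
    unfolding M2_def by (rule vec_of_point[of _ _ "inverse (poly (quad \<alpha>2 \<alpha>3) (fst q))"]) (use that in \<open>auto simp: II.X_def\<close>)
  show "proj_point (M3 q) \<in> points (projective_space 5)" if "q \<in> III.X"
    unfolding M3_def by (rule vec_of_point[of _ _ "inverse (poly (rquad \<alpha>2 \<alpha>3) (fst q))"]) (use that in \<open>auto simp: III.X_def\<close>)
qed

lemma M1_expressible: "I.expressible projective_fractions M1 fst" "I.expressible projective_fractions M1 (\<lambda>q. fst (snd q))"
    "I.expressible projective_fractions M1 (\<lambda>q. snd (snd q))"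
  by (rule I.expressibleI[OF projective_fractionsI[OF hom1[of 4] hom1[of 0]]], simp add: M1_def vec_of_6)
     (rule I.expressibleI[OF projective_fractionsI[OF hom1[of 1] hom1[of 0]]], simp add: M1_def vec_of_6,
      rule I.expressibleI[OF projective_fractionsI[OF hom1[of 2] hom1[of 0]]], simp add: M1_def vec_of_6)

text \<open>The homogenized \<open>quad\<close> in the ratio v0 / vi; \<open>den5'\<close> is the
  homogenized \<open>rquad\<close> in the same ratio. On \<open>M2\<close> with i = 5, respectively
  on \<open>M3\<close> with i = 4, this ratio is the first chart coordinate, and the form takes the
  value 1 / \<open>quad\<close>, respectively 1 / \<open>rquad\<close>, which has no zeros.\<close>

definition den5 :: "nat \<Rightarrow> (nat \<Rightarrow> 'k) \<Rightarrow> 'k"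
  where "den5 i = (\<lambda>v. v 0 ^ 2 - (\<alpha>2 + \<alpha>3) * (v 0 * v i) + \<alpha>2 * \<alpha>3 * v i ^ 2)"

definition den5' :: "nat \<Rightarrow> (nat \<Rightarrow> 'k) \<Rightarrow> 'k"
  where "den5' i = (\<lambda>v. v i ^ 2 - (\<alpha>2 + \<alpha>3) * (v 0 * v i) + \<alpha>2 * \<alpha>3 * v 0 ^ 2)"

lemma hom_den5: "homogeneous 2 (den5 i)" "homogeneous 2 (den5' i)"
  unfolding den5_def den5'_def by (intro homogeneous_diff homogeneous.add homogeneous_smult hom2)+

lemma M2_expressible: "II.expressible projective_fractions M2 fst" "II.expressible projective_fractions M2 (\<lambda>q. fst (snd q))"
    "II.expressible projective_fractions M2 (\<lambda>q. snd (snd q))"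
proof -
  have *: "M2 q 5 \<noteq> 0 \<and> fst q = M2 q 0 / M2 q 5 \<and> den5 5 (M2 q) \<noteq> 0 \<and>
      fst (snd q) = M2 q 1 * M2 q 5 / den5 5 (M2 q) \<and> snd (snd q) = M2 q 3 * M2 q 5 / den5 5 (M2 q)"
    if "q \<in> II.X" for q
  proof -
    obtain x y z where q: "q = (x, y, z)" by (cases q) auto
    let ?P = "poly (quad \<alpha>2 \<alpha>3) x"
    have P: "?P \<noteq> 0" "?P * y ^ 2 = x" using that unfolding q II.X_def by auto
    have c: "M2 q 0 = y ^ 2" "M2 q 1 = y" "M2 q 3 = z" "M2 q 5 = 1 / ?P"
      by (simp_all add: M2_def q vec_of_6 power2_eq_square inverse_eq_divide)
    have y2: "y ^ 2 = x / ?P" using P by (simp add: nonzero_eq_divide_eq mult.commute)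
    have "den5 5 (M2 q) = (x ^ 2 - (\<alpha>2 + \<alpha>3) * x + \<alpha>2 * \<alpha>3) / ?P ^ 2"
      unfolding den5_def c y2 by (simp add: power_divide diff_divide_distrib add_divide_distrib power2_eq_square)
    also have "x ^ 2 - (\<alpha>2 + \<alpha>3) * x + \<alpha>2 * \<alpha>3 = ?P"
      by (simp add: poly_quad algebra_simps power2_eq_square)
    finally have d: "den5 5 (M2 q) = 1 / ?P" using P(1) by (simp add: power2_eq_square)
    show ?thesis
      unfolding d c using P(1) y2 by (simp add: q)
  qed
  show "II.expressible projective_fractions M2 fst"
    by (rule II.expressibleI[OF projective_fractionsI[OF hom1[of 0] hom1[of 5]]]) (use * in blast)
  show "II.expressible projective_fractions M2 (\<lambda>q. fst (snd q))"
    by (rule II.expressibleI[OF projective_fractionsI[OF hom2(2)[of 1 5] hom_den5(1)[of 5]]]) (use * in blast)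
  show "II.expressible projective_fractions M2 (\<lambda>q. snd (snd q))"
    by (rule II.expressibleI[OF projective_fractionsI[OF hom2(2)[of 3 5] hom_den5(1)[of 5]]]) (use * in blast)
qed

lemma M3_expressible: "III.expressible projective_fractions M3 fst" "III.expressible projective_fractions M3 (\<lambda>q. fst (snd q))"
    "III.expressible projective_fractions M3 (\<lambda>q. snd (snd q))"
proof -
  have *: "M3 q 4 \<noteq> 0 \<and> fst q = M3 q 0 / M3 q 4 \<and> den5' 4 (M3 q) \<noteq> 0 \<and>
      fst (snd q) = M3 q 1 * M3 q 4 / den5' 4 (M3 q) \<and> snd (snd q) = M3 q 3 * M3 q 4 / den5' 4 (M3 q)"
    if "q \<in> III.X" for q
  proof -
    obtain x y z where q: "q = (x, y, z)" by (cases q) auto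
    let ?P = "poly (rquad \<alpha>2 \<alpha>3) x"
    have P: "?P \<noteq> 0" "?P * y ^ 2 = x" using that unfolding q III.X_def by auto
    have c: "M3 q 0 = y ^ 2" "M3 q 1 = y" "M3 q 3 = z" "M3 q 4 = 1 / ?P"
      by (simp_all add: M3_def q vec_of_6 power2_eq_square inverse_eq_divide)
    have y2: "y ^ 2 = x / ?P" using P by (simp add: nonzero_eq_divide_eq mult.commute)
    have "den5' 4 (M3 q) = (1 - (\<alpha>2 + \<alpha>3) * x + \<alpha>2 * \<alpha>3 * x ^ 2) / ?P ^ 2"
      unfolding den5'_def c y2 by (simp add: power_divide diff_divide_distrib add_divide_distrib power2_eq_square)
    also have "1 - (\<alpha>2 + \<alpha>3) * x + \<alpha>2 * \<alpha>3 * x ^ 2 = ?P"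
      by (simp add: poly_rquad algebra_simps power2_eq_square)
    finally have d: "den5' 4 (M3 q) = 1 / ?P" using P(1) by (simp add: power2_eq_square)
    show ?thesis
      unfolding d c using P(1) y2 by (simp add: q)
  qed
  show "III.expressible projective_fractions M3 fst"
    by (rule III.expressibleI[OF projective_fractionsI[OF hom1[of 0] hom1[of 4]]]) (use * in blast)
  show "III.expressible projective_fractions M3 (\<lambda>q. fst (snd q))"
    by (rule III.expressibleI[OF projective_fractionsI[OF hom2(2)[of 1 4] hom_den5(2)[of 4]]]) (use * in blast)
  show "III.expressible projective_fractions M3 (\<lambda>q. snd (snd q))"
    by (rule III.expressibleI[OF projective_fractionsI[OF hom2(2)[of 3 4] hom_den5(2)[of 4]]]) (use * in blast)
qed

lemma M_compat:
  assumes "x \<noteq> 0" "y1 \<noteq> 0" "poly (quad \<alpha>2 \<alpha>3) x = y1 ^ 2 / x" "poly (rquad \<alpha>2 \<alpha>3) (1 / x) = y1 ^ 2 / x ^ 3"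
  shows "proj_point (M2 (x, x / y1, y2 / y1)) = proj_point (M1 (x, y1 / x, y2 / x)) \<and>
      proj_point (M3 (1 / x, x / y1, y2 / y1)) = proj_point (M1 (x, y1 / x, y2 / x))"
proof -
  let ?k = "(x / y1) * (x / y1)"
  let ?l = "[1, y1 / x, y2 / x, y1 / x * (y2 / x), x, inverse x]"
  have k: "?k \<noteq> 0" using assms by simp
  have "M2 (x, x / y1, y2 / y1) = vec_of (map (\<lambda>a. ?k * a) ?l)" "M3 (1 / x, x / y1, y2 / y1) = vec_of (map (\<lambda>a. ?k * a) ?l)"
    unfolding M2_def M3_def fst_conv snd_conv assms(3,4) using assms(1,2)
    by (simp_all add: field_simps power2_eq_square power3_eq_cube)
  thus ?thesis
    using vec_of_scale[OF k, of ?l] by (simp add: M1_def)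
qed

lemma boundary_II: "q \<in> II.X \<Longrightarrow> fst q = 0 \<Longrightarrow> \<exists>t. q = (0, 0, t) \<and> \<alpha>2 * \<alpha>3 * t ^ 2 = \<beta>2 * \<beta>3"
  by (cases q) (auto simp: II_X_iff nonzero)

lemma boundary_III: "q \<in> III.X \<Longrightarrow> fst q = 0 \<Longrightarrow> \<exists>t. q = (0, 0, t) \<and> t ^ 2 = 1"
  by (cases q) (auto simp: III_X_iff)

end

lemma closed_zero_locus:
  assumes "homogeneous d h"
  shows "closedin (zariski (projective_space n)) {e \<in> points (projective_space n). \<forall>v\<in>e. h v = 0}"
proof -
  have "{e \<in> points (projective_space n). \<forall>v\<in>e. h v = 0} =
      points (projective_space n) - {e \<in> points (projective_space n). \<forall>v\<in>e. h v \<noteq> 0}"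
  proof (intro equalityI subsetI)
    fix e assume "e \<in> {e \<in> points (projective_space n). \<forall>v\<in>e. h v = 0}"
    thus "e \<in> points (projective_space n) - {e \<in> points (projective_space n). \<forall>v\<in>e. h v \<noteq> 0}"
      using proj_point_self unfolding points_projective_space by blast
  next
    fix e assume e: "e \<in> points (projective_space n) - {e \<in> points (projective_space n). \<forall>v\<in>e. h v \<noteq> 0}"
    then obtain w where w: "e = proj_point w" unfolding points_projective_space by blast
    hence "h w = 0" using e homogeneous_nonzero_iff[OF assms, of w] by blast
    hence "\<forall>v\<in>e. h v = 0"
      unfolding w proj_point_def by (auto simp: homogeneous_scale[OF assms])
    thus "e \<in> {e \<in> points (projective_space n). \<forall>v\<in>e. h v = 0}" using e by blast
  qed
  thus ?thesis
    using open_projective_basic[OF assms, of n] by (auto simp: points_def intro: closedin_diff)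
qed

lemma homogeneous_zero_iff: "homogeneous d h \<Longrightarrow> (\<forall>v\<in>proj_point w. h v = 0) \<longleftrightarrow> h w = 0"
  using proj_point_self[of w] by (auto simp: proj_point_def homogeneous_scale)

section \<open>Quadrics cutting out the image in P^5\<close>

context biquadratic_cover
begin

lemma M_embedding:
  "isomorphism C (subspace_on (projective_space 5) (glue M1 M2 M3 ` points C)) (glue M1 M2 M3)"
  "glue M1 M2 M3 ` points C = (\<lambda>q. proj_point (M1 q)) ` I.X \<union> (\<lambda>q. proj_point (M2 q)) ` {q \<in> II.X. fst q = 0} \<union>
      (\<lambda>q. proj_point (M3 q)) ` {q \<in> III.X. fst q = 0}"
proof -
  have 0: "M1 q 0 \<noteq> 0" for q by (simp add: M1_def vec_of_6)
  have 2: "M2 q 0 = 0 \<and> M2 q 4 = 0" if "q \<in> II.X" "fst q = 0" for q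
    using boundary_II[OF that] by (auto simp: M2_def vec_of_6)
  have 3: "M3 q 0 = 0 \<and> M3 q 4 \<noteq> 0" if "q \<in> III.X" "fst q = 0" for q
    using boundary_III[OF that] by (auto simp: M3_def vec_of_6 poly_rquad)
  have 23: "proj_point (M2 q) \<noteq> proj_point (M3 q')" if "q \<in> II.X" "fst q = 0" "q' \<in> III.X" "fst q' = 0" for q q'
  proof
    assume "proj_point (M2 q) = proj_point (M3 q')"
    then obtain c where "c \<noteq> 0" "\<And>i. M2 q i = c * M3 q' i" by (rule proj_point_eqD) auto
    thus False using 2[OF that(1,2)] 3[OF that(3,4)] by (metis mult_eq_0_iff)
  qed
  note g = glued_embedding[of M1 5 M2 M3]
  show "isomorphism C (subspace_on (projective_space 5) (glue M1 M2 M3 ` points C)) (glue M1 M2 M3)"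
    by (rule g(1); (assumption | rule M_R M_points M1_expressible M2_expressible M3_expressible M_compat 0 2[THEN conjunct1] 3[THEN conjunct1] 23)+)
  show "glue M1 M2 M3 ` points C = (\<lambda>q. proj_point (M1 q)) ` I.X \<union> (\<lambda>q. proj_point (M2 q)) ` {q \<in> II.X. fst q = 0} \<union>
      (\<lambda>q. proj_point (M3 q)) ` {q \<in> III.X. fst q = 0}"
    by (rule g(2); (assumption | rule M_R M_points M1_expressible M2_expressible M3_expressible M_compat 0 2[THEN conjunct1] 3[THEN conjunct1] 23)+)
qed

text \<open>The relations for y z, for x (1 / x), for y^2, for z^2 and, in \<open>qe\<close>, for (y
  z)^2. Where v0 \<noteq> 0 the last follows from the others; on v0 = 0 the others leave v3 free,
  and \<open>qe\<close> cuts out the points over x = 0 and x = \<infinity>.\<close>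

definition "qa v = v 0 * v 3 - v 1 * v (2::nat)" for v :: "nat \<Rightarrow> 'k"
definition "qb v = v 4 * v 5 - v 0 * v (0::nat)" for v :: "nat \<Rightarrow> 'k"
definition "qc v = v 1 * v 1 - (v 0 * v 4 - (\<alpha>2 + \<alpha>3) * (v 0 * v 0) + \<alpha>2 * \<alpha>3 * (v 0 * v (5::nat)))" for v :: "nat \<Rightarrow> 'k"
definition "qd v = v 2 * v 2 - (v 0 * v 4 - (\<beta>2 + \<beta>3) * (v 0 * v 0) + \<beta>2 * \<beta>3 * (v 0 * v (5::nat)))" for v :: "nat \<Rightarrow> 'k"
definition "qe v = v 3 * v 3 - (v 4 - (\<alpha>2 + \<alpha>3) * v 0 + \<alpha>2 * \<alpha>3 * v (5::nat)) * (v 4 - (\<beta>2 + \<beta>3) * v 0 + \<beta>2 * \<beta>3 * v 5)" for v :: "nat \<Rightarrow> 'k"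

lemma hom_q: "homogeneous 2 qa" "homogeneous 2 qb" "homogeneous 2 qc" "homogeneous 2 qd" "homogeneous 2 qe"
proof -
  show "homogeneous 2 qa" "homogeneous 2 qb" "homogeneous 2 qc" "homogeneous 2 qd"
    unfolding qa_def[abs_def] qb_def[abs_def] qc_def[abs_def] qd_def[abs_def]
    by (intro homogeneous_diff homogeneous.add homogeneous_smult hom2)+
  show "homogeneous 2 qe"
    unfolding qe_def[abs_def]
    by (intro homogeneous_diff hom2 homogeneous_mult'[of 1 _ 1] homogeneous.add homogeneous_smult hom1) simp
qed

lemma bicanonical_image_closed:
  "closedin (zariski (projective_space 5)) (glue M1 M2 M3 ` points C)"
proof -
  let ?P = "points (projective_space 5 :: ((nat \<Rightarrow> 'k) set, 'k) kspace)"
  let ?Z = "\<lambda>h :: (nat \<Rightarrow> 'k) \<Rightarrow> 'k. {e \<in> ?P. \<forall>v\<in>e. h v = 0}"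
  let ?S = "?Z qa \<inter> ?Z qb \<inter> ?Z qc \<inter> ?Z qd \<inter> ?Z qe"
  have mem: "proj_point v \<in> ?S \<longleftrightarrow> proj_point v \<in> ?P \<and> qa v = 0 \<and> qb v = 0 \<and> qc v = 0 \<and> qd v = 0 \<and> qe v = 0" for v
    unfolding Int_iff mem_Collect_eq homogeneous_zero_iff[OF hom_q(1)] homogeneous_zero_iff[OF hom_q(2)]
      homogeneous_zero_iff[OF hom_q(3)] homogeneous_zero_iff[OF hom_q(4)] homogeneous_zero_iff[OF hom_q(5)] by blast
  have "glue M1 M2 M3 ` points C = ?S"
  proof (intro equalityI subsetI)
    fix e assume "e \<in> glue M1 M2 M3 ` points C"
    then consider q where "q \<in> I.X" "e = proj_point (M1 q)" | q where "q \<in> II.X" "fst q = 0" "e = proj_point (M2 q)"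
      | q where "q \<in> III.X" "fst q = 0" "e = proj_point (M3 q)"
      unfolding M_embedding(2) by blast
    thus "e \<in> ?S"
    proof cases
      case 1
      obtain x y z where q: "q = (x, y, z)" by (cases q) auto
      have x: "x \<noteq> 0" "x * y ^ 2 = (x - \<alpha>2) * (x - \<alpha>3)" "x * z ^ 2 = (x - \<beta>2) * (x - \<beta>3)"
        using 1(1) unfolding q I_X_iff by auto
      have y: "y * y = x - (\<alpha>2 + \<alpha>3) + \<alpha>2 * \<alpha>3 * inverse x" "z * z = x - (\<beta>2 + \<beta>3) + \<beta>2 * \<beta>3 * inverse x"
        using x by (simp_all add: field_simps power2_eq_square)
      have "(y * z) * (y * z) = (y * y) * (z * z)" by simp
      thus ?thesis
        unfolding 1(2) mem using M_points(1)[of q] x(1) y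
        by (simp add: qa_def qb_def qc_def qd_def qe_def M1_def q vec_of_6)
    next
      case 2
      obtain t where t: "q = (0, 0, t)" "\<alpha>2 * \<alpha>3 * t ^ 2 = \<beta>2 * \<beta>3" using boundary_II[OF 2(1,2)] by blast
      have "t * t = (\<alpha>2 * \<alpha>3 * inverse (\<alpha>2 * \<alpha>3)) * (\<beta>2 * \<beta>3 * inverse (\<alpha>2 * \<alpha>3))"
        unfolding t(2)[symmetric] using nonzero by (simp add: field_simps power2_eq_square)
      thus ?thesis
        unfolding 2(3) mem using M_points(2)[OF 2(1)]
        by (simp add: qa_def qb_def qc_def qd_def qe_def M2_def t(1) vec_of_6 poly_quad)
    next
      case 3
      obtain t where t: "q = (0, 0, t)" "t ^ 2 = 1" using boundary_III[OF 3(1,2)] by blast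
      show ?thesis
        unfolding 3(3) mem using M_points(3)[OF 3(1)] t(2)
        by (simp add: qa_def qb_def qc_def qd_def qe_def M3_def t(1) vec_of_6 poly_rquad power2_eq_square)
    qed
  next
    fix e assume e: "e \<in> ?S"
    then obtain v where v: "e = proj_point v" "\<exists>i. v i \<noteq> 0" "\<forall>i>5. v i = 0"
      unfolding points_projective_space by blast
    have q: "qa v = 0" "qb v = 0" "qc v = 0" "qd v = 0" "qe v = 0"
      using e unfolding v(1) mem by auto
    have vv: "v = vec_of [v 0, v 1, v 2, v 3, v 4, v 5]"
    proof (rule vec_of_nth_eqI[of 5])
      fix i :: nat assume "i \<le> 5"
      hence "i = 0 \<or> i = 1 \<or> i = 2 \<or> i = 3 \<or> i = 4 \<or> i = 5" by linarith
      thus "v i = [v 0, v 1, v 2, v 3, v 4, v 5] ! i" by auto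
    qed (use v(3) in auto)
    have scale: "e = proj_point (vec_of xs)" if "k \<noteq> 0" "[v 0, v 1, v 2, v 3, v 4, v 5] = map (\<lambda>x. k * x) xs" for k xs
      using vec_of_scale[OF that(1), of xs] that(2) vv v(1) by metis
    show "e \<in> glue M1 M2 M3 ` points C"
    proof (cases "v 0 = 0")
      case False
      define x y z where "x = v 4 / v 0" and "y = v 1 / v 0" and "z = v 2 / v 0"
      have c: "v 4 = v 0 * x" "v 1 = v 0 * y" "v 2 = v 0 * z"
        using False by (simp_all add: x_def y_def z_def)
      have 5: "x * v 5 = v 0"
        using q(2) False by (simp add: qb_def c)
      hence x0: "x \<noteq> 0" using False by auto
      have c5: "v 5 = v 0 * inverse x" using 5 x0 by (simp add: field_simps)
      have "v 0 * v 3 - (v 0 * y) * (v 0 * z) = 0" using q(1) unfolding qa_def c .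
      hence "v 0 * (v 3 - v 0 * (y * z)) = 0" by (simp add: algebra_simps)
      hence c3: "v 3 = v 0 * (y * z)" using False by simp
      have "v 0 * v 0 * (y ^ 2 - (x - (\<alpha>2 + \<alpha>3) + \<alpha>2 * \<alpha>3 * inverse x)) = 0"
        using q(3) unfolding qc_def c c5 by (simp add: algebra_simps power2_eq_square)
      hence y2: "y ^ 2 = x - (\<alpha>2 + \<alpha>3) + \<alpha>2 * \<alpha>3 * inverse x" using False by simp
      have "v 0 * v 0 * (z ^ 2 - (x - (\<beta>2 + \<beta>3) + \<beta>2 * \<beta>3 * inverse x)) = 0"
        using q(4) unfolding qd_def c c5 by (simp add: algebra_simps power2_eq_square)
      hence z2: "z ^ 2 = x - (\<beta>2 + \<beta>3) + \<beta>2 * \<beta>3 * inverse x" using False by simp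
      have "(x, y, z) \<in> I.X"
        unfolding I_X_iff y2 z2 using x0 by (simp add: field_simps)
      moreover have "e = proj_point (M1 (x, y, z))"
        unfolding M1_def using False c c3 c5 by (intro scale[of "v 0"]) simp_all
      ultimately show ?thesis unfolding M_embedding(2) by blast
    next
      case True
      have z: "v 1 = 0" "v 2 = 0" using q(3,4) True by (simp_all add: qc_def qd_def)
      have 45: "v 4 * v 5 = 0" using q(2) True by (simp add: qb_def)
      have 33: "v 3 * v 3 = (v 4 + \<alpha>2 * \<alpha>3 * v 5) * (v 4 + \<beta>2 * \<beta>3 * v 5)" using q(5) True by (simp add: qe_def)
      show ?thesis
      proof (cases "v 4 = 0")
        case F4: True
        have v5: "v 5 \<noteq> 0"
        proof
          assume "v 5 = 0"
          hence "v 3 = 0" using 33 F4 by simp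
          hence "v = vec_of [0, 0, 0, 0, 0, 0]" using vv True z F4 \<open>v 5 = 0\<close> by simp
          thus False using v(2) by (auto simp: vec_of_def nth_Cons split: if_splits nat.splits)
        qed
        \<comment> \<open>Chosen so that v5 / k is the last coordinate of \<open>M2\<close> over x =
          0, namely 1 / (\<alpha>2 \<alpha>3).\<close>
        define k where "k = v 5 * (\<alpha>2 * \<alpha>3)"
        have k: "k \<noteq> 0" using v5 nonzero by (simp add: k_def)
        define t where "t = v 3 / k"
        have c: "v 3 = k * t" "v 5 = k * inverse (\<alpha>2 * \<alpha>3)" using k nonzero by (simp_all add: t_def k_def field_simps)
        have "k * t * (k * t) = \<alpha>2 * \<alpha>3 * (\<beta>2 * \<beta>3) * v 5 ^ 2" using 33 F4 unfolding c(1) by (simp add: power2_eq_square)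
        also have "\<alpha>2 * \<alpha>3 * \<dots> = k * k * (\<beta>2 * \<beta>3)" by (simp add: k_def power2_eq_square)
        finally have "k * k * (\<alpha>2 * \<alpha>3 * t ^ 2) = k * k * (\<beta>2 * \<beta>3)"
          by (simp add: power2_eq_square mult.assoc mult.left_commute)
        hence "(0, 0, t) \<in> II.X" unfolding II_X_iff using k nonzero by simp
        moreover have "e = proj_point (M2 (0, 0, t))"
          unfolding M2_def using True z F4 c by (intro scale[OF k]) (simp add: poly_quad)
        ultimately show ?thesis unfolding M_embedding(2) by force
      next
        case F4: False
        hence v5: "v 5 = 0" using 45 by simp
        define t where "t = v 3 / v 4"
        have c: "v 3 = v 4 * t" using F4 by (simp add: t_def)
        have "v 4 * v 4 * (t ^ 2) = v 4 * v 4 * 1" using 33 v5 unfolding c by (simp add: power2_eq_square mult.assoc mult.left_commute)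
        hence "(0, 0, t) \<in> III.X" unfolding III_X_iff using F4 by simp
        moreover have "e = proj_point (M3 (0, 0, t))"
          unfolding M3_def using True z F4 c v5 by (intro scale[OF F4]) (simp add: poly_rquad)
        ultimately show ?thesis unfolding M_embedding(2) by force
      qed
    qed
  qed
  moreover have "closedin (zariski (projective_space 5)) ?S"
    by (intro closedin_Int closed_zero_locus[OF hom_q(1)] closed_zero_locus[OF hom_q(2)] closed_zero_locus[OF hom_q(3)]
        closed_zero_locus[OF hom_q(4)] closed_zero_locus[OF hom_q(5)])
  ultimately show ?thesis by simp
qed

lemma projective_C: "is_projective C"
  unfolding is_projective_def isomorphic_def using M_embedding(1) bicanonical_image_closed by blast

end

subsection \<open>The plane quartic\<close>

locale nonhyperelliptic_cover = biquadratic_cover \<alpha>2 \<alpha>3 \<beta>2 \<beta>3 C \<nu>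
  for \<alpha>2 \<alpha>3 \<beta>2 \<beta>3 :: "'k :: alg_closed_field" and C :: "('c, 'k) kspace" and \<nu> +
  assumes products_differ: "\<alpha>2 * \<alpha>3 \<noteq> \<beta>2 * \<beta>3"
begin

abbreviation "\<tau>1 \<equiv> \<alpha>2 + \<alpha>3"
abbreviation "\<tau>2 \<equiv> \<alpha>2 * \<alpha>3"
abbreviation "\<rho>1 \<equiv> \<beta>2 + \<beta>3"
abbreviation "\<rho>2 \<equiv> \<beta>2 * \<beta>3"

definition "\<delta> = \<tau>2 - \<rho>2"

lemma \<delta>: "\<delta> \<noteq> 0"
  using products_differ by (simp add: \<delta>_def)

text \<open>On the curve, \<open>fa = \<delta> / x\<close> and \<open>fb = \<delta> x\<close>; the quartic is \<open>fa fb = \<delta>\<^sup>2\<close>.\<close>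

definition fa :: "(nat \<Rightarrow> 'k) \<Rightarrow> 'k"
  where "fa v = v 1 ^ 2 - v 2 ^ 2 + (\<tau>1 - \<rho>1) * v 0 ^ 2"

definition fb :: "(nat \<Rightarrow> 'k) \<Rightarrow> 'k"
  where "fb v = \<tau>2 * v 2 ^ 2 - \<rho>2 * v 1 ^ 2 + (\<tau>2 * \<rho>1 - \<rho>2 * \<tau>1) * v 0 ^ 2"

lemma hom_f: "homogeneous 2 fa" "homogeneous 2 fb"
  unfolding fa_def[abs_def] fb_def[abs_def]
  by (intro homogeneous_diff homogeneous.add homogeneous_smult hom2)+

definition N1 :: "'k \<times> 'k \<times> 'k \<Rightarrow> nat \<Rightarrow> 'k"
  where "N1 = (\<lambda>q. vec_of [1, fst (snd q), snd (snd q)])"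

text \<open>The vector \<open>N1\<close> multiplied by x / y1. It serves the second and the third
  chart alike, since the last two coordinates of both are x / y1 and y2 / y1.\<close>

definition N2 :: "'k \<times> 'k \<times> 'k \<Rightarrow> nat \<Rightarrow> 'k"
  where "N2 = (\<lambda>q. vec_of [fst (snd q), 1, snd (snd q)])"

lemma N_eval: "N1 (x, y, z) 0 = 1" "N1 (x, y, z) 1 = y" "N1 (x, y, z) (Suc 0) = y" "N1 (x, y, z) 2 = z"
    "N2 (x, y, z) 0 = y" "N2 (x, y, z) 1 = 1" "N2 (x, y, z) (Suc 0) = 1" "N2 (x, y, z) 2 = z"
  by (simp_all add: N1_def N2_def vec_of_3)

lemma I_fb: "(x, y, z) \<in> I.X \<Longrightarrow> fb (N1 (x, y, z)) = \<delta> * x"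
proof -
  assume "(x, y, z) \<in> I.X"
  hence x: "x \<noteq> 0" "x * y ^ 2 = (x - \<alpha>2) * (x - \<alpha>3)" "x * z ^ 2 = (x - \<beta>2) * (x - \<beta>3)"
    unfolding I_X_iff by auto
  have "x * fb (N1 (x, y, z)) = \<tau>2 * (x * z ^ 2) - \<rho>2 * (x * y ^ 2) + (\<tau>2 * \<rho>1 - \<rho>2 * \<tau>1) * x"
    by (simp add: fb_def N_eval algebra_simps)
  also have "\<dots> = x * (\<delta> * x)"
    unfolding x(2,3) \<delta>_def by algebra
  finally show ?thesis using x(1) by simp
qed

lemma I_fa: "(x, y, z) \<in> I.X \<Longrightarrow> x * fa (N1 (x, y, z)) = \<delta>"
proof -
  assume "(x, y, z) \<in> I.X"
  hence x: "x * y ^ 2 = (x - \<alpha>2) * (x - \<alpha>3)" "x * z ^ 2 = (x - \<beta>2) * (x - \<beta>3)"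
    unfolding I_X_iff by auto
  have "x * fa (N1 (x, y, z)) = x * y ^ 2 - x * z ^ 2 + (\<tau>1 - \<rho>1) * x"
    by (simp add: fa_def N_eval algebra_simps)
  thus ?thesis unfolding x \<delta>_def by algebra
qed

text \<open>Over x = 0 the form \<open>fb\<close> vanishes at \<open>N2\<close>, so x is recovered
  from \<open>fa\<close>, which has no zeros here: x = \<delta> y^2 / fa. Over infinity the two
  forms exchange roles.\<close>

lemma II_fa: "(x, y, z) \<in> II.X \<Longrightarrow> (x - \<alpha>2) * (x - \<alpha>3) * fa (N2 (x, y, z)) = \<delta>"
proof -
  let ?P = "(x - \<alpha>2) * (x - \<alpha>3)"
  assume "(x, y, z) \<in> II.X"
  hence x: "?P * y ^ 2 = x" "?P * z ^ 2 = (x - \<beta>2) * (x - \<beta>3)"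
    unfolding II_X_iff by auto
  have "?P * fa (N2 (x, y, z)) = ?P - ?P * z ^ 2 + (\<tau>1 - \<rho>1) * (?P * y ^ 2)"
    by (simp add: fa_def N_eval algebra_simps)
  thus ?thesis unfolding x \<delta>_def by algebra
qed

lemma III_fb: "(x, y, z) \<in> III.X \<Longrightarrow> (1 - \<alpha>2 * x) * (1 - \<alpha>3 * x) * fb (N2 (x, y, z)) = \<delta>"
proof -
  let ?P = "(1 - \<alpha>2 * x) * (1 - \<alpha>3 * x)"
  assume "(x, y, z) \<in> III.X"
  hence x: "?P * y ^ 2 = x" "?P * z ^ 2 = (1 - \<beta>2 * x) * (1 - \<beta>3 * x)"
    unfolding III_X_iff by auto
  have "?P * fb (N2 (x, y, z)) = \<tau>2 * (?P * z ^ 2) - \<rho>2 * ?P + (\<tau>2 * \<rho>1 - \<rho>2 * \<tau>1) * (?P * y ^ 2)"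
    by (simp add: fb_def N_eval algebra_simps)
  thus ?thesis unfolding x \<delta>_def by algebra
qed

lemma N_R: "(\<lambda>q. N1 q i) \<in> I.R" "(\<lambda>q. N2 q i) \<in> II.R" "(\<lambda>q. N2 q i) \<in> III.R"
  unfolding N1_def N2_def
  by (intro I.R_vec_of_3 I.R_const I.R_y I.R_z II.R_vec_of_3 II.R_const II.R_y II.R_z
      III.R_vec_of_3 III.R_const III.R_y III.R_z)+

lemma N_points: "proj_point (N1 q) \<in> points (projective_space 2)" "proj_point (N2 q) \<in> points (projective_space 2)"
  unfolding N1_def N2_def by (rule vec_of_point[of _ _ 1]; simp)+

lemma N1_expressible: "I.expressible projective_fractions N1 fst" "I.expressible projective_fractions N1 (\<lambda>q. fst (snd q))"
    "I.expressible projective_fractions N1 (\<lambda>q. snd (snd q))"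
proof -
  show "I.expressible projective_fractions N1 fst"
  proof (rule I.expressibleI[OF projective_fractionsI[OF hom_f(2) homogeneous_smult[OF hom2(1)[of 0], of \<delta>]]])
    fix q assume q: "q \<in> I.X"
    obtain x y z where xyz: "q = (x, y, z)" by (cases q) auto
    show "\<delta> * N1 q 0 ^ 2 \<noteq> 0 \<and> fst q = fb (N1 q) / (\<delta> * N1 q 0 ^ 2)"
      using I_fb q \<delta> by (simp add: xyz N_eval)
  qed
  show "I.expressible projective_fractions N1 (\<lambda>q. fst (snd q))"
    by (rule I.expressibleI[OF projective_fractionsI[OF hom1[of 1] hom1[of 0]]]) (simp add: N1_def vec_of_3)
  show "I.expressible projective_fractions N1 (\<lambda>q. snd (snd q))"
    by (rule I.expressibleI[OF projective_fractionsI[OF hom1[of 2] hom1[of 0]]]) (simp add: N1_def vec_of_3)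
qed

lemma N2_expressible: "II.expressible projective_fractions N2 fst" "II.expressible projective_fractions N2 (\<lambda>q. fst (snd q))"
    "II.expressible projective_fractions N2 (\<lambda>q. snd (snd q))"
proof -
  show "II.expressible projective_fractions N2 fst"
  proof (rule II.expressibleI[OF projective_fractionsI[OF homogeneous_smult[OF hom2(1)[of 0], of \<delta>] hom_f(1)]])
    fix q assume q: "q \<in> II.X"
    obtain x y z where xyz: "q = (x, y, z)" by (cases q) auto
    let ?P = "(x - \<alpha>2) * (x - \<alpha>3)" and ?f = "fa (N2 q)"
    have f: "?P * ?f = \<delta>" using II_fa q by (simp add: xyz)
    have P: "?P * y ^ 2 = x" using q unfolding xyz II_X_iff by auto
    have "?f \<noteq> 0" using f \<delta> by auto
    moreover have "x * ?f = \<delta> * y ^ 2"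
    proof -
      have "x * ?f = (?P * y ^ 2) * ?f" by (simp only: P)
      also have "\<dots> = (?P * ?f) * y ^ 2" by (simp only: mult.assoc mult.left_commute mult.commute)
      finally show ?thesis by (simp only: f)
    qed
    ultimately show "?f \<noteq> 0 \<and> fst q = \<delta> * N2 q 0 ^ 2 / ?f"
      by (simp add: xyz N_eval nonzero_eq_divide_eq)
  qed
  show "II.expressible projective_fractions N2 (\<lambda>q. fst (snd q))"
    by (rule II.expressibleI[OF projective_fractionsI[OF hom1[of 0] hom1[of 1]]]) (simp add: N2_def vec_of_3)
  show "II.expressible projective_fractions N2 (\<lambda>q. snd (snd q))"
    by (rule II.expressibleI[OF projective_fractionsI[OF hom1[of 2] hom1[of 1]]]) (simp add: N2_def vec_of_3)
qed

lemma N3_expressible: "III.expressible projective_fractions N2 fst" "III.expressible projective_fractions N2 (\<lambda>q. fst (snd q))"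
    "III.expressible projective_fractions N2 (\<lambda>q. snd (snd q))"
proof -
  show "III.expressible projective_fractions N2 fst"
  proof (rule III.expressibleI[OF projective_fractionsI[OF homogeneous_smult[OF hom2(1)[of 0], of \<delta>] hom_f(2)]])
    fix q assume q: "q \<in> III.X"
    obtain x y z where xyz: "q = (x, y, z)" by (cases q) auto
    let ?P = "(1 - \<alpha>2 * x) * (1 - \<alpha>3 * x)" and ?f = "fb (N2 q)"
    have f: "?P * ?f = \<delta>" using III_fb q by (simp add: xyz)
    have P: "?P * y ^ 2 = x" using q unfolding xyz III_X_iff by auto
    have "?f \<noteq> 0" using f \<delta> by auto
    moreover have "x * ?f = \<delta> * y ^ 2"
    proof -
      have "x * ?f = (?P * y ^ 2) * ?f" by (simp only: P)
      also have "\<dots> = (?P * ?f) * y ^ 2" by (simp only: mult.assoc mult.left_commute mult.commute)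
      finally show ?thesis by (simp only: f)
    qed
    ultimately show "?f \<noteq> 0 \<and> fst q = \<delta> * N2 q 0 ^ 2 / ?f"
      by (simp add: xyz N_eval nonzero_eq_divide_eq)
  qed
  show "III.expressible projective_fractions N2 (\<lambda>q. fst (snd q))"
    by (rule III.expressibleI[OF projective_fractionsI[OF hom1[of 0] hom1[of 1]]]) (simp add: N2_def vec_of_3)
  show "III.expressible projective_fractions N2 (\<lambda>q. snd (snd q))"
    by (rule III.expressibleI[OF projective_fractionsI[OF hom1[of 2] hom1[of 1]]]) (simp add: N2_def vec_of_3)
qed

lemma N_compat:
  assumes "x \<noteq> 0" "y1 \<noteq> 0"
  shows "proj_point (N2 (x, x / y1, y2 / y1)) = proj_point (N1 (x, y1 / x, y2 / x)) \<and>
      proj_point (N2 (1 / x, x / y1, y2 / y1)) = proj_point (N1 (x, y1 / x, y2 / x))"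
proof -
  have k: "x / y1 \<noteq> 0" using assms by simp
  have "N2 (x, x / y1, y2 / y1) = vec_of (map (\<lambda>a. x / y1 * a) [1, y1 / x, y2 / x])"
    "N2 (1 / x, x / y1, y2 / y1) = vec_of (map (\<lambda>a. x / y1 * a) [1, y1 / x, y2 / x])"
    using assms by (simp_all add: N2_def)
  thus ?thesis
    using vec_of_scale[OF k, of "[1, y1 / x, y2 / x]"] by (simp add: N1_def)
qed

lemma N_embedding:
  "isomorphism C (subspace_on (projective_space 2) (glue N1 N2 N2 ` points C)) (glue N1 N2 N2)"
  "glue N1 N2 N2 ` points C = (\<lambda>q. proj_point (N1 q)) ` I.X \<union> (\<lambda>q. proj_point (N2 q)) ` {q \<in> II.X. fst q = 0} \<union>
      (\<lambda>q. proj_point (N2 q)) ` {q \<in> III.X. fst q = 0}"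
  "glue N1 N2 N2 ` D1 = (\<lambda>q. proj_point (N1 q)) ` I.X"
proof -
  have 0: "N1 q 0 \<noteq> 0" for q by (simp add: N1_def vec_of_3)
  have 2: "N2 q 0 = 0" if "q \<in> II.X" "fst q = 0" for q
    using boundary_II[OF that] by (auto simp: N_eval)
  have 3: "N2 q 0 = 0" if "q \<in> III.X" "fst q = 0" for q
    using boundary_III[OF that] by (auto simp: N_eval)
  have 23: "proj_point (N2 q) \<noteq> proj_point (N2 q')" if qq: "q \<in> II.X" "fst q = 0" "q' \<in> III.X" "fst q' = 0" for q q'
  proof
    obtain t t' where t: "q = (0, 0, t)" "\<tau>2 * t ^ 2 = \<rho>2" "q' = (0, 0, t')" "t' ^ 2 = 1"
      using boundary_II[OF qq(1,2)] boundary_III[OF qq(3,4)] by blast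
    assume "proj_point (N2 q) = proj_point (N2 q')"
    then obtain c where c: "c \<noteq> 0" "\<And>i. N2 q i = c * N2 q' i" by (rule proj_point_eqD) auto
    have "c = 1" using c(2)[of 1] by (simp add: t N_eval)
    hence "t = t'" using c(2)[of 2] by (simp add: t N_eval)
    thus False using t(2,4) products_differ by simp
  qed
  note g = glued_embedding[of N1 2 N2 N2]
  show "isomorphism C (subspace_on (projective_space 2) (glue N1 N2 N2 ` points C)) (glue N1 N2 N2)"
    by (rule g(1); (assumption | rule N_R N_points N1_expressible N2_expressible N3_expressible N_compat 0 2 3 23)+)
  show "glue N1 N2 N2 ` points C = (\<lambda>q. proj_point (N1 q)) ` I.X \<union> (\<lambda>q. proj_point (N2 q)) ` {q \<in> II.X. fst q = 0} \<union>
      (\<lambda>q. proj_point (N2 q)) ` {q \<in> III.X. fst q = 0}"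
    by (rule g(2); (assumption | rule N_R N_points N1_expressible N2_expressible N3_expressible N_compat 0 2 3 23)+)
  show "glue N1 N2 N2 ` D1 = (\<lambda>q. proj_point (N1 q)) ` I.X"
    by (rule g(3); (assumption | rule N_R N_points N1_expressible N2_expressible N3_expressible N_compat 0 2 3 23)+)
qed

section \<open>The equation of the canonical image\<close>

definition fq :: "(nat \<Rightarrow> 'k) \<Rightarrow> 'k"
  where "fq v = \<delta> ^ 2 * (v 0 ^ 2) ^ 2 - fa v * fb v"

lemma hom_fq: "homogeneous 4 fq"
proof -
  have "homogeneous 4 (\<lambda>v :: nat \<Rightarrow> 'k. (v 0 ^ 2) ^ 2)"
    using homogeneous_power[OF hom2(1), of 2] by simp
  thus ?thesis
    unfolding fq_def[abs_def]
    by (intro homogeneous_diff homogeneous_smult homogeneous_mult'[OF hom_f]) auto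
qed

lemma poly2_plane_quartic: "poly2 (plane_quartic \<alpha>2 \<alpha>3 \<beta>2 \<beta>3) y z = fq (vec_of [1, y, z])"
  unfolding poly2_def plane_quartic_def Let_def fq_def fa_def fb_def \<delta>_def
  by (simp add: vec_of_3) algebra

lemma affine_part: "{proj_point (vec_of [1, y, z]) | y z. poly2 (plane_quartic \<alpha>2 \<alpha>3 \<beta>2 \<beta>3) y z = 0} = (\<lambda>q. proj_point (N1 q)) ` I.X"
proof (intro equalityI subsetI)
  fix e assume "e \<in> {proj_point (vec_of [1, y, z]) | y z. poly2 (plane_quartic \<alpha>2 \<alpha>3 \<beta>2 \<beta>3) y z = 0}"
  then obtain y z where yz: "e = proj_point (vec_of [1, y, z])" "fq (vec_of [1, y, z]) = 0"
    unfolding poly2_plane_quartic by blast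
  let ?v = "vec_of [1, y, z]"
  define x where "x = fb ?v / \<delta>"
  have ab: "fa ?v * fb ?v = \<delta> ^ 2" using yz(2) by (simp add: fq_def vec_of_3)
  have x0: "x \<noteq> 0" using ab \<delta> by (auto simp: x_def)
  have b: "fb ?v = \<delta> * x" using \<delta> by (simp add: x_def)
  have "x * fa ?v * \<delta> = \<delta> * \<delta>" using ab unfolding b by (simp add: power2_eq_square mult.assoc mult.left_commute mult.commute)
  hence a: "x * fa ?v = \<delta>" using \<delta> by simp
  have a': "x * (y ^ 2 - z ^ 2 + (\<tau>1 - \<rho>1)) = \<delta>" using a by (simp add: fa_def vec_of_3)
  have b': "\<tau>2 * z ^ 2 - \<rho>2 * y ^ 2 + (\<tau>2 * \<rho>1 - \<rho>2 * \<tau>1) = \<delta> * x" using b by (simp add: fb_def vec_of_3)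
  \<comment> \<open>Two linear equations for y^2 and z^2 with determinant \<tau>2 - \<rho>2 =
    \<delta>.\<close>
  have "\<delta> * (x * y ^ 2 - (x - \<alpha>2) * (x - \<alpha>3)) = 0" "\<delta> * (x * z ^ 2 - (x - \<beta>2) * (x - \<beta>3)) = 0"
    using a' b' unfolding \<delta>_def by algebra+
  hence "(x, y, z) \<in> I.X" unfolding I_X_iff using x0 \<delta> by simp
  thus "e \<in> (\<lambda>q. proj_point (N1 q)) ` I.X"
    using yz(1) by (intro image_eqI[of _ _ "(x, y, z)"]) (simp_all add: N1_def)
next
  fix e assume "e \<in> (\<lambda>q. proj_point (N1 q)) ` I.X"
  then obtain x y z where q: "(x, y, z) \<in> I.X" "e = proj_point (N1 (x, y, z))" by auto
  have "x \<noteq> 0" using q(1) by (simp add: I_X_iff)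
  have "x * (fa (N1 (x, y, z)) * fb (N1 (x, y, z))) = (x * fa (N1 (x, y, z))) * fb (N1 (x, y, z))"
    by (simp only: mult.assoc)
  hence "x * (fa (N1 (x, y, z)) * fb (N1 (x, y, z))) = x * \<delta> ^ 2"
    unfolding I_fa[OF q(1)] I_fb[OF q(1)] by (simp add: power2_eq_square)
  hence "fa (N1 (x, y, z)) * fb (N1 (x, y, z)) = \<delta> ^ 2"
    using \<open>x \<noteq> 0\<close> by simp
  moreover have "N1 (x, y, z) = vec_of [1, y, z]" by (simp add: N1_def)
  ultimately have "fa (vec_of [1, y, z]) * fb (vec_of [1, y, z]) = \<delta> ^ 2" by simp
  hence "fq (vec_of [1, y, z]) = 0" by (simp only: fq_def) (simp add: vec_of_3)
  thus "e \<in> {proj_point (vec_of [1, y, z]) | y z. poly2 (plane_quartic \<alpha>2 \<alpha>3 \<beta>2 \<beta>3) y z = 0}"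
    unfolding poly2_plane_quartic q(2) N1_def by auto
qed

lemma quartic_image: "glue N1 N2 N2 ` points C = {e \<in> points (projective_space 2). \<forall>v\<in>e. fq v = 0}"
proof (intro equalityI subsetI)
  fix e assume "e \<in> glue N1 N2 N2 ` points C"
  then consider q where "q \<in> I.X" "e = proj_point (N1 q)" | q where "q \<in> II.X" "fst q = 0" "e = proj_point (N2 q)"
    | q where "q \<in> III.X" "fst q = 0" "e = proj_point (N2 q)"
    unfolding N_embedding(2) by blast
  thus "e \<in> {e \<in> points (projective_space 2). \<forall>v\<in>e. fq v = 0}"
  proof cases
    case 1
    hence "e \<in> {proj_point (vec_of [1, y, z]) | y z. poly2 (plane_quartic \<alpha>2 \<alpha>3 \<beta>2 \<beta>3) y z = 0}"
      unfolding affine_part by blast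
    thus ?thesis
      unfolding poly2_plane_quartic using homogeneous_zero_iff[OF hom_fq] affine_point_in_P2 by blast
  next
    case 2
    obtain t where t: "q = (0, 0, t)" "\<tau>2 * t ^ 2 = \<rho>2" using boundary_II[OF 2(1,2)] by blast
    have "fq (N2 q) = 0" using t(2) by (simp add: t(1) fq_def fa_def fb_def N_eval)
    thus ?thesis unfolding 2(3) using homogeneous_zero_iff[OF hom_fq] N_points by blast
  next
    case 3
    obtain t where t: "q = (0, 0, t)" "t ^ 2 = 1" using boundary_III[OF 3(1,2)] by blast
    have "fq (N2 q) = 0" using t(2) by (simp add: t(1) fq_def fa_def fb_def N_eval)
    thus ?thesis unfolding 3(3) using homogeneous_zero_iff[OF hom_fq] N_points by blast
  qed
next
  fix e assume e: "e \<in> {e \<in> points (projective_space 2). \<forall>v\<in>e. fq v = 0}"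
  then obtain v where v: "e = proj_point v" "\<exists>i. v i \<noteq> 0" "\<forall>i>2. v i = 0"
    unfolding points_projective_space by blast
  have q: "fq v = 0" using e homogeneous_zero_iff[OF hom_fq] unfolding v(1) by blast
  have vv: "v = vec_of [v 0, v 1, v 2]"
  proof (rule vec_of_nth_eqI[of 2])
    fix i :: nat assume "i \<le> 2"
    hence "i = 0 \<or> i = 1 \<or> i = 2" by linarith
    thus "v i = [v 0, v 1, v 2] ! i" by auto
  qed (use v(3) in auto)
  have scale: "e = proj_point (vec_of xs)" if "k \<noteq> 0" "[v 0, v 1, v 2] = map (\<lambda>x. k * x) xs" for k xs
    using vec_of_scale[OF that(1), of xs] that(2) vv v(1) by metis
  show "e \<in> glue N1 N2 N2 ` points C"
  proof (cases "v 0 = 0")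
    case False
    have ev: "e = proj_point (vec_of [1, v 1 / v 0, v 2 / v 0])"
      using False by (intro scale[OF False]) simp
    hence "fq (vec_of [1, v 1 / v 0, v 2 / v 0]) = 0"
      using e homogeneous_zero_iff[OF hom_fq] by blast
    hence "e \<in> (\<lambda>q. proj_point (N1 q)) ` I.X"
      unfolding affine_part[symmetric] poly2_plane_quartic using ev by blast
    thus ?thesis unfolding N_embedding(2) by blast
  next
    case True
    \<comment> \<open>The restriction of the quartic to the line v0 = 0; the first factor belongs to
      the points over infinity, the second to those over x = 0.\<close>
    have f: "(v 1 ^ 2 - v 2 ^ 2) * (\<tau>2 * v 2 ^ 2 - \<rho>2 * v 1 ^ 2) = 0"
      using q True by (simp add: fq_def fa_def fb_def)
    have v1: "v 1 \<noteq> 0"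
    proof
      assume v1: "v 1 = 0"
      hence "v 2 = 0" using f nonzero by simp
      hence "v = vec_of [0, 0, 0]" using vv True v1 by simp
      thus False using v(2) by (auto simp: vec_of_3 split: if_splits)
    qed
    define t where "t = v 2 / v 1"
    have t: "v 2 = v 1 * t" using v1 by (simp add: t_def)
    have "v 1 ^ 2 * v 1 ^ 2 * ((1 - t ^ 2) * (\<tau>2 * t ^ 2 - \<rho>2)) = 0"
      using f unfolding t by (simp add: power_mult_distrib) algebra
    hence "t ^ 2 = 1 \<or> \<tau>2 * t ^ 2 = \<rho>2" using v1 by auto
    moreover have "e = proj_point (N2 (0, 0, t))"
      unfolding N2_def using True t by (intro scale[OF v1]) simp
    moreover have "t ^ 2 = 1 \<Longrightarrow> (0, 0, t) \<in> III.X" "\<tau>2 * t ^ 2 = \<rho>2 \<Longrightarrow> (0, 0, t) \<in> II.X"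
      using nonzero by (simp_all add: II_X_iff III_X_iff)
    ultimately show ?thesis unfolding N_embedding(2) by force
  qed
qed

text \<open>The projective closure is a topological one: the image of \<open>C\<close> is closed,
  being a zero locus, and \<open>D1\<close>, which is dense in \<open>C\<close>, maps onto the
  affine part.\<close>

lemma isomorphic_plane_quartic: "isomorphic C (projective_plane_curve (poly2 (plane_quartic \<alpha>2 \<alpha>3 \<beta>2 \<beta>3)))"
proof -
  let ?P = "zariski (projective_space 2 :: ((nat \<Rightarrow> 'k) set, 'k) kspace)"
  let ?\<Phi> = "glue N1 N2 N2" and ?A = "(\<lambda>q. proj_point (N1 q)) ` I.X"
  have closed: "closedin ?P (?\<Phi> ` points C)"
    unfolding quartic_image by (rule closed_zero_locus[OF hom_fq])
  have sub: "?A \<subseteq> ?\<Phi> ` points C" unfolding N_embedding(2) by blast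
  have "?P closure_of ?A = ?\<Phi> ` points C"
  proof (rule equalityI)
    show "?P closure_of ?A \<subseteq> ?\<Phi> ` points C"
      by (rule closure_of_minimal[OF sub closed])
    show "?\<Phi> ` points C \<subseteq> ?P closure_of ?A"
    proof
      fix e assume e: "e \<in> ?\<Phi> ` points C"
      then obtain p where p: "p \<in> points C" "e = ?\<Phi> p" by blast
      have "\<exists>e'. e' \<in> ?A \<and> e' \<in> U" if U: "e \<in> U" "openin ?P U" for U
      proof -
        have "continuous_map (zariski C) (zariski (subspace_on (projective_space 2) (?\<Phi> ` points C))) ?\<Phi>"
          using N_embedding(1) unfolding isomorphism_def morphism_def by blast
        moreover have "openin (zariski (subspace_on (projective_space 2) (?\<Phi> ` points C))) (U \<inter> ?\<Phi> ` points C)"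
          using U(2) by (auto simp: subspace_on_def openin_subtopology)
        ultimately have "openin (zariski C) {q \<in> topspace (zariski C). ?\<Phi> q \<in> U \<inter> ?\<Phi> ` points C}"
          unfolding continuous_map_def by blast
        moreover have "p \<in> {q \<in> topspace (zariski C). ?\<Phi> q \<in> U \<inter> ?\<Phi> ` points C}"
          using p U(1) by (auto simp: points_def)
        moreover have "D1 \<noteq> {}" using Dy_nonempty Dy_sub(1) by auto
        ultimately obtain q where "q \<in> {q \<in> topspace (zariski C). ?\<Phi> q \<in> U \<inter> ?\<Phi> ` points C} \<inter> D1"
          using opens_meet[OF _ open_D(1), of "{q \<in> topspace (zariski C). ?\<Phi> q \<in> U \<inter> ?\<Phi> ` points C}"]
          by (metis (no_types, lifting) all_not_in_conv)
        hence q: "q \<in> D1" "?\<Phi> q \<in> U" by simp_all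
        have "?\<Phi> q \<in> ?A"
          unfolding N_embedding(3)[symmetric] using q(1) by (rule imageI)
        thus ?thesis using q(2) by (intro exI[of _ "?\<Phi> q"] conjI)
      qed
      moreover have "e \<in> topspace ?P" using closedin_subset[OF closed] e by blast
      ultimately show "e \<in> ?P closure_of ?A" unfolding in_closure_of by blast
    qed
  qed
  thus ?thesis
    unfolding isomorphic_def projective_plane_curve_def affine_part using N_embedding(1) by auto
qed

end

text \<open>A nonunit whose square divides \<open>p\<close> has a root, and this root would be a
  multiple root of \<open>p\<close>.\<close>

lemma poly_squarefreeI:
  fixes p :: "'k :: alg_closed_field poly"
  assumes "p \<noteq> 0" "\<And>r. poly p r = 0 \<Longrightarrow> simple_root r p"
  shows "squarefree p"
proof (rule squarefreeI)
  fix x assume x: "x ^ 2 dvd p"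
  hence x0: "x \<noteq> 0" using assms(1) by auto
  show "x dvd 1"
  proof (rule ccontr)
    assume "\<not> x dvd 1"
    hence "degree x > 0" using x0 by (simp add: is_unit_iff_degree)
    then obtain r where "poly x r = 0" using alg_closed_imp_poly_has_root by blast
    then obtain x' where x': "x = [:- r, 1:] * x'" by (auto simp: poly_eq_0_iff_dvd)
    obtain c where c: "p = x ^ 2 * c" using x by blast
    have pr: "poly p r = 0" unfolding c x' by simp
    obtain p' where p': "p = [:- r, 1:] * p'" "poly p' r \<noteq> 0"
      using assms(2)[OF pr] unfolding simple_root_def by blast
    have "[:- r, 1:] * p' = [:- r, 1:] * (x' * (x * c))"
      unfolding p'(1)[symmetric] unfolding c using x' by (simp add: power2_eq_square mult.assoc del: mult_pCons_left)
    moreover have "[:- r, 1:] \<noteq> 0" by simp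
    ultimately have "p' = x' * (x * c)" by (metis mult_left_cancel)
    hence "poly p' r = 0" unfolding x' by simp
    thus False using p'(2) by simp
  qed
qed

subsection \<open>Square-freeness of the quartic\<close>

context nonhyperelliptic_cover
begin

text \<open>The quartic written out over k[Z]: it is quadratic in Y^2 with constant leading
  coefficient, so degrees, discriminant and derivative can be read off.\<close>

definition "qY = [:[:\<tau>1 ^ 2 * \<rho>2 - \<tau>1 * \<tau>2 * \<rho>1 - \<tau>1 * \<rho>1 * \<rho>2 + \<tau>2 ^ 2 + \<tau>2 * \<rho>1 ^ 2 - 2 * \<tau>2 * \<rho>2 + \<rho>2 ^ 2, 0,
      - \<tau>1 * \<tau>2 - \<tau>1 * \<rho>2 + 2 * \<tau>2 * \<rho>1, 0, \<tau>2:], 0,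
    [:2 * \<tau>1 * \<rho>2 - \<tau>2 * \<rho>1 - \<rho>1 * \<rho>2, 0, - (\<tau>2 + \<rho>2):], 0, [:\<rho>2:]:]"

lemma plane_quartic_eq: "plane_quartic \<alpha>2 \<alpha>3 \<beta>2 \<beta>3 = qY"
  unfolding plane_quartic_def Let_def qY_def
  by (simp add: numeral_2_eq_2 eval_nat_numeral algebra_simps)

text \<open>
  The leading coefficient in \<open>Y\<close> is constant, so a nonconstant square factor would give the quartic
  a double root in \<open>Y\<close> for every value of \<open>Z\<close>; but its discriminant does not vanish identically.
\<close>

lemma squarefree_plane_quartic: "squarefree (plane_quartic \<alpha>2 \<alpha>3 \<beta>2 \<beta>3)"
proof (rule squarefreeI)
  fix g assume g2: "g ^ 2 dvd plane_quartic \<alpha>2 \<alpha>3 \<beta>2 \<beta>3"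
  then obtain h where h: "qY = g ^ 2 * h" unfolding plane_quartic_eq by blast
  have lc: "lead_coeff qY = [:\<rho>2:]" and q0: "qY \<noteq> 0"
    using nonzero by (simp_all add: qY_def)
  have "lead_coeff g ^ 2 * lead_coeff h = [:\<rho>2:]"
    using lc unfolding h by (simp add: lead_coeff_mult lead_coeff_power)
  moreover have "[:\<rho>2:] dvd 1" using nonzero by (simp add: is_unit_iff_degree)
  ultimately have ulc: "lead_coeff g dvd 1"
    by (metis dvd_mult_left dvd_trans dvd_triv_left power2_eq_square)
  have g0: "g \<noteq> 0" using q0 h by auto
  have "degree g = 0"
  proof (rule ccontr)
    assume dg: "degree g \<noteq> 0"
    define c0 where "c0 = coeff qY 0"
    define c2 where "c2 = coeff qY 2"
    have c0: "c0 = [:\<tau>1 ^ 2 * \<rho>2 - \<tau>1 * \<tau>2 * \<rho>1 - \<tau>1 * \<rho>1 * \<rho>2 + \<tau>2 ^ 2 + \<tau>2 * \<rho>1 ^ 2 - 2 * \<tau>2 * \<rho>2 + \<rho>2 ^ 2, 0,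
      - \<tau>1 * \<tau>2 - \<tau>1 * \<rho>2 + 2 * \<tau>2 * \<rho>1, 0, \<tau>2:]"
      and c2: "c2 = [:2 * \<tau>1 * \<rho>2 - \<tau>2 * \<rho>1 - \<rho>1 * \<rho>2, 0, - (\<tau>2 + \<rho>2):]"
      by (simp_all add: c0_def c2_def qY_def numeral_2_eq_2)
    \<comment> \<open>The discriminant of the quadratic in Y^2; its coefficient of Z^4 is (\<tau>2 -
      \<rho>2)^2.\<close>
    have d: "c2 ^ 2 - smult (4 * \<rho>2) c0 \<noteq> 0"
    proof
      assume "c2 ^ 2 - smult (4 * \<rho>2) c0 = 0"
      hence "coeff (c2 ^ 2 - smult (4 * \<rho>2) c0) 4 = 0" by simp
      moreover have "coeff (c2 ^ 2 - smult (4 * \<rho>2) c0) 4 = (\<tau>2 + \<rho>2) ^ 2 - 4 * \<rho>2 * \<tau>2"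
        by (simp add: c0 c2 power2_eq_square eval_nat_numeral) algebra
      ultimately have "(\<tau>2 - \<rho>2) ^ 2 = 0" by algebra
      thus False using products_differ by simp
    qed
    have c00: "c0 \<noteq> 0" using nonzero by (simp add: c0)
    \<comment> \<open>A value of Z at which neither the discriminant nor \<open>c0\<close> vanishes;
      the latter keeps a multiple root \<open>r\<close> in Y away from 0.\<close>
    obtain z where z: "poly (c0 * (c2 ^ 2 - smult (4 * \<rho>2) c0)) z \<noteq> 0"
      using exists_avoiding[OF poly_roots_finite[of "c0 * (c2 ^ 2 - smult (4 * \<rho>2) c0)"]] c00 d by auto
    define ev where "ev = map_poly (\<lambda>c :: 'k poly. poly c z)"
    have ev_mult: "ev (a * b) = ev a * ev b" for a b
      unfolding ev_def by (rule poly_eqI) (simp add: coeff_map_poly coeff_mult poly_sum)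
    have evq: "ev qY = ev g * (ev g * ev h)"
      unfolding h power2_eq_square by (simp add: ev_mult mult.assoc)
    have "coeff (ev g) (degree g) \<noteq> 0"
    proof -
      obtain w where "lead_coeff g * w = 1" using ulc by (metis dvdE)
      hence "poly (lead_coeff g) z * poly w z = 1" by (metis poly_mult poly_1)
      thus ?thesis unfolding ev_def by (auto simp: coeff_map_poly)
    qed
    hence "degree (ev g) > 0" using dg le_degree by (metis bot_nat_0.not_eq_extremum le_zero_eq)
    then obtain r where r: "poly (ev g) r = 0" using alg_closed_imp_poly_has_root by blast
    have pq: "ev qY = [:poly c0 z, 0, poly c2 z, 0, \<rho>2:]"
      unfolding ev_def c0 c2 qY_def by (rule poly_eqI) (simp add: coeff_map_poly coeff_pCons split: nat.splits)
    have 1: "poly c0 z + r ^ 2 * (poly c2 z + r ^ 2 * \<rho>2) = 0"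
    proof -
      have "poly (ev qY) r = 0" unfolding evq using r by simp
      thus ?thesis unfolding pq by (simp add: power2_eq_square algebra_simps)
    qed
    have 2: "r * (2 * poly c2 z + 4 * \<rho>2 * r ^ 2) = 0"
    proof -
      have "poly (pderiv (ev qY)) r = 0" unfolding evq pderiv_mult using r by simp
      thus ?thesis unfolding pq by (simp add: pderiv_pCons power2_eq_square algebra_simps)
    qed
    have "r \<noteq> 0"
      using 1 z by auto
    hence "2 * poly c2 z + 4 * \<rho>2 * r ^ 2 = 0"
      using 2 by (metis mult_eq_0_iff)
    hence "2 * (poly c2 z + 2 * \<rho>2 * r ^ 2) = 0" by algebra
    hence 3: "poly c2 z = - (2 * \<rho>2 * r ^ 2)" using two by (metis mult_eq_0_iff eq_neg_iff_add_eq_0)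
    have 4: "poly c0 z = \<rho>2 * r ^ 4" using 1 unfolding 3 by algebra
    have "(- (2 * \<rho>2 * r ^ 2)) ^ 2 = 4 * \<rho>2 * (\<rho>2 * r ^ 4)"
      by (simp add: power2_eq_square power4_eq_xxxx)
    hence "poly (c2 ^ 2 - smult (4 * \<rho>2) c0) z = 0"
      by (simp only: poly_diff poly_power poly_smult 3 4 diff_self)
    thus False using z by simp
  qed
  then obtain c where "g = [:c:]" using degree_eq_zeroE by blast
  thus "g dvd 1" using ulc by (simp add: is_unit_const_poly_iff)
qed

end

subsection \<open>The hyperelliptic octic\<close>

lemma X2_minus: "[:0, 1:] ^ 2 - [:c :: 'k :: field:] = [:- c, 0, 1:]"
  by (simp add: power2_eq_square)

lemma simple_root_X2:
  assumes "(2 :: 'k :: field) \<noteq> 0" "c \<noteq> 0" "r ^ 2 = c"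
  shows "simple_root r [:- c, 0, 1 :: 'k:]"
proof (rule simple_rootI)
  show "[:- c, 0, 1:] = [:- r, 1:] * [:r, 1:]" using assms(3) by (simp add: power2_eq_square)
  have "r \<noteq> 0" using assms by auto
  thus "poly [:r, 1:] r \<noteq> 0" using assms(1) by (simp flip: mult_2)
qed

lemma quadratic_product:
  fixes c1 c2 c3 c4 :: "'k :: alg_closed_field"
  assumes two: "(2 :: 'k) \<noteq> 0" and nz: "c1 \<noteq> 0" "c2 \<noteq> 0" "c3 \<noteq> 0" "c4 \<noteq> 0"
    and d: "distinct [c1, c2, c3, c4]"
  defines "h \<equiv> [:- c1, 0, 1:] * [:- c2, 0, 1:] * [:- c3, 0, 1:] * [:- c4, 0, 1:]"
  shows "squarefree h" "degree h = 8"
proof -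
  have nz': "[:- c1, 0, 1:] \<noteq> 0" "[:- c2, 0, 1:] \<noteq> 0" "[:- c3, 0, 1:] \<noteq> 0" "[:- c4, 0, 1:] \<noteq> 0" by auto
  have h0: "h \<noteq> 0" unfolding h_def by (simp only: mult_eq_0_iff nz' simp_thms)
  have "degree h = degree [:- c1, 0, 1:] + degree [:- c2, 0, 1:] + degree [:- c3, 0, 1:] + degree [:- c4, 0, 1:]"
    unfolding h_def using nz' by (simp only: degree_mult_eq mult_eq_0_iff simp_thms)
  thus "degree h = 8" by simp
  have ev: "poly [:- c, 0, 1:] r = r ^ 2 - c" for c r :: 'k by (simp add: power2_eq_square)
  show "squarefree h"
  proof (rule poly_squarefreeI[OF h0])
    fix r assume "poly h r = 0"
    hence "(r ^ 2 - c1) * (r ^ 2 - c2) * (r ^ 2 - c3) * (r ^ 2 - c4) = 0"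
      unfolding h_def poly_mult ev .
    then consider "r ^ 2 = c1" | "r ^ 2 = c2" | "r ^ 2 = c3" | "r ^ 2 = c4" by auto
    thus "simple_root r h"
    proof cases
      case 1
      have "h = [:- c1, 0, 1:] * ([:- c2, 0, 1:] * [:- c3, 0, 1:] * [:- c4, 0, 1:])" by (simp only: h_def mult.assoc)
      moreover have "simple_root r ([:- c1, 0, 1:] * ([:- c2, 0, 1:] * [:- c3, 0, 1:] * [:- c4, 0, 1:]))"
        by (rule simple_root_mult[OF simple_root_X2[OF two nz(1) 1]]) (use 1 d in \<open>simp only: poly_mult ev, auto\<close>)
      ultimately show ?thesis by simp
    next
      case 2
      have "h = [:- c2, 0, 1:] * ([:- c1, 0, 1:] * [:- c3, 0, 1:] * [:- c4, 0, 1:])"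
        by (simp only: h_def mult.assoc mult.left_commute mult.commute)
      moreover have "simple_root r ([:- c2, 0, 1:] * ([:- c1, 0, 1:] * [:- c3, 0, 1:] * [:- c4, 0, 1:]))"
        by (rule simple_root_mult[OF simple_root_X2[OF two nz(2) 2]]) (use 2 d in \<open>simp only: poly_mult ev, auto\<close>)
      ultimately show ?thesis by simp
    next
      case 3
      have "h = [:- c3, 0, 1:] * ([:- c1, 0, 1:] * [:- c2, 0, 1:] * [:- c4, 0, 1:])"
        by (simp only: h_def mult.assoc mult.left_commute mult.commute)
      moreover have "simple_root r ([:- c3, 0, 1:] * ([:- c1, 0, 1:] * [:- c2, 0, 1:] * [:- c4, 0, 1:]))"
        by (rule simple_root_mult[OF simple_root_X2[OF two nz(3) 3]]) (use 3 d in \<open>simp only: poly_mult ev, auto\<close>)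
      ultimately show ?thesis by simp
    next
      case 4
      have "h = [:- c4, 0, 1:] * ([:- c1, 0, 1:] * [:- c2, 0, 1:] * [:- c3, 0, 1:])"
        by (simp only: h_def mult.assoc mult.left_commute mult.commute)
      moreover have "simple_root r ([:- c4, 0, 1:] * ([:- c1, 0, 1:] * [:- c2, 0, 1:] * [:- c3, 0, 1:]))"
        by (rule simple_root_mult[OF simple_root_X2[OF two nz(4) 4]]) (use 4 d in \<open>simp only: poly_mult ev, auto\<close>)
      ultimately show ?thesis by simp
    qed
  qed
qed

locale hyperelliptic_cover = biquadratic_cover \<alpha>2 \<alpha>3 \<beta>2 \<beta>3 C \<nu>
  for \<alpha>2 \<alpha>3 \<beta>2 \<beta>3 :: "'k :: alg_closed_field" and C :: "('c, 'k) kspace" and \<nu> +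
  fixes a2 a3 b2 b3 :: 'k
  assumes roots: "a2 ^ 2 = \<alpha>2" "a3 ^ 2 = \<alpha>3" "b2 ^ 2 = \<beta>2" "b3 ^ 2 = \<beta>3" and ab: "a2 * a3 = b2 * b3"
begin

definition "D = a2 ^ 2 + a3 ^ 2 - b2 ^ 2 - b3 ^ 2"

abbreviation "h \<equiv> hyperelliptic_octic a2 a3 b2 b3"

lemma sum_diff_nonzero: "a2 + a3 \<noteq> 0" "a2 - a3 \<noteq> 0" "b2 + b3 \<noteq> 0" "b2 - b3 \<noteq> 0" "a2 + b2 \<noteq> 0" "a2 - b2 \<noteq> 0"
   "a2 + b3 \<noteq> 0" "a2 - b3 \<noteq> 0" "a3 + b2 \<noteq> 0" "a3 - b2 \<noteq> 0" "a3 + b3 \<noteq> 0" "a3 - b3 \<noteq> 0"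
proof -
  have *: "p + q \<noteq> 0 \<and> p - q \<noteq> 0" if "p ^ 2 \<noteq> q ^ 2" for p q :: 'k
    using that by (metis add_eq_0_iff eq_iff_diff_eq_0 power2_minus)
  show "a2 + a3 \<noteq> 0" "a2 - a3 \<noteq> 0" "b2 + b3 \<noteq> 0" "b2 - b3 \<noteq> 0" "a2 + b2 \<noteq> 0" "a2 - b2 \<noteq> 0"
   "a2 + b3 \<noteq> 0" "a2 - b3 \<noteq> 0" "a3 + b2 \<noteq> 0" "a3 - b2 \<noteq> 0" "a3 + b3 \<noteq> 0" "a3 - b3 \<noteq> 0"
    using *[of a2 a3] *[of b2 b3] *[of a2 b2] *[of a2 b3] *[of a3 b2] *[of a3 b3] distinct roots by auto
qed

text \<open>By \<open>ab\<close> the cross terms cancel, so \<open>D\<close> is the difference of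
  the squares of a2 + a3 and b2 + b3, and likewise of a2 - a3 and b2 - b3.\<close>

lemma D_factor: "D = (a2 + a3 + b2 + b3) * (a2 + a3 - b2 - b3)" "D = (a2 - a3 + b2 - b3) * (a2 - a3 - b2 + b3)"
  using ab unfolding D_def by algebra+

text \<open>If \<open>D\<close> vanished, the pairs \<alpha>2, \<alpha>3 and \<beta>2, \<beta>3
  would have the same sum and the same product.\<close>

lemma D_nonzero: "D \<noteq> 0"
proof
  assume "D = 0"
  hence "(\<alpha>2 - \<beta>2) * (\<alpha>2 - \<beta>3) = 0"
    using ab unfolding D_def roots[symmetric] by algebra
  thus False using distinct by auto
qed

lemma octic_eq: "h = [:- ((a2 + a3 + b2 + b3) ^ 2 / D), 0, 1:] * [:- ((a2 + a3 - b2 - b3) ^ 2 / D), 0, 1:] *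
    [:- ((a2 - a3 + b2 - b3) ^ 2 / D), 0, 1:] * [:- ((a2 - a3 - b2 + b3) ^ 2 / D), 0, 1:]"
  unfolding hyperelliptic_octic_def Let_def D_def X2_minus ..

lemma octic: "squarefree h" "degree h = 8"
proof -
  let ?s1 = "a2 + a3 + b2 + b3" and ?s2 = "a2 + a3 - b2 - b3" and ?s3 = "a2 - a3 + b2 - b3" and ?s4 = "a2 - a3 - b2 + b3"
  have s: "?s1 \<noteq> 0" "?s2 \<noteq> 0" "?s3 \<noteq> 0" "?s4 \<noteq> 0"
    using D_factor D_nonzero by (metis mult_zero_left mult_zero_right)+
  have four: "(4 :: 'k) \<noteq> 0" using two by (metis mult_2 mult_eq_0_iff numeral_Bit0)
  \<comment> \<open>Up to the factor \<open>D\<close>, these are the differences of the roots of the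
    octic in X^2; each is 4 times a product of two of the nonzero sums and differences
    above.\<close>
  have "?s1 ^ 2 - ?s2 ^ 2 = 4 * ((a2 + a3) * (b2 + b3))" "?s1 ^ 2 - ?s3 ^ 2 = 4 * ((a3 + b3) * (a2 + b2))"
    "?s1 ^ 2 - ?s4 ^ 2 = 4 * ((a3 + b2) * (a2 + b3))" "?s2 ^ 2 - ?s3 ^ 2 = 4 * ((a3 - b2) * (a2 - b3))"
    "?s2 ^ 2 - ?s4 ^ 2 = 4 * ((a3 - b3) * (a2 - b2))" "?s3 ^ 2 - ?s4 ^ 2 = 4 * ((a2 - a3) * (b2 - b3))"
    by algebra+
  hence n: "?s1 ^ 2 - ?s2 ^ 2 \<noteq> 0" "?s1 ^ 2 - ?s3 ^ 2 \<noteq> 0" "?s1 ^ 2 - ?s4 ^ 2 \<noteq> 0" "?s2 ^ 2 - ?s3 ^ 2 \<noteq> 0"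
    "?s2 ^ 2 - ?s4 ^ 2 \<noteq> 0" "?s3 ^ 2 - ?s4 ^ 2 \<noteq> 0"
    using four sum_diff_nonzero by (simp_all only: mult_eq_0_iff simp_thms not_False_eq_True)
  have "distinct [?s1 ^ 2 / D, ?s2 ^ 2 / D, ?s3 ^ 2 / D, ?s4 ^ 2 / D]"
    using n D_nonzero by (simp del: power2_eq_iff)
  thus "squarefree h" "degree h = 8"
    unfolding octic_eq using s D_nonzero two
    by (intro quadratic_product; simp)+
qed

text \<open>Under this substitution each factor X^2 - t / D becomes -(s^2 + t), up to
  \<open>D\<close>. The factors are multiplied in the two pairs for which \<open>D_factor\<close>
  makes the constant term \<open>D^2\<close>.\<close>

lemma octic_value:
  assumes "D * X ^ 2 = - (s ^ 2)"
  shows "D ^ 4 * poly h X = (s ^ 4 + (2 * (a2 + a3) ^ 2 + 2 * (b2 + b3) ^ 2) * s ^ 2 + D ^ 2) *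
    (s ^ 4 + (2 * (a2 - a3) ^ 2 + 2 * (b2 - b3) ^ 2) * s ^ 2 + D ^ 2)"
proof -
  have q: "D * poly [:- (t / D), 0, 1:] X = - (s ^ 2) - t" for t
  proof -
    have "D * poly [:- (t / D), 0, 1:] X = D * X ^ 2 - t"
      using D_nonzero by (simp add: power2_eq_square right_diff_distrib)
    thus ?thesis using assms by simp
  qed
  have "D ^ 4 * poly h X = (D * poly [:- ((a2 + a3 + b2 + b3) ^ 2 / D), 0, 1:] X) * (D * poly [:- ((a2 + a3 - b2 - b3) ^ 2 / D), 0, 1:] X) *
    ((D * poly [:- ((a2 - a3 + b2 - b3) ^ 2 / D), 0, 1:] X) * (D * poly [:- ((a2 - a3 - b2 + b3) ^ 2 / D), 0, 1:] X))"
    unfolding octic_eq poly_mult by algebra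
  also have "\<dots> = ((- (s ^ 2) - (a2 + a3 + b2 + b3) ^ 2) * (- (s ^ 2) - (a2 + a3 - b2 - b3) ^ 2)) *
    ((- (s ^ 2) - (a2 - a3 + b2 - b3) ^ 2) * (- (s ^ 2) - (a2 - a3 - b2 + b3) ^ 2))"
    unfolding q ..
  also have "(- (s ^ 2) - (a2 + a3 + b2 + b3) ^ 2) * (- (s ^ 2) - (a2 + a3 - b2 - b3) ^ 2) =
      s ^ 4 + (2 * (a2 + a3) ^ 2 + 2 * (b2 + b3) ^ 2) * s ^ 2 + D ^ 2"
    unfolding D_factor(1) by algebra
  also have "(- (s ^ 2) - (a2 - a3 + b2 - b3) ^ 2) * (- (s ^ 2) - (a2 - a3 - b2 + b3) ^ 2) =
      s ^ 4 + (2 * (a2 - a3) ^ 2 + 2 * (b2 - b3) ^ 2) * s ^ 2 + D ^ 2"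
    unfolding D_factor(2) by algebra
  finally show ?thesis .
qed

text \<open>Here \<open>s = y + z\<close>, so \<open>y - z = - D / s\<close>, and \<open>v = x - \<alpha>2 \<alpha>3 / x\<close>.\<close>

lemma octic_value':
  assumes "D * X ^ 2 = - (s ^ 2)" "2 * s * y = s ^ 2 - D" "v ^ 2 = (y ^ 2 + \<alpha>2 + \<alpha>3) ^ 2 - 4 * \<alpha>2 * \<alpha>3"
  shows "D ^ 4 * poly h X = 16 * s ^ 4 * v ^ 2"
proof -
  \<comment> \<open>Since 4 \<alpha>2 \<alpha>3 is the square of 2 a2 a3, the right side is a
    difference of squares. Its two factors match the two pairs of factors of the octic.\<close>
  have v: "v ^ 2 = (y ^ 2 + (a2 + a3) ^ 2) * (y ^ 2 + (a2 - a3) ^ 2)"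
    unfolding assms(3) roots[symmetric] by algebra
  have D': "D = (a2 + a3) ^ 2 - (b2 + b3) ^ 2" "D = (a2 - a3) ^ 2 - (b2 - b3) ^ 2"
    using ab unfolding D_def by algebra+
  have sy: "4 * s ^ 2 * y ^ 2 = (s ^ 2 - D) ^ 2"
    using assms(2) by algebra
  have "s ^ 4 + (2 * (a2 + a3) ^ 2 + 2 * (b2 + b3) ^ 2) * s ^ 2 + D ^ 2 = 4 * s ^ 2 * (y ^ 2 + (a2 + a3) ^ 2)"
    using sy D'(1) by algebra
  moreover have "s ^ 4 + (2 * (a2 - a3) ^ 2 + 2 * (b2 - b3) ^ 2) * s ^ 2 + D ^ 2 = 4 * s ^ 2 * (y ^ 2 + (a2 - a3) ^ 2)"
    using sy D'(2) by algebra
  ultimately show ?thesis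
    unfolding octic_value[OF assms(1)] v by algebra
qed

end

section \<open>The double cover y^2 = h(x) away from x = 0\<close>

lemma poly_eq_0_off_0:
  fixes p :: "'k :: alg_closed_field poly"
  assumes "\<And>x. x \<noteq> 0 \<Longrightarrow> poly p x = 0"
  shows "p = 0"
proof (rule ccontr)
  assume "p \<noteq> 0"
  hence "finite (insert 0 {x. poly p x = 0})" using poly_roots_finite by simp
  then obtain x where "x \<notin> insert 0 {x. poly p x = 0}"
    using infinite_alg_closed ex_new_if_finite by blast
  thus False using assms[of x] by simp
qed

lemma polynomial_function_on_double_cover:
  assumes "g \<in> polynomial_functions"
  shows "\<exists>a b. \<forall>x y. y ^ 2 = poly h x \<longrightarrow> g (vec_of [x, y]) = poly a x + poly b x * y"
  using assms
proof induction
  case (const c)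
  show ?case by (rule exI[of _ "[:c:]"], rule exI[of _ 0]) simp
next
  case (coord i)
  consider "i = 0" | "i = 1" | "i \<noteq> 0" "i \<noteq> 1" by blast
  thus ?case
  proof cases
    case 1
    show ?thesis by (rule exI[of _ "[:0, 1:]"], rule exI[of _ 0]) (simp add: 1 vec_of_2)
  next
    case 2
    show ?thesis by (rule exI[of _ 0], rule exI[of _ 1]) (simp add: 2 vec_of_2)
  next
    case 3
    show ?thesis by (rule exI[of _ 0], rule exI[of _ 0]) (use 3 in \<open>simp add: vec_of_2\<close>)
  qed
next
  case (add f g)
  then obtain a b a' b' where
    "\<And>x y. y ^ 2 = poly h x \<Longrightarrow> f (vec_of [x, y]) = poly a x + poly b x * y"
    "\<And>x y. y ^ 2 = poly h x \<Longrightarrow> g (vec_of [x, y]) = poly a' x + poly b' x * y" by blast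
  thus ?case by (intro exI[of _ "a + a'"] exI[of _ "b + b'"]) (simp add: algebra_simps)
next
  case (mult f g)
  then obtain a b a' b' where *:
    "\<And>x y. y ^ 2 = poly h x \<Longrightarrow> f (vec_of [x, y]) = poly a x + poly b x * y"
    "\<And>x y. y ^ 2 = poly h x \<Longrightarrow> g (vec_of [x, y]) = poly a' x + poly b' x * y" by blast
  have "f (vec_of [x, y]) * g (vec_of [x, y]) = poly (a * a' + b * b' * h) x + poly (a * b' + b * a') x * y"
    if y: "y ^ 2 = poly h x" for x y
    unfolding *[OF y] by (simp add: y[symmetric] algebra_simps power2_eq_square)
  thus ?case by (intro exI[of _ "a * a' + b * b' * h"] exI[of _ "a * b' + b * a'"]) simp
qed

lemma vec_of_2_in_affine_plane: "vec_of [x, y] \<in> points (affine_space 2)"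
  by (simp add: points_affine_space vec_of_2)

text \<open>For density: a polynomial function on the curve is a(x) + b(x) y. If it vanishes for x
  \<noteq> 0, it does so at (x, y) and (x, -y), hence \<open>a\<close> and \<open>b h\<close> vanish
  off 0 and therefore identically, so the function is zero at x = 0 as well.\<close>

lemma double_cover_off_0:
  fixes h :: "'k :: alg_closed_field poly"
  assumes two: "(2 :: 'k) \<noteq> 0" and h: "h \<noteq> 0"
  defines "Y \<equiv> affine_plane_curve (\<lambda>x y. y ^ 2 - poly h x)"
    and "V \<equiv> {vec_of [x, y] | x y. y ^ 2 = poly h x \<and> x \<noteq> 0}"
  shows "openin (zariski Y) V" "zariski Y closure_of V = points Y"
proof -
  let ?A = "zariski (affine_space 2 :: (nat \<Rightarrow> 'k, 'k) kspace)"
  let ?S = "{vec_of [x, y] | x y. y ^ 2 - poly h x = 0}"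
  have zY: "zariski Y = subtopology ?A ?S" by (simp add: Y_def affine_plane_curve_def subspace_on_def)
  have S: "?S \<subseteq> points (affine_space 2)" using vec_of_2_in_affine_plane by blast
  have pY: "points Y = ?S" using S unfolding points_def zY by auto
  have V: "V = {v \<in> points (affine_space 2). v 0 \<noteq> 0} \<inter> ?S"
  proof (intro equalityI subsetI)
    fix v assume "v \<in> V"
    then obtain x y where "v = vec_of [x, y]" "y ^ 2 = poly h x" "x \<noteq> 0" unfolding V_def by blast
    moreover have "vec_of [x, y] 0 = x" by (simp add: vec_of_2)
    ultimately show "v \<in> {v \<in> points (affine_space 2). v 0 \<noteq> 0} \<inter> ?S"
      using vec_of_2_in_affine_plane[of x y] by auto
  next
    fix v assume v: "v \<in> {v \<in> points (affine_space 2). v 0 \<noteq> 0} \<inter> ?S"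
    then obtain x y where "v = vec_of [x, y]" "y ^ 2 - poly h x = 0" by blast
    moreover have "vec_of [x, y] 0 = x" by (simp add: vec_of_2)
    ultimately show "v \<in> V" using v unfolding V_def by auto
  qed
  show "openin (zariski Y) V"
    unfolding zY V openin_subtopology
    using open_affine_basic[OF polynomial_functions.coord[of 0], of 2] by blast
  have vanish: "g (vec_of [x, y]) = 0"
    if g: "g \<in> polynomial_functions" and gV: "\<And>v. v \<in> V \<Longrightarrow> g v = 0" and xy: "y ^ 2 = poly h x" for g x y
  proof -
    obtain a b where ab: "\<And>x y. y ^ 2 = poly h x \<Longrightarrow> g (vec_of [x, y]) = poly a x + poly b x * y"
      using polynomial_function_on_double_cover[OF g, of h] by blast
    have *: "poly a x = 0 \<and> poly b x * poly h x = 0" if "x \<noteq> 0" for x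
    proof -
      obtain y where y: "y ^ 2 = poly h x" using nth_root_exists[of 2] by (metis pos2)
      have "poly a x + poly b x * y = 0" "poly a x - poly b x * y = 0"
        using ab[of y x] ab[of "- y" x] gV[of "vec_of [x, y]"] gV[of "vec_of [x, - y]"] y that
        unfolding V_def by fastforce+
      hence "2 * poly a x = 0" by algebra
      hence "poly a x = 0" using two by simp
      moreover from this have "poly b x * y = 0" using \<open>poly a x + poly b x * y = 0\<close> by simp
      ultimately show ?thesis using y by auto
    qed
    have "a = 0" using * by (intro poly_eq_0_off_0) auto
    moreover have "b * h = 0" using * by (intro poly_eq_0_off_0) simp
    ultimately show ?thesis using ab[OF xy] h by simp
  qed
  show "zariski Y closure_of V = points Y"
  proof (intro equalityI subsetI)
    fix p assume "p \<in> points Y"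
    then obtain x y where p: "p = vec_of [x, y]" "y ^ 2 = poly h x" unfolding pY by auto
    have "\<exists>v\<in>V. v \<in> T" if T: "openin (zariski Y) T" "p \<in> T" for T
    proof (rule ccontr)
      assume n: "\<not> ?thesis"
      obtain T' where T': "openin ?A T'" "T = T' \<inter> ?S" using T(1) unfolding zY openin_subtopology by blast
      have "p \<in> T'" using T(2) T'(2) by simp
      then obtain g where g: "g \<in> polynomial_functions" "g p \<noteq> 0" "{v \<in> points (affine_space 2). g v \<noteq> 0} \<subseteq> T'"
        using affine_basis[OF T'(1)] by blast
      have "g v = 0" if "v \<in> V" for v
        using n g(3) that unfolding T'(2) V by blast
      from vanish[OF g(1) this p(2)] show False using g(2) p(1) by simp
    qed
    thus "p \<in> zariski Y closure_of V"
      unfolding in_closure_of using \<open>p \<in> points Y\<close> unfolding points_def by blast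
  next
    fix p assume "p \<in> zariski Y closure_of V"
    thus "p \<in> points Y" by (simp add: in_closure_of points_def)
  qed
qed

section \<open>The birational map between \<open>C\<close> and the octic\<close>

context hyperelliptic_cover
begin

lemma products_eq: "\<alpha>2 * \<alpha>3 = \<beta>2 * \<beta>3"
  using ab unfolding roots[symmetric] by algebra

lemma D_eq: "D = \<alpha>2 + \<alpha>3 - \<beta>2 - \<beta>3"
  unfolding D_def roots ..

text \<open>The scale between s = y + z and the variable of the octic: X = s / d turns the
  substitution D X^2 = - s^2 into d^2 = - D.\<close>

definition "d = (SOME d. d ^ 2 = - D)"

lemma d: "d ^ 2 = - D" "d \<noteq> 0"
proof -
  show *: "d ^ 2 = - D" unfolding d_def by (rule someI_ex) (rule sqrt_exists)
  show "d \<noteq> 0" using * D_nonzero by auto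
qed

text \<open>The pair X = s / d and Y = 4 s^2 v / D^2 with s = y + z and v = x - \<alpha>2 \<alpha>3
  / x. The second entry is the square root of h(X) supplied by D^4 h(X) = 16 s^4 v^2.\<close>

definition to_octic :: "'k \<times> 'k \<times> 'k \<Rightarrow> nat \<Rightarrow> 'k"
  where "to_octic = (\<lambda>q. vec_of [1 / d * (fst (snd q) + snd (snd q)),
    4 / D ^ 2 * ((fst (snd q) + snd (snd q)) * (fst (snd q) + snd (snd q)) *
      (fst q + - (\<alpha>2 * \<alpha>3) * inverse (poly [:0, 1:] (fst q))))])"

text \<open>The inverse: y and z come from y + z = s and y - z = - D / s. Then 2 x is the sum of x +
  \<alpha>2 \<alpha>3 / x = y^2 + \<alpha>2 + \<alpha>3 and of v = - D Y / (4 X^2).\<close>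

definition octic_x :: "'k \<Rightarrow> 'k \<Rightarrow> 'k"
  where "octic_x X Y = (- D * (X ^ 2 + 1) ^ 2 + 4 * (\<alpha>2 + \<alpha>3) * X ^ 2 - D * Y) / (8 * X ^ 2)"
definition octic_y :: "'k \<Rightarrow> 'k"
  where "octic_y X = (- D * X ^ 2 - D) / (2 * d * X)"
definition octic_z :: "'k \<Rightarrow> 'k"
  where "octic_z X = (- D * X ^ 2 + D) / (2 * d * X)"

lemma eight: "(4 :: 'k) \<noteq> 0" "(8 :: 'k) \<noteq> 0" "(16 :: 'k) \<noteq> 0"
proof -
  have "(4 :: 'k) = 2 * 2" "(8 :: 'k) = 2 * 2 * 2" "(16 :: 'k) = 2 * 2 * 2 * 2" by simp_all
  thus "(4 :: 'k) \<noteq> 0" "(8 :: 'k) \<noteq> 0" "(16 :: 'k) \<noteq> 0" using two by (metis mult_eq_0_iff)+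
qed

lemma to_octic:
  assumes "(x, y, z) \<in> I.X"
  defines "X \<equiv> to_octic (x, y, z) 0" and "Y \<equiv> to_octic (x, y, z) 1"
  shows "X \<noteq> 0" "Y ^ 2 = poly h X" "x = octic_x X Y" "y = octic_y X" "z = octic_z X"
proof -
  have x: "x \<noteq> 0" and xy: "x * y ^ 2 = (x - \<alpha>2) * (x - \<alpha>3)" and xz: "x * z ^ 2 = (x - \<beta>2) * (x - \<beta>3)"
    using assms(1) unfolding I_X_iff by auto
  define s where "s = y + z"
  define x' where "x' = \<alpha>2 * \<alpha>3 * inverse x"
  define v where "v = x - x'"
  have xx': "x * x' = \<alpha>2 * \<alpha>3" using x by (simp add: x'_def)
  have "x * (y ^ 2 + \<alpha>2 + \<alpha>3) = x * (x + x')" using xy xx' by algebra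
  hence w: "y ^ 2 + \<alpha>2 + \<alpha>3 = x + x'" using x by simp
  have "x * (z ^ 2 + \<beta>2 + \<beta>3) = x * (x + x')" using xz xx' products_eq by algebra
  hence w': "z ^ 2 + \<beta>2 + \<beta>3 = x + x'" using x by simp
  have sy: "(y - z) * s = - D" using w w' unfolding s_def D_eq by algebra
  have s0: "s \<noteq> 0" using sy D_nonzero by auto
  have s1: "2 * s * y = s ^ 2 - D" "2 * s * z = s ^ 2 + D" using sy unfolding s_def by algebra+
  have X: "X = s / d" by (simp add: X_def to_octic_def vec_of_2 s_def)
  have sX: "s = d * X" unfolding X using d by simp
  show X0: "X \<noteq> 0" unfolding X using s0 d by simp
  have DX: "D * X ^ 2 = - (s ^ 2)" using d(1) unfolding sX by algebra
  have v2: "v ^ 2 = (y ^ 2 + \<alpha>2 + \<alpha>3) ^ 2 - 4 * \<alpha>2 * \<alpha>3"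
    using xx' unfolding w v_def by algebra
  have "Y = 4 / D ^ 2 * (s * s * v)"
    by (simp add: Y_def to_octic_def vec_of_2 s_def v_def x'_def)
  hence Y: "D ^ 2 * Y = 4 * s ^ 2 * v" using D_nonzero by (simp add: power2_eq_square)
  have "D ^ 4 * Y ^ 2 = D ^ 4 * poly h X"
    unfolding octic_value'[OF DX s1(1) v2] using Y by algebra
  thus "Y ^ 2 = poly h X" using D_nonzero by simp
  show y: "y = octic_y X"
    unfolding octic_y_def using two d(2) X0 DX s1(1)[unfolded sX] sX
    by (simp add: nonzero_eq_divide_eq) algebra
  show "z = octic_z X"
    unfolding octic_z_def using two d(2) X0 DX s1(2)[unfolded sX] sX
    by (simp add: nonzero_eq_divide_eq) algebra
  have "D * (4 * X ^ 2 * y ^ 2) = D * (- D * (X ^ 2 + 1) ^ 2)"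
    using DX s1(1) by algebra
  hence 1: "4 * X ^ 2 * y ^ 2 = - D * (X ^ 2 + 1) ^ 2" by (rule mult_left_cancel[THEN iffD1, OF D_nonzero])
  have "D * (D * Y) = D * (- 4 * X ^ 2 * v)" using Y DX by algebra
  hence 2: "D * Y = - 4 * X ^ 2 * v" by (rule mult_left_cancel[THEN iffD1, OF D_nonzero])
  have "2 * x = y ^ 2 + \<alpha>2 + \<alpha>3 + v" unfolding w v_def by simp
  hence "x * (8 * X ^ 2) = - D * (X ^ 2 + 1) ^ 2 + 4 * (\<alpha>2 + \<alpha>3) * X ^ 2 - D * Y" using 1 2 by algebra
  thus "x = octic_x X Y" unfolding octic_x_def using X0 eight by (simp add: nonzero_eq_divide_eq)
qed

lemma of_octic:
  assumes X0: "X \<noteq> 0" and XY: "Y ^ 2 = poly h X"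
  shows "(octic_x X Y, octic_y X, octic_z X) \<in> I.X" "to_octic (octic_x X Y, octic_y X, octic_z X) = vec_of [X, Y]"
proof -
  define x where "x = octic_x X Y"
  define y where "y = octic_y X"
  define z where "z = octic_z X"
  define s where "s = d * X"
  define v where "v = - D * Y / (4 * X ^ 2)"
  have s0: "s \<noteq> 0" using X0 d by (simp add: s_def)
  have DX: "D * X ^ 2 = - (s ^ 2)" using d(1) unfolding s_def by algebra
  have "y * (2 * d * X) = - D * X ^ 2 - D" "z * (2 * d * X) = - D * X ^ 2 + D"
    unfolding y_def z_def octic_y_def octic_z_def using two d(2) X0 by simp_all
  hence s1: "2 * s * y = s ^ 2 - D" "2 * s * z = s ^ 2 + D" using DX unfolding s_def by algebra+
  have "s * (2 * (y + z)) = s * (2 * s)" using s1 by algebra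
  hence s: "y + z = s" using mult_left_cancel[OF s0] mult_left_cancel[OF two] by blast
  have sy: "(y - z) * s = - D"
  proof -
    have "2 * ((y - z) * s) = 2 * (- D)" using s1 by algebra
    thus ?thesis by (rule mult_left_cancel[THEN iffD1, OF two])
  qed
  have v: "4 * X ^ 2 * v = - D * Y" using X0 eight by (simp add: v_def)
  \<comment> \<open>The identity for the octic is applied to an auxiliary square root
    \<open>v0\<close>; comparing it with Y^2 shows that \<open>v\<close> has the same
    square.\<close>
  obtain v0 where v0: "v0 ^ 2 = (y ^ 2 + \<alpha>2 + \<alpha>3) ^ 2 - 4 * \<alpha>2 * \<alpha>3" using sqrt_exists by blast
  have "16 * s ^ 4 * v0 ^ 2 = D ^ 4 * Y ^ 2"
    using octic_value'[OF DX s1(1) v0] XY by simp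
  also have "\<dots> = 16 * s ^ 4 * v ^ 2" using v DX by algebra
  finally have "v ^ 2 = v0 ^ 2" using s0 eight by simp
  hence v2: "v ^ 2 = (y ^ 2 + \<alpha>2 + \<alpha>3) ^ 2 - 4 * \<alpha>2 * \<alpha>3" using v0 by simp
  have "D * (4 * X ^ 2 * y ^ 2) = D * (- D * (X ^ 2 + 1) ^ 2)"
    using DX s1(1) by algebra
  hence 1: "4 * X ^ 2 * y ^ 2 = - D * (X ^ 2 + 1) ^ 2" by (rule mult_left_cancel[THEN iffD1, OF D_nonzero])
  have "x * (8 * X ^ 2) = - D * (X ^ 2 + 1) ^ 2 + 4 * (\<alpha>2 + \<alpha>3) * X ^ 2 - D * Y"
    unfolding x_def octic_x_def using X0 eight by simp
  hence "(4 * X ^ 2) * (2 * x) = (4 * X ^ 2) * (y ^ 2 + \<alpha>2 + \<alpha>3 + v)" using 1 v by algebra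
  moreover have "4 * X ^ 2 \<noteq> 0" using eight X0 by simp
  ultimately have x2: "2 * x = y ^ 2 + \<alpha>2 + \<alpha>3 + v" by (rule mult_left_cancel[THEN iffD1, rotated])
  \<comment> \<open>Meant to be \<alpha>2 \<alpha>3 / x: from x + x' = y^2 + \<alpha>2 + \<alpha>3
    and x - x' = v, subtracting squares gives 4 x x' = 4 \<alpha>2 \<alpha>3.\<close>
  define x' where "x' = y ^ 2 + \<alpha>2 + \<alpha>3 - x"
  have "4 * (x * x') = 4 * (\<alpha>2 * \<alpha>3)" using x2 v2 unfolding x'_def by algebra
  hence xx': "x * x' = \<alpha>2 * \<alpha>3" by (rule mult_left_cancel[THEN iffD1, OF eight(1)])
  have x0: "x \<noteq> 0" using xx' nonzero by auto
  have vx: "v = x - x'" using x2 unfolding x'_def by algebra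
  have yz: "z ^ 2 = y ^ 2 + D" using sy unfolding s[symmetric] by algebra
  have "x * y ^ 2 = (x - \<alpha>2) * (x - \<alpha>3)" using xx' unfolding x'_def by algebra
  moreover from this have "x * z ^ 2 = (x - \<beta>2) * (x - \<beta>3)" using products_eq unfolding yz D_eq by algebra
  ultimately show "(octic_x X Y, octic_y X, octic_z X) \<in> I.X"
    using x0 unfolding I_X_iff x_def y_def z_def by blast
  have x'': "x' = \<alpha>2 * \<alpha>3 * inverse x" using xx' x0 by (simp add: field_simps)
  have "D ^ 2 * Y = 4 * (s * s * v)" using v DX by algebra
  hence "4 / D ^ 2 * (s * s * v) = Y" using D_nonzero by (simp add: field_simps)
  hence "4 / D ^ 2 * ((y + z) * (y + z) * (x + - (\<alpha>2 * \<alpha>3) * inverse x)) = Y"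
    unfolding s vx x'' by simp
  moreover have "1 / d * (y + z) = X" unfolding s s_def using d by simp
  ultimately show "to_octic (octic_x X Y, octic_y X, octic_z X) = vec_of [X, Y]"
    unfolding to_octic_def fst_conv snd_conv x_def y_def z_def by simp
qed

lemma to_octic_vec: "to_octic q = vec_of [to_octic q 0, to_octic q 1]"
  by (simp add: to_octic_def vec_of_2)

text \<open>On \<open>D1\<close> the relation (y - z) s = - D keeps s and thus X away from 0.
  Conversely, the inverse formulas have only powers of X in their denominators, up to constants, so
  \<open>D1\<close> corresponds exactly to the dense open part X \<noteq> 0 of the octic
  curve.\<close>

lemma birational_octic: "birational C (affine_plane_curve (\<lambda>x y. y ^ 2 - poly h x))"
proof -
  define V where "V = {vec_of [x, y] | x y. y ^ 2 = poly h x \<and> x \<noteq> 0}"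
  have h0: "h \<noteq> 0" using octic(2) by auto
  have image: "to_octic ` I.X = V"
  proof (intro equalityI subsetI)
    fix v assume "v \<in> to_octic ` I.X"
    then obtain x y z where q: "(x, y, z) \<in> I.X" "v = to_octic (x, y, z)" by (auto elim!: imageE)
    show "v \<in> V"
      unfolding V_def q(2) using to_octic_vec[of "(x, y, z)"] to_octic(1,2)[OF q(1)] by blast
  next
    fix v assume "v \<in> V"
    then obtain x y where "v = vec_of [x, y]" "y ^ 2 = poly h x" "x \<noteq> 0" unfolding V_def by blast
    thus "v \<in> to_octic ` I.X" using of_octic[of x y] by (metis image_eqI)
  qed
  have inv: "to_octic q 0 \<noteq> 0 \<and> q = (octic_x (to_octic q 0) (to_octic q 1), octic_y (to_octic q 0), octic_z (to_octic q 0))"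
    if "q \<in> I.X" for q
    proof -
    obtain x y z where q: "q = (x, y, z)" by (cases q) auto
    show ?thesis using to_octic[OF that[unfolded q]] unfolding q by blast
  qed
  have comp: "(\<lambda>q. to_octic q i) \<in> I.R" for i
  proof -
    have "(\<lambda>q. to_octic q 0) \<in> I.R" "(\<lambda>q. to_octic q 1) \<in> I.R"
      unfolding to_octic_def vec_of_2 by (simp_all only: if_True if_False one_neq_zero refl)
        (intro I.R_const I.R_mult I.R_add I.R_x I.R_y I.R_z I.R_inverse_m)+
    moreover have "(\<lambda>q. to_octic q i) = (\<lambda>q. 0)" if "i \<noteq> 0" "i \<noteq> 1"
      using that by (simp add: to_octic_def vec_of_2)
    ultimately show ?thesis using I.R_const[of 0] by (cases "i = 0"; cases "i = 1") auto
  qed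
  have pf: "(\<lambda>v. v 0) \<in> polynomial_functions" "(\<lambda>v. v 1) \<in> polynomial_functions"
    "(\<lambda>v. c) \<in> polynomial_functions" for c :: 'k
    by (rule polynomial_functions.intros)+
  note ops = polynomial_functions.add polynomial_functions.mult pf
  have x: "I.expressible affine_fractions to_octic fst"
  proof (rule I.expressibleI)
    show "((\<lambda>v. - D * ((v 0 * v 0 + 1) * (v 0 * v 0 + 1)) + 4 * (\<alpha>2 + \<alpha>3) * (v 0 * v 0) + - D * v 1), (\<lambda>v. 8 * (v 0 * v 0))) \<in> affine_fractions"
      unfolding affine_fractions_def by (intro SigmaI ops)
    show "8 * (to_octic q 0 * to_octic q 0) \<noteq> 0 \<and> fst q = (- D * ((to_octic q 0 * to_octic q 0 + 1) * (to_octic q 0 * to_octic q 0 + 1)) + 4 * (\<alpha>2 + \<alpha>3) * (to_octic q 0 * to_octic q 0) + - D * to_octic q 1) / (8 * (to_octic q 0 * to_octic q 0))" if "q \<in> I.X" for q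
    proof -
      have "fst q = octic_x (to_octic q 0) (to_octic q 1)" using inv[OF that] by (metis fst_conv)
      thus ?thesis using inv[OF that] eight by (simp add: octic_x_def power2_eq_square)
    qed
  qed
  have y: "I.expressible affine_fractions to_octic (\<lambda>q. fst (snd q))"
  proof (rule I.expressibleI)
    show "((\<lambda>v. - D * (v 0 * v 0) + - D), (\<lambda>v. 2 * d * v 0)) \<in> affine_fractions"
      unfolding affine_fractions_def by (intro SigmaI ops)
    show "2 * d * to_octic q 0 \<noteq> 0 \<and> fst (snd q) = (- D * (to_octic q 0 * to_octic q 0) + - D) / (2 * d * to_octic q 0)" if "q \<in> I.X" for q
    proof -
      have "fst (snd q) = octic_y (to_octic q 0)" using inv[OF that] by (metis fst_conv snd_conv)
      thus ?thesis using inv[OF that] two d by (simp add: octic_y_def power2_eq_square)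
    qed
  qed
  have z: "I.expressible affine_fractions to_octic (\<lambda>q. snd (snd q))"
  proof (rule I.expressibleI)
    show "((\<lambda>v. - D * (v 0 * v 0) + D), (\<lambda>v. 2 * d * v 0)) \<in> affine_fractions"
      unfolding affine_fractions_def by (intro SigmaI ops)
    show "2 * d * to_octic q 0 \<noteq> 0 \<and> snd (snd q) = (- D * (to_octic q 0 * to_octic q 0) + D) / (2 * d * to_octic q 0)" if "q \<in> I.X" for q
    proof -
      have "snd (snd q) = octic_z (to_octic q 0)" using inv[OF that] by (metis snd_conv)
      thus ?thesis using inv[OF that] two d by (simp add: octic_z_def power2_eq_square)
    qed
  qed
  have inj: "inj_on to_octic I.X"
  proof (rule inj_onI)
    fix q q' assume q: "q \<in> I.X" "q' \<in> I.X" "to_octic q = to_octic q'"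
    show "q = q'" using inv[OF q(1)] inv[OF q(2)] unfolding q(3) by simp
  qed
  have pts: "to_octic q \<in> points (affine_space 2)" for q
    using vec_of_2_in_affine_plane to_octic_vec by metis
  have iso: "isomorphism (subspace_on C D1) (subspace_on (affine_space 2) V) (\<lambda>p. to_octic (u1 p))"
    unfolding image[symmetric] by (rule I.affine_embedding[OF cofinite comp pts inj x y z])
  have "{vec_of [x, y] | x y. y ^ 2 - poly h x = 0} \<inter> V = V" unfolding V_def by auto
  hence "isomorphism (subspace_on C D1) (subspace_on (affine_plane_curve (\<lambda>x y. y ^ 2 - poly h x)) V) (\<lambda>p. to_octic (u1 p))"
    unfolding affine_plane_curve_def
    using isomorphism_subspace_of_subspace[OF _ regular_affine_space_restrict, of "subspace_on C D1" 2
      "{vec_of [x, y] | x y. y ^ 2 - poly h x = 0}" V] iso by simp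
  moreover have "D1 \<noteq> {}" using Dy_nonempty Dy_sub by auto
  ultimately show ?thesis
    unfolding birational_def isomorphic_def
    using open_D(1) dense_open[OF open_D(1)] double_cover_off_0[OF two h0, folded V_def] by blast
qed

lemma smooth_projective_model_octic: "is_smooth_projective_model C (affine_plane_curve (\<lambda>x y. y ^ 2 - poly h x))"
  unfolding is_smooth_projective_model_def using smooth_C projective_C birational_octic by blast

end

theorem mainTheorem3:
  fixes \<alpha>2 \<alpha>3 \<beta>2 \<beta>3 :: "'k :: alg_closed_field"
    and C :: "('c, 'k) kspace"
    and \<nu> :: "'c \<Rightarrow> (nat \<Rightarrow> 'k) set \<times> (nat \<Rightarrow> 'k) set"
  assumes "CHAR('k) \<noteq> 2"
    and "\<alpha>2 \<noteq> 0" "\<alpha>3 \<noteq> 0" "\<beta>2 \<noteq> 0" "\<beta>3 \<noteq> 0"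
    and "distinct [\<alpha>2, \<alpha>3, \<beta>2, \<beta>3]"
    and "is_normalization C \<nu>
           (fibre_product (elliptic_cubic \<alpha>2 \<alpha>3) x_cover (elliptic_cubic \<beta>2 \<beta>3) x_cover)"
  shows "(\<alpha>2 * \<alpha>3 = \<beta>2 * \<beta>3 \<longrightarrow>
           (\<forall>a2 a3 b2 b3. a2 ^ 2 = \<alpha>2 \<and> a3 ^ 2 = \<alpha>3 \<and> b2 ^ 2 = \<beta>2 \<and> b3 ^ 2 = \<beta>3 \<and>
                a2 * a3 = b2 * b3 \<longrightarrow>
              (let h = hyperelliptic_octic a2 a3 b2 b3 in
                 squarefree h \<and> degree h = 8 \<and>
                 is_smooth_projective_model C (affine_plane_curve (\<lambda>x y. y ^ 2 - poly h x))))) \<and>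
         (\<alpha>2 * \<alpha>3 \<noteq> \<beta>2 * \<beta>3 \<longrightarrow>
           (let f = plane_quartic \<alpha>2 \<alpha>3 \<beta>2 \<beta>3 in
              squarefree f \<and> isomorphic C (projective_plane_curve (poly2 f))))"
proof -
  have two: "(2 :: 'k) \<noteq> 0"
  proof
    assume "(2 :: 'k) = 0"
    hence "of_nat 2 = (0 :: 'k)" by simp
    hence "CHAR('k) dvd 2" by (simp only: of_nat_eq_0_iff_char_dvd)
    hence "CHAR('k) = 1" using assms(1) by (metis prime_nat_iff two_is_prime_nat)
    thus False using CHAR_not_1' by simp
  qed
  interpret biquadratic_cover \<alpha>2 \<alpha>3 \<beta>2 \<beta>3 C \<nu>
    using two assms by unfold_locales auto
  show ?thesis
  proof (intro conjI impI allI; (elim conjE)?)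
    fix a2 a3 b2 b3
    assume "a2 ^ 2 = \<alpha>2" "a3 ^ 2 = \<alpha>3" "b2 ^ 2 = \<beta>2" "b3 ^ 2 = \<beta>3" "a2 * a3 = b2 * b3"
    then interpret hyperelliptic_cover \<alpha>2 \<alpha>3 \<beta>2 \<beta>3 C \<nu> a2 a3 b2 b3
      by unfold_locales
    show "let h = hyperelliptic_octic a2 a3 b2 b3 in squarefree h \<and> degree h = 8 \<and>
        is_smooth_projective_model C (affine_plane_curve (\<lambda>x y. y ^ 2 - poly h x))"
      unfolding Let_def using octic smooth_projective_model_octic by blast
  next
    assume "\<alpha>2 * \<alpha>3 \<noteq> \<beta>2 * \<beta>3"
    then interpret nonhyperelliptic_cover \<alpha>2 \<alpha>3 \<beta>2 \<beta>3 C \<nu>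
      by unfold_locales
    show "let f = plane_quartic \<alpha>2 \<alpha>3 \<beta>2 \<beta>3 in squarefree f \<and> isomorphic C (projective_plane_curve (poly2 f))"
      unfolding Let_def using squarefree_plane_quartic isomorphic_plane_quartic by blast
  qed
qed

end
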